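(* Let $\Lambda$ be a separated sequence in the open unit disk $\mathbb{D}$. Then $$D^-(\Lambda)=D^-_h(\Lambda)\quad\text{and}\quad D^+(\Lambda)=D^+_h(\Lambda).$$
   Context: $\mathbb{D}=\{z\in\mathbb{C}:|z|<1\}$. The pseudohyperbolic distance between $z,\zeta\in\mathbb{D}$ is $\rho(z,\zeta)=\left|\frac{z-\zeta}{1-\zeta\bar z}\right|$. For $z\in\mathbb{D}$ and $0<r<1$, $D(z,r)=\{\zeta\in\mathbb{D}:\rho(z,\zeta)\le r\}$. A sequence $\Lambda$ of distinct points in $\mathbb{D}$ is separated if $\inf_{\lambda\ne\lambda'}\rho(\lambda,\lambda')>0$ (infimum over $\lambda,\lambda'\in\Lambda$). The lower and upper uniform densities of a separated sequence $\Lambda$ are $$D^-(\Lambda)=\liminf_{r\to1^-}\inf_{z\in\mathbb{D}}\frac{\sum_{\lambda\in\Lambda,\ \rho(\lambda,z)<r}(1-\rho(\lambda,z))}{\log\frac1{1-r}},\qquad D^+(\Lambda)=\limsup_{r\to1^-}\sup_{z\in\mathbb{D}}\frac{\sum_{\lambda\in\Lambda,\ \rho(\lambda,z)<r}(1-\rho(\lambda,z))}{\log\frac1{1-r}}.$$ For $z\in\mathbb{D}$ and $0<r<1$ set $$\Omega(z,r)=\Omega(\Lambda;z,r)=\mathbb{D}\setminus\bigcup_{\lambda\in\Lambda,\ 1/2<\rho(\lambda,z)<r}D(\lambda,1-r),$$ (for $r$ close to $1$, uniformly in $z$, the removed disks are pairwise disjoint and $z\in\Omega(z,r)$, and $\Omega(z,r)$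 is a finitely connected domain). The harmonic-measure densities are $$D^-_h(\Lambda)=\liminf_{r\to1^-}\inf_{z\in\mathbb{D}}\log\frac1{\omega(z,\partial\mathbb{D},\Omega(z,r))},\qquad D^+_h(\Lambda)=\limsup_{r\to1^-}\sup_{\lambda\in\Lambda}\log\frac1{\omega(\lambda,\partial\mathbb{D},\Omega(\lambda,r))}.$$ Harmonic measure: for such a domain $\Omega$ (which is regular for the Dirichlet problem), every continuous $f$ on $\partial\Omega$ has a unique continuous extension to $\overline\Omega$ that is harmonic in $\Omega$; for $z\in\Omega$ its value at $z$ equals $\int_{\partial\Omega}f\,d\omega_z$ for a unique Borel probability measure $\omega_z$ on $\partial\Omega$, and $\omega(z,A,\Omega)=\omega_z(A)$ for Borel $A\subset\partial\Omega$. *)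

theory Defs
  imports "HOL-Probability.Probability"
begin

abbreviation unit_disk :: "complex set" where
  "unit_disk \<equiv> ball 0 1"

definition pseudo_dist :: "complex \<Rightarrow> complex \<Rightarrow> real" where
  "pseudo_dist z w = cmod ((z - w) / (1 - w * cnj z))"

definition pseudo_cball :: "complex \<Rightarrow> real \<Rightarrow> complex set" where
  "pseudo_cball z r = {w \<in> unit_disk. pseudo_dist z w \<le> r}"

(* A sequence of distinct points is represented by its set of terms.  The infimum is taken in ereal,
   so a set with at most one point is separated. *)
definition separated :: "complex set \<Rightarrow> bool" where
  "separated L \<longleftrightarrow> L \<subseteq> unit_disk \<and>
     0 < (INF (a, b) \<in> {(a, b). a \<in> L \<and> b \<in> L \<and> a \<noteq> b}. ereal (pseudo_dist a b))"

(* All densities are ennreal-valued: the quantities involved are nonnegative, and a supremum over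
   the empty set is then 0.  For separated L and r < 1 the sum below is a finite one. *)
definition density_quotient :: "complex set \<Rightarrow> complex \<Rightarrow> real \<Rightarrow> real" where
  "density_quotient L z r =
     (\<Sum>a\<in>{a \<in> L. pseudo_dist a z < r}. 1 - pseudo_dist a z) / ln (1 / (1 - r))"

definition lower_density :: "complex set \<Rightarrow> ennreal" where
  "lower_density L = Liminf (at_left 1) (\<lambda>r. INF z\<in>unit_disk. ennreal (density_quotient L z r))"

definition upper_density :: "complex set \<Rightarrow> ennreal" where
  "upper_density L = Limsup (at_left 1) (\<lambda>r. SUP z\<in>unit_disk. ennreal (density_quotient L z r))"

(* Real functions of class C^2 with vanishing Laplacian; ux, uy, uxx, ... are the partial
   derivatives with respect to Re z and Im z. *)
definition harmonic_on :: "(complex \<Rightarrow> real) \<Rightarrow> complex set \<Rightarrow> bool" where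
  "harmonic_on u S \<longleftrightarrow> open S \<and>
     (\<exists>ux uy uxx uxy uyx uyy :: complex \<Rightarrow> real.
        (\<forall>z\<in>S. (u has_derivative (\<lambda>h. ux z * Re h + uy z * Im h)) (at z) \<and>
               (ux has_derivative (\<lambda>h. uxx z * Re h + uxy z * Im h)) (at z) \<and>
               (uy has_derivative (\<lambda>h. uyx z * Re h + uyy z * Im h)) (at z)) \<and>
        continuous_on S uxx \<and> continuous_on S uxy \<and> continuous_on S uyx \<and> continuous_on S uyy \<and>
        (\<forall>z\<in>S. uxx z + uyy z = 0))"

definition dirichlet_solution ::
    "complex set \<Rightarrow> (complex \<Rightarrow> real) \<Rightarrow> (complex \<Rightarrow> real) \<Rightarrow> bool" where
  "dirichlet_solution S f u \<longleftrightarrow>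
     continuous_on (closure S) u \<and> harmonic_on u S \<and> (\<forall>w\<in>frontier S. u w = f w)"

definition represents_dirichlet :: "complex set \<Rightarrow> complex \<Rightarrow> complex measure \<Rightarrow> bool" where
  "represents_dirichlet S z M \<longleftrightarrow>
     prob_space M \<and> sets M = sets (restrict_space borel (frontier S)) \<and>
     (\<forall>f u. continuous_on (frontier S) f \<and> dirichlet_solution S f u \<longrightarrow> u z = (\<integral>w. f w \<partial>M))"

(* Meaningful for bounded domains S that are regular for the Dirichlet problem and z in S,
   where the representing measure exists and is unique. *)
definition harmonic_measure :: "complex \<Rightarrow> complex set \<Rightarrow> complex set \<Rightarrow> real" where
  "harmonic_measure z A S = measure (THE M. represents_dirichlet S z M) A"

definition Omega :: "complex set \<Rightarrow> complex \<Rightarrow> real \<Rightarrow> complex set" where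
  "Omega L z r =
     unit_disk - (\<Union>a\<in>{a \<in> L. 1/2 < pseudo_dist a z \<and> pseudo_dist a z < r}. pseudo_cball a (1 - r))"

(* For separated L and r close to 1, uniformly in z, the harmonic measure here is well-defined and
   lies in {0<..1}; only such r matter for the limits below. *)
definition log_inv_hm :: "complex set \<Rightarrow> complex \<Rightarrow> real \<Rightarrow> real" where
  "log_inv_hm L z r = ln (1 / harmonic_measure z (frontier unit_disk) (Omega L z r))"

definition lower_h_density :: "complex set \<Rightarrow> ennreal" where
  "lower_h_density L = Liminf (at_left 1) (\<lambda>r. INF z\<in>unit_disk. ennreal (log_inv_hm L z r))"

definition upper_h_density :: "complex set \<Rightarrow> ennreal" where
  "upper_h_density L = Limsup (at_left 1) (\<lambda>r. SUP a\<in>L. ennreal (log_inv_hm L a r))"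

end

theory Submission
  imports Defs "HOL-Complex_Analysis.Complex_Analysis" "HOL-Real_Asymp.Real_Asymp"
begin

text \<open>Write \<open>N = ln (1 / (1 - r))\<close> and let \<open>u\<close> be the harmonic measure of the unit circle in
  \<open>\<Omega>(z, r)\<close>; on a hole around \<open>a\<close> one has \<open>- ln \<rho>(a, \<cdot>) = N\<close>, so the Green potential
  \<open>h = (1/N) \<Sum>\<^sub>a - ln \<rho>(a, \<cdot>)\<close> of the holes has the size of the density quotient.
  Comparing \<open>u\<close> with \<open>exp (- \<kappa> h)\<close>, which is almost subharmonic because \<open>h\<close> is nearly constant
  near each hole apart from the term of that hole, gives \<open>u(z) \<ge> exp (- (1 + o(1)) h(z))\<close>; hence the
  harmonic-measure densities are at most the uniform densities.

  For the converse inequality between the lower densities, the path from \<open>z\<close> to the circle is cut into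
  hyperbolic steps of a fixed large length; each step decreases \<open>u\<close> by a factor controlled by the
  density at the current centre, and the factors multiply to \<open>exp (- D)\<close>.

  For the upper densities, take a disc of nearly maximal density, move its centre to a point of the
  sequence, and compare \<open>u\<close> with \<open>1\<close> minus a weighted Green potential of the holes, the weight of a
  hole \<open>a\<close> being \<open>exp (- b (1 - t))\<close> at the level \<open>t = - ln (1 - \<rho>(a, z)) / N\<close>. Maximality of the
  density bounds the outer layers from above, which makes the comparison function nonnegative on the
  holes and equal to about \<open>exp (- b)\<close> at \<open>z\<close>.\<close>

section \<open>Harmonic functions and the maximum principle\<close>

text \<open>\<open>harmonic_measure\<close> goes through a unique representing measure, so the
  Dirichlet problem and a Riesz representation are needed before any estimate. As the holes stay off
  the circle, the indicator of the circle is continuous on the boundary; its harmonic measure is the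
  value of one Dirichlet solution \<open>u\<close>, and every estimate is a maximum principle
  argument for \<open>u\<close>.

  The linear comparison function \<open>1 - h\<close> says nothing once the density reaches 1, hence
  the exponentials. The walk needs a density bound at every centre, which only the lower density
  gives. A large upper density is seen from some centres only, and \<open>upper_h_density\<close>
  admits only centres in the sequence: this is why a centre is moved and why layers are weighted.
  For b slightly above the density, the layer beyond level t is seen from a hole of level p with
  potential at most about b N (1 - max t p). The weight w is the solution with w(1) = 1 of the
  equation saying that these bounds, together with the own term w(p) N of the hole, add up to N at
  every level p. At the centre the same layers give about N (1 - w(0)), and w(0) = exp (-
  b).\<close>

text \<open>A function is harmonic iff it is locally the real part of a holomorphic function. For the
  maximum principle and for Perron's method, subharmonicity is only needed in the form that the function
  is supported from below by such a real part at each point.\<close>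

definition har :: "(complex \<Rightarrow> real) \<Rightarrow> complex set \<Rightarrow> bool" where
  "har u S \<longleftrightarrow> (\<forall>z\<in>S. \<exists>e>0. \<exists>F. ball z e \<subseteq> S \<and> F holomorphic_on ball z e \<and>
     (\<forall>w\<in>ball z e. u w = Re (F w)))"

definition subhar :: "(complex \<Rightarrow> real) \<Rightarrow> complex set \<Rightarrow> bool" where
  "subhar v S \<longleftrightarrow> (\<forall>z\<in>S. \<exists>e>0. \<exists>F. ball z e \<subseteq> S \<and> F holomorphic_on ball z e \<and>
     v z = Re (F z) \<and> (\<forall>w\<in>ball z e. Re (F w) \<le> v w))"

lemma har_imp_subhar: "har u S \<Longrightarrow> subhar u S"
  unfolding har_def subhar_def
proof
  fix z assume H: "\<forall>z\<in>S. \<exists>e>0. \<exists>F. ball z e \<subseteq> S \<and> F holomorphic_on ball z e \<and>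
     (\<forall>w\<in>ball z e. u w = Re (F w))" and "z \<in> S"
  then obtain e F where "e > 0" "ball z e \<subseteq> S" "F holomorphic_on ball z e" "\<forall>w\<in>ball z e. u w = Re (F w)"
    by blast
  then show "\<exists>e>0. \<exists>F. ball z e \<subseteq> S \<and> F holomorphic_on ball z e \<and>
     u z = Re (F z) \<and> (\<forall>w\<in>ball z e. Re (F w) \<le> u w)"
    by (intro exI[of _ e] conjI exI[of _ F]) auto
qed

lemma harI:
  assumes "\<And>z. z \<in> S \<Longrightarrow> \<exists>e>0. \<exists>F. ball z e \<subseteq> S \<and> F holomorphic_on ball z e \<and>
     (\<forall>w\<in>ball z e. u w = Re (F w))"
  shows "har u S"
  using assms unfolding har_def by blast

lemma harE:
  assumes "har u S" "z \<in> S"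
  obtains e F where "e > 0" "ball z e \<subseteq> S" "F holomorphic_on ball z e"
    "\<And>w. w \<in> ball z e \<Longrightarrow> u w = Re (F w)"
  using assms unfolding har_def by blast

lemma subharE:
  assumes "subhar u S" "z \<in> S"
  obtains e F where "e > 0" "ball z e \<subseteq> S" "F holomorphic_on ball z e" "u z = Re (F z)"
    "\<And>w. w \<in> ball z e \<Longrightarrow> Re (F w) \<le> u w"
  using assms unfolding subhar_def by blast

lemma har_open: "har u S \<Longrightarrow> open S"
  unfolding har_def by (meson openI)

lemma har_Re:
  assumes "F holomorphic_on S" "open S"
  shows "har (\<lambda>w. Re (F w)) S"
proof (rule harI)
  fix z assume "z \<in> S"
  then obtain e where "e > 0" "ball z e \<subseteq> S" using assms(2) openE by blast
  then show "\<exists>e>0. \<exists>G. ball z e \<subseteq> S \<and> G holomorphic_on ball z e \<and>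
     (\<forall>w\<in>ball z e. Re (F w) = Re (G w))"
    by (intro exI[of _ e] conjI exI[of _ F]) (auto intro: holomorphic_on_subset[OF assms(1)])
qed

lemma har_const: "open S \<Longrightarrow> har (\<lambda>w. c) S"
  using har_Re[of "\<lambda>w. of_real c" S] by simp

lemma har_subset:
  assumes "har u S" "T \<subseteq> S" "open T"
  shows "har u T"
proof (rule harI)
  fix z assume z: "z \<in> T"
  obtain e F where e: "e > 0" "ball z e \<subseteq> S" "F holomorphic_on ball z e"
    "\<And>w. w \<in> ball z e \<Longrightarrow> u w = Re (F w)" using harE[OF assms(1), of z] z assms(2) by blast
  obtain d where d: "d > 0" "ball z d \<subseteq> T" using z assms(3) openE by blast
  show "\<exists>e>0. \<exists>F. ball z e \<subseteq> T \<and> F holomorphic_on ball z e \<and> (\<forall>w\<in>ball z e. u w = Re (F w))"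
    by (rule exI[of _ "min d e"])
       (use e d in \<open>auto intro!: exI[of _ F] intro: holomorphic_on_subset[OF e(3)]\<close>)
qed

lemma har_cong:
  assumes "har u S" "\<And>w. w \<in> S \<Longrightarrow> u w = v w"
  shows "har v S"
proof (rule harI)
  fix z assume z: "z \<in> S"
  obtain e F where "e > 0" "ball z e \<subseteq> S" "F holomorphic_on ball z e"
    "\<And>w. w \<in> ball z e \<Longrightarrow> u w = Re (F w)" using harE[OF assms(1) z] by blast
  then show "\<exists>e>0. \<exists>F. ball z e \<subseteq> S \<and> F holomorphic_on ball z e \<and> (\<forall>w\<in>ball z e. v w = Re (F w))"
    using assms(2) by (intro exI[of _ e] conjI exI[of _ F]) (auto simp: subset_iff)
qed

lemma subhar_subset:
  assumes "subhar u S" "T \<subseteq> S" "open T"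
  shows "subhar u T"
  unfolding subhar_def
proof
  fix z assume z: "z \<in> T"
  obtain e F where e: "e > 0" "ball z e \<subseteq> S" "F holomorphic_on ball z e" "u z = Re (F z)"
    "\<And>w. w \<in> ball z e \<Longrightarrow> Re (F w) \<le> u w" using subharE[OF assms(1), of z] z assms(2) by blast
  obtain d where d: "d > 0" "ball z d \<subseteq> T" using z assms(3) openE by blast
  show "\<exists>e>0. \<exists>F. ball z e \<subseteq> T \<and> F holomorphic_on ball z e \<and> u z = Re (F z) \<and> (\<forall>w\<in>ball z e. Re (F w) \<le> u w)"
    by (rule exI[of _ "min d e"])
       (use e d in \<open>auto intro!: exI[of _ F] intro: holomorphic_on_subset[OF e(3)]\<close>)
qed

lemma subhar_add:
  assumes "subhar u S" "subhar v S"
  shows "subhar (\<lambda>w. u w + v w) S"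
  unfolding subhar_def
proof
  fix z assume z: "z \<in> S"
  obtain e F where e: "e > 0" "ball z e \<subseteq> S" "F holomorphic_on ball z e" "u z = Re (F z)"
    "\<And>w. w \<in> ball z e \<Longrightarrow> Re (F w) \<le> u w" using subharE[OF assms(1) z] by blast
  obtain d G where d: "d > 0" "ball z d \<subseteq> S" "G holomorphic_on ball z d" "v z = Re (G z)"
    "\<And>w. w \<in> ball z d \<Longrightarrow> Re (G w) \<le> v w" using subharE[OF assms(2) z] by blast
  show "\<exists>e>0. \<exists>F. ball z e \<subseteq> S \<and> F holomorphic_on ball z e \<and> u z + v z = Re (F z) \<and> (\<forall>w\<in>ball z e. Re (F w) \<le> u w + v w)"
    by (rule exI[of _ "min d e"], intro conjI exI[of _ "\<lambda>w. F w + G w"] holomorphic_on_add)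
       (use e d in \<open>auto intro: holomorphic_on_subset[OF e(3)] holomorphic_on_subset[OF d(3)] add_mono\<close>)
qed

lemma har_add:
  assumes "har u S" "har v S"
  shows "har (\<lambda>w. u w + v w) S"
proof (rule harI)
  fix z assume z: "z \<in> S"
  obtain e F where e: "e > 0" "ball z e \<subseteq> S" "F holomorphic_on ball z e"
    "\<And>w. w \<in> ball z e \<Longrightarrow> u w = Re (F w)" using harE[OF assms(1) z] by blast
  obtain d G where d: "d > 0" "ball z d \<subseteq> S" "G holomorphic_on ball z d"
    "\<And>w. w \<in> ball z d \<Longrightarrow> v w = Re (G w)" using harE[OF assms(2) z] by blast
  show "\<exists>e>0. \<exists>F. ball z e \<subseteq> S \<and> F holomorphic_on ball z e \<and> (\<forall>w\<in>ball z e. u w + v w = Re (F w))"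
    by (rule exI[of _ "min d e"], intro conjI exI[of _ "\<lambda>w. F w + G w"] holomorphic_on_add)
       (use e d in \<open>auto intro: holomorphic_on_subset[OF e(3)] holomorphic_on_subset[OF d(3)]\<close>)
qed

lemma har_cmult:
  assumes "har u S"
  shows "har (\<lambda>w. c * u w) S"
proof (rule harI)
  fix z assume z: "z \<in> S"
  obtain e F where e: "e > 0" "ball z e \<subseteq> S" "F holomorphic_on ball z e"
    "\<And>w. w \<in> ball z e \<Longrightarrow> u w = Re (F w)" using harE[OF assms(1) z] by blast
  show "\<exists>e>0. \<exists>F. ball z e \<subseteq> S \<and> F holomorphic_on ball z e \<and> (\<forall>w\<in>ball z e. c * u w = Re (F w))"
    by (rule exI[of _ e], intro conjI exI[of _ "\<lambda>w. of_real c * F w"])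
       (use e in \<open>auto intro!: holomorphic_intros\<close>)
qed

lemma har_minus: "har u S \<Longrightarrow> har (\<lambda>w. - u w) S"
  using har_cmult[of u S "-1"] by simp

lemma har_diff: "har u S \<Longrightarrow> har v S \<Longrightarrow> har (\<lambda>w. u w - v w) S"
  using har_add[of u S "\<lambda>w. - v w"] har_minus[of v S] by simp

lemma har_sum:
  assumes "open S" "\<And>i. i \<in> I \<Longrightarrow> har (u i) S"
  shows "har (\<lambda>w. \<Sum>i\<in>I. u i w) S"
  using assms(2)
  by (induction I rule: infinite_finite_induct) (auto intro: har_const assms(1) har_add)

lemma subhar_max:
  assumes "subhar u S" "subhar v S"
  shows "subhar (\<lambda>w. max (u w) (v w)) S"
  unfolding subhar_def
proof
  fix z assume z: "z \<in> S"
  obtain e F where e: "e > 0" "ball z e \<subseteq> S" "F holomorphic_on ball z e" "u z = Re (F z)"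
    "\<And>w. w \<in> ball z e \<Longrightarrow> Re (F w) \<le> u w" using subharE[OF assms(1) z] by blast
  obtain d G where d: "d > 0" "ball z d \<subseteq> S" "G holomorphic_on ball z d" "v z = Re (G z)"
    "\<And>w. w \<in> ball z d \<Longrightarrow> Re (G w) \<le> v w" using subharE[OF assms(2) z] by blast
  show "\<exists>e>0. \<exists>F. ball z e \<subseteq> S \<and> F holomorphic_on ball z e \<and> max (u z) (v z) = Re (F z) \<and> (\<forall>w\<in>ball z e. Re (F w) \<le> max (u w) (v w))"
  proof (cases "u z \<le> v z")
    case True
    then show ?thesis using d by (intro exI[of _ d] conjI exI[of _ G]) (auto simp: max_absorb2 le_max_iff_disj)
  next
    case False
    then show ?thesis using e by (intro exI[of _ e] conjI exI[of _ F]) (auto simp: max_absorb1 le_max_iff_disj)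
  qed
qed

lemma har_ln_cmod:
  assumes "F holomorphic_on S" "open S" "\<And>w. w \<in> S \<Longrightarrow> F w \<noteq> 0"
  shows "har (\<lambda>w. ln (cmod (F w))) S"
proof (rule harI)
  fix z assume z: "z \<in> S"
  obtain e where e: "e > 0" "ball z e \<subseteq> S" using z assms(2) openE by blast
  obtain g where g: "g holomorphic_on ball z e" "\<And>w. w \<in> ball z e \<Longrightarrow> F w = exp (g w)"
  proof (rule holomorphic_logarithm_exists[of "ball z e" F z])
    show "F holomorphic_on ball z e" using assms(1) e(2) holomorphic_on_subset by blast
  qed (use e assms in auto)
  have "ln (cmod (F w)) = Re (g w)" if "w \<in> ball z e" for w
    using g(2)[OF that] by simp
  then show "\<exists>e>0. \<exists>G. ball z e \<subseteq> S \<and> G holomorphic_on ball z e \<and> (\<forall>w\<in>ball z e. ln (cmod (F w)) = Re (G w))"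
    using e g(1) by blast
qed

text \<open>Among the interior maximum points of \<open>v\<close> take one with maximal real part: the harmonic
  support there forces \<open>v\<close> to be maximal on a whole disc.\<close>

theorem subhar_max_principle:
  assumes S: "open S" "bounded S" and v: "subhar v S" "continuous_on (closure S) v"
    and fr: "\<And>w. w \<in> frontier S \<Longrightarrow> v w \<le> m" and w: "w \<in> closure S"
  shows "v w \<le> m"
proof (rule ccontr)
  assume neg: "\<not> v w \<le> m"
  have cpt: "compact (closure S)" using S by (simp add: compact_closure)
  obtain x0 where x0: "x0 \<in> closure S" "\<And>y. y \<in> closure S \<Longrightarrow> v y \<le> v x0"
    using continuous_attains_sup[OF cpt _ v(2)] w by (metis empty_iff)
  define E where "E = {x \<in> closure S. v x = v x0}"
  have "closed E" unfolding E_def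
    using v(2) by (intro continuous_closed_preimage_constant) auto
  moreover have "bounded E" using cpt by (auto simp: E_def intro: bounded_subset compact_imp_bounded)
  ultimately have "compact E" by (simp add: compact_eq_bounded_closed)
  moreover have "E \<noteq> {}" using x0(1) by (auto simp: E_def)
  ultimately obtain c where c: "c \<in> E" "\<And>y. y \<in> E \<Longrightarrow> Re y \<le> Re c"
    using continuous_attains_sup[of E Re] continuous_on_Re[OF continuous_on_id, of E] by auto
  have "v c > m" using c(1) x0(2)[OF w] neg by (auto simp: E_def)
  then have "c \<notin> frontier S" using fr[of c] by linarith
  then have cS: "c \<in> S" using c(1) S(1) by (auto simp: E_def frontier_def interior_open)
  obtain e F where e: "e > 0" "ball c e \<subseteq> S" "F holomorphic_on ball c e" "v c = Re (F c)"
    "\<And>w. w \<in> ball c e \<Longrightarrow> Re (F w) \<le> v w" using subharE[OF v(1) cS] by blast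
  have le: "Re (F y) \<le> Re (F c)" if "y \<in> ball c e" for y
    using e(2,4) e(5)[OF that] x0(2)[of y] c(1) that closure_subset[of S] by (force simp: E_def)
  \<comment> \<open>The modulus of \<open>exp (F y)\<close> is exp (Re F), so a maximum of the
    supporting real part is a maximum of modulus.\<close>
  have "(\<lambda>y. exp (F y)) constant_on ball c e"
    by (rule maximum_modulus_principle[of _ _ "ball c e" c])
       (use e le in \<open>auto intro!: holomorphic_intros\<close>)
  then obtain k where k: "\<And>y. y \<in> ball c e \<Longrightarrow> exp (F y) = k" by (auto simp: constant_on_def)
  define y where "y = c + of_real (e/2)"
  have yb: "y \<in> ball c e" using e(1) by (simp add: y_def dist_norm)
  have "cmod (exp (F y)) = cmod (exp (F c))" using k[OF yb] k[of c] e(1) by simp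
  then have "Re (F y) = Re (F c)" by simp
  then have "v y \<ge> v c" using e(4) e(5)[OF yb] by simp
  then have "y \<in> E" using c(1) x0(2)[of y] yb e(2) closure_subset[of S] by (force simp: E_def)
  then show False using c(2)[of y] e(1) by (simp add: y_def)
qed

lemma har_max_principle:
  assumes "har u S" "bounded S" "continuous_on (closure S) u"
    and "\<And>w. w \<in> frontier S \<Longrightarrow> u w \<le> m" and "w \<in> closure S"
  shows "u w \<le> m"
  by (rule subhar_max_principle[of S]) (use assms har_imp_subhar har_open in auto)

lemma har_min_principle:
  assumes "har u S" "bounded S" "continuous_on (closure S) u"
    and "\<And>w. w \<in> frontier S \<Longrightarrow> m \<le> u w" and "w \<in> closure S"
  shows "m \<le> u w"
  using har_max_principle[of "\<lambda>w. - u w" S "-m" w] har_minus[of u S] assms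
  by (force intro: continuous_on_minus)

text \<open>After rescaling to the unit disc, G = F - F(c) takes values in the half plane Re < A,
  which \<open>G / (2 A - G)\<close> maps into the unit disc, fixing 0. The Schwarz lemma bounds
  this quotient by the modulus of the variable; solving for |G| gives the estimate.\<close>

lemma Borel_Caratheodory_ball:
  assumes F: "F holomorphic_on ball c R" and R: "R > 0" and A: "A \<ge> 0"
    and le: "\<And>w. w \<in> ball c R \<Longrightarrow> Re (F w) \<le> Re (F c) + A" and z: "z \<in> ball c R"
  shows "cmod (F z - F c) \<le> 2 * A * (cmod (z - c) / R) / (1 - cmod (z - c) / R)"
proof -
  have main: "cmod (F z - F c) \<le> 2 * A * (cmod (z - c) / R) / (1 - cmod (z - c) / R)"
    if A: "A > 0" and le: "\<And>w. w \<in> ball c R \<Longrightarrow> Re (F w) < Re (F c) + A" for A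
  proof -
    define \<zeta> where "\<zeta> = (z - c) / of_real R"
    define G where "G = (\<lambda>w. F (c + of_real R * w) - F c)"
    define h where "h = (\<lambda>w. G w / (of_real (2 * A) - G w))"
    have inb: "c + of_real R * w \<in> ball c R" if "norm w < 1" for w
      using that R by (simp add: dist_norm norm_mult)
    have ReG: "Re (G w) < A" if "norm w < 1" for w
      using le[OF inb[OF that]] by (simp add: G_def)
    have ne: "of_real (2 * A) - G w \<noteq> 0" if "norm w < 1" for w
    proof
      assume "of_real (2 * A) - G w = 0"
      then have "Re (G w) = 2 * A" by (metis Re_complex_of_real eq_iff_diff_eq_0)
      then show False using ReG[OF that] A by simp
    qed
    have holG: "G holomorphic_on ball 0 1" unfolding G_def
    proof (intro holomorphic_intros)
      have "(F \<circ> (\<lambda>w. c + of_real R * w)) holomorphic_on ball 0 1"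
        by (rule holomorphic_on_compose_gen[OF _ F]) (use inb in \<open>auto intro!: holomorphic_intros\<close>)
      then show "(\<lambda>w. F (c + of_real R * w)) holomorphic_on ball 0 1" by (simp add: o_def)
    qed
    have holh: "h holomorphic_on ball 0 1" unfolding h_def
      by (intro holomorphic_intros holG) (use ne in auto)
    have lt: "cmod (G w) < cmod (of_real (2*A) - G w)" if "norm w < 1" for w
    proof -
      have "(cmod (of_real (2*A) - G w))\<^sup>2 - (cmod (G w))\<^sup>2 = 4 * A * (A - Re (G w))"
        unfolding cmod_power2 by (simp add: power2_eq_square algebra_simps)
      moreover have "4 * A * (A - Re (G w)) > 0" using A ReG[OF that] by simp
      ultimately show ?thesis by (metis diff_gt_0_iff_gt norm_ge_zero power_less_imp_less_base)
    qed
    have z1: "norm \<zeta> < 1" using z R by (simp add: \<zeta>_def norm_divide dist_norm norm_minus_commute)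
    have "norm (h \<zeta>) \<le> norm \<zeta>"
    proof (rule Schwarz_Lemma(1)[OF holh])
      show "h 0 = 0" by (simp add: h_def G_def)
      show "norm (h w) < 1" if "norm w < 1" for w
        using lt[OF that] ne[OF that] by (simp add: h_def norm_divide)
    qed (rule z1)
    then have "cmod (G \<zeta>) \<le> norm \<zeta> * cmod (of_real (2*A) - G \<zeta>)"
      using ne[OF z1] by (simp add: h_def norm_divide pos_divide_le_eq)
    also have "\<dots> \<le> norm \<zeta> * (2 * A + cmod (G \<zeta>))"
      using norm_triangle_ineq4[of "of_real (2*A)" "G \<zeta>"] A by (intro mult_left_mono) auto
    finally have "cmod (G \<zeta>) * (1 - norm \<zeta>) \<le> 2 * A * norm \<zeta>" by (simp add: algebra_simps)
    then have "cmod (G \<zeta>) \<le> 2 * A * norm \<zeta> / (1 - norm \<zeta>)"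
      using z1 by (simp add: pos_le_divide_eq)
    moreover have "G \<zeta> = F z - F c" using R by (simp add: G_def \<zeta>_def)
    moreover have "norm \<zeta> = cmod (z - c) / R" using R by (simp add: \<zeta>_def norm_divide)
    ultimately show ?thesis by simp
  qed
  \<comment> \<open>The Schwarz argument needs a strict bound on the real part and A > 0; it is
    applied with A + \<epsilon>, and \<epsilon> tends to 0.\<close>
  have lim: "cmod (F z - F c) \<le> 2 * (A + \<epsilon>) * (cmod (z - c) / R) / (1 - cmod (z - c) / R)" if "\<epsilon> > 0" for \<epsilon>
    by (rule main) (use le A that in force)+
  have t: "((\<lambda>\<epsilon>. 2 * (A + \<epsilon>) * (cmod (z - c) / R) / (1 - cmod (z - c) / R)) \<longlongrightarrow>
        2 * (A + 0) * (cmod (z - c) / R) / (1 - cmod (z - c) / R)) (at_right 0)"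
    using z R by (intro tendsto_intros) (auto simp: dist_norm norm_minus_commute)
  have "cmod (F z - F c) \<le> 2 * (A + 0) * (cmod (z - c) / R) / (1 - cmod (z - c) / R)"
    by (rule tendsto_lowerbound[OF t]) (use lim in \<open>auto intro: eventually_mono[OF eventually_at_right_less]\<close>)
  then show ?thesis by simp
qed

section \<open>Equivalence of local real parts with the C^2 definition of harmonicity\<close>

lemma har_unfold_ball:
  assumes "F holomorphic_on ball z e" "e > 0" "\<And>w. w \<in> ball z e \<Longrightarrow> u w = Re (F w)"
  shows "(u has_derivative (\<lambda>h. Re (deriv F z) * Re h + (- Im (deriv F z)) * Im h)) (at z)"
proof -
  have "(F has_field_derivative deriv F z) (at z)"
    using assms(1,2) by (meson centre_in_ball holomorphic_derivI open_ball)
  then have "(F has_derivative (\<lambda>h. deriv F z * h)) (at z)"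
    by (simp add: has_field_derivative_def)
  then have "((\<lambda>w. Re (F w)) has_derivative (\<lambda>h. Re (deriv F z * h))) (at z)"
    by (rule has_derivative_Re)
  then have "(u has_derivative (\<lambda>h. Re (deriv F z * h))) (at z)"
    by (rule has_derivative_transform_within_open[of _ _ _ _ "ball z e"]) (use assms in auto)
  then show ?thesis by simp
qed

lemma ball_shift_subset: "w \<in> ball z e \<Longrightarrow> ball w (e - dist z w) \<subseteq> ball z (e::real)"
proof
  fix y assume "y \<in> ball w (e - dist z w)"
  then show "y \<in> ball z e" using dist_triangle[of z y w] by simp
qed

lemma har_imp_harmonic_on:
  assumes "har u S"
  shows "harmonic_on u S"
proof -
  have "\<forall>z. \<exists>F. z \<in> S \<longrightarrow> (\<exists>e>0. ball z e \<subseteq> S \<and> F holomorphic_on ball z e \<and> (\<forall>w\<in>ball z e. u w = Re (F w)))"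
    using assms unfolding har_def by blast
  then obtain F where F: "\<And>z. z \<in> S \<Longrightarrow> \<exists>e>0. ball z e \<subseteq> S \<and> F z holomorphic_on ball z e \<and> (\<forall>w\<in>ball z e. u w = Re (F z w))"
    by metis
  \<comment> \<open>On overlaps the local functions \<open>F z\<close> have the same real part,
    hence the same derivative, so the derivatives glue to one function although the
    \<open>F z\<close> themselves need not. The agreement is read off from the uniqueness of the
    derivative of \<open>u\<close>.\<close>
  define f where "f = (\<lambda>z. deriv (F z) z)"
  have loc: "\<exists>e>0. ball z e \<subseteq> S \<and> F z holomorphic_on ball z e \<and> (\<forall>w\<in>ball z e. u w = Re (F z w) \<and> f w = deriv (F z) w)"
    if z: "z \<in> S" for z
  proof -
    obtain e where e: "e > 0" "ball z e \<subseteq> S" "F z holomorphic_on ball z e" "\<forall>w\<in>ball z e. u w = Re (F z w)"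
      using F[OF z] by blast
    have "f w = deriv (F z) w" if w: "w \<in> ball z e" for w
    proof -
      have 1: "(u has_derivative (\<lambda>h. Re (deriv (F z) w) * Re h + (- Im (deriv (F z) w)) * Im h)) (at w)"
        by (rule har_unfold_ball[of _ _ "e - dist z w"])
           (use e w ball_shift_subset[OF w] in \<open>auto intro: holomorphic_on_subset\<close>)
      obtain d where d: "d > 0" "F w holomorphic_on ball w d" "\<forall>y\<in>ball w d. u y = Re (F w y)"
        using F[of w] w e(2) by blast
      have 2: "(u has_derivative (\<lambda>h. Re (deriv (F w) w) * Re h + (- Im (deriv (F w) w)) * Im h)) (at w)"
        by (rule har_unfold_ball[of _ _ d]) (use d in auto)
      have eq: "(\<lambda>h. Re (deriv (F z) w) * Re h + (- Im (deriv (F z) w)) * Im h) =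
            (\<lambda>h. Re (deriv (F w) w) * Re h + (- Im (deriv (F w) w)) * Im h)"
        by (rule has_derivative_unique[OF 1 2])
      from fun_cong[OF eq, of 1] fun_cong[OF eq, of \<i>] show ?thesis
        by (auto simp: f_def complex_eq_iff)
    qed
    then show ?thesis using e by blast
  qed
  have holf: "f holomorphic_on S"
    unfolding holomorphic_on_def
  proof
    fix z assume z: "z \<in> S"
    obtain e where e: "e > 0" "ball z e \<subseteq> S" "F z holomorphic_on ball z e" "\<forall>w\<in>ball z e. u w = Re (F z w) \<and> f w = deriv (F z) w"
      using loc[OF z] by blast
    have "deriv (F z) holomorphic_on ball z e" using e by (intro holomorphic_deriv) auto
    then have "f holomorphic_on ball z e" using e(4) by (metis holomorphic_transform)
    then have "f field_differentiable at z" using e(1) by (simp add: holomorphic_on_imp_differentiable_at)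
    then show "f field_differentiable at z within S" by (rule field_differentiable_at_within)
  qed
  have oS: "open S" using assms har_open by blast
  have df: "(f has_derivative (\<lambda>h. deriv f z * h)) (at z)" if "z \<in> S" for z
    using holomorphic_derivI[OF holf oS that] by (simp add: has_field_derivative_def)
  have cd: "continuous_on S (deriv f)"
    using holf oS by (intro holomorphic_on_imp_continuous_on holomorphic_deriv)
  show ?thesis
    unfolding harmonic_on_def
  proof (intro conjI oS exI ballI)
    fix z assume z: "z \<in> S"
    obtain e where e: "e > 0" "ball z e \<subseteq> S" "F z holomorphic_on ball z e" "\<forall>w\<in>ball z e. u w = Re (F z w) \<and> f w = deriv (F z) w"
      using loc[OF z] by blast
    show "(u has_derivative (\<lambda>h. Re (f z) * Re h + (- Im (f z)) * Im h)) (at z)"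
      using har_unfold_ball[OF e(3,1), of u] e(1,4) by simp
    show "((\<lambda>z. Re (f z)) has_derivative (\<lambda>h. Re (deriv f z) * Re h + (- Im (deriv f z)) * Im h)) (at z)"
      using has_derivative_Re[OF df[OF z]] by simp
    show "((\<lambda>z. - Im (f z)) has_derivative (\<lambda>h. (- Im (deriv f z)) * Re h + (- Re (deriv f z)) * Im h)) (at z)"
      using has_derivative_minus[OF has_derivative_Im[OF df[OF z]]] by (simp add: algebra_simps)
    show "Re (deriv f z) + - Re (deriv f z) = 0" by simp
  qed (auto intro!: continuous_intros cd)
qed

text \<open>Both mixed derivatives are limits of the same second difference quotient.\<close>

lemma mixed_difference:
  fixes f fx fy fxy fyx :: "real \<Rightarrow> real \<Rightarrow> real"
  assumes t: "0 < t" "t < r"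
    and fx: "\<And>a b. \<bar>a\<bar> < r \<Longrightarrow> \<bar>b\<bar> < r \<Longrightarrow> ((\<lambda>x. f x b) has_real_derivative fx a b) (at a)"
    and fxy: "\<And>a b. \<bar>a\<bar> < r \<Longrightarrow> \<bar>b\<bar> < r \<Longrightarrow> ((\<lambda>y. fx a y) has_real_derivative fxy a b) (at b)"
  shows "\<exists>\<xi> \<eta>. 0 < \<xi> \<and> \<xi> < t \<and> 0 < \<eta> \<and> \<eta> < t \<and> f t t - f t 0 - f 0 t + f 0 0 = t * (t * fxy \<xi> \<eta>)"
proof -
  have "\<exists>\<xi>. 0 < \<xi> \<and> \<xi> < t \<and> (f t t - f t 0) - (f 0 t - f 0 0) = (t - 0) * (fx \<xi> t - fx \<xi> 0)"
    by (rule MVT2) (use t in \<open>auto intro!: DERIV_diff fx\<close>)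
  then obtain \<xi> where x: "0 < \<xi>" "\<xi> < t" "(f t t - f t 0) - (f 0 t - f 0 0) = t * (fx \<xi> t - fx \<xi> 0)"
    by auto
  have "\<exists>\<eta>. 0 < \<eta> \<and> \<eta> < t \<and> fx \<xi> t - fx \<xi> 0 = (t - 0) * fxy \<xi> \<eta>"
    by (rule MVT2) (use t x in \<open>auto intro!: fxy\<close>)
  then obtain \<eta> where y: "0 < \<eta>" "\<eta> < t" "fx \<xi> t - fx \<xi> 0 = t * fxy \<xi> \<eta>" by auto
  show ?thesis using x y by (intro exI[of _ \<xi>] exI[of _ \<eta>]) auto
qed

lemma mixed_derivatives_eq:
  fixes u ux uy uxx uxy uyx uyy :: "complex \<Rightarrow> real"
  assumes "open S" "c \<in> S"
    and du: "\<And>z. z \<in> S \<Longrightarrow> (u has_derivative (\<lambda>h. ux z * Re h + uy z * Im h)) (at z)"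
    and dx: "\<And>z. z \<in> S \<Longrightarrow> (ux has_derivative (\<lambda>h. uxx z * Re h + uxy z * Im h)) (at z)"
    and dy: "\<And>z. z \<in> S \<Longrightarrow> (uy has_derivative (\<lambda>h. uyx z * Re h + uyy z * Im h)) (at z)"
    and cont: "continuous_on S uxy" "continuous_on S uyx"
  shows "uxy c = uyx c"
proof -
  obtain R where R: "R > 0" "ball c R \<subseteq> S" using assms(1,2) openE by blast
  define P where "P = (\<lambda>s t. c + Complex s t)"
  have dP: "dist c (P s t) \<le> \<bar>s\<bar> + \<bar>t\<bar>" for s t
    using cmod_le[of "Complex s t"] by (simp add: P_def dist_norm)
  have inS: "P s t \<in> S" if "\<bar>s\<bar> < R/2" "\<bar>t\<bar> < R/2" for s t
    using dP[of s t] that R by (intro subsetD[OF R(2)]) auto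
  have line1: "((\<lambda>s. f (P s b)) has_real_derivative p (P s b)) (at s)"
    if "\<And>z. z \<in> S \<Longrightarrow> (f has_derivative (\<lambda>h. p z * Re h + q z * Im h)) (at z)" "\<bar>s\<bar> < R/2" "\<bar>b\<bar> < R/2"
    for f p q :: "complex \<Rightarrow> real" and b s
  proof -
    have "((\<lambda>s. P s b) has_derivative (\<lambda>h. of_real h)) (at s)"
      unfolding P_def complex_eq_iff Complex_eq by (auto intro!: derivative_eq_intros)
    from has_derivative_compose[OF this that(1)[OF inS[OF that(2,3)]]]
    show ?thesis unfolding has_field_derivative_def by simp
  qed
  have line2: "((\<lambda>t. f (P a t)) has_real_derivative q (P a t)) (at t)"
    if "\<And>z. z \<in> S \<Longrightarrow> (f has_derivative (\<lambda>h. p z * Re h + q z * Im h)) (at z)" "\<bar>a\<bar> < R/2" "\<bar>t\<bar> < R/2"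
    for f p q :: "complex \<Rightarrow> real" and a t
  proof -
    have "((\<lambda>t. P a t) has_derivative (\<lambda>h. \<i> * of_real h)) (at t)"
      unfolding P_def complex_eq_iff Complex_eq by (auto intro!: derivative_eq_intros)
    from has_derivative_compose[OF this that(1)[OF inS[OF that(2,3)]]]
    show ?thesis unfolding has_field_derivative_def by simp
  qed
  have key: "\<exists>p q. dist p c < 2 * t \<and> dist q c < 2 * t \<and> uxy p = uyx q" if t: "0 < t" "t < R/2" for t
  proof -
    have "\<exists>\<xi> \<eta>. 0 < \<xi> \<and> \<xi> < t \<and> 0 < \<eta> \<and> \<eta> < t \<and>
        u (P t t) - u (P t 0) - u (P 0 t) + u (P 0 0) = t * (t * uxy (P \<xi> \<eta>))"
      by (rule mixed_difference[where f="\<lambda>a b. u (P a b)" and fx="\<lambda>a b. ux (P a b)" and fxy="\<lambda>a b. uxy (P a b)", OF t])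
         (rule line1[OF du] line2[OF dx]; assumption)+
    then obtain a b where ab: "0 < a" "a < t" "0 < b" "b < t"
        "u (P t t) - u (P t 0) - u (P 0 t) + u (P 0 0) = t * (t * uxy (P a b))" by auto
    have "\<exists>\<xi> \<eta>. 0 < \<xi> \<and> \<xi> < t \<and> 0 < \<eta> \<and> \<eta> < t \<and>
        u (P t t) - u (P 0 t) - u (P t 0) + u (P 0 0) = t * (t * uyx (P \<eta> \<xi>))"
      by (rule mixed_difference[where f="\<lambda>b a. u (P a b)" and fx="\<lambda>b a. uy (P a b)" and fxy="\<lambda>b a. uyx (P a b)", OF t])
         (rule line2[OF du] line1[OF dy]; assumption)+
    then obtain a' b' where ab': "0 < a'" "a' < t" "0 < b'" "b' < t"
        "u (P t t) - u (P 0 t) - u (P t 0) + u (P 0 0) = t * (t * uyx (P a' b'))" by auto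
    have "t * (t * uxy (P a b)) = t * (t * uyx (P a' b'))" using ab(5) ab'(5) by linarith
    then have "uxy (P a b) = uyx (P a' b')" using t by simp
    moreover have "dist (P a b) c < 2 * t" "dist (P a' b') c < 2 * t"
      using dP[of a b] dP[of a' b'] ab ab' by (auto simp: dist_commute)
    ultimately show ?thesis by blast
  qed
  show ?thesis
  proof (rule ccontr)
    assume ne: "uxy c \<noteq> uyx c"
    define \<epsilon> where "\<epsilon> = \<bar>uxy c - uyx c\<bar> / 2"
    have e: "\<epsilon> > 0" using ne by (simp add: \<epsilon>_def)
    have "isCont uxy c" "isCont uyx c"
      using cont assms(1,2) by (auto simp: continuous_on_eq_continuous_at)
    then obtain d1 d2 where d: "d1 > 0" "\<And>x. dist x c < d1 \<Longrightarrow> dist (uxy x) (uxy c) < \<epsilon>"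
        "d2 > 0" "\<And>x. dist x c < d2 \<Longrightarrow> dist (uyx x) (uyx c) < \<epsilon>"
      using e unfolding continuous_at_eps_delta by metis
    define t where "t = min (R/4) (min (d1/2) (d2/2))"
    have "0 < t" "t < R/2" "2 * t \<le> d1" "2 * t \<le> d2" using R d by (auto simp: t_def)
    with key[of t] obtain p q where "dist p c < d1" "dist q c < d2" "uxy p = uyx q"
      by (metis order_less_le_trans)
    with d(2)[of p] d(4)[of q] have "\<bar>uyx q - uxy c\<bar> < \<epsilon>" "\<bar>uyx q - uyx c\<bar> < \<epsilon>"
      by (auto simp: dist_real_def)
    then show False
      using abs_triangle_ineq4[of "uyx q - uyx c" "uyx q - uxy c"] by (simp add: \<epsilon>_def)
  qed
qed

text \<open>The conjugate gradient of a harmonic function is holomorphic; its primitive on a disc has the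
  function as real part.\<close>

lemma harmonic_on_ball_Re:
  assumes u: "harmonic_on u S" and B: "ball c R \<subseteq> S" "R > 0"
  obtains F where "F holomorphic_on ball c R" "\<And>w. w \<in> ball c R \<Longrightarrow> u w = Re (F w)"
proof -
  obtain ux uy uxx uxy uyx uyy where o: "open S" and
    D: "\<And>z. z\<in>S \<Longrightarrow> (u has_derivative (\<lambda>h. ux z * Re h + uy z * Im h)) (at z)"
      "\<And>z. z\<in>S \<Longrightarrow> (ux has_derivative (\<lambda>h. uxx z * Re h + uxy z * Im h)) (at z)"
      "\<And>z. z\<in>S \<Longrightarrow> (uy has_derivative (\<lambda>h. uyx z * Re h + uyy z * Im h)) (at z)" and
    C: "continuous_on S uxy" "continuous_on S uyx" and
    L: "\<And>z. z\<in>S \<Longrightarrow> uxx z + uyy z = 0"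
    using u unfolding harmonic_on_def by blast
  define f where "f = (\<lambda>z. Complex (ux z) (- uy z))"
  have df: "(f has_field_derivative Complex (uxx z) (- uxy z)) (at z)" if z: "z \<in> S" for z
  proof -
    have "((\<lambda>z. of_real (ux z) + \<i> * of_real (- uy z)) has_derivative
        (\<lambda>h. of_real (uxx z * Re h + uxy z * Im h) + \<i> * of_real (- (uyx z * Re h + uyy z * Im h)))) (at z)"
      by (intro derivative_intros D z)
    moreover have "uyx z = uxy z" using mixed_derivatives_eq[OF o z D C] by simp
    moreover have "uyy z = - uxx z" using L[OF z] by simp
    ultimately show ?thesis
      unfolding has_field_derivative_def f_def Complex_eq
      by (elim has_derivative_eq_rhs) (auto simp: complex_eq_iff algebra_simps)
  qed
  have "f holomorphic_on ball c R"
    unfolding holomorphic_on_def using df B(1) field_differentiable_at_within field_differentiable_def by blast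
  then obtain g where g: "\<And>x. x \<in> ball c R \<Longrightarrow> (g has_field_derivative f x) (at x within ball c R)"
    using holomorphic_convex_primitive'[of "ball c R" f] by auto
  have g': "(g has_field_derivative f x) (at x)" if "x \<in> ball c R" for x
    using g[OF that] at_within_open[OF that open_ball] by simp
  have "\<exists>k. \<forall>x\<in>ball c R. u x - Re (g x) = k"
  proof (rule has_derivative_zero_constant)
    fix x assume x: "x \<in> ball c R"
    have "(g has_derivative (\<lambda>h. f x * h)) (at x)"
      using g'[OF x] by (simp add: has_field_derivative_def)
    then have "((\<lambda>x. u x - Re (g x)) has_derivative (\<lambda>h. (ux x * Re h + uy x * Im h) - Re (f x * h))) (at x)"
      by (intro derivative_intros D has_derivative_Re) (use x B in auto)
    then have "((\<lambda>x. u x - Re (g x)) has_derivative (\<lambda>h. 0)) (at x)"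
      by (simp add: f_def)
    then show "((\<lambda>x. u x - Re (g x)) has_derivative (\<lambda>h. 0)) (at x within ball c R)"
      by (rule has_derivative_at_withinI)
  qed simp
  then obtain k where k: "\<And>x. x \<in> ball c R \<Longrightarrow> u x - Re (g x) = k" by auto
  show ?thesis
  proof (rule that[of "\<lambda>x. g x + of_real k"])
    show "(\<lambda>x. g x + of_real k) holomorphic_on ball c R"
      using g by (intro holomorphic_intros) (metis holomorphic_on_def field_differentiable_def)
    show "u w = Re (g w + of_real k)" if "w \<in> ball c R" for w using k[OF that] by simp
  qed
qed

lemma harmonic_on_iff_har: "harmonic_on u S \<longleftrightarrow> har u S"
proof
  assume u: "harmonic_on u S"
  then have o: "open S" by (simp add: harmonic_on_def)
  show "har u S"
  proof (rule harI)
    fix z assume "z \<in> S"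
    then obtain e where e: "e > 0" "ball z e \<subseteq> S" using o openE by blast
    obtain F where "F holomorphic_on ball z e" "\<And>w. w \<in> ball z e \<Longrightarrow> u w = Re (F w)"
      using harmonic_on_ball_Re[OF u e(2,1)] by blast
    then show "\<exists>e>0. \<exists>F. ball z e \<subseteq> S \<and> F holomorphic_on ball z e \<and> (\<forall>w\<in>ball z e. u w = Re (F w))"
      using e by blast
  qed
qed (rule har_imp_harmonic_on)

lemma har_ball_Re:
  assumes "har u S" "ball c R \<subseteq> S" "R > 0"
  obtains F where "F holomorphic_on ball c R" "\<And>w. w \<in> ball c R \<Longrightarrow> u w = Re (F w)"
  using harmonic_on_ball_Re assms harmonic_on_iff_har by metis

text \<open>A one-sided bound above the value at the centre controls the oscillation on both sides.
  The estimate depends on \<open>A\<close> and the radius only, so it survives suprema over families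
  of harmonic functions; Perron's function will be continuous for this reason.\<close>

lemma har_oscillation:
  assumes u: "har u (ball c R)" and "R > 0" "A \<ge> 0"
    and "\<And>w. w \<in> ball c R \<Longrightarrow> u w \<le> u c + A" and z: "z \<in> ball c R"
  shows "\<bar>u z - u c\<bar> \<le> 2 * A * (cmod (z - c) / R) / (1 - cmod (z - c) / R)"
proof -
  obtain F where F: "F holomorphic_on ball c R" "\<And>w. w \<in> ball c R \<Longrightarrow> u w = Re (F w)"
    using har_ball_Re[OF u order_refl assms(2)] by blast
  have "\<bar>u z - u c\<bar> = \<bar>Re (F z - F c)\<bar>" using F(2)[OF z] F(2)[of c] assms(2) by simp
  also have "\<dots> \<le> cmod (F z - F c)" by (rule abs_Re_le_cmod)
  also have "\<dots> \<le> 2 * A * (cmod (z - c) / R) / (1 - cmod (z - c) / R)"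
    by (rule Borel_Caratheodory_ball[OF F(1)]) (use assms F in auto)
  finally show ?thesis .
qed

lemma har_compose:
  assumes u: "har u T" and \<phi>: "\<phi> holomorphic_on S" "open S" "\<phi> ` S \<subseteq> T"
  shows "har (\<lambda>w. u (\<phi> w)) S"
proof (rule harI)
  fix z assume z: "z \<in> S"
  then have zT: "\<phi> z \<in> T" using \<phi>(3) by blast
  obtain e F where e: "e > 0" "ball (\<phi> z) e \<subseteq> T" "F holomorphic_on ball (\<phi> z) e"
    "\<And>w. w \<in> ball (\<phi> z) e \<Longrightarrow> u w = Re (F w)" using harE[OF u zT] by blast
  have "isCont \<phi> z" using \<phi>(1,2) z by (meson continuous_on_eq_continuous_at holomorphic_on_imp_continuous_on)
  then obtain d1 where d1: "d1 > 0" "\<And>w. dist w z < d1 \<Longrightarrow> dist (\<phi> w) (\<phi> z) < e"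
    using e(1) unfolding continuous_at_eps_delta by metis
  obtain d2 where d2: "d2 > 0" "ball z d2 \<subseteq> S" using z \<phi>(2) openE by blast
  define d where "d = min d1 d2"
  have sub: "ball z d \<subseteq> S" "\<phi> ` ball z d \<subseteq> ball (\<phi> z) e"
    using d1(2) d2(2) by (auto simp: d_def dist_commute)
  have "(F \<circ> \<phi>) holomorphic_on ball z d"
    by (rule holomorphic_on_compose_gen[OF _ e(3)]) (use sub \<phi>(1) holomorphic_on_subset in blast)+
  then show "\<exists>e>0. \<exists>F. ball z e \<subseteq> S \<and> F holomorphic_on ball z e \<and> (\<forall>w\<in>ball z e. u (\<phi> w) = Re (F w))"
    using d1(1) d2(1) sub e(4) by (intro exI[of _ d] conjI exI[of _ "F \<circ> \<phi>"]) (auto simp: d_def)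
qed

section \<open>The Dirichlet problem\<close>

lemma circle_Re_poly_sum:
  assumes "\<And>i. i \<in> I \<Longrightarrow> \<exists>p::complex poly. \<forall>w\<in>sphere 0 1. g i w = Re (poly p w)"
  shows "\<exists>p::complex poly. \<forall>w\<in>sphere 0 1. (\<Sum>i\<in>I. g i w) = Re (poly p w)"
proof -
  obtain p :: "_ \<Rightarrow> complex poly" where "\<And>i w. i \<in> I \<Longrightarrow> w\<in>sphere 0 1 \<Longrightarrow> g i w = Re (poly (p i) w)"
    using assms by metis
  then show ?thesis by (intro exI[of _ "\<Sum>i\<in>I. p i"]) (simp add: poly_sum)
qed

text \<open>On the unit circle cnj w = 1 / w, and Re x Re y = Re (x y + x cnj y) / 2. The mixed term
  becomes a monomial of degree i - j; when this is negative, conjugating the other factor gives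
  degree j - i instead.\<close>

lemma circle_Re_poly_monom:
  "\<exists>p::complex poly. \<forall>w\<in>sphere 0 1. Re (a * w ^ i) * Re (b * w ^ j) = Re (poly p w)"
proof -
  have id: "Re x * Re y = Re ((x * y + x * cnj y) / 2)" for x y by simp
  have id': "Re x * Re y = Re ((x * y + cnj x * y) / 2)" for x y by simp
  have unit: "w ^ m * cnj (w ^ m) = 1" if "w \<in> sphere 0 1" for w :: complex and m
    using that by (metis complex_norm_square dist_0_norm mem_sphere norm_power of_real_1 power_one)
  show ?thesis
  proof (cases "j \<le> i")
    case True
    have "Re (a * w ^ i) * Re (b * w ^ j) = Re (poly (monom (a * b / 2) (i + j) + monom (a * cnj b / 2) (i - j)) w)"
      if "w \<in> sphere 0 1" for w
    proof -
      have eq: "w ^ i = w ^ (i - j) * w ^ j" using True by (simp flip: power_add)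
      have "(a * w ^ i) * cnj (b * w ^ j) = a * cnj b * w ^ (i - j) * (w ^ j * cnj (w ^ j))"
        by (simp only: eq complex_cnj_mult mult_ac)
      then have E: "(a * w ^ i) * cnj (b * w ^ j) = a * cnj b * w ^ (i - j)" by (simp only: unit[OF that] mult_1_right)
      show ?thesis unfolding id E by (simp add: poly_monom power_add add_divide_distrib mult_ac)
    qed
    then show ?thesis by blast
  next
    case False
    have "Re (a * w ^ i) * Re (b * w ^ j) = Re (poly (monom (a * b / 2) (i + j) + monom (cnj a * b / 2) (j - i)) w)"
      if "w \<in> sphere 0 1" for w
    proof -
      have eq: "w ^ j = w ^ (j - i) * w ^ i" using False by (simp flip: power_add)
      have "cnj (a * w ^ i) * (b * w ^ j) = cnj a * b * w ^ (j - i) * (w ^ i * cnj (w ^ i))"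
        by (simp only: eq complex_cnj_mult mult_ac)
      then have E: "cnj (a * w ^ i) * (b * w ^ j) = cnj a * b * w ^ (j - i)" by (simp only: unit[OF that] mult_1_right)
      show ?thesis unfolding id' E by (simp add: poly_monom power_add add_divide_distrib mult_ac)
    qed
    then show ?thesis by blast
  qed
qed

text \<open>Real polynomials in Re w and Im w restrict to trigonometric polynomials on the circle,
  so each of them is the boundary value of an explicit harmonic function, the real part of a complex
  polynomial.\<close>

lemma real_polynomial_on_circle:
  fixes g :: "complex \<Rightarrow> real"
  assumes "real_polynomial_function g"
  shows "\<exists>p::complex poly. \<forall>w\<in>sphere 0 1. g w = Re (poly p w)"
  using assms
proof (induction g rule: real_polynomial_function.induct)
  case (linear f)
  interpret bounded_linear f by fact
  have "f w = Re (poly [:0, Complex (f 1) (- f \<i>):] w)" for w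
  proof -
    have "f w = f (Re w *\<^sub>R 1 + Im w *\<^sub>R \<i>)" by (rule arg_cong[of _ _ f]) (simp add: complex_eq_iff)
    also have "\<dots> = Re w * f 1 + Im w * f \<i>" by (simp only: add scaleR real_scaleR_def)
    finally show ?thesis by simp
  qed
  then show ?case by blast
next
  case (const c)
  then show ?case by (intro exI[of _ "[:of_real c:]"]) simp
next
  case (add f g)
  then obtain p q :: "complex poly" where "\<forall>w\<in>sphere 0 1. f w = Re (poly p w)" "\<forall>w\<in>sphere 0 1. g w = Re (poly q w)"
    by blast
  then show ?case by (intro exI[of _ "p + q"]) simp
next
  case (mult f g)
  then obtain p q :: "complex poly" where pq: "\<forall>w\<in>sphere 0 1. f w = Re (poly p w)" "\<forall>w\<in>sphere 0 1. g w = Re (poly q w)"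
    by blast
  have "\<exists>r::complex poly. \<forall>w\<in>sphere 0 1. (\<Sum>i\<le>degree p. \<Sum>j\<le>degree q. Re (coeff p i * w ^ i) * Re (coeff q j * w ^ j)) = Re (poly r w)"
    by (intro circle_Re_poly_sum circle_Re_poly_monom)
  then obtain r :: "complex poly" where r: "\<forall>w\<in>sphere 0 1. (\<Sum>i\<le>degree p. \<Sum>j\<le>degree q. Re (coeff p i * w ^ i) * Re (coeff q j * w ^ j)) = Re (poly r w)"
    by blast
  have "f w * g w = Re (poly r w)" if w: "w \<in> sphere 0 1" for w
  proof -
    have "f w * g w = (\<Sum>i\<le>degree p. Re (coeff p i * w ^ i)) * (\<Sum>j\<le>degree q. Re (coeff q j * w ^ j))"
      using pq w by (simp only: poly_altdef Re_sum)
    also have "\<dots> = (\<Sum>i\<le>degree p. \<Sum>j\<le>degree q. Re (coeff p i * w ^ i) * Re (coeff q j * w ^ j))"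
      by (rule sum_product)
    finally show ?thesis using r w by simp
  qed
  then show ?case by blast
qed

text \<open>Approximation takes the place of the Poisson kernel. Boundary values are uniform limits
  of real parts of polynomials; the maximum principle extends the convergence to the closed disc,
  and \<open>Borel_Caratheodory_ball\<close> lifts it to locally uniform convergence of the
  polynomials themselves, so the limit is again locally a real part.\<close>

lemma dirichlet_unit_disc:
  fixes f :: "complex \<Rightarrow> real"
  assumes f: "continuous_on (sphere 0 1) f"
  obtains h where "continuous_on (cball 0 1) h" "har h (ball 0 1)" "\<And>w. w \<in> sphere 0 1 \<Longrightarrow> h w = f w"
proof -
  have "\<exists>p::complex poly. (\<forall>w\<in>sphere 0 1. \<bar>f w - Re (poly p w)\<bar> < inverse (real (Suc n))) \<and> Im (poly p 0) = 0" for n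
  proof -
    obtain g where g: "real_polynomial_function g" "\<And>w. w \<in> sphere 0 1 \<Longrightarrow> \<bar>f w - g w\<bar> < inverse (real (Suc n))"
      using Stone_Weierstrass_real_polynomial_function[OF _ f, of "inverse (real (Suc n))"] by auto
    obtain p :: "complex poly" where p: "\<forall>w\<in>sphere 0 1. g w = Re (poly p w)"
      using real_polynomial_on_circle[OF g(1)] by blast
    \<comment> \<open>Subtracting an imaginary constant does not affect the real part and normalises
      the imaginary part at 0; without this the polynomials need not converge.\<close>
    show ?thesis
      by (rule exI[of _ "p - [:\<i> * of_real (Im (poly p 0)):]"]) (use p g(2) in auto)
  qed
  then obtain p :: "nat \<Rightarrow> complex poly" where
    p: "\<And>n w. w \<in> sphere 0 1 \<Longrightarrow> \<bar>f w - Re (poly (p n) w)\<bar> < inverse (real (Suc n))" "\<And>n. Im (poly (p n) 0) = 0"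
    by metis
  define F where "F = (\<lambda>n. poly (p n))"
  have hol: "F n holomorphic_on A" for n A unfolding F_def by (intro holomorphic_intros)
  have cont: "continuous_on A (\<lambda>w. Re (F n w))" for n A unfolding F_def by (intro continuous_intros)
  define \<epsilon> where "\<epsilon> = (\<lambda>m n. inverse (real (Suc m)) + inverse (real (Suc n)))"
  have e0: "\<epsilon> m n > 0" for m n by (simp add: \<epsilon>_def add_pos_pos)
  have small: "\<exists>N. \<forall>m\<ge>N. \<forall>n\<ge>N. \<epsilon> m n < e" if e: "e > 0" for e
  proof -
    obtain N where N: "inverse (real (Suc N)) < e / 2" using reals_Archimedean[of "e / 2"] half_gt_zero[OF e] by blast
    have "\<epsilon> m n < e" if "m \<ge> N" "n \<ge> N" for m n
    proof -
      have "inverse (real (Suc m)) \<le> inverse (real (Suc N))" "inverse (real (Suc n)) \<le> inverse (real (Suc N))"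
        using that by (simp_all add: le_imp_inverse_le)
      then show ?thesis using N unfolding \<epsilon>_def by linarith
    qed
    then show ?thesis by blast
  qed
  have one: "Re (F m w) - Re (F n w) \<le> \<epsilon> m n" if "w \<in> cball 0 1" for m n w
  proof -
    have "(\<lambda>w. Re (F m w) - Re (F n w)) w \<le> \<epsilon> m n"
    proof (rule har_max_principle[of "\<lambda>w. Re (F m w) - Re (F n w)" "ball 0 1"])
      show "har (\<lambda>w. Re (F m w) - Re (F n w)) (ball 0 1)" by (intro har_diff har_Re hol) auto
      show "continuous_on (closure (ball 0 1)) (\<lambda>w. Re (F m w) - Re (F n w))" by (intro continuous_intros cont)
      show "Re (F m w) - Re (F n w) \<le> \<epsilon> m n" if "w \<in> frontier (ball 0 1)" for w
        using p(1)[of w m] p(1)[of w n] that by (simp add: \<epsilon>_def F_def)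
    qed (use that in auto)
    then show ?thesis .
  qed
  have two: "\<bar>Re (F m w) - Re (F n w)\<bar> \<le> \<epsilon> m n" if "w \<in> cball 0 1" for m n w
    using one[OF that, of m n] one[OF that, of n m] by (simp add: \<epsilon>_def)
  have "\<forall>e>0. \<exists>N. \<forall>m n x. N \<le> m \<and> N \<le> n \<and> x \<in> cball 0 1 \<longrightarrow> dist (Re (F m x)) (Re (F n x)) < e"
    using small two unfolding dist_real_def by (meson order_le_less_trans)
  then obtain h where h: "\<And>e. e > 0 \<Longrightarrow> \<exists>N. \<forall>n x. N \<le> n \<and> x \<in> cball 0 1 \<longrightarrow> dist (Re (F n x)) (h x) < e"
    using uniformly_convergent_eq_cauchy[of "\<lambda>x. x \<in> cball 0 1" "\<lambda>n x. Re (F n x)"] by blast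
  have ul: "uniform_limit (cball 0 1) (\<lambda>n x. Re (F n x)) h sequentially"
    unfolding uniform_limit_sequentially_iff using h by blast
  have ptw: "(\<lambda>n. Re (F n x)) \<longlonglongrightarrow> h x" if "x \<in> cball 0 1" for x
    using tendsto_uniform_limitI[OF ul that] .
  have ch: "continuous_on (cball 0 1) h"
    by (rule uniform_limit_theorem[OF _ ul]) (intro always_eventually allI cont trivial_limit_sequentially)+
  have hf: "h w = f w" if "w \<in> sphere 0 1" for w
  proof -
    have "(\<lambda>n. Re (F n w)) \<longlonglongrightarrow> f w"
    proof (rule LIMSEQ_I)
      fix e :: real assume "e > 0"
      then obtain N where N: "inverse (real (Suc N)) < e" using reals_Archimedean by blast
      have "norm (Re (F n w) - f w) < e" if "n \<ge> N" for n
      proof -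
        have "inverse (real (Suc n)) \<le> inverse (real (Suc N))" using that by (simp add: le_imp_inverse_le)
        then have "\<bar>f w - Re (F n w)\<bar> < e"
          using p(1)[OF \<open>w \<in> sphere 0 1\<close>, of n] N unfolding F_def by linarith
        then show ?thesis by (simp add: abs_minus_commute)
      qed
      then show "\<exists>N. \<forall>n\<ge>N. norm (Re (F n w) - f w) < e" by blast
    qed
    then show ?thesis using ptw[of w] that LIMSEQ_unique by fastforce
  qed
  have loc: "\<exists>G. G holomorphic_on ball 0 s \<and> (\<forall>w\<in>ball 0 s. h w = Re (G w))" if s: "0 < s" "s < 1" for s
  proof -
    have bd: "cmod (F m w - F n w) \<le> \<epsilon> m n * (1 + 4 * s / (1 - s))" if w: "w \<in> cball 0 s" for m n w
    proof -
      define H where "H = (\<lambda>w. F m w - F n w)"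
      have "cmod (H w - H 0) \<le> 2 * (2 * \<epsilon> m n) * (cmod (w - 0) / 1) / (1 - cmod (w - 0) / 1)"
      proof (rule Borel_Caratheodory_ball)
        show "H holomorphic_on ball 0 1" unfolding H_def by (intro holomorphic_intros hol)
        show "Re (H x) \<le> Re (H 0) + 2 * \<epsilon> m n" if "x \<in> ball 0 1" for x
          using two[of x m n] two[of 0 m n] that by (simp add: H_def)
      qed (use w s e0[of m n] in auto)
      also have "\<dots> = 4 * \<epsilon> m n * (cmod w / (1 - cmod w))" by simp
      also have "\<dots> \<le> 4 * \<epsilon> m n * (s / (1 - s))"
        using w s e0[of m n] by (intro mult_left_mono frac_le) auto
      finally have 1: "cmod (H w - H 0) \<le> 4 * \<epsilon> m n * (s / (1 - s))" .
      have "Im (H 0) = 0" using p(2) by (simp add: H_def F_def)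
      then have "cmod (H 0) = \<bar>Re (H 0)\<bar>" by (simp add: cmod_def)
      then have 2: "cmod (H 0) \<le> \<epsilon> m n" using two[of 0 m n] by (simp add: H_def)
      have "cmod (H w) \<le> cmod (H w - H 0) + cmod (H 0)" by (metis diff_add_cancel norm_triangle_ineq)
      then show ?thesis using 1 2 by (simp add: H_def algebra_simps)
    qed
    define K where "K = 1 + 4 * s / (1 - s)"
    have K: "K > 0" using s by (simp add: K_def add_pos_nonneg)
    have "\<forall>e>0. \<exists>N. \<forall>m n x. N \<le> m \<and> N \<le> n \<and> x \<in> cball 0 s \<longrightarrow> dist (F m x) (F n x) < e"
    proof (intro allI impI)
      fix e :: real assume "e > 0"
      then obtain N where N: "\<forall>m\<ge>N. \<forall>n\<ge>N. \<epsilon> m n < e / K" using small[of "e/K"] K by auto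
      have "dist (F m x) (F n x) < e" if "N \<le> m" "N \<le> n" "x \<in> cball 0 s" for m n x
      proof -
        have "dist (F m x) (F n x) \<le> \<epsilon> m n * K" using bd[OF that(3)] by (simp add: K_def dist_norm)
        also have "\<dots> < e" using N that K by (simp add: pos_less_divide_eq)
        finally show ?thesis .
      qed
      then show "\<exists>N. \<forall>m n x. N \<le> m \<and> N \<le> n \<and> x \<in> cball 0 s \<longrightarrow> dist (F m x) (F n x) < e" by blast
    qed
    then obtain G where G: "\<And>e. e > 0 \<Longrightarrow> \<exists>N. \<forall>n x. N \<le> n \<and> x \<in> cball 0 s \<longrightarrow> dist (F n x) (G x) < e"
      using uniformly_convergent_eq_cauchy[of "\<lambda>x. x \<in> cball 0 s" F] by blast
    have ulG: "uniform_limit (cball 0 s) F G sequentially"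
      unfolding uniform_limit_sequentially_iff using G by blast
    have "G holomorphic_on ball 0 s"
      by (rule holomorphic_uniform_limit[OF _ ulG])
         (intro always_eventually allI conjI holomorphic_on_imp_continuous_on hol trivial_limit_sequentially)+
    moreover have "h w = Re (G w)" if "w \<in> ball 0 s" for w
    proof -
      have "(\<lambda>n. F n w) \<longlonglongrightarrow> G w" using tendsto_uniform_limitI[OF ulG] that by force
      then have "(\<lambda>n. Re (F n w)) \<longlonglongrightarrow> Re (G w)" by (rule tendsto_Re)
      then show ?thesis using ptw[of w] that s LIMSEQ_unique by fastforce
    qed
    ultimately show ?thesis by blast
  qed
  have "har h (ball 0 1)"
  proof (rule harI)
    fix z :: complex assume z: "z \<in> ball 0 1"
    define s where "s = (1 + cmod z) / 2"
    have s: "0 < s" "s < 1" "cmod z < s" using z by (auto simp: s_def intro: add_pos_nonneg)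
    obtain G where G: "G holomorphic_on ball 0 s" "\<forall>w\<in>ball 0 s. h w = Re (G w)" using loc[OF s(1,2)] by blast
    have sub: "ball z (s - cmod z) \<subseteq> ball 0 s" using ball_shift_subset[of z 0 s] s by simp
    have "ball z (s - cmod z) \<subseteq> ball 0 1" using sub s by force
    then show "\<exists>e>0. \<exists>F. ball z e \<subseteq> ball 0 1 \<and> F holomorphic_on ball z e \<and> (\<forall>w\<in>ball z e. h w = Re (F w))"
      using s sub G by (intro exI[of _ "s - cmod z"] conjI exI[of _ G]) (auto intro: holomorphic_on_subset)
  qed
  then show ?thesis using that ch hf by blast
qed

lemma dirichlet_disc:
  fixes f :: "complex \<Rightarrow> real"
  assumes f: "continuous_on (sphere c R) f" and R: "R > 0"
  obtains h where "continuous_on (cball c R) h" "har h (ball c R)" "\<And>w. w \<in> sphere c R \<Longrightarrow> h w = f w"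
proof -
  define \<psi> where "\<psi> = (\<lambda>w. c + of_real R * w)"
  define \<phi> where "\<phi> = (\<lambda>w. (w - c) / of_real R)"
  have "continuous_on (sphere 0 1) (f \<circ> \<psi>)"
    by (rule continuous_on_compose2[OF f, of _ \<psi>, unfolded o_def[symmetric]])
       (use R in \<open>auto simp: \<psi>_def dist_norm norm_mult intro!: continuous_intros\<close>)
  then obtain h where h: "continuous_on (cball 0 1) h" "har h (ball 0 1)" "\<And>w. w \<in> sphere 0 1 \<Longrightarrow> h w = f (\<psi> w)"
    using dirichlet_unit_disc by (metis o_apply)
  have n: "cmod (\<phi> w) = dist c w / R" for w using R by (simp add: \<phi>_def norm_divide dist_norm norm_minus_commute)
  have inv: "\<psi> (\<phi> w) = w" for w using R by (simp add: \<psi>_def \<phi>_def)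
  show ?thesis
  proof (rule that[of "\<lambda>w. h (\<phi> w)"])
    show "continuous_on (cball c R) (\<lambda>w. h (\<phi> w))"
      by (rule continuous_on_compose2[OF h(1)]) (use R n in \<open>auto simp: \<phi>_def intro!: continuous_intros\<close>)
    show "har (\<lambda>w. h (\<phi> w)) (ball c R)"
      by (rule har_compose[OF h(2)]) (use R n in \<open>auto simp: \<phi>_def intro!: holomorphic_intros\<close>)
    show "h (\<phi> w) = f w" if "w \<in> sphere c R" for w
      using h(3)[of "\<phi> w"] inv n R that by simp
  qed
qed

section \<open>Perron's method\<close>

definition perron_family :: "complex set \<Rightarrow> (complex \<Rightarrow> real) \<Rightarrow> (complex \<Rightarrow> real) set" where
  "perron_family S f = {v. continuous_on (closure S) v \<and> subhar v S \<and> (\<forall>w\<in>frontier S. v w \<le> f w)}"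

lemma perron_family_max:
  "v \<in> perron_family S f \<Longrightarrow> w \<in> perron_family S f \<Longrightarrow> (\<lambda>x. max (v x) (w x)) \<in> perron_family S f"
  unfolding perron_family_def by (auto intro!: subhar_max continuous_on_max)

lemma perron_family_finite_max:
  assumes "finite D" "v0 \<in> perron_family S f" "\<And>x. x \<in> D \<Longrightarrow> V x \<in> perron_family S f"
  shows "\<exists>v\<in>perron_family S f. \<forall>x\<in>D. \<forall>w. V x w \<le> v w"
  using assms(1,3)
proof (induction D)
  case empty
  then show ?case using assms(2) by blast
next
  case (insert x D)
  then obtain v where v: "v \<in> perron_family S f" "\<forall>x\<in>D. \<forall>w. V x w \<le> v w" by auto
  show ?case
    by (rule bexI[of _ "\<lambda>y. max (v y) (V x y)"])
       (use v insert.prems perron_family_max in \<open>auto simp: le_max_iff_disj\<close>)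
qed

text \<open>Replacing a subfunction inside a disc by the harmonic function with the same values on
  the bounding circle can only increase it, by the maximum principle, and keeps it in the
  family.\<close>

lemma perron_lift:
  assumes S: "open S" "bounded S" and v: "v \<in> perron_family S f" and B: "cball c R \<subseteq> S" "R > 0"
  obtains v' where "v' \<in> perron_family S f" "\<And>w. w \<in> closure S \<Longrightarrow> v w \<le> v' w" "har v' (ball c R)"
    "continuous_on (cball c R) v'" "\<And>w. w \<notin> ball c R \<Longrightarrow> v' w = v w"
proof -
  have v': "continuous_on (closure S) v" "subhar v S" "\<And>w. w \<in> frontier S \<Longrightarrow> v w \<le> f w"
    using v by (auto simp: perron_family_def)
  have BS: "cball c R \<subseteq> closure S" using B closure_subset by blast
  have "continuous_on (sphere c R) v" by (rule continuous_on_subset[OF v'(1)]) (use BS in auto)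
  then obtain h where h: "continuous_on (cball c R) h" "har h (ball c R)" "\<And>w. w \<in> sphere c R \<Longrightarrow> h w = v w"
    using dirichlet_disc B(2) by blast
  define V where "V = (\<lambda>w. if w \<in> cball c R then h w else v w)"
  have le: "v w \<le> h w" if "w \<in> cball c R" for w
  proof -
    have "(\<lambda>w. v w + - h w) w \<le> 0"
    proof (rule subhar_max_principle[of "ball c R" "\<lambda>w. v w + - h w"])
      show "subhar (\<lambda>w. v w + - h w) (ball c R)"
        by (intro subhar_add har_imp_subhar har_minus h subhar_subset[OF v'(2)]) (use B in auto)
      show "continuous_on (closure (ball c R)) (\<lambda>w. v w + - h w)"
        using B(2) BS by (auto intro!: continuous_intros h continuous_on_subset[OF v'(1)])
    qed (use that B(2) h(3) in auto)
    then show ?thesis by simp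
  qed
  have leV: "v w \<le> V w" for w using le by (simp add: V_def)
  have out: "V w = v w" if "w \<notin> ball c R" for w
    using that h(3) by (auto simp: V_def)
  have harV: "har V (ball c R)" by (rule har_cong[OF h(2)]) (simp add: V_def)
  have contV: "continuous_on (cball c R) V"
    using h(1) by (rule continuous_on_eq) (simp add: V_def)
  have "continuous_on (cball c R \<union> (closure S - ball c R)) V"
  proof (rule continuous_on_closed_Un)
    show "continuous_on (closure S - ball c R) V"
      by (rule continuous_on_eq[OF continuous_on_subset[OF v'(1)]]) (use out in auto)
  qed (auto intro: contV closed_Diff)
  moreover have "cball c R \<union> (closure S - ball c R) = closure S" using BS by auto
  ultimately have cV: "continuous_on (closure S) V" by simp
  have "subhar V S"
    unfolding subhar_def
  proof
    fix z assume z: "z \<in> S"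
    show "\<exists>e>0. \<exists>F. ball z e \<subseteq> S \<and> F holomorphic_on ball z e \<and> V z = Re (F z) \<and> (\<forall>w\<in>ball z e. Re (F w) \<le> V w)"
    proof (cases "z \<in> ball c R")
      case True
      obtain e F where F: "e > 0" "ball z e \<subseteq> ball c R" "F holomorphic_on ball z e" "V z = Re (F z)"
        "\<And>w. w \<in> ball z e \<Longrightarrow> Re (F w) \<le> V w" using subharE[OF har_imp_subhar[OF harV] True] by blast
      have "ball z e \<subseteq> S" using F(2) B(1) ball_subset_cball[of c R] by blast
      then show ?thesis using F by blast
    next
      case False
      \<comment> \<open>Outside the open disc \<open>V\<close> equals \<open>v\<close> at
        \<open>z\<close> and is at least \<open>v\<close> nearby, so the harmonic support of
        \<open>v\<close> at \<open>z\<close> also supports \<open>V\<close>.\<close>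
      obtain e F where F: "e > 0" "ball z e \<subseteq> S" "F holomorphic_on ball z e" "v z = Re (F z)"
        "\<And>w. w \<in> ball z e \<Longrightarrow> Re (F w) \<le> v w" using subharE[OF v'(2) z] by blast
      have "\<forall>w\<in>ball z e. Re (F w) \<le> V w" using F(5) leV order_trans by blast
      then show ?thesis using F out[OF False] by auto
    qed
  qed
  moreover have "V w \<le> f w" if "w \<in> frontier S" for w
  proof -
    have "w \<notin> S" using that S(1) by (simp add: frontier_def interior_open)
    then have "w \<notin> ball c R" using B(1) by force
    then show ?thesis using out v'(3)[OF that] by simp
  qed
  ultimately have "V \<in> perron_family S f" using cV by (simp add: perron_family_def)
  then show ?thesis using that leV harV contV out by blast
qed

text \<open>The disc of half the radius that touches the exterior disc from inside at \<zeta> meets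
  the closure of \<open>S\<close> at most at \<zeta>. The logarithm of the distance to its centre,
  divided by its radius, therefore vanishes at \<zeta> and is positive elsewhere on the
  closure.\<close>

lemma exterior_disc_barrier:
  fixes S :: "complex set"
  assumes r: "r > 0" "dist \<zeta> c = r" "ball c r \<inter> S = {}" and S: "open S"
  obtains b where "har b S" "continuous_on (closure S) b" "b \<zeta> = 0"
    "\<And>w. w \<in> closure S \<Longrightarrow> w \<noteq> \<zeta> \<Longrightarrow> b w > 0"
proof -
  define q where "q = (\<zeta> - c) / 2"
  define c' where "c' = c + q"
  have cq: "cmod q = r / 2" using r(2) by (simp add: q_def norm_divide dist_norm)
  have cl: "dist c w \<ge> r" if "w \<in> closure S" for w
  proof -
    have "ball c r \<inter> closure S = {}" using r(3) open_Int_closure_eq_empty[of "ball c r" S] by simp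
    then show ?thesis using that by force
  qed
  have ge: "cmod (w - c') \<ge> r / 2" if "w \<in> closure S" for w
  proof -
    have "r \<le> cmod (w - c)" using cl[OF that] by (simp add: dist_norm norm_minus_commute)
    also have "w - c = (w - c') + q" by (simp add: c'_def)
    also have "cmod \<dots> \<le> cmod (w - c') + cmod q" by (rule norm_triangle_ineq)
    finally show ?thesis using cq by simp
  qed
  have gt: "cmod (w - c') > r / 2" if "w \<in> closure S" "w \<noteq> \<zeta>" for w
  proof (rule ccontr)
    assume "\<not> ?thesis"
    then have p: "cmod (w - c') = r / 2" using ge[OF that(1)] by simp
    have "r \<le> cmod ((w - c') + q)" using cl[OF that(1)] by (simp add: dist_norm norm_minus_commute c'_def)
    then have "r\<^sup>2 \<le> (cmod ((w - c') + q))\<^sup>2" using r(1) by (simp add: power_mono)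
    \<comment> \<open>Parallelogram law: |w - c'| = |q| and |w - c| \<ge> 2 |q| force w - c' = q,
      that is, w = \<zeta>.\<close>
    moreover have "(cmod ((w - c') + q))\<^sup>2 + (cmod ((w - c') - q))\<^sup>2 = 2 * (cmod (w - c'))\<^sup>2 + 2 * (cmod q)\<^sup>2"
      unfolding cmod_power2 by (simp add: power2_eq_square algebra_simps)
    moreover have "2 * (cmod (w - c'))\<^sup>2 + 2 * (cmod q)\<^sup>2 = r\<^sup>2" unfolding p cq by (simp add: power2_eq_square)
    ultimately have "(cmod ((w - c') - q))\<^sup>2 \<le> 0" by linarith
    then have "w - c' = q" by simp
    then have "w = \<zeta>" by (simp add: c'_def q_def field_simps)
    then show False using that by simp
  qed
  show ?thesis
  proof (rule that[of "\<lambda>w. ln (cmod ((w - c') / of_real (r/2)))"])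
    have ne: "w - c' \<noteq> 0" if "w \<in> closure S" for w using ge[OF that] r(1) by auto
    show "har (\<lambda>w. ln (cmod ((w - c') / of_real (r/2)))) S"
      by (rule har_ln_cmod) (use r(1) ne closure_subset S in \<open>auto intro!: holomorphic_intros\<close>)
    show "continuous_on (closure S) (\<lambda>w. ln (cmod ((w - c') / of_real (r/2))))"
      using r(1) ne by (auto intro!: continuous_intros)
    have "\<zeta> - c' = q" by (simp add: c'_def q_def field_simps)
    then show "ln (cmod ((\<zeta> - c') / of_real (r/2))) = 0" using cq r(1) by (simp add: norm_divide)
    show "ln (cmod ((w - c') / of_real (r/2))) > 0" if "w \<in> closure S" "w \<noteq> \<zeta>" for w
    proof (rule ln_gt_zero)
      have "cmod ((w - c') / of_real (r/2)) = cmod (w - c') / (r/2)" using r(1) by (simp only: norm_divide norm_of_real abs_of_pos half_gt_zero)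
      then show "1 < cmod ((w - c') / of_real (r/2))" using gt[OF that] r(1) by simp
    qed
  qed
qed

text \<open>Continuity of the supremum inside comes from one oscillation bound valid for all lifts.
  Harmonicity follows by comparing the supremum on each disc with the Dirichlet solution for its own
  values on the circle, and the boundary values from the barriers supplied by exterior
  discs.\<close>

theorem perron_dirichlet:
  fixes f :: "complex \<Rightarrow> real"
  assumes S: "open S" "bounded S" and f: "continuous_on (frontier S) f"
    and ext: "\<And>\<zeta>. \<zeta> \<in> frontier S \<Longrightarrow> \<exists>c r. r > 0 \<and> dist \<zeta> c = r \<and> ball c r \<inter> S = {}"
  obtains u where "continuous_on (closure S) u" "har u S" "\<And>w. w \<in> frontier S \<Longrightarrow> u w = f w"
proof -
  have cfr: "compact (frontier S)" using S(2) by (rule compact_frontier_bounded)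
  have "bounded (f ` frontier S)" using compact_continuous_image[OF f cfr] compact_imp_bounded by blast
  then obtain B0 where B0: "\<And>w. w \<in> frontier S \<Longrightarrow> \<bar>f w\<bar> \<le> B0" by (auto simp: bounded_iff)
  define B where "B = max B0 1"
  have B: "B > 0" "\<And>w. w \<in> frontier S \<Longrightarrow> \<bar>f w\<bar> \<le> B" using B0 by (auto simp: B_def le_max_iff_disj)
  have fB: "f w \<le> B" "- B \<le> f w" if "w \<in> frontier S" for w
    using B(2)[OF that] by linarith+
  define P where "P = perron_family S f"
  define u where "u = (\<lambda>z. SUP v\<in>P. v z)"
  have Pc: "continuous_on (closure S) v" and Ps: "subhar v S" and Pf: "\<And>w. w \<in> frontier S \<Longrightarrow> v w \<le> f w"
    if "v \<in> P" for v using that by (auto simp: P_def perron_family_def)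
  have vB: "v w \<le> B" if "v \<in> P" "w \<in> closure S" for v w
    by (rule subhar_max_principle[OF S Ps[OF that(1)] Pc[OF that(1)] _ that(2)])
       (use Pf[OF that(1)] fB in \<open>blast intro: order_trans\<close>)
  have constP: "(\<lambda>w. - B) \<in> P"
    using fB unfolding P_def perron_family_def
    by (auto intro: har_imp_subhar har_const S(1))
  have up: "v w \<le> u w" if "v \<in> P" "w \<in> closure S" for v w
    unfolding u_def by (rule cSUP_upper[OF that(1)]) (use vB that in \<open>auto simp: bdd_above_def\<close>)
  have lub: "u w \<le> k" if "\<And>v. v \<in> P \<Longrightarrow> v w \<le> k" for w k
    unfolding u_def by (rule cSUP_least) (use constP that in auto)
  have clS: "w \<in> S \<Longrightarrow> w \<in> closure S" for w using closure_subset by blast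
  have osc: "\<bar>u z - u c\<bar> \<le> 4 * B * (cmod (z - c) / R) / (1 - cmod (z - c) / R)"
    if c: "cball c R \<subseteq> S" "R > 0" and z: "z \<in> ball c R" for c z R
  proof -
    define w where "w = 4 * B * (cmod (z - c) / R) / (1 - cmod (z - c) / R)"
    have cS: "c \<in> S" "z \<in> S" using c z by (auto simp: subset_iff)
    have ex: "\<exists>v'\<in>P. v z \<le> v' z \<and> v c \<le> v' c \<and> \<bar>v' z - v' c\<bar> \<le> w" if v: "v \<in> P" for v
    proof -
      \<comment> \<open>Truncation at - B bounds the lift at the centre from below, so that A = 2 B
        is admissible in \<open>har_oscillation\<close> for every subfunction.\<close>
      have "(\<lambda>x. max (v x) (- B)) \<in> perron_family S f"
        using v constP unfolding P_def by (rule perron_family_max)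
      from perron_lift[OF S this c] obtain v' where v': "v' \<in> P"
        "\<And>w. w \<in> closure S \<Longrightarrow> max (v w) (- B) \<le> v' w" "har v' (ball c R)" by (metis P_def)
      have "\<bar>v' z - v' c\<bar> \<le> 2 * (2 * B) * (cmod (z - c) / R) / (1 - cmod (z - c) / R)"
      proof (rule har_oscillation[OF v'(3) c(2)])
        show "v' x \<le> v' c + 2 * B" if "x \<in> ball c R" for x
          using vB[OF v'(1), of x] v'(2)[of c] clS cS(1) that c(1) ball_subset_cball[of c R] by force
      qed (use B z in auto)
      then show ?thesis using v' clS cS by (intro bexI[of _ v']) (auto simp: w_def)
    qed
    have "u z \<le> u c + w"
    proof (rule lub)
      fix v assume "v \<in> P"
      from ex[OF this] obtain v' where "v' \<in> P" "v z \<le> v' z" "\<bar>v' z - v' c\<bar> \<le> w" by blast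
      then show "v z \<le> u c + w" using up[of v' c] clS[OF cS(1)] by linarith
    qed
    moreover have "u c \<le> u z + w"
    proof (rule lub)
      fix v assume "v \<in> P"
      from ex[OF this] obtain v' where "v' \<in> P" "v c \<le> v' c" "\<bar>v' z - v' c\<bar> \<le> w" by blast
      then show "v c \<le> u z + w" using up[of v' z] clS[OF cS(2)] by linarith
    qed
    ultimately show ?thesis by (simp add: w_def abs_le_iff)
  qed
  have cu: "isCont u c" if c: "c \<in> S" for c
  proof -
    obtain R where R: "R > 0" "cball c R \<subseteq> S" using S(1) c open_contains_cball by blast
    have "((\<lambda>z. 4 * B * (cmod (z - c) / R) / (1 - cmod (z - c) / R)) \<longlongrightarrow> 4 * B * (cmod (c - c) / R) / (1 - cmod (c - c) / R)) (at c)"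
      using R by (intro tendsto_intros) auto
    then have lim: "((\<lambda>z. 4 * B * (cmod (z - c) / R) / (1 - cmod (z - c) / R)) \<longlongrightarrow> 0) (at c)" by simp
    have "eventually (\<lambda>z. z \<in> ball c R) (at c)"
      using R(1) by (intro eventually_at_in_open') auto
    then have "eventually (\<lambda>z. norm (u z - u c) \<le> 4 * B * (cmod (z - c) / R) / (1 - cmod (z - c) / R)) (at c)"
      by eventually_elim (use osc[OF R(2,1)] in simp)
    then have "((\<lambda>z. u z - u c) \<longlongrightarrow> 0) (at c)"
      by (rule Lim_null_comparison[OF _ lim])
    then show ?thesis unfolding isCont_def using LIM_zero_cancel by blast
  qed
  have ball: "\<exists>h. har h (ball c R) \<and> (\<forall>w\<in>ball c R. u w = h w)" if c: "cball c R \<subseteq> S" "R > 0" for c R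
  proof -
    have cS: "closure S \<supseteq> cball c R" using c(1) clS by blast
    have "continuous_on (sphere c R) u"
      by (rule continuous_at_imp_continuous_on) (use c(1) cu in \<open>auto simp: subset_iff\<close>)
    then obtain h where h: "continuous_on (cball c R) h" "har h (ball c R)" "\<And>w. w \<in> sphere c R \<Longrightarrow> h w = u w"
      using dirichlet_disc c(2) by blast
    have "u w = h w" if w: "w \<in> ball c R" for w
    proof (rule antisym)
      show "u w \<le> h w"
      proof (rule lub)
        fix v assume v: "v \<in> P"
        have "(\<lambda>w. v w + - h w) w \<le> 0"
        proof (rule subhar_max_principle[of "ball c R" "\<lambda>w. v w + - h w"])
          show "subhar (\<lambda>w. v w + - h w) (ball c R)"
            by (intro subhar_add har_imp_subhar har_minus h subhar_subset[OF Ps[OF v]]) (use c in auto)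
          show "continuous_on (closure (ball c R)) (\<lambda>w. v w + - h w)"
            using c(2) cS by (auto intro!: continuous_intros h continuous_on_subset[OF Pc[OF v]])
          show "v w + - h w \<le> 0" if "w \<in> frontier (ball c R)" for w
            using that c(2) h(3)[of w] up[OF v, of w] cS by auto
        qed (use w c(2) in auto)
        then show "v w \<le> h w" by simp
      qed
      show "h w \<le> u w"
      proof (rule field_le_epsilon)
        fix \<epsilon> :: real assume e: "\<epsilon> > 0"
        \<comment> \<open>Compactness of the circle: finitely many subfunctions, each within
          \<epsilon> of \<open>u\<close> near one point, have a maximum within \<epsilon> of
          \<open>u\<close> on the whole circle. The lift of this maximum is compared with
          \<open>h\<close>.\<close>
        have "\<exists>v\<in>P. u x - \<epsilon> < v x" for x
          using lub[of x "u x - \<epsilon>"] e by force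
        then obtain V where V: "\<And>x. V x \<in> P" "\<And>x. u x - \<epsilon> < V x x" by metis
        define T where "T = (\<lambda>x. {w \<in> S. u w - \<epsilon> < V x w})"
        have "open (T x)" for x
        proof -
          have "continuous_on S (\<lambda>w. V x w - u w)"
            by (intro continuous_intros continuous_on_subset[OF Pc[OF V(1)]] continuous_at_imp_continuous_on)
               (use cu closure_subset in auto)
          then have "open (S \<inter> (\<lambda>w. V x w - u w) -` {- \<epsilon><..})"
            using continuous_on_open_vimage[OF S(1)] by (metis inf_commute open_greaterThan)
          moreover have "S \<inter> (\<lambda>w. V x w - u w) -` {- \<epsilon><..} = T x" by (auto simp: T_def)
          ultimately show ?thesis by simp
        qed
        moreover have "sphere c R \<subseteq> (\<Union>x\<in>sphere c R. T x)"
        proof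
          fix x assume x: "x \<in> sphere c R"
          then have "x \<in> T x" using V(2) c(1) by (auto simp: T_def subset_iff)
          then show "x \<in> (\<Union>x\<in>sphere c R. T x)" using x by blast
        qed
        ultimately obtain D where D: "D \<subseteq> sphere c R" "finite D" "sphere c R \<subseteq> (\<Union>x\<in>D. T x)"
          using compactE_image[of "sphere c R" "sphere c R" T] by auto
        obtain v where v: "v \<in> P" "\<forall>x\<in>D. \<forall>w. V x w \<le> v w"
          using perron_family_finite_max[OF D(2), of _ S f V] constP V(1) unfolding P_def by blast
        have vs: "u x - \<epsilon> < v x" if x: "x \<in> sphere c R" for x
        proof -
          obtain y where "y \<in> D" "x \<in> T y" using D(3) x by blast
          then have "u x - \<epsilon> < V y x" "V y x \<le> v x" using v(2) by (auto simp: T_def)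
          then show ?thesis by linarith
        qed
        from perron_lift[OF S v(1)[unfolded P_def] c] obtain v' where v': "v' \<in> P"
          "\<And>w. w \<in> closure S \<Longrightarrow> v w \<le> v' w" "har v' (ball c R)" "continuous_on (cball c R) v'"
          by (metis P_def)
        have "(\<lambda>w. h w - v' w) w \<le> \<epsilon>"
        proof (rule har_max_principle[of "\<lambda>w. h w - v' w" "ball c R"])
          show "har (\<lambda>w. h w - v' w) (ball c R)" by (intro har_diff h v')
          show "continuous_on (closure (ball c R)) (\<lambda>w. h w - v' w)"
            using c(2) by (auto intro!: continuous_intros h v')
          show "h w - v' w \<le> \<epsilon>" if "w \<in> frontier (ball c R)" for w
          proof -
            have "w \<in> sphere c R" using that c(2) by simp
            moreover have "w \<in> closure S" using calculation cS by auto
            ultimately show ?thesis using vs[of w] v'(2)[of w] h(3)[of w] by linarith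
          qed
        qed (use w c(2) in auto)
        then show "h w \<le> u w + \<epsilon>" using up[OF v'(1), of w] w cS by force
      qed
    qed
    then show ?thesis using h(2) by blast
  qed
  have hu: "har u S"
  proof (rule harI)
    fix z assume z: "z \<in> S"
    obtain R where R: "R > 0" "cball z R \<subseteq> S" using S(1) z open_contains_cball by blast
    obtain h where h: "har h (ball z R)" "\<forall>w\<in>ball z R. u w = h w" using ball[OF R(2,1)] by blast
    obtain F where "F holomorphic_on ball z R" "\<And>w. w \<in> ball z R \<Longrightarrow> h w = Re (F w)"
      using har_ball_Re[OF h(1) order_refl R(1)] by blast
    then show "\<exists>e>0. \<exists>F. ball z e \<subseteq> S \<and> F holomorphic_on ball z e \<and> (\<forall>w\<in>ball z e. u w = Re (F w))"
      using R h(2) ball_subset_cball[of z R] by (intro exI[of _ R] conjI exI[of _ F]) auto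
  qed
  have bdry: "u \<zeta> = f \<zeta> \<and> continuous (at \<zeta> within closure S) u" if \<zeta>: "\<zeta> \<in> frontier S" for \<zeta>
  proof -
    obtain c r where r: "r > 0" "dist \<zeta> c = r" "ball c r \<inter> S = {}" using ext[OF \<zeta>] by blast
    obtain b where b: "har b S" "continuous_on (closure S) b" "b \<zeta> = 0" "\<And>w. w \<in> closure S \<Longrightarrow> w \<noteq> \<zeta> \<Longrightarrow> b w > 0"
      using exterior_disc_barrier[OF r S(1)] by blast
    have \<zeta>c: "\<zeta> \<in> closure S" using \<zeta> by (simp add: frontier_def)
    have b0: "b w \<ge> 0" if "w \<in> closure S" for w using b(3) b(4)[OF that] by (cases "w = \<zeta>") auto
    \<comment> \<open>Near \<zeta> the continuity of \<open>f\<close> suffices; away from \<zeta>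
      the barrier has a positive lower bound \<beta>, and K = 2 B / \<beta> makes K b exceed the
      oscillation of \<open>f\<close>.\<close>
    have K: "\<exists>K\<ge>0. \<forall>w\<in>frontier S. \<bar>f w - f \<zeta>\<bar> \<le> \<epsilon> + K * b w" if e: "\<epsilon> > 0" for \<epsilon>
    proof -
      obtain d where d: "d > 0" "\<And>w. w \<in> frontier S \<Longrightarrow> dist w \<zeta> < d \<Longrightarrow> dist (f w) (f \<zeta>) < \<epsilon>"
        using f \<zeta> e unfolding continuous_on_iff by meson
      define Q where "Q = frontier S - ball \<zeta> d"
      have Q: "compact Q" unfolding Q_def by (intro compact_diff cfr) auto
      have fc: "frontier S \<subseteq> closure S" by (auto simp: frontier_def)
      have "\<exists>\<beta>>0. \<forall>w\<in>Q. \<beta> \<le> b w"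
      proof (cases "Q = {}")
        case True then show ?thesis by (intro exI[of _ 1]) auto
      next
        case False
        have "continuous_on Q b" by (rule continuous_on_subset[OF b(2)]) (use fc in \<open>auto simp: Q_def\<close>)
        then obtain q where q: "q \<in> Q" "\<And>w. w \<in> Q \<Longrightarrow> b q \<le> b w"
          using continuous_attains_inf[OF Q False] by blast
        have "q \<in> closure S" "q \<noteq> \<zeta>" using q(1) fc d(1) by (auto simp: Q_def)
        then show ?thesis using q(2) b(4) by blast
      qed
      then obtain \<beta> where \<beta>: "\<beta> > 0" "\<And>w. w \<in> Q \<Longrightarrow> \<beta> \<le> b w" by blast
      have "\<bar>f w - f \<zeta>\<bar> \<le> \<epsilon> + (2 * B / \<beta>) * b w" if w: "w \<in> frontier S" for w
      proof (cases "dist w \<zeta> < d")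
        case True
        have "0 \<le> (2 * B / \<beta>) * b w" using b0[of w] w fc B(1) \<beta>(1) by auto
        then show ?thesis using d(2)[OF w True] by (simp add: dist_real_def)
      next
        case False
        then have "w \<in> Q" using w by (simp add: Q_def dist_commute)
        have "2 * B = (2 * B / \<beta>) * \<beta>" using \<beta>(1) by simp
        also have "\<dots> \<le> (2 * B / \<beta>) * b w" using \<beta> B(1) \<open>w \<in> Q\<close> by (intro mult_left_mono) auto
        finally show ?thesis using B(2)[OF w] B(2)[OF \<zeta>] e by linarith
      qed
      then show ?thesis using B(1) \<beta>(1) by (intro exI[of _ "2 * B / \<beta>"]) auto
    qed
    have near: "\<exists>K. \<forall>w\<in>closure S. \<bar>u w - f \<zeta>\<bar> \<le> \<epsilon> + K * b w" if e: "\<epsilon> > 0" for \<epsilon>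
    proof -
      obtain K where K: "K \<ge> 0" "\<And>w. w\<in>frontier S \<Longrightarrow> \<bar>f w - f \<zeta>\<bar> \<le> \<epsilon> + K * b w" using K[OF e] by blast
      define g where "g = (\<lambda>w. \<epsilon> + K * b w)"
      have g: "har g S" "continuous_on (closure S) g" unfolding g_def
        by (auto intro!: har_add har_cmult har_const S b continuous_intros)
      have "(\<lambda>w. f \<zeta> - g w) \<in> P" unfolding P_def perron_family_def
        using g K(2) by (force intro!: har_imp_subhar har_diff har_const S continuous_intros simp: g_def abs_le_iff)
      then have lo: "f \<zeta> - g w \<le> u w" if "w \<in> closure S" for w using up[OF _ that] by blast
      have "u w \<le> f \<zeta> + g w" if w: "w \<in> closure S" for w
      proof (rule lub)
        fix v assume v: "v \<in> P"
        have "(\<lambda>w. v w + (- g w)) w \<le> f \<zeta>"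
        proof (rule subhar_max_principle[where v="\<lambda>w. v w + (- g w)", OF S _ _ _ w])
          show "subhar (\<lambda>w. v w + (- g w)) S" by (intro subhar_add Ps v har_imp_subhar har_minus g)
          show "continuous_on (closure S) (\<lambda>w. v w + (- g w))" by (intro continuous_intros Pc v g)
          show "v w + (- g w) \<le> f \<zeta>" if "w \<in> frontier S" for w
            using Pf[OF v that] K(2)[OF that] unfolding g_def abs_le_iff by linarith
        qed
        then show "v w \<le> f \<zeta> + g w" by simp
      qed
      then show ?thesis using lo by (intro exI[of _ K]) (force simp: g_def abs_le_iff)
    qed
    have u\<zeta>: "u \<zeta> = f \<zeta>"
    proof -
      have "\<bar>u \<zeta> - f \<zeta>\<bar> \<le> 0 + e" if "e > 0" for e using near[OF that] \<zeta>c b(3) by force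
      then have "\<bar>u \<zeta> - f \<zeta>\<bar> \<le> 0" by (rule field_le_epsilon)
      then show ?thesis by simp
    qed
    have "continuous (at \<zeta> within closure S) u"
      unfolding continuous_within_eps_delta
    proof (intro allI impI)
      fix e :: real assume "e > 0"
      then obtain K where K: "\<And>w. w\<in>closure S \<Longrightarrow> \<bar>u w - f \<zeta>\<bar> \<le> e/2 + K * b w" using near[of "e/2"] by auto
      have "continuous_on (closure S) (\<lambda>w. K * b w)" by (intro continuous_intros b)
      then obtain d where d: "d > 0" "\<And>w. w \<in> closure S \<Longrightarrow> dist w \<zeta> < d \<Longrightarrow> dist (K * b w) (K * b \<zeta>) < e/2"
        using \<zeta>c \<open>e > 0\<close> unfolding continuous_on_iff by (meson half_gt_zero)
      have "dist (u w) (u \<zeta>) < e" if "w \<in> closure S" "dist w \<zeta> < d" for w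
        using d(2)[OF that] K[OF that(1)] b(3) u\<zeta> by (simp add: dist_real_def)
      then show "\<exists>d>0. \<forall>x'\<in>closure S. dist x' \<zeta> < d \<longrightarrow> dist (u x') (u \<zeta>) < e" using d(1) by blast
    qed
    then show ?thesis using u\<zeta> by simp
  qed
  have "continuous_on (closure S) u"
    unfolding continuous_on_eq_continuous_within
  proof
    fix z assume z: "z \<in> closure S"
    show "continuous (at z within closure S) u"
    proof (cases "z \<in> S")
      case True then show ?thesis using cu continuous_at_imp_continuous_within by blast
    next
      case False
      then have "z \<in> frontier S" using z S(1) by (simp add: frontier_def interior_open)
      then show ?thesis using bdry by blast
    qed
  qed
  then show ?thesis using that hu bdry by blast
qed

section \<open>The representing measure\<close>

text \<open>The parameter set is any compact set of reals rather than an interval, so finite unions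
  of circles and their closed subsets qualify, and measures on \<open>K\<close> arise as images of
  measures on the line.\<close>

definition real_parametrized :: "complex set \<Rightarrow> bool" where
  "real_parametrized K \<longleftrightarrow> (\<exists>(A :: real set) \<gamma>. compact A \<and> continuous_on A \<gamma> \<and> \<gamma> ` A = K)"

lemma real_parametrized_sphere: "real_parametrized (sphere c R)"
proof (cases "R \<ge> 0")
  case True
  have "(\<lambda>t. c + of_real R * exp (\<i> * of_real t)) ` {0..2*pi} = sphere c R"
  proof (intro set_eqI iffI)
    fix w assume "w \<in> sphere c R"
    then have "cmod (w - c) = R" by (simp add: dist_norm norm_minus_commute)
    then have "w = c + of_real R * exp (\<i> * of_real (Arg2pi (w - c)))"
      using Arg2pi_eq[of "w - c"] by simp
    then show "w \<in> (\<lambda>t. c + of_real R * exp (\<i> * of_real t)) ` {0..2*pi}"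
      using Arg2pi_ge_0[of "w - c"] Arg2pi_lt_2pi[of "w - c"] by (intro image_eqI[of _ _ "Arg2pi (w - c)"]) auto
  qed (use True in \<open>auto simp: dist_norm norm_mult\<close>)
  moreover have "continuous_on {0..2*pi} (\<lambda>t. c + of_real R * exp (\<i> * of_real t))" by (intro continuous_intros)
  ultimately show ?thesis unfolding real_parametrized_def by (meson compact_Icc)
next
  case False
  then show ?thesis unfolding real_parametrized_def by (intro exI[of _ "{}"]) auto
qed

lemma real_parametrized_Un:
  assumes "real_parametrized K" "real_parametrized L"
  shows "real_parametrized (K \<union> L)"
proof -
  obtain A :: "real set" and \<gamma> where A: "compact A" "continuous_on A \<gamma>" "\<gamma> ` A = K"
    using assms(1) unfolding real_parametrized_def by blast
  obtain B :: "real set" and \<delta> where B: "compact B" "continuous_on B \<delta>" "\<delta> ` B = L"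
    using assms(2) unfolding real_parametrized_def by blast
  obtain a where a: "\<And>x. x \<in> A \<Longrightarrow> \<bar>x\<bar> \<le> a" using compact_imp_bounded[OF A(1)] by (auto simp: bounded_iff)
  obtain b where b: "\<And>x. x \<in> B \<Longrightarrow> \<bar>x\<bar> \<le> b" using compact_imp_bounded[OF B(1)] by (auto simp: bounded_iff)
  \<comment> \<open>Translation by \<open>s\<close> moves \<open>B\<close> to the right of
    \<open>A\<close>, so the two parametrisations get disjoint domains.\<close>
  define s where "s = a + b + 1"
  define B' where "B' = (\<lambda>x. x + s) ` B"
  have dis: "x \<notin> B'" if "x \<in> A" for x
    using a[OF that] b by (force simp: B'_def s_def)
  define \<eta> where "\<eta> = (\<lambda>x. if x \<in> A then \<gamma> x else \<delta> (x - s))"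
  have cB: "compact B'" unfolding B'_def by (intro compact_continuous_image B continuous_intros)
  have "continuous_on (A \<union> B') \<eta>"
  proof (rule continuous_on_closed_Un)
    show "continuous_on A \<eta>" using A(2) by (rule continuous_on_eq) (simp add: \<eta>_def)
    have "continuous_on B' (\<lambda>x. \<delta> (x - s))"
      by (rule continuous_on_compose2[OF B(2)]) (auto simp: B'_def intro!: continuous_intros)
    then show "continuous_on B' \<eta>" by (rule continuous_on_eq) (use dis in \<open>auto simp: \<eta>_def\<close>)
  qed (use A(1) cB compact_imp_closed in auto)
  moreover have "\<eta> ` A = K" using A(3) by (auto simp: \<eta>_def)
  moreover have "\<eta> ` B' = L"
  proof -
    have "\<eta> x = \<delta> (x - s)" if "x \<in> B'" for x using dis that by (auto simp: \<eta>_def)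
    then have "\<eta> ` B' = (\<lambda>x. \<delta> (x - s)) ` B'" by (rule image_cong[OF refl])
    also have "\<dots> = L" using B(3) by (auto simp: B'_def image_image)
    finally show ?thesis .
  qed
  ultimately show ?thesis unfolding real_parametrized_def
    using A(1) cB by (intro exI[of _ "A \<union> B'"] exI[of _ \<eta>]) (auto simp: image_Un)
qed

lemma real_parametrized_UN:
  assumes "finite I" "\<And>i. i \<in> I \<Longrightarrow> real_parametrized (K i)"
  shows "real_parametrized (\<Union>i\<in>I. K i)"
  using assms
proof (induction I)
  case empty
  show ?case unfolding real_parametrized_def by (intro exI[of _ "{}"]) auto
qed (auto intro: real_parametrized_Un)

lemma real_parametrized_subset:
  assumes "real_parametrized K" "closed L" "L \<subseteq> K"
  shows "real_parametrized L"
proof -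
  obtain A :: "real set" and \<gamma> where A: "compact A" "continuous_on A \<gamma>" "\<gamma> ` A = K"
    using assms(1) unfolding real_parametrized_def by blast
  have "closed (A \<inter> \<gamma> -` L)"
    using continuous_closed_preimage[OF A(2) compact_imp_closed[OF A(1)] assms(2)] .
  then have "compact (A \<inter> \<gamma> -` L)" using A(1) by (metis Int_assoc Int_absorb closed_Int_compact Int_commute)
  moreover have "\<gamma> ` (A \<inter> \<gamma> -` L) = L" using A(3) assms(3) by auto
  moreover have "continuous_on (A \<inter> \<gamma> -` L) \<gamma>" using A(2) continuous_on_subset by blast
  ultimately show ?thesis unfolding real_parametrized_def by blast
qed

text \<open>Tent functions of radius \<open>d\<close> around the points of a finite net, divided by
  their sum.\<close>

lemma partition_of_unity_fine:
  fixes K :: "complex set"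
  assumes K: "compact K" and d: "d > 0"
  obtains X p where "finite X" "X \<subseteq> K" "\<And>x. x \<in> X \<Longrightarrow> continuous_on K (p x)" "\<And>x w. x \<in> X \<Longrightarrow> w \<in> K \<Longrightarrow> 0 \<le> p x w"
    "\<And>w. w \<in> K \<Longrightarrow> (\<Sum>x\<in>X. p x w) = (1::real)" "\<And>x w. x \<in> X \<Longrightarrow> w \<in> K \<Longrightarrow> p x w \<noteq> 0 \<Longrightarrow> dist w x < d"
proof -
  have "K \<subseteq> (\<Union>x\<in>K. ball x d)" using d by force
  then obtain X where X: "X \<subseteq> K" "finite X" "K \<subseteq> (\<Union>x\<in>X. ball x d)"
    using compactE_image[OF K, of K "\<lambda>x. ball x d"] by auto
  define h :: "complex \<Rightarrow> complex \<Rightarrow> real" where "h = (\<lambda>x w. max 0 (d - dist w x))"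
  define s where "s = (\<lambda>w. \<Sum>x\<in>X. h x w)"
  have h0: "h x w \<ge> 0" for x w by (simp add: h_def)
  have s0: "s w > 0" if "w \<in> K" for w
  proof -
    obtain x where x: "x \<in> X" "dist w x < d" using X(3) \<open>w \<in> K\<close> by (auto simp: dist_commute)
    have "0 < h x w" using x by (simp add: h_def)
    also have "\<dots> \<le> s w" unfolding s_def by (rule member_le_sum) (use x X h0 in auto)
    finally show ?thesis .
  qed
  show ?thesis
  proof (rule that[of X "\<lambda>x w. h x w / s w"])
    show "continuous_on K (\<lambda>w. h x w / s w)" for x
      using s0 unfolding s_def h_def by (intro continuous_intros) (metis less_irrefl)
    show "(\<Sum>x\<in>X. h x w / s w) = 1" if "w \<in> K" for w
    proof -
      have "(\<Sum>x\<in>X. h x w / s w) = s w / s w" unfolding s_def by (rule sum_divide_distrib[symmetric])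
      then show ?thesis using s0[OF that] by simp
    qed
    show "dist w x < d" if "h x w / s w \<noteq> 0" for x w
      using that by (auto simp: h_def max_def split: if_splits)
  qed (use X s0 h0 in \<open>auto intro!: divide_nonneg_nonneg intro: less_imp_le\<close>)
qed

text \<open>Riesz representation on a compact set which is a continuous image of a compact set of reals:
  discretize the functional by partitions of unity, lift the discrete measures to the real line and
  use Helly's selection theorem there.\<close>

theorem Riesz_real_parametrized:
  fixes \<phi> :: "(complex \<Rightarrow> real) \<Rightarrow> real"
  assumes "real_parametrized K"
    and add: "\<And>f g. continuous_on K f \<Longrightarrow> continuous_on K g \<Longrightarrow> \<phi> (\<lambda>w. f w + g w) = \<phi> f + \<phi> g"
    and cmult: "\<And>c f. continuous_on K f \<Longrightarrow> \<phi> (\<lambda>w. c * f w) = c * \<phi> f"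
    and pos: "\<And>f. continuous_on K f \<Longrightarrow> (\<And>w. w \<in> K \<Longrightarrow> 0 \<le> f w) \<Longrightarrow> 0 \<le> \<phi> f"
    and one: "\<phi> (\<lambda>w. 1) = 1"
  obtains M where "prob_space M" "sets M = sets (restrict_space borel K)"
    "\<And>f. continuous_on K f \<Longrightarrow> (\<integral>w. f w \<partial>M) = \<phi> f"
proof -
  obtain A :: "real set" and \<gamma> where A: "compact A" "continuous_on A \<gamma>" "\<gamma> ` A = K"
    using assms(1) unfolding real_parametrized_def by blast
  have K: "compact K" using A compact_continuous_image by blast
  have const: "\<phi> (\<lambda>w. c) = c" for c using cmult[of "\<lambda>w. 1" c] one by simp
  have Kne: "K \<noteq> {}"
  proof
    assume "K = {}"
    then have "0 \<le> \<phi> (\<lambda>w. -1)" by (intro pos) auto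
    then show False using const by simp
  qed
  have mono: "\<phi> f \<le> \<phi> g" if "continuous_on K f" "continuous_on K g" "\<And>w. w \<in> K \<Longrightarrow> f w \<le> g w" for f g
  proof -
    have "0 \<le> \<phi> (\<lambda>w. g w + (-1) * f w)" using that by (intro pos continuous_intros) auto
    also have "\<dots> = \<phi> g + \<phi> (\<lambda>w. (-1) * f w)" by (intro add continuous_intros that)
    also have "\<phi> (\<lambda>w. (-1) * f w) = (-1) * \<phi> f" by (intro cmult that)
    finally show ?thesis by simp
  qed
  have sum: "\<phi> (\<lambda>w. \<Sum>i\<in>I. f i w) = (\<Sum>i\<in>I. \<phi> (f i))" if "finite I" "\<And>i. i \<in> I \<Longrightarrow> continuous_on K (f i)"
    for I :: "complex set" and f
    using that
  proof (induction I)
    case empty then show ?case using const by simp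
  next
    case (insert i I)
    then show ?case by (simp add: add continuous_on_sum)
  qed
  have step: "\<exists>\<mu>. real_distribution \<mu> \<and> measure \<mu> A = 1 \<and>
      (\<forall>f e. continuous_on K f \<longrightarrow> (\<forall>w\<in>K. \<forall>w'\<in>K. dist w w' < d \<longrightarrow> \<bar>f w - f w'\<bar> \<le> e) \<longrightarrow>
         (\<forall>F. F \<in> borel_measurable borel \<longrightarrow> (\<forall>t\<in>A. F t = f (\<gamma> t)) \<longrightarrow> \<bar>(\<integral>t. F t \<partial>\<mu>) - \<phi> f\<bar> \<le> e))"
    if d: "d > 0" for d
  proof -
    obtain X p where X: "finite X" "X \<subseteq> K" "\<And>x. x \<in> X \<Longrightarrow> continuous_on K (p x)" "\<And>x w. x \<in> X \<Longrightarrow> w \<in> K \<Longrightarrow> 0 \<le> p x w"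
      "\<And>w. w \<in> K \<Longrightarrow> (\<Sum>x\<in>X. p x w) = (1::real)" "\<And>x w. x \<in> X \<Longrightarrow> w \<in> K \<Longrightarrow> p x w \<noteq> 0 \<Longrightarrow> dist w x < d"
      using partition_of_unity_fine[OF K d] by blast
    \<comment> \<open>The default 0 off \<open>X\<close> turns the weights into a mass function on
      the whole plane; it is carried to the line by choosing a parameter for each net point.\<close>
    define a where "a = (\<lambda>x. if x \<in> X then \<phi> (p x) else 0)"
    have a0: "a x \<ge> 0" for x using pos[of "p x"] X by (auto simp: a_def)
    have asum: "(\<Sum>x\<in>X. a x) = 1"
    proof -
      have "(\<Sum>x\<in>X. a x) = (\<Sum>x\<in>X. \<phi> (p x))" by (rule sum.cong) (auto simp: a_def)
      also have "\<dots> = \<phi> (\<lambda>w. \<Sum>x\<in>X. p x w)" using X by (intro sum[symmetric]) auto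
      also have "\<dots> = \<phi> (\<lambda>w. 1)"
        by (intro antisym mono) (use X in \<open>auto intro!: continuous_on_sum\<close>)
      finally show ?thesis using one by simp
    qed
    have nn: "(\<integral>\<^sup>+x. ennreal (a x) \<partial>count_space UNIV) = 1"
    proof -
      have "(\<integral>\<^sup>+x. ennreal (a x) \<partial>count_space UNIV) = (\<Sum>x\<in>X. ennreal (a x))"
        by (rule nn_integral_count_space'[OF X(1)]) (auto simp: a_def)
      also have "\<dots> = ennreal (\<Sum>x\<in>X. a x)" using a0 by (intro sum_ennreal) auto
      finally show ?thesis using asum by simp
    qed
    define P where "P = embed_pmf a"
    have P: "pmf P x = a x" for x unfolding P_def by (rule pmf_embed_pmf[OF a0 nn])
    have setP: "set_pmf P \<subseteq> X" unfolding set_pmf_eq P by (auto simp: a_def)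
    have "\<forall>x\<in>K. \<exists>t\<in>A. \<gamma> t = x" using A(3) by blast
    then obtain t where t: "\<And>x. x \<in> K \<Longrightarrow> t x \<in> A \<and> \<gamma> (t x) = x" by metis
    define \<mu> where "\<mu> = distr (measure_pmf P) borel t"
    have tm: "t \<in> measurable (measure_pmf P) borel" by simp
    have rd: "real_distribution \<mu>"
      unfolding real_distribution_def real_distribution_axioms_def \<mu>_def
      by (auto intro!: measure_pmf.prob_space_distr)
    have "measure \<mu> A = measure (measure_pmf P) (t -` A)"
      unfolding \<mu>_def using A(1) by (subst measure_distr) (auto intro: borel_closed compact_imp_closed)
    also have "\<dots> = 1"
      using setP X(2) t by (subst measure_pmf.prob_eq_1) (auto simp: AE_measure_pmf_iff)
    finally have mA: "measure \<mu> A = 1" .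
    have "\<bar>(\<integral>t. F t \<partial>\<mu>) - \<phi> f\<bar> \<le> e"
      if f: "continuous_on K f" and e: "\<forall>w\<in>K. \<forall>w'\<in>K. dist w w' < d \<longrightarrow> \<bar>f w - f w'\<bar> \<le> e"
        and F: "F \<in> borel_measurable borel" "\<forall>t\<in>A. F t = f (\<gamma> t)" for f e F
    proof -
      have "(\<integral>t. F t \<partial>\<mu>) = (\<integral>x. F (t x) \<partial>measure_pmf P)"
        unfolding \<mu>_def by (rule integral_distr[OF tm F(1)])
      also have "\<dots> = (\<Sum>x\<in>X. F (t x) * pmf P x)"
        by (rule integral_measure_pmf_real[OF X(1)]) (use setP in auto)
      also have "\<dots> = (\<Sum>x\<in>X. f x * \<phi> (p x))"
      proof (rule sum.cong[OF refl])
        fix x assume "x \<in> X"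
        then show "F (t x) * pmf P x = f x * \<phi> (p x)" using t[of x] F(2) X(2) P by (auto simp: a_def)
      qed
      also have "\<dots> = (\<Sum>x\<in>X. \<phi> (\<lambda>w. f x * p x w))" using X by (intro sum.cong refl cmult[symmetric]) auto
      also have "\<dots> = \<phi> (\<lambda>w. \<Sum>x\<in>X. f x * p x w)"
        using X by (intro sum[symmetric]) (auto intro!: continuous_intros)
      finally have I: "(\<integral>t. F t \<partial>\<mu>) = \<phi> (\<lambda>w. \<Sum>x\<in>X. f x * p x w)" .
      have c: "continuous_on K (\<lambda>w. \<Sum>x\<in>X. f x * p x w)" using X by (intro continuous_intros) auto
      have near: "\<bar>(\<Sum>x\<in>X. f x * p x w) - f w\<bar> \<le> e" if w: "w \<in> K" for w
      proof -
        have "(\<Sum>x\<in>X. f x * p x w) - f w = (\<Sum>x\<in>X. (f x - f w) * p x w)"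
          using X(5)[OF w] by (simp add: left_diff_distrib sum_subtractf flip: sum_distrib_left)
        also have "\<bar>\<dots>\<bar> \<le> (\<Sum>x\<in>X. \<bar>(f x - f w) * p x w\<bar>)" by (rule sum_abs)
        also have "\<dots> \<le> (\<Sum>x\<in>X. e * p x w)"
        proof (rule sum_mono)
          fix x assume x: "x \<in> X"
          show "\<bar>(f x - f w) * p x w\<bar> \<le> e * p x w"
          proof (cases "p x w = 0")
            case False
            then have "\<bar>f x - f w\<bar> \<le> e" using e X(6)[OF x w] x X(2) w by (metis dist_commute subsetD)
            then show ?thesis using X(4)[OF x w] by (simp add: abs_mult mult_right_mono)
          qed simp
        qed
        also have "\<dots> = e" using X(5)[OF w] by (simp flip: sum_distrib_left)
        finally show ?thesis .
      qed
      have "\<phi> (\<lambda>w. \<Sum>x\<in>X. f x * p x w) \<le> \<phi> (\<lambda>w. f w + e)"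
        by (intro mono c continuous_intros f) (use near in \<open>force simp: abs_le_iff\<close>)
      moreover have "\<phi> f \<le> \<phi> (\<lambda>w. (\<Sum>x\<in>X. f x * p x w) + e)"
        by (intro mono continuous_on_add c continuous_on_const f) (use near in \<open>force simp: abs_le_iff\<close>)
      moreover have "\<phi> (\<lambda>w. f w + e) = \<phi> f + e" by (subst add) (use f const in auto)
      moreover have "\<phi> (\<lambda>w. (\<Sum>x\<in>X. f x * p x w) + e) = \<phi> (\<lambda>w. \<Sum>x\<in>X. f x * p x w) + e"
        by (subst add) (use c const in auto)
      ultimately show ?thesis unfolding I by linarith
    qed
    then show ?thesis using rd mA by blast
  qed
  obtain \<mu> where \<mu>: "\<And>n. real_distribution (\<mu> n)" "\<And>n. measure (\<mu> n) A = 1"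
    and \<mu>f: "\<And>n f e F. continuous_on K f \<Longrightarrow> (\<forall>w\<in>K. \<forall>w'\<in>K. dist w w' < inverse (real (Suc n)) \<longrightarrow> \<bar>f w - f w'\<bar> \<le> e) \<Longrightarrow>
        F \<in> borel_measurable borel \<Longrightarrow> (\<forall>t\<in>A. F t = f (\<gamma> t)) \<Longrightarrow> \<bar>(\<integral>t. F t \<partial>\<mu> n) - \<phi> f\<bar> \<le> e"
    using step[of "inverse (real (Suc _))"] by (metis inverse_positive_iff_positive of_nat_0_less_iff zero_less_Suc)
  obtain m where m: "\<And>x. x \<in> A \<Longrightarrow> \<bar>x\<bar> \<le> m" using compact_imp_bounded[OF A(1)] by (auto simp: bounded_iff)
  have tight: "tight \<mu>"
    unfolding tight_def
  proof (intro conjI allI impI \<mu>(1))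
    fix e :: real assume e: "e > 0"
    have "measure (\<mu> n) {- \<bar>m\<bar> - 1<..\<bar>m\<bar> + 1} > 1 - e" for n
    proof -
      interpret real_distribution "\<mu> n" by (rule \<mu>(1))
      have "measure (\<mu> n) A \<le> measure (\<mu> n) {- \<bar>m\<bar> - 1<..\<bar>m\<bar> + 1}"
        by (rule finite_measure_mono) (use m in \<open>force+\<close>)
      then show ?thesis using \<mu>(2)[of n] e by simp
    qed
    then show "\<exists>a b. a < b \<and> (\<forall>n. 1 - e < measure (\<mu> n) {a<..b})"
      by (intro exI[of _ "- \<bar>m\<bar> - 1"] exI[of _ "\<bar>m\<bar> + 1"]) auto
  qed
  obtain r \<nu> where r: "strict_mono (r :: nat \<Rightarrow> nat)" and \<nu>: "real_distribution \<nu>" and wc: "weak_conv_m (\<mu> \<circ> id \<circ> r) \<nu>"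
    using tight_imp_convergent_subsubsequence[OF tight strict_mono_id] by blast
  have wc': "weak_conv_m (\<lambda>n. \<mu> (r n)) \<nu>" using wc by (simp add: o_def)
  interpret \<nu>: real_distribution \<nu> by (rule \<nu>)
  have lim: "(\<integral>t. F t \<partial>\<nu>) = \<phi> f"
    if F: "\<And>x. isCont F x" "\<And>x. norm (F x) \<le> B" and f: "continuous_on K f" "\<And>t. t \<in> A \<Longrightarrow> F t = f (\<gamma> t)" for F f B
  proof -
    have "(\<lambda>n. (\<integral>t. F t \<partial>\<mu> (r n))) \<longlonglongrightarrow> (\<integral>t. F t \<partial>\<nu>)"
      by (rule weak_conv_imp_integral_bdd_continuous_conv[OF \<mu>(1) \<nu> wc' F])
    moreover have "(\<lambda>n. (\<integral>t. F t \<partial>\<mu> (r n))) \<longlonglongrightarrow> \<phi> f"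
    proof (rule LIMSEQ_I)
      fix e :: real assume e: "e > 0"
      have "uniformly_continuous_on K f" using compact_uniformly_continuous[OF f(1) K] .
      then obtain d where d: "d > 0" "\<And>w w'. w \<in> K \<Longrightarrow> w' \<in> K \<Longrightarrow> dist w' w < d \<Longrightarrow> dist (f w') (f w) < e/2"
        unfolding uniformly_continuous_on_def by (meson e half_gt_zero)
      obtain N where N: "inverse (real (Suc N)) < d" using reals_Archimedean[OF d(1)] by blast
      have "norm ((\<integral>t. F t \<partial>\<mu> (r n)) - \<phi> f) < e" if n: "n \<ge> N" for n
      proof -
        have "N \<le> r n" using n seq_suble[OF r, of n] by simp
        then have "inverse (real (Suc (r n))) \<le> inverse (real (Suc N))" by (simp add: le_imp_inverse_le)
        then have "inverse (real (Suc (r n))) < d" using N by linarith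
        then have "\<forall>w\<in>K. \<forall>w'\<in>K. dist w w' < inverse (real (Suc (r n))) \<longrightarrow> \<bar>f w - f w'\<bar> \<le> e/2"
          using d(2) by (metis dist_real_def less_imp_le order_less_trans)
        moreover have "F \<in> borel_measurable borel"
          using F(1) by (intro borel_measurable_continuous_onI continuous_at_imp_continuous_on) auto
        ultimately have "\<bar>(\<integral>t. F t \<partial>\<mu> (r n)) - \<phi> f\<bar> \<le> e/2" using f by (intro \<mu>f) auto
        then show ?thesis using e by simp
      qed
      then show "\<exists>N. \<forall>n\<ge>N. norm ((\<integral>t. F t \<partial>\<mu> (r n)) - \<phi> f) < e" by blast
    qed
    ultimately show ?thesis by (rule LIMSEQ_unique)
  qed
  have Ane: "A \<noteq> {}" using Kne A(3) by blast
  have cA: "closed A" using A(1) compact_imp_closed by blast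
  \<comment> \<open>The truncated distance to \<open>A\<close> corresponds to the zero function on
    \<open>K\<close>, so its integral in the limit is 0: the weak limit has no mass off
    \<open>A\<close>.\<close>
  have AEA: "AE t in \<nu>. t \<in> A"
  proof -
    define F where "F = (\<lambda>t. min 1 (infdist t A))"
    have "continuous_on UNIV F" unfolding F_def by (intro continuous_intros)
    then have F1: "isCont F x" for x by (simp add: continuous_on_eq_continuous_at)
    have F2: "norm (F x) \<le> 1" for x by (simp add: F_def infdist_nonneg)
    note F = F1 F2
    have Fm: "F \<in> borel_measurable borel"
      using F(1) by (intro borel_measurable_continuous_onI continuous_at_imp_continuous_on) auto
    have "(\<integral>t. F t \<partial>\<nu>) = \<phi> (\<lambda>w. 0)" by (rule lim[OF F]) (auto simp: F_def)
    then have "(\<integral>t. F t \<partial>\<nu>) = 0" using const by simp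
    moreover have "integrable \<nu> F"
      by (rule \<nu>.integrable_const_bound[where B=1]) (use F Fm in auto)
    moreover have "AE t in \<nu>. 0 \<le> F t" by (simp add: F_def infdist_nonneg)
    ultimately have "AE t in \<nu>. F t = 0" by (simp add: integral_nonneg_eq_0_iff_AE)
    then show ?thesis
    proof eventually_elim
      case (elim t)
      then have "infdist t A = 0" by (auto simp: F_def min_def split: if_splits)
      then show "t \<in> A" using in_closed_iff_infdist_zero[OF cA Ane] by blast
    qed
  qed
  obtain k0 where k0: "k0 \<in> K" using Kne by blast
  \<comment> \<open>Off \<open>A\<close>, a null set, the value is a fixed point of
    \<open>K\<close>, so that \<open>g\<close> maps the whole line into \<open>K\<close>.\<close>
  define g where "g = (\<lambda>t. if t \<in> A then \<gamma> t else k0)"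
  have gm: "g \<in> borel_measurable borel" unfolding g_def
    by (rule borel_measurable_continuous_on_if) (use A cA in auto)
  have gK: "g t \<in> K" for t using A(3) k0 by (auto simp: g_def)
  have gm': "g \<in> measurable \<nu> (restrict_space borel K)"
    by (rule measurable_restrict_space2) (use gK gm in \<open>auto simp: measurable_cong_sets[OF \<nu>.events_eq_borel refl]\<close>)
  show ?thesis
  proof (rule that[of "distr \<nu> (restrict_space borel K) g"])
    show "prob_space (distr \<nu> (restrict_space borel K) g)" using gm' by (rule \<nu>.prob_space_distr)
    show "sets (distr \<nu> (restrict_space borel K) g) = sets (restrict_space borel K)" by simp
    fix f :: "complex \<Rightarrow> real" assume f: "continuous_on K f"
    have fm: "f \<in> borel_measurable (restrict_space borel K)" using f by (rule borel_measurable_continuous_on_restrict)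
    have c1: "continuous_on A (\<lambda>t. f (\<gamma> t))" by (rule continuous_on_compose2[OF f A(2)]) (use A(3) in auto)
    obtain B where B: "B \<ge> 0" "\<And>w. w \<in> K \<Longrightarrow> norm (f w) \<le> B"
    proof -
      obtain B where "\<And>w. w \<in> K \<Longrightarrow> norm (f w) \<le> B"
        using compact_imp_bounded[OF compact_continuous_image[OF f K]] by (auto simp: bounded_iff)
      then show ?thesis using that[of "max B 0"] by (auto simp: le_max_iff_disj)
    qed
    have c2: "closedin (top_of_set UNIV) A" using cA by simp
    have c3: "\<And>t. t \<in> A \<Longrightarrow> norm (f (\<gamma> t)) \<le> B" using B(2) A(3) by blast
    \<comment> \<open>Weak convergence needs a bounded continuous function on the whole line; Tietze
      extends \<open>f\<close> composed with \<gamma> from \<open>A\<close>.\<close>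
    obtain F where F: "continuous_on UNIV F" "\<And>t. t \<in> A \<Longrightarrow> F t = f (\<gamma> t)" "\<And>t. norm (F t) \<le> B"
      using Tietze[OF c1 c2 B(1) c3] by (metis UNIV_I)
    have iF: "isCont F x" for x using F(1) by (simp add: continuous_on_eq_continuous_at)
    have Fm: "F \<in> borel_measurable \<nu>"
      using F(1) borel_measurable_continuous_onI measurable_cong_sets[OF \<nu>.events_eq_borel refl] by blast
    have "(\<integral>w. f w \<partial>distr \<nu> (restrict_space borel K) g) = (\<integral>t. f (g t) \<partial>\<nu>)"
      by (rule integral_distr[OF gm' fm])
    also have "\<dots> = (\<integral>t. F t \<partial>\<nu>)"
    proof (rule integral_cong_AE)
      show "(\<lambda>t. f (g t)) \<in> borel_measurable \<nu>" using measurable_comp[OF gm' fm] by (simp add: o_def)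
      show "AE t in \<nu>. f (g t) = F t" using AEA by eventually_elim (use F(2) in \<open>simp add: g_def\<close>)
    qed (rule Fm)
    also have "\<dots> = \<phi> f" by (rule lim[OF iF F(3) f F(2)])
    finally show "(\<integral>w. f w \<partial>distr \<nu> (restrict_space borel K) g) = \<phi> f" .
  qed
qed

text \<open>The indicator of a closed set is a bounded limit of continuous functions of the
  distance, so the integrals determine the measure of closed sets, an intersection-stable generator.
  The measures are compared after being pushed to the whole plane (\<open>D\<close>), where closed
  sets generate the Borel sets.\<close>

lemma measure_eq_if_continuous_integrals_eq:
  fixes K :: "complex set"
  assumes M: "prob_space M" "sets M = sets (restrict_space borel K)"
    and N: "prob_space N" "sets N = sets (restrict_space borel K)"
    and eq: "\<And>f. continuous_on K f \<Longrightarrow> (\<integral>w. f w \<partial>M) = (\<integral>w. (f w :: real) \<partial>N)"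
  shows "M = N"
proof -
  have id: "(\<lambda>x. x) \<in> measurable Q borel" if "sets Q = sets (restrict_space borel K)" for Q :: "complex measure"
    unfolding measurable_cong_sets[OF that refl] by (simp add: measurable_restrict_space1)
  define D where "D = (\<lambda>Q. distr Q (borel :: complex measure) (\<lambda>x. x))"
  have cl: "measure (D M) C = measure (D N) C" if C: "closed C" "C \<noteq> {}" for C
  proof -
    define f where "f = (\<lambda>n w. max 0 (1 - real n * infdist w C))"
    have fc: "continuous_on S (f n)" for S n unfolding f_def by (intro continuous_intros)
    have ptw: "(\<lambda>n. f n w) \<longlonglongrightarrow> indicator C w" for w
    proof (cases "w \<in> C")
      case True
      then show ?thesis by (simp add: f_def)
    next
      case False
      then have i: "infdist w C > 0"
        using in_closed_iff_infdist_zero[OF C, of w] infdist_nonneg[of w C] by linarith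
      obtain N where N: "real N * infdist w C > 1" using reals_Archimedean3[OF i] by blast
      have "f n w = 0" if "n \<ge> N" for n
      proof -
        have "real N * infdist w C \<le> real n * infdist w C" using that i by (intro mult_right_mono) auto
        then show ?thesis using N by (simp add: f_def)
      qed
      then have "eventually (\<lambda>n. f n w = indicator C w) sequentially"
        using False by (auto simp: eventually_sequentially)
      then show ?thesis by (simp add: tendsto_eventually)
    qed
    have "(\<lambda>n. \<integral>w. f n w \<partial>Q) \<longlonglongrightarrow> measure (D Q) C"
      if Q: "prob_space Q" "sets Q = sets (restrict_space borel K)" for Q
    proof -
      interpret prob_space Q by (rule Q(1))
      have m: "g \<in> borel_measurable Q" if "g \<in> borel_measurable borel" for g :: "complex \<Rightarrow> real"
        using measurable_comp[OF id[OF Q(2)] that] by (simp add: o_def)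
      have "(\<lambda>n. \<integral>w. f n w \<partial>Q) \<longlonglongrightarrow> (\<integral>w. indicator C w \<partial>Q)"
      proof (rule integral_dominated_convergence[where w="\<lambda>_. 1"])
        show "(indicator C :: complex \<Rightarrow> real) \<in> borel_measurable Q" by (rule m, rule borel_measurable_indicator) (use C in \<open>auto intro: borel_closed\<close>)
        show "f n \<in> borel_measurable Q" for n by (intro m borel_measurable_continuous_onI fc)
        show "AE w in Q. norm (f n w) \<le> 1" for n by (simp add: f_def infdist_nonneg)
      qed (use ptw in auto)
      moreover have "measure (D Q) C = (\<integral>w. indicator C w \<partial>Q)"
        unfolding D_def using id[OF Q(2)] C
        by (subst measure_distr) (auto simp: borel_closed Int_commute)
      ultimately show ?thesis by simp
    qed
    from this[OF M] this[OF N] show ?thesis using eq[OF fc] LIMSEQ_unique by fastforce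
  qed
  have fin: "prob_space (D M)" "prob_space (D N)" unfolding D_def
    using prob_space.prob_space_distr[OF M(1) id[OF M(2)]] prob_space.prob_space_distr[OF N(1) id[OF N(2)]] by auto
  have "D M = D N"
  proof (rule measure_eqI_generator_eq[where E="Collect closed" and \<Omega>=UNIV and A="\<lambda>_. UNIV"])
    show "Int_stable (Collect closed :: complex set set)" by (auto simp: Int_stable_def)
    show "emeasure (D M) X = emeasure (D N) X" if "X \<in> Collect closed" for X
      using cl[of X] that fin by (cases "X = {}") (auto simp: finite_measure.emeasure_eq_measure prob_space_def)
    show "sets (D M) = sigma_sets UNIV (Collect closed)" "sets (D N) = sigma_sets UNIV (Collect closed)"
      unfolding D_def by (simp_all add: borel_eq_closed)
    show "emeasure (D M) UNIV \<noteq> \<infinity>" using fin(1) by (simp add: finite_measure.emeasure_eq_measure prob_space_def)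
  qed auto
  show "M = N"
  proof (rule measure_eqI)
    show "sets M = sets N" using M N by simp
    fix X assume X: "X \<in> sets M"
    then obtain B where B: "B \<in> sets borel" "X = K \<inter> B" using M(2) by (auto simp: sets_restrict_space)
    have "emeasure Q X = emeasure (D Q) B" if Q: "sets Q = sets (restrict_space borel K)" for Q
    proof -
      have "space Q = K" using sets_eq_imp_space_eq[OF Q] by (simp add: space_restrict_space)
      then show ?thesis unfolding D_def using id[OF Q] B by (subst emeasure_distr) (auto simp: Int_commute)
    qed
    then show "emeasure M X = emeasure N X" using M N \<open>D M = D N\<close> by simp
  qed
qed

text \<open>By the maximum principle, evaluation at \<open>z\<close> of the Dirichlet solution is a
  positive normalised linear functional of the boundary values, so the Riesz theorem yields the
  measure. It is unique because solvability for all continuous data prescribes every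
  integral.\<close>

theorem represents_dirichlet_unique_ex:
  assumes S: "open S" "bounded S" and z: "z \<in> S"
    and fr: "real_parametrized (frontier S)"
    and ext: "\<And>\<zeta>. \<zeta> \<in> frontier S \<Longrightarrow> \<exists>c r. r > 0 \<and> dist \<zeta> c = r \<and> ball c r \<inter> S = {}"
  shows "\<exists>!M. represents_dirichlet S z M"
proof -
  let ?K = "frontier S"
  have ex: "\<exists>u. dirichlet_solution S f u" if "continuous_on ?K f" for f
    using perron_dirichlet[OF S that ext] unfolding dirichlet_solution_def harmonic_on_iff_har by metis
  have zc: "z \<in> closure S" using z closure_subset by blast
  have uniq: "u z \<le> v z" if "dirichlet_solution S f u" "dirichlet_solution S g v" "\<And>w. w \<in> ?K \<Longrightarrow> f w \<le> g w" for f g u v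
  proof -
    have "u z - v z \<le> 0"
      by (rule har_max_principle[of "\<lambda>w. u w - v w" S])
         (use that S zc in \<open>auto simp: dirichlet_solution_def harmonic_on_iff_har intro!: har_diff continuous_intros\<close>)
    then show ?thesis by simp
  qed
  \<comment> \<open>The choice of solution is immaterial: \<open>uniq\<close>, applied both ways,
    shows that all solutions agree at \<open>z\<close>.\<close>
  define \<phi> where "\<phi> = (\<lambda>f. (SOME u. dirichlet_solution S f u) z)"
  have \<phi>: "\<phi> f = u z" if "continuous_on ?K f" "dirichlet_solution S f u" for f u
    using uniq[OF someI_ex[OF ex[OF that(1)]] that(2)] uniq[OF that(2) someI_ex[OF ex[OF that(1)]]]
    unfolding \<phi>_def by fastforce
  obtain M :: "complex measure" where M: "prob_space M" "sets M = sets (restrict_space borel ?K)"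
    "\<And>f :: complex \<Rightarrow> real. continuous_on ?K f \<Longrightarrow> (\<integral>w. f w \<partial>M) = \<phi> f"
  proof (rule Riesz_real_parametrized[OF fr, of \<phi>])
    show "\<phi> (\<lambda>w. f w + g w) = \<phi> f + \<phi> g" if c: "continuous_on ?K f" "continuous_on ?K g" for f g
    proof -
      obtain u v where uv: "dirichlet_solution S f u" "dirichlet_solution S g v" using ex c by blast
      then have "dirichlet_solution S (\<lambda>w. f w + g w) (\<lambda>w. u w + v w)"
        by (auto simp: dirichlet_solution_def harmonic_on_iff_har intro!: har_add continuous_intros)
      then show ?thesis using \<phi>[OF c(1) uv(1)] \<phi>[OF c(2) uv(2)] \<phi>[OF continuous_on_add[OF c]] by simp
    qed
    show "\<phi> (\<lambda>w. k * f w) = k * \<phi> f" if c: "continuous_on ?K f" for f k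
    proof -
      obtain u where u: "dirichlet_solution S f u" using ex c by blast
      then have "dirichlet_solution S (\<lambda>w. k * f w) (\<lambda>w. k * u w)"
        by (auto simp: dirichlet_solution_def harmonic_on_iff_har intro!: har_cmult continuous_intros)
      then show ?thesis using \<phi>[OF c u] \<phi>[OF continuous_on_mult_left[OF c]] by simp
    qed
    have k: "dirichlet_solution S (\<lambda>w. k) (\<lambda>w. k)" for k
      by (simp add: dirichlet_solution_def harmonic_on_iff_har har_const S)
    show "0 \<le> \<phi> f" if c: "continuous_on ?K f" "\<And>w. w \<in> ?K \<Longrightarrow> 0 \<le> f w" for f
    proof -
      obtain u where u: "dirichlet_solution S f u" using ex c by blast
      show ?thesis using uniq[OF k[of 0] u c(2)] \<phi>[OF c(1) u] by simp
    qed
    show "\<phi> (\<lambda>w. 1) = 1" using \<phi>[OF _ k[of 1]] by simp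
  qed blast
  show ?thesis
  proof (rule ex1I[of _ M])
    show "represents_dirichlet S z M" unfolding represents_dirichlet_def using M \<phi> by auto
    fix N assume N: "represents_dirichlet S z N"
    show "N = M"
    proof (rule measure_eq_if_continuous_integrals_eq[of N ?K M])
      show "(\<integral>w. f w \<partial>N) = (\<integral>w. f w \<partial>M)" if f: "continuous_on ?K f" for f :: "complex \<Rightarrow> real"
      proof -
        obtain u where u: "dirichlet_solution S f u" using ex f by blast
        then show ?thesis using N M(3)[OF f] \<phi>[OF f u] f unfolding represents_dirichlet_def by metis
      qed
    qed (use N M in \<open>auto simp: represents_dirichlet_def\<close>)
  qed
qed

text \<open>Representing measures are tested on continuous boundary data only. The indicator of a
  boundary part that is separated from the rest of the boundary is such a datum, so the measure of
  this part is read off from a Dirichlet solution.\<close>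

theorem harmonic_measure_eq_solution:
  assumes S: "open S" "bounded S" and z: "z \<in> S"
    and fr: "real_parametrized (frontier S)"
    and ext: "\<And>\<zeta>. \<zeta> \<in> frontier S \<Longrightarrow> \<exists>c r. r > 0 \<and> dist \<zeta> c = r \<and> ball c r \<inter> S = {}"
    and A: "closed A" "A \<subseteq> frontier S" and cA: "continuous_on (frontier S) (indicator A :: complex \<Rightarrow> real)"
    and u: "dirichlet_solution S (indicator A) u"
  shows "harmonic_measure z A S = u z"
proof -
  define M where "M = (THE M. represents_dirichlet S z M)"
  have M: "represents_dirichlet S z M"
    unfolding M_def by (rule theI'[OF represents_dirichlet_unique_ex[OF S z fr ext]])
  have sp: "space M = frontier S"
    using M sets_eq_imp_space_eq[of M "restrict_space borel (frontier S)"]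
    by (simp add: represents_dirichlet_def space_restrict_space)
  have "A \<in> sets M" using M A by (auto simp: represents_dirichlet_def sets_restrict_space borel_closed intro!: image_eqI[of _ _ A])
  have "u z = (\<integral>w. indicator A w \<partial>M)" using M cA u unfolding represents_dirichlet_def by blast
  also have "\<dots> = measure M A" using A(2) sp by (simp add: Int_absorb2)
  finally show ?thesis by (simp add: harmonic_measure_def M_def)
qed

section \<open>Pseudohyperbolic geometry and separated sets\<close>

definition mob :: "complex \<Rightarrow> complex \<Rightarrow> complex" where
  "mob c z = (z - c) / (1 - cnj c * z)"

lemma pseudo_dist_mob: "pseudo_dist c z = cmod (mob c z)"
  by (simp add: pseudo_dist_def mob_def norm_divide norm_minus_commute mult.commute)

lemma pseudo_dist_commute: "pseudo_dist z w = pseudo_dist w z"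
proof -
  have "cmod (1 - w * cnj z) = cmod (cnj (1 - w * cnj z))" by (simp only: complex_mod_cnj)
  then show ?thesis by (simp add: pseudo_dist_def norm_divide norm_minus_commute mult.commute)
qed

lemma one_minus_cnj_mult_neq_0:
  assumes "cmod z < 1" "cmod w \<le> 1"
  shows "1 - cnj z * w \<noteq> 0"
proof
  assume "1 - cnj z * w = 0"
  then have "cmod (cnj z * w) = 1" by (metis eq_iff_diff_eq_0 norm_one)
  moreover have "cmod z * cmod w \<le> cmod z" using assms by (simp add: mult_left_le)
  ultimately show False using assms by (simp add: norm_mult)
qed

lemma mob_identity:
  "(cmod (1 - cnj z * w))\<^sup>2 - (cmod (w - z))\<^sup>2 = (1 - (cmod z)\<^sup>2) * (1 - (cmod w)\<^sup>2)"
  unfolding cmod_power2 by (simp add: power2_eq_square algebra_simps)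

lemma one_minus_pseudo_dist_square:
  assumes "cmod z < 1" "cmod w \<le> 1"
  shows "1 - (pseudo_dist z w)\<^sup>2 = (1 - (cmod z)\<^sup>2) * (1 - (cmod w)\<^sup>2) / (cmod (1 - cnj z * w))\<^sup>2"
proof -
  have "cmod (1 - cnj z * w) > 0" using one_minus_cnj_mult_neq_0[OF assms] by simp
  then show ?thesis
    unfolding pseudo_dist_mob mob_def norm_divide power_divide mob_identity[symmetric]
    by (simp add: diff_divide_distrib)
qed

lemma pseudo_dist_nonneg: "0 \<le> pseudo_dist z w"
  by (simp add: pseudo_dist_def)

lemma pseudo_dist_less_1:
  assumes "cmod z < 1" "cmod w < 1"
  shows "pseudo_dist z w < 1"
proof -
  have "0 < (1 - (cmod z)\<^sup>2) * (1 - (cmod w)\<^sup>2) / (cmod (1 - cnj z * w))\<^sup>2"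
    using assms one_minus_cnj_mult_neq_0[of z w]
    by (intro divide_pos_pos mult_pos_pos) (auto simp: abs_square_less_1)
  then have "(pseudo_dist z w)\<^sup>2 < 1" using one_minus_pseudo_dist_square[of z w] assms by simp
  then show ?thesis using pseudo_dist_nonneg[of z w] by (simp add: abs_square_less_1)
qed

lemma pseudo_dist_boundary:
  assumes "cmod z < 1" "cmod w = 1"
  shows "pseudo_dist z w = 1"
proof -
  have "(pseudo_dist z w)\<^sup>2 = 1" using one_minus_pseudo_dist_square[of z w] assms by simp
  then show ?thesis using pseudo_dist_nonneg[of z w] by (simp add: power2_eq_1_iff)
qed

lemma pseudo_dist_eq_0_iff:
  assumes "cmod z < 1" "cmod w \<le> 1"
  shows "pseudo_dist z w = 0 \<longleftrightarrow> z = w"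
  using one_minus_cnj_mult_neq_0[OF assms] by (auto simp: pseudo_dist_mob mob_def)

lemma mob_less_1: "cmod c < 1 \<Longrightarrow> cmod z < 1 \<Longrightarrow> cmod (mob c z) < 1"
  using pseudo_dist_less_1 pseudo_dist_mob by metis

lemma pseudo_dist_mob_mob:
  assumes c: "cmod c < 1" and z: "cmod z < 1" and w: "cmod w < 1"
  shows "pseudo_dist (mob c z) (mob c w) = pseudo_dist z w"
proof -
  define p where "p = 1 - cnj c * z"
  define q where "q = 1 - cnj c * w"
  have nz: "p \<noteq> 0" "q \<noteq> 0" using one_minus_cnj_mult_neq_0 c z w by (auto simp: p_def q_def)
  have k: "1 - (cmod c)\<^sup>2 \<noteq> 0" using c by (metis abs_norm_cancel abs_square_less_1 diff_gt_0_iff_gt less_irrefl)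
  have cc: "of_real (1 - (cmod c)\<^sup>2) = 1 - c * cnj c" using complex_norm_square[of c] by simp
  have kz: "1 - c * cnj c \<noteq> 0" using k unfolding cc[symmetric] of_real_eq_0_iff .
  have "mob c w - mob c z = (w - z) * (1 - c * cnj c) / (q * p)"
    using nz by (simp add: mob_def p_def[symmetric] q_def[symmetric] divide_simps) (simp add: p_def q_def algebra_simps)
  moreover have "1 - cnj (mob c z) * mob c w = (1 - cnj z * w) * (1 - c * cnj c) / (q * cnj p)"
  proof -
    have "cnj (mob c z) = (cnj z - cnj c) / cnj p" by (simp add: mob_def p_def)
    moreover have "cnj p \<noteq> 0" using nz by simp
    moreover have "cnj p = 1 - c * cnj z" by (simp add: p_def)
    ultimately show ?thesis
      using nz by (simp add: mob_def q_def[symmetric] divide_simps) (simp add: q_def algebra_simps)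
  qed
  ultimately have "pseudo_dist (mob c z) (mob c w) =
     cmod ((w - z) * (1 - c * cnj c) / (q * p)) / cmod ((1 - cnj z * w) * (1 - c * cnj c) / (q * cnj p))"
    by (simp only: pseudo_dist_mob mob_def[of "mob c z"] norm_divide)
  also have "\<dots> = cmod (w - z) / cmod (1 - cnj z * w)"
    using nz kz by (simp add: norm_divide norm_mult)
  finally show ?thesis by (simp add: pseudo_dist_mob mob_def norm_divide)
qed

lemma mob_self: "mob c c = 0" by (simp add: mob_def)

lemma pseudo_dist_0_left: "pseudo_dist 0 w = cmod w" by (simp add: pseudo_dist_mob mob_def)

text \<open>A disc automorphism moves \<open>y\<close> to 0, and there |1 - cnj X Z| \<le> 1 + |X|
  |Z|. This is the addition law of tanh, with distance at most (a + b) / (1 + a b), kept free of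
  division.\<close>

lemma pseudo_dist_sum_bound:
  assumes x: "cmod x < 1" and y: "cmod y < 1" and z: "cmod z < 1"
  shows "pseudo_dist x z * (1 + pseudo_dist x y * pseudo_dist y z) \<le> pseudo_dist x y + pseudo_dist y z"
proof -
  define X where "X = mob y x"
  define Z where "Z = mob y z"
  define a where "a = cmod X"
  define b where "b = cmod Z"
  have X: "cmod X < 1" and Z: "cmod Z < 1" using mob_less_1 x y z by (auto simp: X_def Z_def)
  have ab: "0 \<le> a" "a < 1" "0 \<le> b" "b < 1" using X Z by (auto simp: a_def b_def)
  have xz: "pseudo_dist x z = pseudo_dist X Z" using pseudo_dist_mob_mob[OF y x z] by (simp add: X_def Z_def)
  have xy: "pseudo_dist x y = a" by (simp add: a_def X_def pseudo_dist_mob pseudo_dist_commute[of x y] flip: pseudo_dist_mob)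
  have yz: "pseudo_dist y z = b" by (simp add: b_def Z_def pseudo_dist_mob)
  define d where "d = pseudo_dist X Z"
  have "1 - d\<^sup>2 = (1 - a\<^sup>2) * (1 - b\<^sup>2) / (cmod (1 - cnj X * Z))\<^sup>2"
    using one_minus_pseudo_dist_square[of X Z] X Z by (simp add: d_def a_def b_def)
  also have "\<dots> \<ge> (1 - a\<^sup>2) * (1 - b\<^sup>2) / (1 + a * b)\<^sup>2"
  proof (rule divide_left_mono)
    have "cmod (1 - cnj X * Z) \<le> 1 + a * b"
      using norm_triangle_ineq4[of 1 "cnj X * Z"] by (simp add: norm_mult a_def b_def)
    then show "(cmod (1 - cnj X * Z))\<^sup>2 \<le> (1 + a * b)\<^sup>2" by (simp add: power_mono)
    show "0 \<le> (1 - a\<^sup>2) * (1 - b\<^sup>2)" using ab by (simp add: abs_square_le_1)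
    have "cmod (1 - cnj X * Z) > 0" using one_minus_cnj_mult_neq_0[of X Z] X Z by simp
    moreover have "1 + a * b > 0" using ab by (simp add: add_pos_nonneg)
    ultimately show "0 < (1 + a * b)\<^sup>2 * (cmod (1 - cnj X * Z))\<^sup>2" by simp
  qed
  finally have "(1 - a\<^sup>2) * (1 - b\<^sup>2) / (1 + a * b)\<^sup>2 \<le> 1 - d\<^sup>2" .
  moreover have "1 + a * b > 0" using ab by (simp add: add_pos_nonneg)
  ultimately have "(1 - a\<^sup>2) * (1 - b\<^sup>2) \<le> (1 - d\<^sup>2) * (1 + a * b)\<^sup>2" by (simp add: pos_divide_le_eq)
  then have "(d * (1 + a * b))\<^sup>2 \<le> (a + b)\<^sup>2"
    by (simp add: power2_eq_square algebra_simps)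
  then have "d * (1 + a * b) \<le> a + b" by (rule power2_le_imp_le) (use ab in simp)
  then show ?thesis unfolding xz xy yz d_def .
qed

lemma one_minus_pseudo_dist_ge:
  assumes x: "cmod x < 1" and y: "cmod y < 1" and z: "cmod z < 1"
  shows "1 - pseudo_dist x z \<ge> (1 - pseudo_dist x y) * (1 - pseudo_dist y z) / (1 + pseudo_dist x y * pseudo_dist y z)"
proof -
  let ?a = "pseudo_dist x y" let ?b = "pseudo_dist y z" let ?d = "pseudo_dist x z"
  have p: "1 + ?a * ?b > 0" using pseudo_dist_nonneg by (simp add: add_pos_nonneg)
  have "(1 - ?a) * (1 - ?b) \<le> (1 - ?d) * (1 + ?a * ?b)"
    using pseudo_dist_sum_bound[OF assms] by (simp add: algebra_simps)
  then show ?thesis using p by (simp add: pos_divide_le_eq)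
qed

text \<open>The depth - ln (1 - \<open>pseudo_dist\<close>) is thus subadditive up to ln 2; radii
  are added in this form whenever a centre is changed.\<close>

lemma one_minus_pseudo_dist_ge_half:
  assumes x: "cmod x < 1" and y: "cmod y < 1" and z: "cmod z < 1"
  shows "1 - pseudo_dist x z \<ge> (1 - pseudo_dist x y) * (1 - pseudo_dist y z) / 2"
proof -
  let ?a = "pseudo_dist x y" let ?b = "pseudo_dist y z"
  have ab: "0 \<le> ?a" "?a < 1" "0 \<le> ?b" "?b < 1" using pseudo_dist_nonneg pseudo_dist_less_1 assms by auto
  then have "?a * ?b \<le> 1" by (simp add: mult_le_one)
  moreover have "1 + ?a * ?b > 0" using ab by (simp add: add_pos_nonneg)
  ultimately have "(1 - ?a) * (1 - ?b) / 2 \<le> (1 - ?a) * (1 - ?b) / (1 + ?a * ?b)"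
    using ab by (intro divide_left_mono) auto
  then show ?thesis using one_minus_pseudo_dist_ge[OF assms] by linarith
qed

text \<open>Moving an endpoint by at most \<open>s\<close> changes 1 - \<open>pseudo_dist\<close> by
  a bounded factor, close to 1 for small \<open>s\<close>. For s \<le> 1/2 the factor is at least
  1/3, which is the origin of the thirds in later estimates.\<close>

lemma one_minus_pseudo_dist_ge_near:
  assumes x: "cmod x < 1" and y: "cmod y < 1" and z: "cmod z < 1" and s: "pseudo_dist y z \<le> s" "s < 1"
  shows "1 - pseudo_dist x z \<ge> (1 - pseudo_dist x y) * ((1 - s) / (1 + s))"
proof -
  let ?a = "pseudo_dist x y" let ?b = "pseudo_dist y z"
  have ab: "0 \<le> ?a" "?a < 1" "0 \<le> ?b" "?b < 1" using pseudo_dist_nonneg pseudo_dist_less_1 assms by auto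
  have 1: "?a * ?b \<le> s" using ab s mult_left_le_one_le[of ?b ?a] by linarith
  have "(1 - ?a) * (1 - s) / (1 + s) \<le> (1 - ?a) * (1 - ?b) / (1 + ?a * ?b)"
    using ab s 1 by (intro frac_le mult_mono mult_nonneg_nonneg) (auto intro: add_pos_nonneg)
  then show ?thesis using one_minus_pseudo_dist_ge[OF x y z] by simp
qed

lemma pseudo_dist_triangle:
  assumes x: "cmod x < 1" and y: "cmod y < 1" and z: "cmod z < 1"
  shows "pseudo_dist x z \<le> pseudo_dist x y + pseudo_dist y z"
proof -
  have "pseudo_dist x z \<le> pseudo_dist x z * (1 + pseudo_dist x y * pseudo_dist y z)"
    using pseudo_dist_nonneg by (simp add: algebra_simps)
  then show ?thesis using pseudo_dist_sum_bound[OF assms] by linarith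
qed

lemma continuous_on_pseudo_dist:
  assumes "cmod a < 1" "S \<subseteq> cball 0 1"
  shows "continuous_on S (\<lambda>w. pseudo_dist a w)"
  unfolding pseudo_dist_mob mob_def
  by (intro continuous_intros) (use one_minus_cnj_mult_neq_0[OF assms(1)] assms(2) in \<open>auto simp: subset_iff\<close>)

lemma har_ln_pseudo_dist:
  assumes "cmod a < 1" "open S" "S \<subseteq> ball 0 1" "a \<notin> S"
  shows "har (\<lambda>w. ln (pseudo_dist a w)) S"
  unfolding pseudo_dist_mob
proof (rule har_ln_cmod)
  have nz: "1 - cnj a * w \<noteq> 0" if "w \<in> S" for w
    using one_minus_cnj_mult_neq_0[OF assms(1), of w] assms(3) that by (auto simp: subset_iff)
  show "mob a holomorphic_on S" unfolding mob_def[abs_def] by (intro holomorphic_intros nz)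
  show "mob a w \<noteq> 0" if "w \<in> S" for w using nz[OF that] that assms(4) by (auto simp: mob_def)
qed (rule assms)

text \<open>Circles of Apollonius: after squaring, both conditions are the same quadratic inequality
  up to the positive factor \<open>k\<close>. The Euclidean form is what makes \<open>Omega\<close>
  a circular domain with exterior discs at its holes.\<close>

lemma pseudo_cball_eq_cball:
  assumes a: "cmod a < 1" and s: "0 \<le> s" "s < 1"
  defines "k \<equiv> 1 - s\<^sup>2 * (cmod a)\<^sup>2"
  shows "pseudo_cball a s = cball (of_real ((1 - s\<^sup>2) / k) * a) (s * (1 - (cmod a)\<^sup>2) / k)"
proof (intro set_eqI)
  fix w
  have a2: "(cmod a)\<^sup>2 < 1" using a by (simp add: abs_square_less_1)
  have s2: "s\<^sup>2 < 1" using s by (simp add: abs_square_less_1)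
  have "s\<^sup>2 * (cmod a)\<^sup>2 \<le> s\<^sup>2" using a2 by (simp add: mult_left_le)
  then have k: "k > 0" using s2 by (simp add: k_def)
  have id: "(cmod (of_real k * w - of_real (1 - s\<^sup>2) * a))\<^sup>2 - (s * (1 - (cmod a)\<^sup>2))\<^sup>2
      = k * ((cmod (w - a))\<^sup>2 - s\<^sup>2 * (cmod (1 - cnj a * w))\<^sup>2)"
    unfolding k_def cmod_power2 by (simp add: power2_eq_square algebra_simps)
  have "w \<in> cball (of_real ((1 - s\<^sup>2) / k) * a) (s * (1 - (cmod a)\<^sup>2) / k) \<longleftrightarrow>
     cmod (w - of_real ((1 - s\<^sup>2) / k) * a) \<le> s * (1 - (cmod a)\<^sup>2) / k"
    by (simp add: dist_norm norm_minus_commute)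
  also have "\<dots> \<longleftrightarrow> k * cmod (w - of_real ((1 - s\<^sup>2) / k) * a) \<le> s * (1 - (cmod a)\<^sup>2)"
    using k by (simp add: pos_le_divide_eq mult.commute)
  also have "k * cmod (w - of_real ((1 - s\<^sup>2) / k) * a) = cmod (of_real k * (w - of_real ((1 - s\<^sup>2) / k) * a))"
    using k by (simp add: norm_mult)
  also have "of_real k * (w - of_real ((1 - s\<^sup>2) / k) * a) = of_real k * w - of_real (1 - s\<^sup>2) * a"
  proof -
    have "of_real k * of_real ((1 - s\<^sup>2) / k) = (of_real (1 - s\<^sup>2) :: complex)" using k by (simp flip: of_real_mult)
    then show ?thesis by (simp only: right_diff_distrib mult.assoc[symmetric])
  qed
  also have "cmod (of_real k * w - of_real (1 - s\<^sup>2) * a) \<le> s * (1 - (cmod a)\<^sup>2) \<longleftrightarrow>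
     (cmod (of_real k * w - of_real (1 - s\<^sup>2) * a))\<^sup>2 \<le> (s * (1 - (cmod a)\<^sup>2))\<^sup>2"
    using abs_le_square_iff[of "cmod (of_real k * w - of_real (1 - s\<^sup>2) * a)" "s * (1 - (cmod a)\<^sup>2)"] s a2 by simp
  also have "\<dots> \<longleftrightarrow> k * ((cmod (w - a))\<^sup>2 - s\<^sup>2 * (cmod (1 - cnj a * w))\<^sup>2) \<le> 0"
    using id by linarith
  also have "\<dots> \<longleftrightarrow> (cmod (w - a))\<^sup>2 \<le> s\<^sup>2 * (cmod (1 - cnj a * w))\<^sup>2"
    using k by (simp add: mult_le_0_iff)
  finally have E: "w \<in> cball (of_real ((1 - s\<^sup>2) / k) * a) (s * (1 - (cmod a)\<^sup>2) / k) \<longleftrightarrow>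
    (cmod (w - a))\<^sup>2 \<le> s\<^sup>2 * (cmod (1 - cnj a * w))\<^sup>2" .
  show "w \<in> pseudo_cball a s \<longleftrightarrow> w \<in> cball (of_real ((1 - s\<^sup>2) / k) * a) (s * (1 - (cmod a)\<^sup>2) / k)"
  proof (cases "cmod w < 1")
    case True
    have p: "cmod (1 - cnj a * w) > 0" using one_minus_cnj_mult_neq_0[OF a, of w] True by simp
    have "w \<in> pseudo_cball a s \<longleftrightarrow> cmod (w - a) \<le> s * cmod (1 - cnj a * w)"
      using True p by (simp add: pseudo_cball_def pseudo_dist_mob mob_def norm_divide pos_divide_le_eq)
    also have "\<dots> \<longleftrightarrow> (cmod (w - a))\<^sup>2 \<le> (s * cmod (1 - cnj a * w))\<^sup>2"
      using s by (metis mult_nonneg_nonneg norm_ge_zero power2_le_imp_le power_mono)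
    finally show ?thesis unfolding E by (simp add: power_mult_distrib)
  next
    case False
    \<comment> \<open>For |w| \<ge> 1 the identity gives |1 - cnj a w| \<le> |w - a|, so the
      quadratic inequality with s < 1 would force w = a.\<close>
    have "\<not> (cmod (w - a))\<^sup>2 \<le> s\<^sup>2 * (cmod (1 - cnj a * w))\<^sup>2"
    proof
      assume H: "(cmod (w - a))\<^sup>2 \<le> s\<^sup>2 * (cmod (1 - cnj a * w))\<^sup>2"
      have "1 \<le> (cmod w)\<^sup>2" using False by (simp add: one_le_power)
      then have "(1 - (cmod a)\<^sup>2) * (1 - (cmod w)\<^sup>2) \<le> 0" using a2 by (simp add: mult_le_0_iff)
      then have J: "(cmod (1 - cnj a * w))\<^sup>2 \<le> (cmod (w - a))\<^sup>2" using mob_identity[of a w] by linarith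
      have "(1 - s\<^sup>2) * (cmod (w - a))\<^sup>2 \<le> 0"
        using H mult_left_mono[OF J, of "s\<^sup>2"] by (simp add: algebra_simps)
      then have "w = a" using s2 by (simp add: mult_le_0_iff)
      then show False using a False by simp
    qed
    then show ?thesis using E False by (simp add: pseudo_cball_def)
  qed
qed

section \<open>Separated sets: counting and logarithmic sums\<close>

lemma inj_on_mob:
  assumes "cmod z < 1"
  shows "inj_on (mob z) (ball 0 1)"
proof (rule inj_onI)
  fix a b assume ab: "a \<in> ball 0 1" "b \<in> ball 0 1" "mob z a = mob z b"
  then have "pseudo_dist a b = pseudo_dist (mob z b) (mob z b)" using pseudo_dist_mob_mob[OF assms, of a b] by simp
  then have "pseudo_dist a b = 0" by (simp add: pseudo_dist_def)
  then show "a = b" using pseudo_dist_eq_0_iff[of a b] ab by simp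
qed

text \<open>The explicit \<delta> is preserved by disc automorphisms, so constants depending on
  \<delta> alone serve all recentred sets at once. The cap 1/2 is a normalisation, since \<delta>
  may always be decreased.\<close>

definition separated_by :: "real \<Rightarrow> complex set \<Rightarrow> bool" where
  "separated_by \<delta> L \<longleftrightarrow> L \<subseteq> ball 0 1 \<and> 0 < \<delta> \<and> \<delta> \<le> 1/2 \<and>
     (\<forall>a\<in>L. \<forall>b\<in>L. a \<noteq> b \<longrightarrow> \<delta> \<le> pseudo_dist a b)"

lemma separated_imp_separated_by:
  assumes "separated L"
  obtains \<delta> where "separated_by \<delta> L"
proof -
  define I where "I = (INF (a, b) \<in> {(a, b). a \<in> L \<and> b \<in> L \<and> a \<noteq> b}. ereal (pseudo_dist a b))"
  have L: "L \<subseteq> ball 0 1" and I: "0 < I" using assms by (auto simp: separated_def I_def)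
  obtain d where d: "0 < ereal d" "ereal d < I" using ereal_dense2[OF I] by blast
  have "d \<le> pseudo_dist a b" if "a \<in> L" "b \<in> L" "a \<noteq> b" for a b
  proof -
    have "I \<le> ereal (pseudo_dist a b)" unfolding I_def using that by (intro INF_lower2[of "(a,b)"]) auto
    then have "ereal d \<le> ereal (pseudo_dist a b)" using d(2) by order
    then show ?thesis by simp
  qed
  then have "separated_by (min d (1/2)) L" using L d(1) by (force simp: separated_by_def)
  then show ?thesis using that by blast
qed

lemma separated_by_mob:
  assumes "separated_by \<delta> L" "cmod w < 1"
  shows "separated_by \<delta> (mob w ` L)"
proof -
  have L: "\<And>a. a \<in> L \<Longrightarrow> cmod a < 1" using assms(1) by (auto simp: separated_by_def)
  have "\<delta> \<le> pseudo_dist (mob w a) (mob w b)" if "a \<in> L" "b \<in> L" "mob w a \<noteq> mob w b" for a b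
    using that assms L pseudo_dist_mob_mob[of w a b] by (auto simp: separated_by_def)
  then show ?thesis using assms L mob_less_1 by (auto simp: separated_by_def)
qed

lemma polar_dist_le: "cmod (rcis s \<theta> - rcis t \<phi>) \<le> \<bar>s - t\<bar> + \<bar>t\<bar> * \<bar>\<theta> - \<phi>\<bar>"
proof -
  have "rcis s \<theta> - rcis t \<phi> = of_real (s - t) * cis \<theta> + of_real t * (cis \<theta> - cis \<phi>)"
    by (simp add: rcis_def algebra_simps)
  then have "cmod (rcis s \<theta> - rcis t \<phi>) \<le> cmod (of_real (s - t) * cis \<theta>) + cmod (of_real t * (cis \<theta> - cis \<phi>))"
    by (metis norm_triangle_ineq)
  also have "\<dots> = \<bar>s - t\<bar> + \<bar>t\<bar> * cmod (cis \<theta> - cis \<phi>)"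
    unfolding norm_mult norm_of_real norm_cis by simp
  also have "cmod (cis \<theta> - cis \<phi>) \<le> \<bar>\<theta> - \<phi>\<bar>"
  proof -
    have "cmod (cis \<theta> - cis \<phi>) = 2 * \<bar>sin ((\<theta> - \<phi>) / 2)\<bar>"
      using dist_exp_i_1[of "\<theta> - \<phi>"]
    proof -
      have "cis \<theta> - cis \<phi> = cis \<phi> * (exp (\<i> * of_real (\<theta> - \<phi>)) - 1)"
        by (simp add: cis_conv_exp right_diff_distrib algebra_simps flip: exp_add)
      then show ?thesis using dist_exp_i_1[of "\<theta> - \<phi>"] by (simp only: norm_mult norm_cis mult_1)
    qed
    also have "\<dots> \<le> 2 * \<bar>(\<theta> - \<phi>) / 2\<bar>" using abs_sin_x_le_abs_x[of "(\<theta> - \<phi>)/2"] by simp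
    finally show ?thesis by simp
  qed
  finally show ?thesis by (simp add: mult_left_mono)
qed

text \<open>Each dyadic annulus is cut into cells of pseudohyperbolic diameter less than \<open>\<delta>\<close> in polar
  coordinates.\<close>

lemma annulus_count:
  assumes L: "separated_by \<delta> L" and K: "4 / \<delta> \<le> real K"
  defines "A \<equiv> \<lambda>n. {a \<in> L. 1 / 2 ^ Suc n < 1 - cmod a \<and> 1 - cmod a \<le> 1 / 2 ^ n}"
  shows "finite (A n) \<and> real (card (A n)) \<le> real (K + 1) * real (8 * K * 2 ^ n)"
proof -
  have d: "0 < \<delta>" "\<delta> \<le> 1/2" using L by (auto simp: separated_by_def)
  have K4: "real K \<ge> 8"
  proof -
    have "8 \<le> 4 / \<delta>" using d by (simp add: pos_le_divide_eq)
    then show ?thesis using K by linarith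
  qed
  define f where "f = (\<lambda>a. (nat \<lfloor>real K * 2 ^ n * (1 - cmod a)\<rfloor>, nat \<lfloor>real K * 2 ^ n * Arg2pi a\<rfloor>))"
  have inj: "inj_on f (A n)"
  proof (rule inj_onI)
    fix a b assume ab: "a \<in> A n" "b \<in> A n" "f a = f b"
    have near: "\<bar>x - y\<bar> < 1" if "nat \<lfloor>x\<rfloor> = nat \<lfloor>y\<rfloor>" "0 \<le> x" "0 \<le> y" for x y :: real
      using that by linarith
    have norm1: "cmod a < 1" "cmod b < 1" using ab(1,2) L by (auto simp: A_def separated_by_def)
    have p: "real K * 2 ^ n > 0" using K4 by simp
    have eqf: "nat \<lfloor>real K * 2 ^ n * (1 - cmod a)\<rfloor> = nat \<lfloor>real K * 2 ^ n * (1 - cmod b)\<rfloor>"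
      "nat \<lfloor>real K * 2 ^ n * Arg2pi a\<rfloor> = nat \<lfloor>real K * 2 ^ n * Arg2pi b\<rfloor>" using ab(3) by (simp_all add: f_def)
    have "\<bar>real K * 2 ^ n * (1 - cmod a) - real K * 2 ^ n * (1 - cmod b)\<bar> < 1"
      by (rule near[OF eqf(1)]) (use norm1 in auto)
    then have "\<bar>real K * 2 ^ n * (cmod a - cmod b)\<bar> < 1" by (simp add: algebra_simps abs_minus_commute)
    then have 1: "\<bar>cmod a - cmod b\<bar> < 1 / (real K * 2 ^ n)" using p by (simp add: abs_mult pos_less_divide_eq mult.commute)
    have "\<bar>real K * 2 ^ n * Arg2pi a - real K * 2 ^ n * Arg2pi b\<bar> < 1"
      by (rule near[OF eqf(2)]) (simp_all add: Arg2pi_ge_0)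
    then have "\<bar>real K * 2 ^ n * (Arg2pi a - Arg2pi b)\<bar> < 1" by (simp add: algebra_simps)
    then have 2: "\<bar>Arg2pi a - Arg2pi b\<bar> < 1 / (real K * 2 ^ n)" using p by (simp add: abs_mult pos_less_divide_eq mult.commute)
    have rc: "x = rcis (cmod x) (Arg2pi x)" for x using Arg2pi_eq[of x] by (simp add: rcis_def cis_conv_exp)
    have "cmod (a - b) \<le> \<bar>cmod a - cmod b\<bar> + \<bar>cmod b\<bar> * \<bar>Arg2pi a - Arg2pi b\<bar>"
      using polar_dist_le[of "cmod a" "Arg2pi a" "cmod b" "Arg2pi b"] rc[of a, symmetric] rc[of b, symmetric] by simp
    also have "\<dots> \<le> \<bar>cmod a - cmod b\<bar> + \<bar>Arg2pi a - Arg2pi b\<bar>"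
      using norm1 by (simp add: mult_left_le_one_le)
    also have "\<dots> < 1 / (real K * 2 ^ n) + 1 / (real K * 2 ^ n)" using 1 2 by (rule add_strict_mono)
    also have "\<dots> = 2 / (real K * 2 ^ n)" by simp
    finally have 3: "cmod (a - b) < 2 / (real K * 2 ^ n)" .
    have "1 / 2 ^ Suc n < 1 - cmod a" using ab(1) by (simp add: A_def)
    also have "\<dots> \<le> 1 - cmod a * cmod b" using norm1 by (simp add: mult_left_le)
    also have "\<dots> \<le> cmod (1 - cnj a * b)" using norm_triangle_ineq2[of 1 "cnj a * b"] by (simp add: norm_mult)
    finally have 4: "1 / 2 ^ Suc n < cmod (1 - cnj a * b)" .
    show "a = b"
    proof (rule ccontr)
      assume "a \<noteq> b"
      then have "\<delta> \<le> pseudo_dist a b" using L ab(1,2) by (simp add: separated_by_def A_def)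
      also have "\<dots> = cmod (a - b) / cmod (1 - cnj a * b)"
        by (simp add: pseudo_dist_mob mob_def norm_divide norm_minus_commute)
      also have "\<dots> < (2 / (real K * 2 ^ n)) / (1 / 2 ^ Suc n)"
        by (rule frac_less) (use 3 4 in auto)
      also have "\<dots> = 4 / real K" using K4 by (simp add: field_simps)
      also have "\<dots> \<le> \<delta>" using K d K4 by (simp add: field_simps)
      finally show False by simp
    qed
  qed
  have sub: "f ` A n \<subseteq> {..K} \<times> {..<8 * K * 2 ^ n}"
  proof
    fix x assume "x \<in> f ` A n"
    then obtain a where a: "a \<in> A n" "x = f a" by blast
    have "real K * 2 ^ n * (1 - cmod a) \<le> real K * 2 ^ n * (1 / 2 ^ n)"
      using a(1) by (intro mult_left_mono) (auto simp: A_def)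
    then have 1: "real K * 2 ^ n * (1 - cmod a) \<le> real K" by simp
    have "Arg2pi a < 8" using Arg2pi_lt_2pi[of a] pi_less_4 by linarith
    then have "real K * 2 ^ n * Arg2pi a < real K * 2 ^ n * 8"
      using K4 by (intro mult_strict_left_mono) auto
    then have 2: "real K * 2 ^ n * Arg2pi a < real (8 * K * 2 ^ n)" by simp
    have "nat \<lfloor>real K * 2 ^ n * (1 - cmod a)\<rfloor> \<le> K" using 1 by linarith
    moreover have "nat \<lfloor>real K * 2 ^ n * Arg2pi a\<rfloor> < 8 * K * 2 ^ n"
      using 2 Arg2pi_ge_0[of a] by (simp add: nat_less_iff floor_less_iff)
    ultimately show "x \<in> {..K} \<times> {..<8 * K * 2 ^ n}" using a(2) by (simp add: f_def)
  qed
  have fin: "finite (f ` A n)" by (rule finite_subset[OF sub]) simp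
  have finA: "finite (A n)" using finite_imageD[OF fin inj] .
  have "card (A n) = card (f ` A n)" using card_image[OF inj] by simp
  also have "\<dots> \<le> card ({..K} \<times> {..<8 * K * 2 ^ n})" by (rule card_mono[OF _ sub]) simp
  finally have "card (A n) \<le> (K + 1) * (8 * K * 2 ^ n)" by (simp add: card_cartesian_product)
  then have "real (card (A n)) \<le> real ((K + 1) * (8 * K * 2 ^ n))" by (rule of_nat_mono)
  then show ?thesis using finA by (simp only: of_nat_mult)
qed

lemma sum_UN_atMost_le:
  fixes f :: "'a \<Rightarrow> real"
  assumes "\<And>n. finite (A n)" "\<And>n a. a \<in> A n \<Longrightarrow> 0 \<le> f a"
  shows "sum f (\<Union>n\<le>(N::nat). A n) \<le> (\<Sum>n\<le>N. sum f (A n))"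
proof (induction N)
  case (Suc N)
  have "sum f (\<Union>n\<le>Suc N. A n) = sum f ((\<Union>n\<le>N. A n) \<union> A (Suc N))" by (simp add: atMost_Suc Un_commute)
  also have "\<dots> \<le> sum f (\<Union>n\<le>N. A n) + sum f (A (Suc N))"
  proof -
    have fin: "finite (\<Union>n\<le>N. A n)" using assms(1) by blast
    have "0 \<le> sum f ((\<Union>n\<le>N. A n) \<inter> A (Suc N))" by (rule sum_nonneg) (use assms(2) in blast)
    then show ?thesis using sum.union_inter[OF fin assms(1)[of "Suc N"], of f] by linarith
  qed
  finally show ?case using Suc by simp
qed simp

text \<open>The n-th dyadic annulus holds at most c 2^n points of size at most 2^(-n), hence
  contributes a bounded amount, and the number of annuli meeting the disc is of order 1 + ln (1 / (1
  - r)). The constant is chosen before the set so that it also serves all Moebius images.\<close>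

lemma sum_one_minus_cmod:
  assumes \<delta>: "0 < \<delta>"
  shows "\<exists>C>0. \<forall>L (r::real). separated_by \<delta> L \<longrightarrow> 0 \<le> r \<longrightarrow> r < 1 \<longrightarrow>
     finite {a \<in> L. cmod a < r} \<and> (\<Sum>a\<in>{a \<in> L. cmod a < r}. 1 - cmod a) \<le> C * (1 + ln (1 / (1 - r)))"
proof -
  obtain K :: nat where K: "4 / \<delta> \<le> real K" using real_arch_simple by blast
  define c where "c = real (K + 1) * real (8 * K)"
  have "real K > 0" using K \<delta> by (metis divide_pos_pos less_le_trans zero_less_numeral)
  then have c: "c > 0" by (simp add: c_def)
  show ?thesis
  proof (intro exI[of _ "2 * c"] conjI allI impI)
    fix L and r :: real assume L: "separated_by \<delta> L" and r: "0 \<le> r" "r < 1"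
    define A where "A n = {a \<in> L. 1 / 2 ^ Suc n < 1 - cmod a \<and> 1 - cmod a \<le> 1 / 2 ^ n}" for n
    note A = annulus_count[OF L K, folded A_def]
    \<comment> \<open>ln 2 \<ge> 1/2 turns n ln 2 \<le> ln (1 / (1 - r)) into n \<le> N.\<close>
    define N where "N = nat \<lfloor>2 * ln (1 / (1 - r))\<rfloor>"
    have sub: "{a \<in> L. cmod a < r} \<subseteq> (\<Union>n\<le>N. A n)"
    proof
      fix a assume a: "a \<in> {a \<in> L. cmod a < r}"
      define x where "x = 1 - cmod a"
      have x: "0 < x" "x \<le> 1" "1 - r < x" using a r by (auto simp: x_def)
      obtain m where m: "(1/2) ^ m < x" using real_arch_pow_inv[OF x(1), of "1/2"] by auto
      have "1 / 2 ^ Suc m \<le> (1/2 :: real) ^ m" by (simp add: power_one_over divide_simps)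
      then have ex: "\<exists>n. 1 / 2 ^ Suc n < x" using m by (metis order_le_less_trans)
      define n where "n = (LEAST n. 1 / 2 ^ Suc n < x)"
      have n1: "1 / 2 ^ Suc n < x" unfolding n_def using LeastI_ex[OF ex] .
      have n2: "x \<le> 1 / 2 ^ n"
      proof (cases n)
        case (Suc m)
        then have "\<not> 1 / 2 ^ Suc m < x" using not_less_Least[of m "\<lambda>n. 1 / 2 ^ Suc n < x"] by (simp add: n_def)
        then show ?thesis using Suc by simp
      qed (use x in simp)
      have "2 ^ n < 1 / (1 - r)"
      proof -
        have "(1 - r) * 2 ^ n < x * 2 ^ n" using x(3) by simp
        also have "\<dots> \<le> 1" using n2 by (simp add: pos_le_divide_eq)
        finally show ?thesis using r by (simp add: pos_less_divide_eq mult.commute)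
      qed
      then have "ln (2 ^ n) \<le> ln (1 / (1 - r))" using r by (intro ln_mono) auto
      then have "real n * ln 2 \<le> ln (1 / (1 - r))" by (simp add: ln_realpow)
      moreover have "ln 2 \<ge> (1/2 :: real)" using ln2_ge_two_thirds by linarith
      ultimately have "real n \<le> 2 * ln (1 / (1 - r))"
        using mult_left_mono[of "1/2" "ln 2" "real n"] by simp
      then have "n \<le> N" unfolding N_def by (simp add: le_nat_floor)
      moreover have "a \<in> A n" using a n1 n2 by (simp add: A_def x_def)
      ultimately show "a \<in> (\<Union>n\<le>N. A n)" by blast
    qed
    have finU: "finite (\<Union>n\<le>N. A n)" using A by auto
    show "finite {a \<in> L. cmod a < r}" using finite_subset[OF sub finU] .
    have "(\<Sum>a\<in>{a \<in> L. cmod a < r}. 1 - cmod a) \<le> (\<Sum>a\<in>(\<Union>n\<le>N. A n). 1 - cmod a)"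
      by (rule sum_mono2[OF finU sub]) (use L in \<open>force simp: A_def separated_by_def\<close>)
    also have "\<dots> \<le> (\<Sum>n\<le>N. \<Sum>a\<in>A n. 1 - cmod a)"
    proof (rule sum_UN_atMost_le)
      show "finite (A n)" for n using A by blast
      show "0 \<le> 1 - cmod a" if "a \<in> A n" for n a using that L by (force simp: A_def separated_by_def)
    qed
    also have "\<dots> \<le> (\<Sum>n\<le>N. c)"
    proof (rule sum_mono)
      fix n
      have "(\<Sum>a\<in>A n. 1 - cmod a) \<le> real (card (A n)) * (1 / 2 ^ n)"
        by (rule sum_bounded_above) (simp add: A_def)
      also have "\<dots> \<le> real (K + 1) * real (8 * K * 2 ^ n) * (1 / 2 ^ n)"
        using A by (intro mult_right_mono) auto
      also have "\<dots> = c" by (simp add: c_def)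
      finally show "(\<Sum>a\<in>A n. 1 - cmod a) \<le> c" .
    qed
    also have "\<dots> = c * (1 + real N)" by simp
    also have "real N \<le> 2 * ln (1 / (1 - r))"
      using r unfolding N_def by (simp add: ln_div)
    finally show "(\<Sum>a\<in>{a \<in> L. cmod a < r}. 1 - cmod a) \<le> 2 * c * (1 + ln (1 / (1 - r)))"
      using c by (simp add: algebra_simps)
  qed (use c in simp)
qed

text \<open>The centred estimate is applied to the Moebius image that sends \<open>w\<close> to 0;
  the count follows since every summand exceeds 1 - r.\<close>

lemma sum_one_minus_pseudo_dist:
  assumes "0 < \<delta>"
  obtains C where "C > 0" "\<And>L w r. separated_by \<delta> L \<Longrightarrow> cmod w < 1 \<Longrightarrow> r < 1 \<Longrightarrow> finite {a \<in> L. pseudo_dist a w < r}"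
    "\<And>L w r. separated_by \<delta> L \<Longrightarrow> cmod w < 1 \<Longrightarrow> 0 \<le> r \<Longrightarrow> r < 1 \<Longrightarrow>
      (\<Sum>a\<in>{a \<in> L. pseudo_dist a w < r}. 1 - pseudo_dist a w) \<le> C * (1 + ln (1 / (1 - r)))"
    "\<And>L w r. separated_by \<delta> L \<Longrightarrow> cmod w < 1 \<Longrightarrow> 0 \<le> r \<Longrightarrow> r < 1 \<Longrightarrow>
      real (card {a \<in> L. pseudo_dist a w < r}) \<le> C * (1 + ln (1 / (1 - r))) / (1 - r)"
proof -
  obtain C where C: "C > 0" "\<And>L r. separated_by \<delta> L \<Longrightarrow> 0 \<le> r \<Longrightarrow> r < 1 \<Longrightarrow>
     finite {a \<in> L. cmod a < r} \<and> (\<Sum>a\<in>{a \<in> L. cmod a < r}. 1 - cmod a) \<le> C * (1 + ln (1 / (1 - r)))"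
    using sum_one_minus_cmod[OF assms] by blast
  have main: "finite {a \<in> L. pseudo_dist a w < r} \<and>
      (\<Sum>a\<in>{a \<in> L. pseudo_dist a w < r}. 1 - pseudo_dist a w) \<le> C * (1 + ln (1 / (1 - r)))"
    if L: "separated_by \<delta> L" and w: "cmod w < 1" and r: "0 \<le> r" "r < 1" for L w r
  proof -
    have L1: "\<And>a. a \<in> L \<Longrightarrow> cmod a < 1" using L by (auto simp: separated_by_def)
    have pm: "pseudo_dist a w = cmod (mob w a)" for a using pseudo_dist_mob pseudo_dist_commute by metis
    have inj: "inj_on (mob w) L" using inj_on_mob[OF w] by (rule inj_on_subset) (use L1 in auto)
    have im: "mob w ` {a \<in> L. pseudo_dist a w < r} = {b \<in> mob w ` L. cmod b < r}" by (auto simp: pm)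
    have inj': "inj_on (mob w) {a \<in> L. pseudo_dist a w < r}" using inj by (rule inj_on_subset) auto
    note D = C(2)[OF separated_by_mob[OF L w] r]
    have "finite {a \<in> L. pseudo_dist a w < r}" using D finite_imageD[OF _ inj'] im by simp
    moreover have "(\<Sum>a\<in>{a \<in> L. pseudo_dist a w < r}. 1 - pseudo_dist a w) = (\<Sum>b\<in>{b \<in> mob w ` L. cmod b < r}. 1 - cmod b)"
      unfolding im[symmetric] by (subst sum.reindex[OF inj']) (simp add: pm)
    ultimately show ?thesis using D by simp
  qed
  show ?thesis
  proof (rule that[OF C(1)])
    show "finite {a \<in> L. pseudo_dist a w < r}" if "separated_by \<delta> L" "cmod w < 1" "r < 1" for L w r
    proof (cases "0 \<le> r")
      case False
      have "\<not> pseudo_dist a w < r" for a using False pseudo_dist_nonneg[of a w] by linarith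
      then have E: "{a \<in> L. pseudo_dist a w < r} = {}" by auto
      show ?thesis unfolding E by simp
    qed (use main that in blast)
    show "(\<Sum>a\<in>{a \<in> L. pseudo_dist a w < r}. 1 - pseudo_dist a w) \<le> C * (1 + ln (1 / (1 - r)))"
      if "separated_by \<delta> L" "cmod w < 1" "0 \<le> r" "r < 1" for L w r using main that by blast
    show "real (card {a \<in> L. pseudo_dist a w < r}) \<le> C * (1 + ln (1 / (1 - r))) / (1 - r)"
      if "separated_by \<delta> L" "cmod w < 1" "0 \<le> r" "r < 1" for L w r
    proof -
      have "real (card {a \<in> L. pseudo_dist a w < r}) * (1 - r) = (\<Sum>a\<in>{a \<in> L. pseudo_dist a w < r}. 1 - r)" by simp
      also have "\<dots> \<le> (\<Sum>a\<in>{a \<in> L. pseudo_dist a w < r}. 1 - pseudo_dist a w)" by (rule sum_mono) auto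
      also have "\<dots> \<le> C * (1 + ln (1 / (1 - r)))" using main that by blast
      finally show ?thesis using that by (simp add: pos_le_divide_eq)
    qed
  qed
qed

lemma finite_pseudo_ball:
  assumes "separated_by \<delta> L" "cmod w < 1" "r < 1"
  shows "finite {a \<in> L. pseudo_dist a w < r}"
proof -
  have "0 < \<delta>" using assms by (simp add: separated_by_def)
  then obtain C where "\<And>L w r. separated_by \<delta> L \<Longrightarrow> cmod w < 1 \<Longrightarrow> r < 1 \<Longrightarrow> finite {a \<in> L. pseudo_dist a w < r}"
    using sum_one_minus_pseudo_dist by metis
  then show ?thesis using assms by blast
qed

section \<open>Harmonic measure of the unit circle\<close>

text \<open>The circle is disjoint from the closed union of the holes, so its indicator is
  continuous on the frontier. Exterior discs are the holes themselves and, at a point \<zeta> of the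
  circle, the disc of radius 1 about 2 \<zeta>.\<close>

lemma circular_domain:
  fixes c :: "'i \<Rightarrow> complex" and R :: "'i \<Rightarrow> real"
  assumes J: "finite J" "\<And>j. j \<in> J \<Longrightarrow> R j > 0" "\<And>j. j \<in> J \<Longrightarrow> cball (c j) (R j) \<subseteq> ball 0 1"
    and S: "S = ball 0 1 - (\<Union>j\<in>J. cball (c j) (R j))" and z: "z \<in> S"
  obtains u where "continuous_on (closure S) u" "har u S" "\<And>w. cmod w = 1 \<Longrightarrow> u w = 1"
    "\<And>w. w \<in> frontier S \<Longrightarrow> cmod w < 1 \<Longrightarrow> u w = 0" "harmonic_measure z (sphere 0 1) S = u z"
    "sphere 0 1 \<subseteq> closure S" "open S"
proof -
  define C where "C = (\<Union>j\<in>J. cball (c j) (R j))"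
  have cC: "closed C" unfolding C_def using J(1) by (intro closed_UN) auto
  have CB: "C \<subseteq> ball 0 1" using J(3) by (auto simp: C_def)
  have SC: "S = ball 0 1 - C" using S by (simp add: C_def)
  have oS: "open S" unfolding SC using cC by (intro open_Diff) auto
  have bS: "bounded S" unfolding SC by (rule bounded_subset[of "ball 0 1"]) auto
  have clS: "closure S \<subseteq> cball 0 1" unfolding SC by (rule closure_minimal) auto
  have nC: "w \<notin> C" if "cmod w = 1" for w using CB that by force
  have sph: "sphere 0 1 \<subseteq> closure S"
  proof
    fix w :: complex assume w: "w \<in> sphere 0 1"
    have "closure (ball 0 1) \<subseteq> closure (S \<union> C)" by (rule closure_mono) (auto simp: SC)
    moreover have "w \<in> closure (ball 0 1)" using w by simp
    ultimately have "w \<in> closure S \<union> closure C" by (auto simp only: closure_Un)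
    then show "w \<in> closure S" using nC w cC by auto
  qed
  have fr: "frontier S = closure S - S" using oS by (simp add: frontier_def interior_open)
  have "sphere 0 1 \<inter> S = {}" by (auto simp: SC)
  then have sphf: "sphere 0 1 \<subseteq> frontier S" using sph unfolding fr by blast
  have disj: "ball (c j) (R j) \<inter> S = {}" if "j \<in> J" for j
    using that ball_subset_cball[of "c j" "R j"] by (auto simp: SC C_def)
  have hole: "\<exists>j\<in>J. w \<in> sphere (c j) (R j)" if w: "w \<in> frontier S" "cmod w \<noteq> 1" for w
  proof -
    have "cmod w < 1" using w(2) subsetD[OF clS, of w] w(1) unfolding fr by auto
    moreover have "w \<notin> S" using w fr by blast
    ultimately have "w \<in> C" by (auto simp: SC)
    then obtain j where j: "j \<in> J" "w \<in> cball (c j) (R j)" by (auto simp: C_def)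
    have "ball (c j) (R j) \<inter> closure S = {}"
      using disj[OF j(1)] by (simp add: open_Int_closure_eq_empty)
    then have "w \<notin> ball (c j) (R j)" using w by (auto simp: fr)
    then show ?thesis using j by auto
  qed
  have par: "real_parametrized (frontier S)"
  proof (rule real_parametrized_subset)
    show "real_parametrized (sphere 0 1 \<union> (\<Union>j\<in>J. sphere (c j) (R j)))"
      by (intro real_parametrized_Un real_parametrized_UN real_parametrized_sphere J(1))
    show "frontier S \<subseteq> sphere 0 1 \<union> (\<Union>j\<in>J. sphere (c j) (R j))" using hole by fastforce
  qed simp
  have ext: "\<exists>c r. r > 0 \<and> dist \<zeta> c = r \<and> ball c r \<inter> S = {}" if \<zeta>: "\<zeta> \<in> frontier S" for \<zeta>
  proof (cases "cmod \<zeta> = 1")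
    case True
    have "ball (2 * \<zeta>) 1 \<inter> S = {}"
    proof (rule ccontr)
      assume "ball (2 * \<zeta>) 1 \<inter> S \<noteq> {}"
      then obtain x where "dist (2 * \<zeta>) x < 1" "cmod x < 1" by (auto simp: SC)
      moreover have "cmod (2 * \<zeta>) \<le> dist (2 * \<zeta>) x + cmod x"
        using norm_triangle_ineq[of "2 * \<zeta> - x" x] by (simp add: dist_norm)
      ultimately show False using True by (simp add: norm_mult)
    qed
    moreover have "dist \<zeta> (2 * \<zeta>) = 1" using True by (simp add: dist_norm)
    ultimately show ?thesis by (intro exI[of _ "2 * \<zeta>"] exI[of _ 1]) auto
  next
    case False
    then obtain j where "j \<in> J" "\<zeta> \<in> sphere (c j) (R j)" using hole \<zeta> by blast
    then show ?thesis using J(2) disj by (intro exI[of _ "c j"] exI[of _ "R j"]) (auto simp: dist_commute)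
  qed
  have ci: "continuous_on (frontier S) (indicator (sphere 0 1) :: complex \<Rightarrow> real)"
  proof -
    have "continuous_on (sphere 0 1 \<union> C) (indicator (sphere 0 1) :: complex \<Rightarrow> real)"
    proof (rule continuous_on_closed_Un)
      show "continuous_on (sphere 0 1) (indicator (sphere 0 1) :: complex \<Rightarrow> real)"
        by (rule continuous_on_eq[OF continuous_on_const[of _ 1]]) auto
      show "continuous_on C (indicator (sphere 0 1) :: complex \<Rightarrow> real)"
        by (rule continuous_on_eq[OF continuous_on_const[of _ 0]]) (use nC in \<open>auto simp: indicator_def\<close>)
    qed (use cC in auto)
    then show ?thesis
      by (rule continuous_on_subset) (use hole in \<open>fastforce simp: C_def\<close>)
  qed
  obtain u where u: "continuous_on (closure S) u" "har u S" "\<And>w. w \<in> frontier S \<Longrightarrow> u w = indicator (sphere 0 1) w"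
    using perron_dirichlet[OF oS bS ci ext] by blast
  have "dirichlet_solution S (indicator (sphere 0 1)) u"
    using u by (simp add: dirichlet_solution_def harmonic_on_iff_har)
  then have "harmonic_measure z (sphere 0 1) S = u z"
    by (intro harmonic_measure_eq_solution[OF oS bS z par ext _ sphf ci]) auto
  moreover have "u w = 1" if "cmod w = 1" for w using u(3)[of w] sphf that by auto
  moreover have "u w = 0" if "w \<in> frontier S" "cmod w < 1" for w using u(3)[OF that(1)] that by simp
  ultimately show ?thesis using that u sph oS by blast
qed

section \<open>The domains \<open>Omega\<close> and their circle solutions\<close>

definition holes :: "complex set \<Rightarrow> complex \<Rightarrow> real \<Rightarrow> complex set" where
  "holes L z r = {a \<in> L. 1/2 < pseudo_dist a z \<and> pseudo_dist a z < r}"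

lemma Omega_holes: "Omega L z r = ball 0 1 - (\<Union>a\<in>holes L z r. pseudo_cball a (1 - r))"
  by (simp add: Omega_def holes_def)

lemma finite_holes:
  assumes "separated_by \<delta> L" "cmod z < 1" "r < 1"
  shows "finite (holes L z r)"
  using finite_pseudo_ball[OF assms] by (rule finite_subset[rotated]) (auto simp: holes_def)

lemma holes_less_1: "separated_by \<delta> L \<Longrightarrow> a \<in> holes L z r \<Longrightarrow> cmod a < 1"
  by (auto simp: separated_by_def holes_def)

text \<open>Removed discs have centres at distance more than 1/2 from \<open>z\<close> and radius 1
  - r \<le> 1/2.\<close>

lemma z_in_Omega:
  assumes "cmod z < 1" "1/2 \<le> r"
  shows "z \<in> Omega L z r"
  using assms by (auto simp: Omega_holes holes_def pseudo_cball_def)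

lemma Omega_solution:
  assumes L: "separated_by \<delta> L" and z: "cmod z < 1" and r: "1/2 \<le> r" "r < 1"
  obtains u where "continuous_on (closure (Omega L z r)) u" "har u (Omega L z r)"
    "\<And>w. cmod w = 1 \<Longrightarrow> u w = 1"
    "\<And>w. w \<in> frontier (Omega L z r) \<Longrightarrow> cmod w < 1 \<Longrightarrow> u w = 0"
    "harmonic_measure z (frontier unit_disk) (Omega L z r) = u z"
    "sphere 0 1 \<subseteq> closure (Omega L z r)" "open (Omega L z r)"
proof -
  define s where "s = 1 - r"
  have s: "0 < s" "s < 1" using r by (auto simp: s_def)
  define k where "k = (\<lambda>a::complex. 1 - s\<^sup>2 * (cmod a)\<^sup>2)"
  define c where "c = (\<lambda>a::complex. of_real ((1 - s\<^sup>2) / k a) * a)"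
  define R where "R = (\<lambda>a::complex. s * (1 - (cmod a)\<^sup>2) / k a)"
  have pc: "pseudo_cball a s = cball (c a) (R a)" if "a \<in> holes L z r" for a
    using pseudo_cball_eq_cball[of a s] holes_less_1[OF L that] s by (simp add: c_def R_def k_def)
  have Rp: "R a > 0" if "a \<in> holes L z r" for a
  proof -
    have a: "(cmod a)\<^sup>2 < 1" using holes_less_1[OF L that] by (simp add: abs_square_less_1)
    have "s\<^sup>2 * (cmod a)\<^sup>2 \<le> s\<^sup>2" using a by (simp add: mult_left_le)
    moreover have "s\<^sup>2 < 1" using s by (simp add: abs_square_less_1)
    ultimately have "k a > 0" unfolding k_def by linarith
    then show ?thesis using a s by (simp add: R_def)
  qed
  have sub: "cball (c a) (R a) \<subseteq> ball 0 1" if "a \<in> holes L z r" for a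
    unfolding pc[OF that, symmetric] by (auto simp: pseudo_cball_def)
  have S: "Omega L z r = ball 0 1 - (\<Union>a\<in>holes L z r. cball (c a) (R a))"
    unfolding Omega_holes s_def[symmetric] using pc by auto
  have zO: "z \<in> Omega L z r" using z_in_Omega[OF z r(1)] .
  show ?thesis
    using circular_domain[OF finite_holes[OF L z r(2)] Rp sub S zO] that by auto
qed

lemma closure_Omega:
  assumes L: "separated_by \<delta> L" and w: "w \<in> closure (Omega L z r)"
  shows "cmod w \<le> 1" and "a \<in> holes L z r \<Longrightarrow> 1 - r \<le> pseudo_dist a w"
proof -
  have c: "closure (Omega L z r) \<subseteq> cball 0 1"
    by (rule closure_minimal) (auto simp: Omega_holes)
  then show "cmod w \<le> 1" using w by auto
  assume a: "a \<in> holes L z r"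
  show "1 - r \<le> pseudo_dist a w"
  proof (rule continuous_ge_on_closure[OF _ w])
    show "continuous_on (closure (Omega L z r)) (pseudo_dist a)"
      using continuous_on_pseudo_dist[OF holes_less_1[OF L a] c] .
    show "1 - r \<le> pseudo_dist a x" if "x \<in> Omega L z r" for x
      using that a by (auto simp: Omega_holes pseudo_cball_def not_le less_imp_le)
  qed
qed

lemma frontier_Omega:
  assumes L: "separated_by \<delta> L" and w: "w \<in> frontier (Omega L z r)" "open (Omega L z r)" "cmod w < 1"
  obtains a where "a \<in> holes L z r" "pseudo_dist a w = 1 - r"
proof -
  have w': "w \<in> closure (Omega L z r)" "w \<notin> Omega L z r" using w by (auto simp: frontier_def interior_open)
  then obtain a where a: "a \<in> holes L z r" "w \<in> pseudo_cball a (1 - r)" using w(3) by (auto simp: Omega_holes)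
  have "pseudo_dist a w = 1 - r"
    using closure_Omega(2)[OF L w'(1) a(1)] a(2) by (simp add: pseudo_cball_def)
  then show ?thesis using that a(1) by blast
qed

text \<open>This is the harmonic measure of the unit circle as a function of the point, in the one
  domain belonging to the base point \<open>z\<close>. Keeping the domain fixed while the point
  moves is what allows maximum principle arguments.\<close>

definition circle_solution :: "complex set \<Rightarrow> complex \<Rightarrow> real \<Rightarrow> (complex \<Rightarrow> real) \<Rightarrow> bool" where
  "circle_solution L z r u \<longleftrightarrow> continuous_on (closure (Omega L z r)) u \<and> har u (Omega L z r) \<and>
     (\<forall>w. cmod w = 1 \<longrightarrow> u w = 1) \<and> (\<forall>w\<in>frontier (Omega L z r). cmod w < 1 \<longrightarrow> u w = 0)"

lemma circle_solution_ex:
  assumes "separated_by \<delta> L" "cmod z < 1" "1/2 \<le> r" "r < 1"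
  obtains u where "circle_solution L z r u" "harmonic_measure z (frontier unit_disk) (Omega L z r) = u z"
  using Omega_solution[OF assms] unfolding circle_solution_def by metis

lemma bounded_Omega: "bounded (Omega L z r)"
  by (rule bounded_subset[of "ball 0 1"]) (auto simp: Omega_holes)

lemma circle_solution_range:
  assumes L: "separated_by \<delta> L" and u: "circle_solution L z r u" and w: "w \<in> closure (Omega L z r)"
  shows "0 \<le> u w" "u w \<le> 1"
proof -
  have "u x = 0 \<or> u x = 1" if "x \<in> frontier (Omega L z r)" for x
  proof -
    have "cmod x \<le> 1" using closure_Omega(1)[OF L, of x z r] that by (simp add: frontier_def)
    then show ?thesis using u that unfolding circle_solution_def by (cases "cmod x = 1") auto
  qed
  then have b: "0 \<le> u x \<and> u x \<le> 1" if "x \<in> frontier (Omega L z r)" for x using that by fastforce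
  show "0 \<le> u w" by (rule har_min_principle[OF _ bounded_Omega _ _ w]) (use u b in \<open>auto simp: circle_solution_def\<close>)
  show "u w \<le> 1" by (rule har_max_principle[OF _ bounded_Omega _ _ w]) (use u b in \<open>auto simp: circle_solution_def\<close>)
qed

lemma continuous_on_mob:
  assumes "cmod c < 1" "S \<subseteq> cball 0 1"
  shows "continuous_on S (mob c)"
  unfolding mob_def[abs_def]
  by (intro continuous_intros) (use one_minus_cnj_mult_neq_0[OF assms(1)] assms(2) in \<open>auto simp: subset_iff\<close>)

lemma holomorphic_on_mob:
  assumes "cmod c < 1" "S \<subseteq> cball 0 1"
  shows "mob c holomorphic_on S"
  unfolding mob_def[abs_def]
  by (intro holomorphic_intros) (use one_minus_cnj_mult_neq_0[OF assms(1)] assms(2) in \<open>auto simp: subset_iff\<close>)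

section \<open>Upper bound by a walk to the boundary\<close>

text \<open>Green's function, with pole A, of the disc of radius \<rho> about 0.\<close>

definition disc_green :: "real \<Rightarrow> complex \<Rightarrow> complex \<Rightarrow> real" where
  "disc_green \<rho> A Z = ln (cmod ((of_real (\<rho>\<^sup>2) - cnj A * Z) / (of_real \<rho> * (Z - A))))"

lemma disc_green_0: "0 < \<rho> \<Longrightarrow> disc_green \<rho> A 0 = ln (\<rho> / cmod A)"
  by (simp add: disc_green_def norm_divide norm_mult power2_eq_square)

lemma disc_green_boundary:
  assumes "0 < \<rho>" "cmod Z = \<rho>" "Z \<noteq> A"
  shows "disc_green \<rho> A Z = 0"
proof -
  have "of_real (\<rho>\<^sup>2) = Z * cnj Z" using assms(2) complex_norm_square[of Z] by simp
  then have "of_real (\<rho>\<^sup>2) - cnj A * Z = Z * cnj (Z - A)" by (simp add: algebra_simps)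
  then have "cmod (of_real (\<rho>\<^sup>2) - cnj A * Z) = \<rho> * cmod (Z - A)"
    using assms(2) by (simp only: norm_mult complex_mod_cnj)
  then show ?thesis using assms by (simp add: disc_green_def norm_divide norm_mult)
qed

lemma disc_green_numerator:
  assumes "0 < \<rho>" "cmod Z \<le> \<rho>" "cmod A < \<rho>"
  shows "of_real (\<rho>\<^sup>2) - cnj A * Z \<noteq> 0"
proof
  assume "of_real (\<rho>\<^sup>2) - cnj A * Z = 0"
  then have "cmod (of_real (\<rho>\<^sup>2)) = cmod (cnj A * Z)" by simp
  then have "\<rho> * \<rho> = cmod A * cmod Z" by (simp add: norm_mult power2_eq_square)
  moreover have "cmod A * cmod Z \<le> cmod A * \<rho>" using assms by (intro mult_left_mono) auto
  moreover have "cmod A * \<rho> < \<rho> * \<rho>" using assms by simp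
  ultimately show False by linarith
qed

text \<open>A crude comparison with - ln \<open>pseudo_dist\<close>, the Green function of the unit
  disc. The additive constant depends on \<rho> only and is negligible against - ln (1 - r), the
  value at the edge of a hole.\<close>

lemma disc_green_upper:
  assumes \<rho>: "0 < \<rho>" "\<rho> < 1" and Z: "cmod Z \<le> \<rho>" and A: "cmod A < \<rho>" "Z \<noteq> A"
  shows "disc_green \<rho> A Z \<le> ln (2 / (\<rho> * (1 - \<rho>))) - ln (pseudo_dist A Z)"
proof -
  have "cmod A * cmod Z \<le> \<rho> * \<rho>" using assms by (intro mult_mono) auto
  also have "\<dots> \<le> \<rho>" using \<rho> by (simp add: mult_left_le)
  finally have AZ: "cmod A * cmod Z \<le> \<rho>" .
  have 1: "1 - \<rho> \<le> cmod (1 - cnj A * Z)"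
    using norm_triangle_ineq2[of 1 "cnj A * Z"] AZ by (simp add: norm_mult)
  have pd: "pseudo_dist A Z > 0"
    using pseudo_dist_nonneg[of A Z] pseudo_dist_eq_0_iff[of A Z] assms by fastforce
  have "pseudo_dist A Z * (1 - \<rho>) \<le> pseudo_dist A Z * cmod (1 - cnj A * Z)"
    using 1 pd by (intro mult_left_mono) auto
  also have "\<dots> = cmod (Z - A)"
  proof -
    have "cmod (1 - cnj A * Z) \<noteq> 0" using 1 \<rho> by linarith
    then show ?thesis by (simp add: pseudo_dist_mob mob_def norm_divide)
  qed
  finally have 2: "pseudo_dist A Z * (1 - \<rho>) \<le> cmod (Z - A)" .
  have "cmod (of_real (\<rho>\<^sup>2) - cnj A * Z) \<le> cmod (of_real (\<rho>\<^sup>2)) + cmod (cnj A * Z)" by (rule norm_triangle_ineq4)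
  also have "\<dots> \<le> 2"
  proof -
    have "cmod (of_real (\<rho>\<^sup>2)) \<le> 1" using \<rho> by (simp add: norm_power power_le_one)
    then show ?thesis using AZ \<rho> by (simp add: norm_mult)
  qed
  finally have 3: "cmod (of_real (\<rho>\<^sup>2) - cnj A * Z) \<le> 2" .
  have n: "cmod (of_real (\<rho>\<^sup>2) - cnj A * Z) > 0" using disc_green_numerator[OF \<rho>(1) Z A(1)] by simp
  have "cmod ((of_real (\<rho>\<^sup>2) - cnj A * Z) / (of_real \<rho> * (Z - A))) = cmod (of_real (\<rho>\<^sup>2) - cnj A * Z) / (\<rho> * cmod (Z - A))"
    using \<rho> by (simp add: norm_divide norm_mult)
  also have "\<dots> \<le> 2 / (\<rho> * (pseudo_dist A Z * (1 - \<rho>)))"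
    using 2 3 n pd \<rho> by (intro frac_le mult_left_mono mult_pos_pos) auto
  also have "\<dots> = (2 / (\<rho> * (1 - \<rho>))) / pseudo_dist A Z" by simp
  finally have "cmod ((of_real (\<rho>\<^sup>2) - cnj A * Z) / (of_real \<rho> * (Z - A))) \<le> (2 / (\<rho> * (1 - \<rho>))) / pseudo_dist A Z" .
  moreover have "0 < cmod ((of_real (\<rho>\<^sup>2) - cnj A * Z) / (of_real \<rho> * (Z - A)))"
    using n \<rho> A(2) by (simp add: norm_divide norm_mult)
  ultimately have "disc_green \<rho> A Z \<le> ln ((2 / (\<rho> * (1 - \<rho>))) / pseudo_dist A Z)"
    unfolding disc_green_def by (intro ln_mono) auto
  also have "\<dots> = ln (2 / (\<rho> * (1 - \<rho>))) - ln (pseudo_dist A Z)"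
    using \<rho> pd by (subst ln_div) auto
  finally show ?thesis .
qed

text \<open>Sums of a function blowing up at the points of a separated set: at most one of these points
  is close to the argument.\<close>

lemma separated_by_sum_le:
  assumes L: "separated_by \<delta> L" and A: "A \<subseteq> L" "finite A" "real (card A) \<le> n" and x: "cmod x < 1"
    and far: "\<And>a. a \<in> A \<Longrightarrow> \<delta> / 2 \<le> pseudo_dist a x \<Longrightarrow> f a \<le> B" and B: "0 \<le> B"
    and near: "\<And>a. a \<in> A \<Longrightarrow> f a \<le> B + N" and N: "0 \<le> N"
  shows "(\<Sum>a\<in>A. f a) \<le> N + n * (B :: real)"
proof -
  define P where "P = {a \<in> A. pseudo_dist a x < \<delta> / 2}"
  have one: "a = b" if "a \<in> P" "b \<in> P" for a b
  proof (rule ccontr)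
    assume "a \<noteq> b"
    then have "\<delta> \<le> pseudo_dist a b" using that A(1) L by (auto simp: P_def separated_by_def)
    also have "\<dots> \<le> pseudo_dist a x + pseudo_dist x b"
      using that A(1) L x by (intro pseudo_dist_triangle) (auto simp: P_def separated_by_def)
    also have "\<dots> < \<delta>" using that pseudo_dist_commute[of x b] by (simp add: P_def)
    finally show False by simp
  qed
  have cP: "card P \<le> 1"
    using one A(2) card_le_Suc0_iff_eq[of P] by (auto simp: P_def)
  have "(\<Sum>a\<in>A. f a) \<le> (\<Sum>a\<in>A. B + (if a \<in> P then N else 0))"
    using far near by (intro sum_mono) (auto simp: P_def not_less)
  also have "\<dots> = real (card A) * B + real (card P) * N"
    using A(2) by (simp add: sum.distrib sum.If_cases P_def Int_def)
  also have "\<dots> \<le> n * B + 1 * N" using A(3) B N cP by (intro add_mono mult_right_mono) auto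
  finally show ?thesis by simp
qed

text \<open>A Green potential of a disc of centre \<open>w0\<close> bounds the decrease of \<open>u\<close> from the circle of
  that disc to its centre.\<close>

lemma walk_step:
  assumes L: "separated_by \<delta> L" and z: "cmod z < 1" and r: "1/2 \<le> r" "r < 1" and u: "circle_solution L z r u"
    and w0: "w0 \<in> Omega L z r" and \<rho>: "0 < \<rho>" "\<rho> < 1"
    and A: "A \<subseteq> holes L z r" "\<And>a. a \<in> A \<Longrightarrow> pseudo_dist a w0 < \<rho>" "real (card A) \<le> n"
    and s: "0 \<le> s" "\<And>x. x \<in> closure (Omega L z r) \<Longrightarrow> cmod x < 1 \<Longrightarrow> pseudo_dist x w0 \<le> \<rho> \<Longrightarrow> u x \<le> s"
    and K: "K = - ln (1 - r) + n * (ln (2 / (\<rho> * (1 - \<rho>))) + ln (2 / \<delta>))"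
  shows "u w0 \<le> s * (1 - (\<Sum>a\<in>A. ln (\<rho> / pseudo_dist a w0)) / K)"
proof -
  define \<Omega> where "\<Omega> = Omega L z r"
  have \<Omega>: "\<Omega> \<subseteq> ball 0 1" "open \<Omega>" using u har_open unfolding \<Omega>_def circle_solution_def Omega_holes by blast+
  have w0': "cmod w0 < 1" using w0 \<Omega>(1) by (auto simp: \<Omega>_def)
  have d: "0 < \<delta>" "\<delta> \<le> 1/2" using L by (auto simp: separated_by_def)
  have finA: "finite A" using finite_subset[OF A(1) finite_holes[OF L z r(2)]] .
  have AL: "A \<subseteq> L" using A(1) by (auto simp: holes_def)
  have A1: "cmod a < 1" if "a \<in> A" for a using AL L that by (auto simp: separated_by_def)
  define \<phi> where "\<phi> = mob w0"
  define G where "G = (\<lambda>a x. disc_green \<rho> (\<phi> a) (\<phi> x))"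
  define T where "T = {x \<in> \<Omega>. cmod (\<phi> x) < \<rho>}"
  have T: "open T"
  proof -
    have "continuous_on \<Omega> (\<lambda>x. cmod (\<phi> x))"
      unfolding \<phi>_def by (intro continuous_intros continuous_on_mob) (use w0' \<Omega> in auto)
    then have "open (\<Omega> \<inter> (\<lambda>x. cmod (\<phi> x)) -` {..<\<rho>})"
      using continuous_on_open_vimage[OF \<Omega>(2)] by (metis inf_commute open_lessThan)
    moreover have "\<Omega> \<inter> (\<lambda>x. cmod (\<phi> x)) -` {..<\<rho>} = T" by (auto simp: T_def)
    ultimately show ?thesis by simp
  qed
  have TO: "T \<subseteq> \<Omega>" by (auto simp: T_def)
  have bT: "bounded T" using TO \<Omega>(1) bounded_subset by (metis bounded_ball)
  have clT: "x \<in> closure \<Omega> \<and> cmod x < 1 \<and> cmod (\<phi> x) \<le> \<rho>" if x: "x \<in> closure T" for x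
  proof -
    have xO: "x \<in> closure \<Omega>" using x closure_mono[OF TO] by blast
    have c1: "closure T \<subseteq> cball 0 1" by (rule closure_minimal) (use TO \<Omega>(1) in auto)
    have le: "cmod (\<phi> x) \<le> \<rho>"
    proof (rule continuous_le_on_closure[OF _ x])
      show "continuous_on (closure T) (\<lambda>x. cmod (\<phi> x))"
        unfolding \<phi>_def by (intro continuous_intros continuous_on_mob c1 w0')
    qed (auto simp: T_def)
    have "cmod x \<noteq> 1" using le \<rho> pseudo_dist_boundary[OF w0', of x] by (auto simp: \<phi>_def pseudo_dist_mob)
    moreover have "cmod x \<le> 1" using c1 x by auto
    ultimately show ?thesis using xO le by simp
  qed
  have pa: "cmod (\<phi> a) < \<rho>" "cmod (\<phi> a) = pseudo_dist a w0" if "a \<in> A" for a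
    using A(2)[OF that] pseudo_dist_commute[of a w0] by (auto simp: \<phi>_def pseudo_dist_mob)
  have hole: "1 - r \<le> pseudo_dist a x" if "a \<in> A" "x \<in> closure \<Omega>" for a x
    using closure_Omega(2)[OF L that(2)[unfolded \<Omega>_def]] A(1) that(1) by auto
  have ne: "\<phi> x \<noteq> \<phi> a" if "a \<in> A" "x \<in> closure \<Omega>" "cmod x < 1" for a x
  proof
    assume "\<phi> x = \<phi> a"
    then have "pseudo_dist a x = pseudo_dist (\<phi> a) (\<phi> a)"
      using pseudo_dist_mob_mob[OF w0' A1[OF that(1)] that(3)] by (simp add: \<phi>_def)
    then have "pseudo_dist a x = 0" by (simp add: pseudo_dist_def)
    then show False using hole[OF that(1,2)] r by simp
  qed
  have 1: "ln (2 / (\<rho> * (1 - \<rho>))) \<ge> 0"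
  proof -
    have "\<rho> * (1 - \<rho>) \<le> 1" using \<rho> by (intro mult_le_one) auto
    then show ?thesis using \<rho> by (intro ln_ge_zero) (simp add: pos_le_divide_eq)
  qed
  have 2: "ln (2 / \<delta>) \<ge> 0" using d by (intro ln_ge_zero) (simp add: pos_le_divide_eq)
  have Gup: "(\<Sum>a\<in>A. G a x) \<le> K" if x: "x \<in> closure T" for x
  proof -
    note x' = clT[OF x]
    have g: "G a x \<le> ln (2 / (\<rho> * (1 - \<rho>))) - ln (pseudo_dist a x)" if "a \<in> A" for a
    proof -
      have "pseudo_dist a x = pseudo_dist (\<phi> a) (\<phi> x)"
        using pseudo_dist_mob_mob[OF w0' A1[OF that], of x] x' by (simp add: \<phi>_def)
      then show ?thesis unfolding G_def
        using disc_green_upper[OF \<rho> _ pa(1)[OF that] ne[OF that], of x] x' by simp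
    qed
    show ?thesis unfolding K
    proof (rule separated_by_sum_le[OF L AL finA A(3), of x])
      fix a assume a: "a \<in> A"
      { assume "\<delta> / 2 \<le> pseudo_dist a x"
        then have "ln (\<delta> / 2) \<le> ln (pseudo_dist a x)" using d by (intro ln_mono) auto
        moreover have "ln (\<delta> / 2) = - ln (2 / \<delta>)" using d by (simp add: ln_div)
        ultimately show "G a x \<le> ln (2 / (\<rho> * (1 - \<rho>))) + ln (2 / \<delta>)" using g[OF a] by linarith }
      have "ln (1 - r) \<le> ln (pseudo_dist a x)" using hole[OF a] x' r by (intro ln_mono) auto
      then show "G a x \<le> ln (2 / (\<rho> * (1 - \<rho>))) + ln (2 / \<delta>) + - ln (1 - r)" using g[OF a] 2 by linarith
    qed (use x' 1 2 r in auto)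
  qed
  have Kpos: "K > 0"
  proof -
    have "0 \<le> n" using A(3) by simp
    then have "0 \<le> n * (ln (2 / (\<rho> * (1 - \<rho>))) + ln (2 / \<delta>))" using 1 2 by simp
    moreover have "0 < - ln (1 - r)" using r by simp
    ultimately show ?thesis unfolding K by linarith
  qed
  \<comment> \<open>The majorant of \<open>u\<close> is s - (s / K) times the potential: it equals
    \<open>s\<close> on the outer circle, where the Green functions vanish, and is nonnegative at
    the holes because \<open>K\<close> bounds the potential.\<close>
  have vh: "har (\<lambda>x. u x + (s / K * (\<Sum>a\<in>A. G a x) + - s)) T"
  proof (intro har_add har_cmult har_sum har_const T)
    show "har u T" using u har_subset[OF _ TO T] by (simp add: circle_solution_def \<Omega>_def)
    fix a assume a: "a \<in> A"
    have TC: "T \<subseteq> cball 0 1" using TO \<Omega>(1) by auto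
    show "har (G a) T" unfolding G_def disc_green_def
    proof (rule har_ln_cmod[OF _ T])
      have num: "of_real (\<rho>\<^sup>2) - cnj (\<phi> a) * \<phi> x \<noteq> 0" if "x \<in> T" for x
        using disc_green_numerator[OF \<rho>(1) _ pa(1)[OF a], of "\<phi> x"] that by (auto simp: T_def)
      have den: "of_real \<rho> * (\<phi> x - \<phi> a) \<noteq> 0" if "x \<in> T" for x
        using ne[OF a, of x] that TO \<Omega>(1) closure_subset[of \<Omega>] \<rho> by force
      show "(\<lambda>x. (of_real (\<rho>\<^sup>2) - cnj (\<phi> a) * \<phi> x) / (of_real \<rho> * (\<phi> x - \<phi> a))) holomorphic_on T"
        using den unfolding \<phi>_def by (intro holomorphic_intros holomorphic_on_mob w0' TC) auto
      show "(of_real (\<rho>\<^sup>2) - cnj (\<phi> a) * \<phi> x) / (of_real \<rho> * (\<phi> x - \<phi> a)) \<noteq> 0" if "x \<in> T" for x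
        using num[OF that] den[OF that] by simp
    qed
  qed
  have Gc: "continuous_on (closure T) (G a)" if a: "a \<in> A" for a
  proof -
    have c1: "closure T \<subseteq> cball 0 1" using clT by force
    have num: "of_real (\<rho>\<^sup>2) - cnj (\<phi> a) * \<phi> x \<noteq> 0" if "x \<in> closure T" for x
      using disc_green_numerator[OF \<rho>(1) _ pa(1)[OF a], of "\<phi> x"] clT[OF that] by auto
    have den: "\<phi> x - \<phi> a \<noteq> 0" if "x \<in> closure T" for x
      using ne[OF a, of x] clT[OF that] by simp
    have "continuous_on (closure T) \<phi>" unfolding \<phi>_def by (rule continuous_on_mob[OF w0' c1])
    then show ?thesis unfolding G_def disc_green_def
      using num den \<rho> by (intro continuous_intros) auto
  qed
  have w0T: "w0 \<in> T" using w0 \<rho> by (simp add: T_def \<Omega>_def \<phi>_def mob_self)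
  have "u w0 + (s / K * (\<Sum>a\<in>A. G a w0) + - s) \<le> 0"
  proof (rule har_max_principle[OF vh bT])
    show "continuous_on (closure T) (\<lambda>x. u x + (s / K * (\<Sum>a\<in>A. G a x) + - s))"
    proof (intro continuous_intros Gc)
      show "continuous_on (closure T) u"
        by (rule continuous_on_subset[of "closure \<Omega>"]) (use u clT in \<open>auto simp: circle_solution_def \<Omega>_def\<close>)
    qed
    show "w0 \<in> closure T" using w0T closure_subset by blast
    fix x assume x: "x \<in> frontier T"
    then have xc: "x \<in> closure T" "x \<notin> T" using T by (auto simp: frontier_def interior_open)
    note x' = clT[OF xc(1)]
    show "u x + (s / K * (\<Sum>a\<in>A. G a x) + - s) \<le> 0"
    proof (cases "x \<in> \<Omega>")
      case True
      then have e: "cmod (\<phi> x) = \<rho>" using xc(2) x' by (auto simp: T_def)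
      have "G a x = 0" if "a \<in> A" for a
        unfolding G_def using disc_green_boundary[OF \<rho>(1) e ne[OF that]] x' by blast
      moreover have "u x \<le> s"
        using s(2)[of x] x' e pseudo_dist_commute[of x w0] by (simp add: \<Omega>_def \<phi>_def pseudo_dist_mob)
      ultimately show ?thesis by simp
    next
      case False
      then have "x \<in> frontier \<Omega>" using x' \<Omega>(2) by (simp add: frontier_def interior_open)
      then have "u x = 0" using u x' by (simp add: circle_solution_def \<Omega>_def)
      moreover have "s / K * (\<Sum>a\<in>A. G a x) \<le> s"
      proof -
        have "s * (\<Sum>a\<in>A. G a x) \<le> s * K" using Gup[OF xc(1)] s(1) by (intro mult_left_mono) auto
        then show ?thesis using Kpos by (simp add: pos_divide_le_eq)
      qed
      ultimately show ?thesis by simp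
    qed
  qed
  moreover have "(\<Sum>a\<in>A. G a w0) = (\<Sum>a\<in>A. ln (\<rho> / pseudo_dist a w0))"
    by (rule sum.cong) (use pa \<rho> in \<open>auto simp: G_def \<phi>_def mob_self disc_green_0\<close>)
  ultimately show ?thesis by (simp add: algebra_simps)
qed

lemma filterlim_minus_ln: "filterlim (\<lambda>r::real. - ln (1 - r)) at_top (at_left 1)"
  by real_asymp

lemma eventually_minus_ln:
  assumes "eventually P at_top"
  shows "eventually (\<lambda>r::real. P (- ln (1 - r))) (at_left 1)"
  using filterlim_minus_ln assms by (simp add: filterlim_iff)

lemma eventually_near_1: "eventually (\<lambda>r::real. 1/2 \<le> r \<and> r < 1) (at_left 1)"
  unfolding eventually_at_left_field by (intro exI[of _ "1/2"]) auto

lemma card_pseudo_ball: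
  assumes "0 < \<delta>"
  obtains C where "C > 0" "\<And>L w r. separated_by \<delta> L \<Longrightarrow> cmod w < 1 \<Longrightarrow> 0 \<le> r \<Longrightarrow> r < 1 \<Longrightarrow>
      real (card {a \<in> L. pseudo_dist a w < r}) \<le> C * (1 + ln (1 / (1 - r))) / (1 - r)"
proof (rule sum_one_minus_pseudo_dist[OF assms])
  fix C :: real
  assume "C > 0" "\<And>L w r. separated_by \<delta> L \<Longrightarrow> cmod w < 1 \<Longrightarrow> 0 \<le> r \<Longrightarrow> r < 1 \<Longrightarrow>
      real (card {a \<in> L. pseudo_dist a w < r}) \<le> C * (1 + ln (1 / (1 - r))) / (1 - r)"
  then show thesis by (rule that)
qed

text \<open>A step multiplies 1 - \<open>pseudo_dist x z\<close> by at least (1 - \<rho>) / 2.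
  Hence, while k < m, the disc of the step sees only points closer than \<open>r\<close> to
  \<open>z\<close>, and those beyond distance 1/2 from \<open>z\<close> are holes; each step then
  yields a factor 1 - X / K. The index \<open>k\<close> counts the steps made away from
  \<open>z\<close>.\<close>

lemma walk_iterate:
  assumes L: "separated_by \<delta> L" and z: "cmod z < 1" and r: "1/2 \<le> r" "r < 1" and u: "circle_solution L z r u"
    and \<rho>: "0 < \<rho>" "\<rho> < 1"
    and n: "\<And>w. cmod w < 1 \<Longrightarrow> real (card {a \<in> L. pseudo_dist a w < \<rho>}) \<le> n"
    and X: "\<And>w. cmod w < 1 \<Longrightarrow> w \<in> Omega L z r \<Longrightarrow> pseudo_dist w z < r \<Longrightarrow>
        X \<le> (\<Sum>a\<in>{a \<in> L. 1/2 < pseudo_dist a z \<and> pseudo_dist a w < \<rho>}. ln (\<rho> / pseudo_dist a w))"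
    and K: "K = - ln (1 - r) + n * (ln (2 / (\<rho> * (1 - \<rho>))) + ln (2 / \<delta>))" "K > 0" "X \<le> K"
    and m: "1 - r < ((1 - \<rho>) / 2) ^ m"
  shows "k \<le> m \<Longrightarrow> x \<in> closure (Omega L z r) \<Longrightarrow> cmod x < 1 \<Longrightarrow> ((1 - \<rho>) / 2) ^ k \<le> 1 - pseudo_dist x z \<Longrightarrow>
    u x \<le> (1 - X / K) ^ (m - k)"
proof (induction "m - k" arbitrary: k x)
  case 0
  then show ?case using circle_solution_range(2)[OF L u] by simp
next
  case (Suc j)
  define q where "q = (1 - \<rho>) / 2"
  have q: "0 < q" "q < 1" using \<rho> by (auto simp: q_def)
  have k: "m - k = Suc j" "m - Suc k = j" "Suc k \<le> m" using Suc.hyps(2) by auto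
  have XK: "0 \<le> 1 - X / K" using K by (simp add: pos_divide_le_eq)
  have oO: "open (Omega L z r)" using u har_open by (auto simp: circle_solution_def)
  show ?case
  proof (cases "x \<in> Omega L z r")
    case False
    then have "u x = 0" using Suc.prems u oO by (auto simp: circle_solution_def frontier_def interior_open)
    then show ?thesis using XK by simp
  next
    case True
    define A where "A = {a \<in> L. 1/2 < pseudo_dist a z \<and> pseudo_dist a x < \<rho>}"
    have L1: "cmod a < 1" if "a \<in> L" for a using L that by (auto simp: separated_by_def)
    have lev: "q ^ Suc k \<le> 1 - pseudo_dist y z" if "cmod y < 1" "pseudo_dist y x \<le> \<rho>" for y
    proof -
      have "q ^ Suc k \<le> (1 - \<rho>) * (1 - pseudo_dist x z) / 2"
        using Suc.prems(4) \<rho> by (simp add: q_def mult_left_mono)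
      also have "\<dots> \<le> (1 - pseudo_dist y x) * (1 - pseudo_dist x z) / 2"
        using that pseudo_dist_less_1[of x z] Suc.prems(3) z by (intro divide_right_mono mult_right_mono) auto
      also have "\<dots> \<le> 1 - pseudo_dist y z"
        using one_minus_pseudo_dist_ge_half that Suc.prems(3) z by blast
      finally show ?thesis .
    qed
    have "1 - r < q ^ m" using m by (simp add: q_def)
    also have "\<dots> \<le> q ^ k" using q k(3) by (intro power_decreasing) auto
    finally have near: "pseudo_dist x z < r" using Suc.prems(4) by (simp add: q_def)
    have "u x \<le> (1 - X / K) ^ j * (1 - (\<Sum>a\<in>A. ln (\<rho> / pseudo_dist a x)) / K)"
    proof (rule walk_step[OF L z r u True \<rho> _ _ _ _ _ K(1)])
      show "A \<subseteq> holes L z r"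
      proof
        fix a assume a: "a \<in> A"
        have "1 - r < q ^ m" using m by (simp add: q_def)
        also have "\<dots> \<le> q ^ Suc k" using q k(3) by (intro power_decreasing) auto
        also have "\<dots> \<le> 1 - pseudo_dist a z" using a L1 by (intro lev) (auto simp: A_def)
        finally show "a \<in> holes L z r" using a by (simp add: holes_def A_def)
      qed
      have "finite {a \<in> L. pseudo_dist a x < \<rho>}"
        using finite_pseudo_ball[OF L Suc.prems(3) \<rho>(2)] .
      then have "card A \<le> card {a \<in> L. pseudo_dist a x < \<rho>}" by (rule card_mono) (auto simp: A_def)
      then show "real (card A) \<le> n" using n[OF Suc.prems(3)] by linarith
      show "0 \<le> (1 - X / K) ^ j" using XK by simp
      show "u y \<le> (1 - X / K) ^ j" if "y \<in> closure (Omega L z r)" "cmod y < 1" "pseudo_dist y x \<le> \<rho>" for y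
        using Suc.hyps(1)[of "Suc k" y] k that lev[OF that(2,3)] by (simp add: q_def)
    qed (auto simp: A_def)
    also have "\<dots> \<le> (1 - X / K) ^ j * (1 - X / K)"
      using X[OF Suc.prems(3) True near] K XK by (intro mult_left_mono) (auto simp: A_def divide_right_mono)
    finally show ?thesis using k by (simp add: mult.commute)
  qed
qed

text \<open>With N = - ln (1 - r) there is room for about N / ln (2 / (1 - \<rho>)) steps, and each
  gives a factor 1 - X / (N + c); for large N the product is about exp (- X / ln (2 / (1 -
  \<rho>))). The condition \<open>a \<noteq> w\<close> keeps the logarithms away from their
  poles.\<close>

theorem walk_bound:
  assumes L: "separated_by \<delta> L" and \<rho>: "0 < \<rho>" "\<rho> < 1" and e: "e > 0" and X0: "0 \<le> X"
    and X: "\<And>z w. cmod z < 1 \<Longrightarrow> cmod w < 1 \<Longrightarrow> (\<And>a. a \<in> L \<Longrightarrow> 1/2 < pseudo_dist a z \<Longrightarrow> pseudo_dist a w < \<rho> \<Longrightarrow> a \<noteq> w) \<Longrightarrow>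
        X \<le> (\<Sum>a\<in>{a \<in> L. 1/2 < pseudo_dist a z \<and> pseudo_dist a w < \<rho>}. ln (\<rho> / pseudo_dist a w))"
  shows "eventually (\<lambda>r. \<forall>z u. cmod z < 1 \<longrightarrow> circle_solution L z r u \<longrightarrow> u z \<le> exp (- (X / ln (2 / (1 - \<rho>)) - e))) (at_left 1)"
proof -
  have d: "0 < \<delta>" "\<delta> \<le> 1/2" using L by (auto simp: separated_by_def)
  obtain C where C: "C > 0" "\<And>L w r. separated_by \<delta> L \<Longrightarrow> cmod w < 1 \<Longrightarrow> 0 \<le> r \<Longrightarrow> r < 1 \<Longrightarrow>
      real (card {a \<in> L. pseudo_dist a w < r}) \<le> C * (1 + ln (1 / (1 - r))) / (1 - r)"
    using card_pseudo_ball[OF d(1)] by blast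
  define n where "n = C * (1 + ln (1 / (1 - \<rho>))) / (1 - \<rho>)"
  have n: "real (card {a \<in> L. pseudo_dist a w < \<rho>}) \<le> n" if "cmod w < 1" for w
    using C(2)[OF L that, of \<rho>] \<rho> by (simp add: n_def)
  have n0: "0 \<le> n" using n[of 0] by simp
  define c where "c = n * (ln (2 / (\<rho> * (1 - \<rho>))) + ln (2 / \<delta>))"
  have c0: "0 \<le> c"
  proof -
    have "\<rho> * (1 - \<rho>) \<le> 1" using \<rho> by (intro mult_le_one) auto
    then have "ln (2 / (\<rho> * (1 - \<rho>))) \<ge> 0" using \<rho> by (intro ln_ge_zero) (simp add: pos_le_divide_eq)
    moreover have "ln (2 / \<delta>) \<ge> 0" using d by (intro ln_ge_zero) (simp add: pos_le_divide_eq)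
    ultimately show ?thesis using n0 by (simp add: c_def)
  qed
  define l where "l = ln (2 / (1 - \<rho>))"
  have l: "l > 0" using \<rho> unfolding l_def by (intro ln_gt_zero) (simp add: pos_less_divide_eq)
  have "((\<lambda>N. X * (N / l - 1) / (N + c)) \<longlongrightarrow> X * inverse l) at_top"
    using l by real_asymp
  then have lim: "((\<lambda>N. X * (N / l - 1) / (N + c)) \<longlongrightarrow> X / l) at_top"
    by (simp only: divide_inverse)
  have "eventually (\<lambda>N. X / l - e < X * (N / l - 1) / (N + c)) at_top"
    using order_tendstoD(1)[OF lim, of "X / l - e"] e by simp
  moreover have "eventually (\<lambda>N::real. X \<le> N \<and> 1 \<le> N) at_top"
    by (intro eventually_conj eventually_ge_at_top)
  ultimately have "eventually (\<lambda>N. X / l - e < X * (N / l - 1) / (N + c) \<and> X \<le> N \<and> 1 \<le> N) at_top"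
    by eventually_elim auto
  from eventually_minus_ln[OF this] eventually_near_1 show ?thesis
  proof eventually_elim
    case (elim r)
    define N where "N = - ln (1 - r)"
    define K where "K = N + c"
    have N: "X / l - e < X * (N / l - 1) / K" "X \<le> N" "1 \<le> N" and r: "1/2 \<le> r" "r < 1"
      using elim by (auto simp: N_def K_def)
    have K: "K > 0" "X \<le> K" using N c0 by (auto simp: K_def)
    \<comment> \<open>One less than the rounded-up quotient, so that m l < N holds strictly and
      every point met is closer than \<open>r\<close> to \<open>z\<close>.\<close>
    define m where "m = nat \<lceil>N / l\<rceil> - 1"
    have "0 < N / l" using N l by simp
    then have "1 \<le> nat \<lceil>N / l\<rceil>" by (simp add: Suc_le_eq)
    then have m: "real m < N / l" "N / l - 1 \<le> real m" unfolding m_def by linarith+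
    have q: "ln ((1 - \<rho>) / 2) = - l" using \<rho> by (simp add: l_def ln_div)
    have "1 - r < ((1 - \<rho>) / 2) ^ m"
    proof -
      have "real m * l < N" using m(1) l by (simp add: pos_less_divide_eq)
      then have "ln (1 - r) < real m * ln ((1 - \<rho>) / 2)" unfolding q N_def by simp
      also have "\<dots> = ln (((1 - \<rho>) / 2) ^ m)" by (rule ln_realpow[symmetric])
      finally show ?thesis using r \<rho> by (subst (asm) ln_less_cancel_iff) auto
    qed
    note mm = this
    show ?case
    proof (intro allI impI)
      fix z u assume z: "cmod z < 1" and u: "circle_solution L z r u"
      have "u z \<le> (1 - X / K) ^ (m - 0)"
      proof (rule walk_iterate[OF L z r u \<rho> n _ _ K mm])
        show "X \<le> (\<Sum>a\<in>{a \<in> L. 1/2 < pseudo_dist a z \<and> pseudo_dist a w < \<rho>}. ln (\<rho> / pseudo_dist a w))"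
          if w: "cmod w < 1" "w \<in> Omega L z r" "pseudo_dist w z < r" for w
        proof (rule X[OF z w(1)])
          fix a assume a: "a \<in> L" "1/2 < pseudo_dist a z"
          show "a \<noteq> w"
          proof
            assume "a = w"
            moreover have "pseudo_dist w w = 0" by (simp add: pseudo_dist_def)
            ultimately show False using w a r by (auto simp: Omega_holes holes_def pseudo_cball_def)
          qed
        qed
        show "z \<in> closure (Omega L z r)" using z_in_Omega[OF z r(1)] closure_subset by blast
        show "((1 - \<rho>) / 2) ^ 0 \<le> 1 - pseudo_dist z z" by (simp add: pseudo_dist_def)
      qed (use z in \<open>auto simp: K_def N_def c_def\<close>)
      also have "\<dots> \<le> exp (- (X / K)) ^ m"
      proof -
        have "1 - X / K \<le> exp (- (X / K))" using exp_ge_add_one_self[of "- (X / K)"] by simp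
        moreover have "0 \<le> 1 - X / K" using K by (simp add: pos_divide_le_eq)
        ultimately show ?thesis by (simp add: power_mono)
      qed
      also have "\<dots> = exp (- (X / K * real m))" by (simp add: exp_of_nat_mult[symmetric] mult.commute)
      also have "\<dots> \<le> exp (- (X / l - e))"
      proof -
        have "X / l - e \<le> X / K * (N / l - 1)" using N(1) by simp
        also have "\<dots> \<le> X / K * real m" using m(2) X0 K by (intro mult_left_mono) auto
        finally show ?thesis by simp
      qed
      finally show "u z \<le> exp (- (X / ln (2 / (1 - \<rho>)) - e))" by (simp add: l_def)
    qed
  qed
qed

section \<open>Lower bound by the Green potential\<close>

lemma sphere_subset_closure_Omega:
  assumes "separated_by \<delta> L" "cmod z < 1" "1/2 \<le> r" "r < 1"
  shows "sphere 0 1 \<subseteq> closure (Omega L z r)"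
  using Omega_solution[OF assms] by blast

text \<open>By convexity of exp, the tangent to exp at c h(z), composed with c h, is a harmonic
  support at \<open>z\<close>.\<close>

lemma subhar_exp_har:
  assumes "har h S"
  shows "subhar (\<lambda>w. exp (c * h w)) S"
  unfolding subhar_def
proof
  fix z assume z: "z \<in> S"
  obtain e F where e: "e > 0" "ball z e \<subseteq> S" "F holomorphic_on ball z e"
    "\<And>w. w \<in> ball z e \<Longrightarrow> h w = Re (F w)" using harE[OF assms z] by blast
  define k where "k = exp (c * h z)"
  define G where "G = (\<lambda>w. of_real k * (1 + of_real c * (F w - of_real (h z))))"
  have G: "Re (G w) = k * (1 + c * (h w - h z))" if "w \<in> ball z e" for w
    using e(4)[OF that] by (simp add: G_def)
  show "\<exists>e>0. \<exists>F. ball z e \<subseteq> S \<and> F holomorphic_on ball z e \<and> exp (c * h z) = Re (F z) \<and>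
      (\<forall>w\<in>ball z e. Re (F w) \<le> exp (c * h w))"
  proof (intro exI[of _ e] conjI exI[of _ G] ballI)
    show "G holomorphic_on ball z e" unfolding G_def by (intro holomorphic_intros e)
    show "exp (c * h z) = Re (G z)" using G[of z] e(1) by (simp add: k_def)
    fix w assume w: "w \<in> ball z e"
    have "Re (G w) = k * (1 + c * (h w - h z))" by (rule G[OF w])
    also have "\<dots> \<le> k * exp (c * (h w - h z))" by (intro mult_left_mono) (simp_all add: k_def)
    also have "\<dots> = exp (c * h w)" by (simp add: k_def algebra_simps flip: exp_add)
    finally show "Re (G w) \<le> exp (c * h w)" .
  qed (use e in auto)
qed

text \<open>Compare \<open>u\<close> with \<open>exp (- \<kappa> h)\<close> off the discs of radius \<open>exp (- \<eta> N)\<close> around the holes.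
  At a worst point, which lies on such a disc, the lower bound for \<open>u\<close> on a slightly larger circle
  and the explicit harmonic function of the annulus around the hole give a contradiction.\<close>

lemma subharmonic_lower_bound:
  assumes L: "separated_by \<delta> L" and z: "cmod z < 1" and r: "1/2 \<le> r" "r < 1" and u: "circle_solution L z r u"
    and N: "N = - ln (1 - r)" and \<eta>: "0 < \<eta>" "\<eta> < 1" and \<kappa>: "\<kappa> > 0" "1 / (1 - \<eta>) < \<kappa> * (1 - \<theta>)"
    and s: "s0 = exp (- \<eta> * N)" "s1 = exp 1 * s0" "s1 \<le> \<delta> / 4"
    and osc: "\<And>k b w. k \<in> holes L z r \<Longrightarrow> cmod b < 1 \<Longrightarrow> cmod w < 1 \<Longrightarrow> pseudo_dist k b = s0 \<Longrightarrow> pseudo_dist k w = s1 \<Longrightarrow>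
        (\<Sum>j\<in>holes L z r - {k}. ln (pseudo_dist j b) - ln (pseudo_dist j w)) \<le> \<theta>"
  shows "exp (- \<kappa> * ((\<Sum>a\<in>holes L z r. - ln (pseudo_dist a z)) / N)) \<le> u z"
proof -
  define J where "J = holes L z r"
  define \<Omega> where "\<Omega> = Omega L z r"
  have d: "0 < \<delta>" "\<delta> \<le> 1/2" using L by (auto simp: separated_by_def)
  have fJ: "finite J" unfolding J_def by (rule finite_holes[OF L z r(2)])
  have J1: "cmod a < 1" if "a \<in> J" for a using holes_less_1[OF L] that by (simp add: J_def)
  have Jsep: "\<delta> \<le> pseudo_dist a b" if "a \<in> J" "b \<in> J" "a \<noteq> b" for a b
    using L that by (auto simp: separated_by_def J_def holes_def)
  have Np: "N > 0" using r by (simp add: N)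
  have er: "exp (- N) = 1 - r" using r by (simp add: N)
  have s01: "1 - r < s0" "0 < s0" "s0 < s1"
  proof -
    have "- N < - \<eta> * N" using \<eta> Np by simp
    then show "1 - r < s0" unfolding s er[symmetric] by simp
    show "0 < s0" by (simp add: s)
    then show "s0 < s1" by (simp add: s(2))
  qed
  have s1: "s1 \<le> 1/8" using s(3) d by simp
  define h where "h = (\<lambda>w. (\<Sum>a\<in>J. - ln (pseudo_dist a w)) / N)"
  \<comment> \<open>The radius s0 is much larger than the radius exp (- N) of the holes; this leaves
    room for an annulus on which the decay towards a hole is explicit.\<close>
  define E where "E = {w \<in> cball 0 1. \<forall>a\<in>J. s0 \<le> pseudo_dist a w}"
  define Q where "Q = {w \<in> ball 0 1. \<forall>a\<in>J. s0 < pseudo_dist a w}"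
  have cpd: "continuous_on (cball 0 1) (pseudo_dist a)" if "a \<in> J" for a
    by (rule continuous_on_pseudo_dist[OF J1[OF that] order_refl])
  have cE: "closed E"
  proof -
    have eq: "E = cball 0 1 \<inter> (\<Inter>a\<in>J. cball 0 1 \<inter> pseudo_dist a -` {s0..})" by (auto simp: E_def)
    have cl: "closed (cball 0 1 \<inter> pseudo_dist a -` {s0..})" if "a \<in> J" for a
      by (rule continuous_closed_preimage[OF cpd[OF that]]) auto
    show ?thesis unfolding eq by (intro closed_Int closed_INT ballI closed_cball cl)
  qed
  have "E \<subseteq> cball 0 1" by (auto simp: E_def)
  then have "bounded E" by (rule bounded_subset[OF bounded_cball])
  then have kE: "compact E" using cE by (simp add: compact_eq_bounded_closed)
  have oQ: "open Q"
  proof -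
    have eq: "Q = ball 0 1 \<inter> (\<Inter>a\<in>J. ball 0 1 \<inter> pseudo_dist a -` {s0<..})" by (auto simp: Q_def)
    have op: "open (ball 0 1 \<inter> pseudo_dist a -` {s0<..})" if "a \<in> J" for a
    proof -
      have "continuous_on (ball 0 1) (pseudo_dist a)"
        by (rule continuous_on_subset[OF cpd[OF that]]) auto
      then show ?thesis using continuous_on_open_vimage[of "ball 0 1" "pseudo_dist a"] by (simp add: Int_commute)
    qed
    show ?thesis unfolding eq by (intro open_Int open_INT ballI open_ball op fJ)
  qed
  have QE: "Q \<subseteq> E" by (auto simp: Q_def E_def less_imp_le)
  have ballE: "w \<in> \<Omega>" if "w \<in> E" "cmod w < 1" for w
    using that s01 by (force simp: \<Omega>_def Omega_holes E_def J_def pseudo_cball_def)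
  have sphO: "sphere 0 1 \<subseteq> closure \<Omega>" unfolding \<Omega>_def by (rule sphere_subset_closure_Omega[OF L z r])
  have EO: "E \<subseteq> closure \<Omega>"
  proof
    fix w assume w: "w \<in> E"
    show "w \<in> closure \<Omega>"
    proof (cases "cmod w < 1")
      case True then show ?thesis using ballE[OF w] closure_subset by blast
    next
      case False then have "w \<in> sphere 0 1" using w by (auto simp: E_def)
      then show ?thesis using sphO by blast
    qed
  qed
  have pos: "0 < pseudo_dist a w" if "w \<in> E" "a \<in> J" for a w
    using that s01(2) by (fastforce simp: E_def)
  have ch: "continuous_on E h" unfolding h_def
  proof (intro continuous_intros)
    show "continuous_on E (pseudo_dist a)" if "a \<in> J" for a
      by (rule continuous_on_subset[OF cpd[OF that]]) (auto simp: E_def)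
  qed (use pos Np in force)+
  have cu: "continuous_on E u" by (rule continuous_on_subset[OF _ EO]) (use u in \<open>simp add: circle_solution_def \<Omega>_def\<close>)
  have hh: "har h Q"
  proof -
    have "har (\<lambda>w. (- 1 / N) * (\<Sum>a\<in>J. ln (pseudo_dist a w))) Q"
    proof (intro har_cmult har_sum oQ har_ln_pseudo_dist J1)
      show "Q \<subseteq> ball 0 1" by (auto simp: Q_def)
      show "a \<notin> Q" if "a \<in> J" for a
      proof
        assume "a \<in> Q"
        then have "s0 < pseudo_dist a a" using that by (auto simp: Q_def)
        then show False using s01 by (simp add: pseudo_dist_def)
      qed
    qed
    then show ?thesis by (rule har_cong) (simp add: h_def sum_negf)
  qed
  have u0: "0 \<le> u w" if "w \<in> closure \<Omega>" for w using circle_solution_range(1)[OF L u] that by (simp add: \<Omega>_def)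
  have sphE: "w \<in> E" if "cmod w = 1" for w
    using that pseudo_dist_boundary[OF J1 that] s01 s1 by (auto simp: E_def)
  have zE: "z \<in> E" using z s01 s1 by (force simp: E_def J_def holes_def)
  \<comment> \<open>Adding \<open>d\<close> makes \<open>U\<close> positive, so that the quotient
    has a maximum on \<open>E\<close>, and makes the comparison strict on the unit circle.\<close>
  have main: "exp (- \<kappa> * h z) \<le> u z + d" if dp: "d > 0" for d
  proof -
    define U where "U = (\<lambda>w. u w + d)"
    have Up: "U w > 0" if "w \<in> closure \<Omega>" for w using u0[OF that] dp by (simp add: U_def)
    have cf: "continuous_on E (\<lambda>w. exp (- \<kappa> * h w) / U w)"
      unfolding U_def by (intro continuous_intros ch cu) (use Up EO in \<open>force simp: U_def\<close>)
    obtain w0 where w0: "w0 \<in> E" "\<And>w. w \<in> E \<Longrightarrow> exp (- \<kappa> * h w) / U w \<le> exp (- \<kappa> * h w0) / U w0"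
      using continuous_attains_sup[OF kE _ cf] zE by (metis empty_iff)
    define C where "C = exp (- \<kappa> * h w0) / U w0"
    have Cp: "C > 0" using Up[of w0] w0 EO by (auto simp: C_def)
    define V where "V = (\<lambda>w. exp (- \<kappa> * h w) + - (C * U w))"
    have V0: "V w \<le> 0" if "w \<in> E" for w
    proof -
      have "U w > 0" using Up that EO by blast
      moreover have "exp (- \<kappa> * h w) / U w \<le> C" using w0(2)[OF that] by (simp add: C_def)
      ultimately show ?thesis by (simp add: V_def pos_divide_le_eq)
    qed
    have Vw0: "V w0 = 0"
    proof -
      have "U w0 > 0" using Up w0 EO by blast
      then show ?thesis by (simp add: V_def C_def)
    qed
    have cV: "continuous_on E V" unfolding V_def U_def by (intro continuous_intros ch cu)
    have sV: "subhar V Q" unfolding V_def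
    proof (intro subhar_add subhar_exp_har hh har_imp_subhar har_minus har_cmult)
      show "har U Q" unfolding U_def
      proof (intro har_add har_const oQ)
        have "Q \<subseteq> \<Omega>" using QE ballE by (auto simp: Q_def)
        then show "har u Q" using u har_subset oQ by (auto simp: circle_solution_def \<Omega>_def)
      qed
    qed
    have "C \<le> 1"
    proof (rule ccontr)
      assume "\<not> C \<le> 1"
      then have C1: "C > 1" by simp
      have cB: "compact (E - Q)" using kE oQ by (rule compact_diff)
      have "1 \<in> E - Q" using sphE[of 1] by (simp add: Q_def)
      then obtain b where b: "b \<in> E - Q" "\<And>w. w \<in> E - Q \<Longrightarrow> V w \<le> V b"
        using continuous_attains_sup[OF cB, of V] continuous_on_subset[OF cV, of "E - Q"] by blast
      have clQ: "closure Q \<subseteq> E" by (rule closure_minimal[OF QE cE])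
      \<comment> \<open>The maximum principle moves a contact point of
        \<open>exp (- \<kappa> h)\<close> and C U from \<open>Q\<close> to the rest of
        \<open>E\<close>.\<close>
      have Vb: "V b = 0"
      proof (rule ccontr)
        assume "V b \<noteq> 0"
        then have neg: "V b < 0" using V0[of b] b by force
        have "V w \<le> V b" if "w \<in> E" for w
        proof (cases "w \<in> Q")
          case True
          show ?thesis
          proof (rule subhar_max_principle[OF oQ _ sV])
            show "bounded Q" by (rule bounded_subset[of "ball 0 1"]) (auto simp: Q_def)
            show "continuous_on (closure Q) V" using cV clQ continuous_on_subset by blast
            show "V x \<le> V b" if "x \<in> frontier Q" for x
              using that clQ oQ by (intro b(2)) (auto simp: frontier_def interior_open)
            show "w \<in> closure Q" using True closure_subset by blast
          qed
        qed (use that b in auto)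
        then show False using neg Vw0 w0(1) by force
      qed
      have bn: "cmod b < 1"
      proof (rule ccontr)
        assume "\<not> cmod b < 1"
        then have b1: "cmod b = 1" using b(1) by (auto simp: E_def)
        have "h b = 0" using pseudo_dist_boundary[OF J1 b1] by (simp add: h_def)
        moreover have "u b = 1" using u b1 by (simp add: circle_solution_def)
        ultimately have "1 = C * (1 + d)" using Vb by (simp add: V_def U_def)
        moreover have "1 < C * (1 + d)" using C1 dp by (simp add: less_1_mult)
        ultimately show False by simp
      qed
      obtain k where k: "k \<in> J" "pseudo_dist k b = s0" using b(1) bn by (fastforce simp: E_def Q_def)
      have k1: "cmod k < 1" using J1 k by blast
      define T where "T = {w \<in> ball 0 1. 1 - r < pseudo_dist k w \<and> pseudo_dist k w < s1}"
      have oT: "open T"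
      proof -
        have "continuous_on (ball 0 1) (pseudo_dist k)"
          by (rule continuous_on_subset[OF cpd[OF k(1)]]) auto
        then have "open (pseudo_dist k -` {1 - r<..<s1} \<inter> ball 0 1)"
          using continuous_on_open_vimage[of "ball 0 1" "pseudo_dist k"] by simp
        moreover have "pseudo_dist k -` {1 - r<..<s1} \<inter> ball 0 1 = T" by (auto simp: T_def)
        ultimately show ?thesis by simp
      qed
      have T0: "closure T \<subseteq> cball 0 1" by (rule closure_minimal) (auto simp: T_def)
      have Tc: "1 - r \<le> pseudo_dist k w \<and> pseudo_dist k w \<le> s1 \<and> cmod w < 1" if w: "w \<in> closure T" for w
      proof -
        have c: "continuous_on (closure T) (pseudo_dist k)" using continuous_on_subset[OF cpd[OF k(1)] T0] .
        have 1: "1 - r \<le> pseudo_dist k w" by (rule continuous_ge_on_closure[OF c w]) (auto simp: T_def)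
        have 2: "pseudo_dist k w \<le> s1" by (rule continuous_le_on_closure[OF c w]) (auto simp: T_def)
        have "cmod w \<noteq> 1" using pseudo_dist_boundary[OF k1, of w] 2 s1 by auto
        moreover have "cmod w \<le> 1" using w T0 by auto
        ultimately show ?thesis using 1 2 by simp
      qed
      have other: "\<delta> / 2 \<le> pseudo_dist j w" if "j \<in> J" "j \<noteq> k" "cmod w < 1" "pseudo_dist k w \<le> s1" for j w
        using pseudo_dist_triangle[OF J1[OF that(1)] that(3) k1] Jsep[OF that(1) k(1) that(2)] that(4) s(3) d(1) pseudo_dist_commute[of k w]
        by linarith
      have oth2: "s0 < \<delta> / 2" using s01 s d by linarith
      have TO: "T \<subseteq> \<Omega>"
      proof
        fix w assume w: "w \<in> T"
        have "1 - r < pseudo_dist j w" if "j \<in> J" for j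
          using w other[of j w] that oth2 s01 by (cases "j = k") (auto simp: T_def)
        then show "w \<in> \<Omega>" using w by (force simp: \<Omega>_def Omega_holes J_def[symmetric] pseudo_cball_def T_def)
      qed
      \<comment> \<open>From \<open>b\<close> to the circle of radius s1 = e s0, \<open>h\<close>
        drops by at least (1 - \<theta>) / N: the term of the hole \<open>k\<close> drops by 1 / N,
        and the others rise by at most \<theta> / N. Since V b = 0 and V \<le> 0, \<open>p\<close>
        is a lower bound for \<open>U\<close> on that circle.\<close>
      define p where "p = U b * exp (\<kappa> * (1 - \<theta>) / N)"
      have bO: "b \<in> closure \<Omega>" using b EO by blast
      define M where "M = N - \<eta> * N + 1"
      have Mp: "M > 0" using \<eta> Np by (simp add: M_def add_pos_pos)
      \<comment> \<open>The harmonic function of the annulus with values 0 at the edge of the hole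
        and \<open>p\<close> on the outer circle; \<open>M\<close> is the logarithmic width of the
        annulus.\<close>
      define P where "P = (\<lambda>w. p / M * (N + ln (pseudo_dist k w)))"
      have key: "0 \<le> U b - P b"
      proof (rule har_min_principle[of "\<lambda>w. U w - P w" T])
        have "har (\<lambda>w. u w + d) T" using u har_subset[OF _ TO oT] oT by (auto simp: circle_solution_def \<Omega>_def intro!: har_add har_const)
        moreover have "k \<notin> T" using r by (simp add: T_def pseudo_dist_def)
        then have "har P T" unfolding P_def
          by (intro har_cmult har_add har_const oT har_ln_pseudo_dist k1) (auto simp: T_def)
        ultimately show "har (\<lambda>w. U w - P w) T" unfolding U_def by (rule har_diff)
        show "bounded T" by (rule bounded_subset[of "ball 0 1"]) (auto simp: T_def)
        have "continuous_on (closure T) u"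
          by (rule continuous_on_subset[of "closure \<Omega>"]) (use u closure_mono[OF TO] in \<open>auto simp: circle_solution_def \<Omega>_def\<close>)
        then show "continuous_on (closure T) (\<lambda>w. U w - P w)" unfolding U_def P_def
          by (intro continuous_intros continuous_on_subset[OF cpd[OF k(1)] T0]) (use Tc r in force)+
        have "b \<in> T" using k bn s01 by (simp add: T_def)
        then show "b \<in> closure T" using closure_subset by blast
        fix w assume w: "w \<in> frontier T"
        then have wc: "w \<in> closure T" "w \<notin> T" using oT by (auto simp: frontier_def interior_open)
        have wO: "w \<in> closure \<Omega>" using wc(1) closure_mono[OF TO] by blast
        show "0 \<le> U w - P w"
        proof (cases "pseudo_dist k w = s1")
          case False
          then have "pseudo_dist k w = 1 - r" using wc Tc[OF wc(1)] by (auto simp: T_def)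
          then have "P w = 0" by (simp add: P_def N)
          then show ?thesis using Up[OF wO] by simp
        next
          case True
          have w1: "cmod w < 1" using Tc wc by blast
          have "s0 \<le> pseudo_dist j w" if "j \<in> J" for j
            using other[OF that _ w1] True oth2 s01 by (cases "j = k") auto
          then have wE: "w \<in> E" using w1 by (simp add: E_def)
          have "N + ln s1 = M" by (simp add: s ln_mult M_def)
          then have "P w = p" using Mp by (simp add: P_def True)
          have split: "h x = - ln (pseudo_dist k x) / N + (\<Sum>j\<in>J - {k}. - ln (pseudo_dist j x)) / N" for x
            unfolding h_def by (subst sum.remove[OF fJ k(1)]) (rule add_divide_distrib)
          have o: "(\<Sum>j\<in>J - {k}. ln (pseudo_dist j b) - ln (pseudo_dist j w)) \<le> \<theta>"
            using osc[of k b w] k bn w1 True by (simp add: J_def)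
          have "h w - h b = (ln s0 - ln s1) / N + (\<Sum>j\<in>J - {k}. ln (pseudo_dist j b) - ln (pseudo_dist j w)) / N"
            unfolding split k(2) True by (simp add: sum_negf sum_subtractf diff_divide_distrib)
          also have "ln s0 - ln s1 = - 1" by (simp add: s ln_mult)
          also have "- 1 / N + (\<Sum>j\<in>J - {k}. ln (pseudo_dist j b) - ln (pseudo_dist j w)) / N \<le> - 1 / N + \<theta> / N"
            using o Np by (intro add_left_mono divide_right_mono) auto
          finally have hw: "h w \<le> h b - (1 - \<theta>) / N" by (simp add: diff_divide_distrib)
          have "U b = exp (- \<kappa> * h b) / C" using Vb Cp by (simp add: V_def field_simps)
          then have "p = exp (- \<kappa> * h b) / C * exp (\<kappa> * (1 - \<theta>) / N)" by (simp add: p_def)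
          also have "\<dots> = exp (- \<kappa> * (h b - (1 - \<theta>) / N)) / C"
          proof -
            have eq: "- \<kappa> * (h b - (1 - \<theta>) / N) = - \<kappa> * h b + \<kappa> * (1 - \<theta>) / N"
              by (simp add: right_diff_distrib[of \<kappa> "h b"])
            show ?thesis unfolding eq exp_add by simp
          qed
          also have "\<dots> \<le> exp (- \<kappa> * h w) / C"
            using hw \<kappa> Cp by (intro divide_right_mono) auto
          also have "\<dots> \<le> U w" using V0[OF wE] Cp by (simp add: V_def pos_divide_le_eq mult.commute)
          finally show ?thesis using \<open>P w = p\<close> by simp
        qed
      qed
      have "P b = p / M * ((1 - \<eta>) * N)" using k(2) by (simp add: P_def s algebra_simps)
      then have "p * ((1 - \<eta>) * N) \<le> U b * M" using key Mp by (simp add: pos_divide_le_eq)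
      then have "U b * (exp (\<kappa> * (1 - \<theta>) / N) * ((1 - \<eta>) * N)) \<le> U b * M" by (simp add: p_def mult.assoc)
      then have 1: "exp (\<kappa> * (1 - \<theta>) / N) * ((1 - \<eta>) * N) \<le> M" using Up[OF bO] by simp
      have q: "(1 - \<eta>) * N > 0" using \<eta> Np by simp
      have "exp (\<kappa> * (1 - \<theta>) / N) \<le> M / ((1 - \<eta>) * N)" using 1 q by (simp add: pos_le_divide_eq)
      also have "M / ((1 - \<eta>) * N) = 1 + 1 / ((1 - \<eta>) * N)"
      proof -
        have "M = (1 - \<eta>) * N + 1" by (simp add: M_def algebra_simps)
        moreover have "1 - \<eta> \<noteq> 0" "N \<noteq> 0" using \<eta> Np by auto
        ultimately show ?thesis by (simp add: add_divide_distrib)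
      qed
      also have "\<dots> \<le> exp (1 / ((1 - \<eta>) * N))" by (rule exp_ge_add_one_self)
      finally have "\<kappa> * (1 - \<theta>) / N \<le> 1 / ((1 - \<eta>) * N)" by simp
      then have "\<kappa> * (1 - \<theta>) / N * N \<le> 1 / ((1 - \<eta>) * N) * N" using Np by (intro mult_right_mono) auto
      then have "\<kappa> * (1 - \<theta>) \<le> 1 / (1 - \<eta>)" using Np by simp
      then show False using \<kappa>(2) by simp
    qed
    have "exp (- \<kappa> * h z) \<le> C * U z" using V0[OF zE] by (simp add: V_def)
    also have "\<dots> \<le> 1 * U z" using \<open>C \<le> 1\<close> Up[of z] zE EO by (intro mult_right_mono) auto
    finally show ?thesis by (simp add: U_def)
  qed
  have "exp (- \<kappa> * h z) \<le> u z" by (rule field_le_epsilon) (rule main)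
  then show ?thesis by (simp add: h_def J_def)
qed

text \<open>The factor 1 - \<open>pseudo_dist a b\<close> is the point of the estimate: summed over
  many \<open>a\<close>, the differences are controlled by the logarithmically growing sum of these
  factors instead of by the number of points.\<close>

lemma ln_pseudo_dist_diff:
  assumes a: "cmod a < 1" and b: "cmod b < 1" and w: "cmod w < 1"
    and t: "pseudo_dist w b \<le> t" "t \<le> 1/2" and c: "0 < c" "c \<le> pseudo_dist a w" "0 < pseudo_dist a b"
  shows "ln (pseudo_dist a b) - ln (pseudo_dist a w) \<le> 4 * t / c * (1 - pseudo_dist a b)"
proof -
  define x where "x = pseudo_dist a b"
  define y where "y = pseudo_dist a w"
  define s where "s = pseudo_dist w b"
  have s: "0 \<le> s" "s \<le> t" using pseudo_dist_nonneg t by (auto simp: s_def)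
  have x: "0 < x" "x < 1" and y: "0 < y" "y < 1" "c \<le> y"
    using c pseudo_dist_less_1[OF a b] pseudo_dist_less_1[OF a w] by (auto simp: x_def y_def)
  have "x * (1 + y * s) \<le> y + s" using pseudo_dist_sum_bound[OF a w b] by (simp add: x_def y_def s_def)
  then have 1: "x - y \<le> s * (1 - x * y)" by (simp add: algebra_simps)
  have near: "(1 - y) * ((1 - t) / (1 + t)) \<le> 1 - x"
    using one_minus_pseudo_dist_ge_near[OF a w b t(1)] t(2) by (simp add: x_def y_def)
  have "1 / 3 \<le> (1 - t) / (1 + t)" using s t(2) by (simp add: pos_le_divide_eq)
  then have "(1 - y) * (1 / 3) \<le> (1 - y) * ((1 - t) / (1 + t))" using y by (intro mult_left_mono) auto
  from order_trans[OF this near] have 2: "1 - y \<le> 3 * (1 - x)" by simp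
  have "1 - x * y = (1 - x) + x * (1 - y)" by (simp add: algebra_simps)
  also have "\<dots> \<le> (1 - x) + (1 - y)" using x y by (simp add: mult_left_le_one_le)
  also have "\<dots> \<le> (1 - x) + 3 * (1 - x)" using 2 by (rule add_left_mono)
  finally have 3: "1 - x * y \<le> 4 * (1 - x)" by simp
  have "ln x - ln y = ln (x / y)" using x y by (simp add: ln_div)
  also have "\<dots> \<le> x / y - 1" using x y by (intro ln_le_minus_one) auto
  also have "\<dots> = (x - y) / y" using y by (simp add: diff_divide_distrib)
  also have "\<dots> \<le> (t * (4 * (1 - x))) / c"
  proof (rule frac_le)
    have "x * y \<le> 1" using x y by (intro mult_le_one) auto
    then have "s * (1 - x * y) \<le> t * (4 * (1 - x))" using s 3 by (intro mult_mono) auto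
    then show "x - y \<le> t * (4 * (1 - x))" using 1 by linarith
  qed (use x y c s in auto)
  also have "\<dots> = 4 * t / c * (1 - x)" by simp
  finally show ?thesis unfolding x_def y_def .
qed

lemma ln_6_le_2: "ln (6::real) \<le> 2"
proof -
  have "(6::real) \<le> exp 1 * exp 1"
    using mult_mono[of "5/2" "exp 1" "5/2" "exp (1::real)"] exp_ge_add_one_self[of 1] e_approx_32
    by (simp add: abs_if split: if_splits)
  then have "(6::real) \<le> exp 2" by (simp flip: exp_add)
  then show ?thesis by (metis ln_exp ln_mono zero_less_numeral exp_gt_zero)
qed

text \<open>Seen from a point near a hole, the sum of 1 - \<open>pseudo_dist\<close> over the holes
  is O(N), while the circles to be compared have radius of order exp (- \<eta> N). The terms of the
  other holes therefore oscillate by o(1), as \<open>subharmonic_lower_bound\<close>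
  requires.\<close>

theorem hm_lower_bound_holes:
  assumes L: "separated_by \<delta> L" and e: "\<epsilon> > 0"
  shows "eventually (\<lambda>r. \<forall>z u. cmod z < 1 \<longrightarrow> circle_solution L z r u \<longrightarrow>
     exp (- (1 + \<epsilon>) * ((\<Sum>a\<in>holes L z r. - ln (pseudo_dist a z)) / (- ln (1 - r)))) \<le> u z) (at_left 1)"
proof -
  have d: "0 < \<delta>" "\<delta> \<le> 1/2" using L by (auto simp: separated_by_def)
  obtain C where C: "C > 0" "\<And>L w r. separated_by \<delta> L \<Longrightarrow> cmod w < 1 \<Longrightarrow> 0 \<le> r \<Longrightarrow> r < 1 \<Longrightarrow>
      (\<Sum>a\<in>{a \<in> L. pseudo_dist a w < r}. 1 - pseudo_dist a w) \<le> C * (1 + ln (1 / (1 - r)))"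
  proof (rule sum_one_minus_pseudo_dist[OF d(1)])
    fix C :: real
    assume "C > 0" "\<And>L w r. separated_by \<delta> L \<Longrightarrow> cmod w < 1 \<Longrightarrow> 0 \<le> r \<Longrightarrow> r < 1 \<Longrightarrow>
      (\<Sum>a\<in>{a \<in> L. pseudo_dist a w < r}. 1 - pseudo_dist a w) \<le> C * (1 + ln (1 / (1 - r)))"
    then show thesis by (rule that)
  qed
  \<comment> \<open>With this \<eta> and the \<theta> below, 1 / (1 - \<eta>) = 1 + \<epsilon> / 2,
    whereas (1 + \<epsilon>) (1 - \<theta>) = 1 + 3 \<epsilon> / 4.\<close>
  define \<eta> where "\<eta> = \<epsilon> / (2 + \<epsilon>)"
  have \<eta>: "0 < \<eta>" "\<eta> < 1" using e by (auto simp: \<eta>_def)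
  have \<eta>1: "1 / (1 - \<eta>) = 1 + \<epsilon> / 2" using e by (simp add: \<eta>_def field_simps)
  define \<theta> where "\<theta> = \<epsilon> / (4 * (1 + \<epsilon>))"
  have "1 + \<epsilon> \<noteq> 0" using e by simp
  then have "(1 + \<epsilon>) * \<theta> = \<epsilon> / 4" unfolding \<theta>_def by (simp add: field_simps)
  then have "(1 + \<epsilon>) * (1 - \<theta>) = 1 + \<epsilon> - \<epsilon> / 4" by (simp add: right_diff_distrib)
  then have \<theta>: "\<theta> > 0" "1 + \<epsilon> / 2 < (1 + \<epsilon>) * (1 - \<theta>)" using e by (auto simp: \<theta>_def)
  define B where "B = 16 * exp 1 / \<delta> * C"
  have lim1: "((\<lambda>N. B * exp (- \<eta> * N) * (3 + 2 * N)) \<longlongrightarrow> 0) at_top" using \<eta> by real_asymp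
  have lim2: "((\<lambda>N. exp 1 * exp (- \<eta> * N)) \<longlongrightarrow> 0) at_top" using \<eta> by real_asymp
  have "eventually (\<lambda>N. B * exp (- \<eta> * N) * (3 + 2 * N) < \<theta>) at_top"
    using order_tendstoD(2)[OF lim1 \<theta>(1)] .
  moreover have "eventually (\<lambda>N. exp 1 * exp (- \<eta> * N) < \<delta> / 4) at_top"
    using order_tendstoD(2)[OF lim2, of "\<delta> / 4"] d by simp
  ultimately have "eventually (\<lambda>N. B * exp (- \<eta> * N) * (3 + 2 * N) < \<theta> \<and> exp 1 * exp (- \<eta> * N) < \<delta> / 4) at_top"
    by eventually_elim auto
  from eventually_minus_ln[OF this] eventually_near_1 show ?thesis
  proof eventually_elim
    case (elim r)
    define N where "N = - ln (1 - r)"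
    define s0 where "s0 = exp (- \<eta> * N)"
    define s1 where "s1 = exp 1 * s0"
    have r: "1/2 \<le> r" "r < 1" and small: "B * s0 * (3 + 2 * N) < \<theta>" "s1 < \<delta> / 4"
      using elim by (auto simp: N_def s0_def s1_def)
    have s01: "0 < s0" "s0 < s1" by (auto simp: s0_def s1_def)
    show ?case
    proof (intro allI impI)
      fix z u assume z: "cmod z < 1" and u: "circle_solution L z r u"
      have "exp (- (1 + \<epsilon>) * ((\<Sum>a\<in>holes L z r. - ln (pseudo_dist a z)) / N)) \<le> u z"
      proof (rule subharmonic_lower_bound[OF L z r u N_def \<eta> _ _ s0_def s1_def])
        show "1 + \<epsilon> > 0" using e by simp
        show "1 / (1 - \<eta>) < (1 + \<epsilon>) * (1 - \<theta>)" using \<eta>1 \<theta> by simp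
        show "s1 \<le> \<delta> / 4" using small by simp
        fix k b w assume k: "k \<in> holes L z r" and b: "cmod b < 1" and w: "cmod w < 1"
          and kb: "pseudo_dist k b = s0" and kw: "pseudo_dist k w = s1"
        define J where "J = holes L z r - {k}"
        have k1: "cmod k < 1" using holes_less_1[OF L k] .
        have kL: "k \<in> L" "pseudo_dist k z < r" using k by (auto simp: holes_def)
        have J1: "cmod j < 1" "j \<in> L" "j \<noteq> k" "pseudo_dist j z < r" if "j \<in> J" for j
          using that holes_less_1[OF L] by (auto simp: J_def holes_def)
        have wb: "pseudo_dist w b \<le> 2 * s1"
          using pseudo_dist_triangle[OF w k1 b] kb kw s01 pseudo_dist_commute[of w k] by linarith
        have far: "\<delta> / 2 \<le> pseudo_dist j x" if "j \<in> J" "cmod x < 1" "pseudo_dist k x \<le> s1" for j x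
        proof -
          have "\<delta> \<le> pseudo_dist j k" using L J1[OF that(1)] kL by (auto simp: separated_by_def)
          also have "\<dots> \<le> pseudo_dist j x + pseudo_dist x k"
            by (rule pseudo_dist_triangle[OF J1(1)[OF that(1)] that(2) k1])
          finally show ?thesis using that(3) small(2) d pseudo_dist_commute[of k x] by linarith
        qed
        \<comment> \<open>Passing from j through z to b costs a factor 1/2; 1 -
          \<open>pseudo_dist\<close> exceeds 1 - r for j and is at least (1 - r) / 3 for b, which
          lies close to the hole centre k.\<close>
        define R where "R = 1 - (1 - r)\<^sup>2 / 6"
        have R: "0 \<le> R" "R < 1"
        proof -
          have "(1 - r)\<^sup>2 \<le> 1" using r by (simp add: power_le_one)
          then show "0 \<le> R" by (simp add: R_def)
          show "R < 1" using r by (simp add: R_def)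
        qed
        have lnR: "ln (1 / (1 - R)) \<le> 2 + 2 * N"
        proof -
          have "1 / (1 - R) = 6 / (1 - r)\<^sup>2" by (simp add: R_def)
          then have "ln (1 / (1 - R)) = ln 6 + 2 * N" using r by (simp add: N_def ln_div ln_realpow)
          then show ?thesis using ln_6_le_2 by simp
        qed
        have inR: "pseudo_dist j b < R" if "j \<in> J" for j
        proof -
          have "(1 - r) * (1 / 3) \<le> (1 - pseudo_dist z k) * ((1 - s0) / (1 + s0))"
          proof (rule mult_mono)
            show "1 - r \<le> 1 - pseudo_dist z k" using kL pseudo_dist_commute[of z k] by simp
            have "s0 \<le> 1/2" using s01 small d by linarith
            then show "1 / 3 \<le> (1 - s0) / (1 + s0)" using s01 by (simp add: pos_le_divide_eq)
          qed (use r pseudo_dist_less_1[OF z k1] in auto)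
          also have "\<dots> \<le> 1 - pseudo_dist z b"
            by (rule one_minus_pseudo_dist_ge_near[OF z k1 b]) (use kb small d s01 in auto)
          finally have 1: "(1 - r) / 3 \<le> 1 - pseudo_dist z b" by simp
          have "(1 - r)\<^sup>2 / 6 = (1 - r) * ((1 - r) / 3) / 2" by (simp add: power2_eq_square)
          also have "\<dots> < (1 - pseudo_dist j z) * ((1 - r) / 3) / 2" using J1[OF that] r by simp
          also have "\<dots> \<le> (1 - pseudo_dist j z) * (1 - pseudo_dist z b) / 2"
            using 1 J1[OF that] r by (intro divide_right_mono mult_left_mono) auto
          also have "\<dots> \<le> 1 - pseudo_dist j b" by (rule one_minus_pseudo_dist_ge_half[OF J1(1)[OF that] z b])
          finally show ?thesis by (simp add: R_def)
        qed
        have "(\<Sum>j\<in>J. ln (pseudo_dist j b) - ln (pseudo_dist j w)) \<le>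
              (\<Sum>j\<in>J. 4 * (2 * s1) / (\<delta> / 2) * (1 - pseudo_dist j b))"
        proof (rule sum_mono)
          fix j assume j: "j \<in> J"
          show "ln (pseudo_dist j b) - ln (pseudo_dist j w) \<le> 4 * (2 * s1) / (\<delta> / 2) * (1 - pseudo_dist j b)"
            by (rule ln_pseudo_dist_diff[OF J1(1)[OF j] b w wb])
               (use far[OF j b] far[OF j w] kb kw s01 small d in auto)
        qed
        also have "\<dots> = 16 * s1 / \<delta> * (\<Sum>j\<in>J. 1 - pseudo_dist j b)" by (simp add: sum_distrib_left)
        also have "\<dots> \<le> 16 * s1 / \<delta> * (C * (1 + ln (1 / (1 - R))))"
        proof (rule mult_left_mono)
          have "(\<Sum>j\<in>J. 1 - pseudo_dist j b) \<le> (\<Sum>a\<in>{a \<in> L. pseudo_dist a b < R}. 1 - pseudo_dist a b)"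
            by (rule sum_mono2[OF finite_pseudo_ball[OF L b R(2)]]) (use J1 inR R in auto)
          also have "\<dots> \<le> C * (1 + ln (1 / (1 - R)))" by (rule C(2)[OF L b R])
          finally show "(\<Sum>j\<in>J. 1 - pseudo_dist j b) \<le> C * (1 + ln (1 / (1 - R)))" .
        qed (use s01 d in auto)
        also have "\<dots> \<le> 16 * s1 / \<delta> * (C * (1 + (2 + 2 * N)))"
          using lnR C s01 d by (intro mult_left_mono) auto
        also have "\<dots> = B * s0 * (3 + 2 * N)" by (simp add: B_def s1_def)
        also have "\<dots> \<le> \<theta>" using small by simp
        finally show "(\<Sum>j\<in>holes L z r - {k}. ln (pseudo_dist j b) - ln (pseudo_dist j w)) \<le> \<theta>"
          by (simp add: J_def)
      qed
      then show "exp (- (1 + \<epsilon>) * ((\<Sum>a\<in>holes L z r. - ln (pseudo_dist a z)) / (- ln (1 - r)))) \<le> u z"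
        by (simp add: N_def)
    qed
  qed
qed

text \<open>- ln x \<le> (1 + \<epsilon>) (1 - x) for 1 / (1 + \<epsilon>) \<le> x < 1. The points
  closer than that to \<open>w\<close> are bounded in number, and the distance \<open>c\<close>
  bounds each of their terms.\<close>

lemma green_sum_le:
  assumes d: "0 < \<delta>" and e: "\<epsilon> > 0" and c: "0 < c" "c \<le> 1"
  obtains C where "C > 0" "\<And>L w A. separated_by \<delta> L \<Longrightarrow> cmod w < 1 \<Longrightarrow> A \<subseteq> L \<Longrightarrow> finite A \<Longrightarrow>
     (\<And>a. a \<in> A \<Longrightarrow> c \<le> pseudo_dist a w) \<Longrightarrow>
     (\<Sum>a\<in>A. - ln (pseudo_dist a w)) \<le> (1 + \<epsilon>) * (\<Sum>a\<in>A. 1 - pseudo_dist a w) + C"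
proof -
  define x0 where "x0 = 1 / (1 + \<epsilon>)"
  have x0: "0 < x0" "x0 < 1" using e by (auto simp: x0_def)
  obtain C0 where C0: "C0 > 0" "\<And>L w r. separated_by \<delta> L \<Longrightarrow> cmod w < 1 \<Longrightarrow> 0 \<le> r \<Longrightarrow> r < 1 \<Longrightarrow>
      real (card {a \<in> L. pseudo_dist a w < r}) \<le> C0 * (1 + ln (1 / (1 - r))) / (1 - r)"
    using card_pseudo_ball[OF d] by blast
  define n where "n = C0 * (1 + ln (1 / (1 - x0))) / (1 - x0)"
  have lc: "0 \<le> - ln c" using c by simp
  have n0: "n > 0" using C0(1) x0 unfolding n_def by (intro divide_pos_pos mult_pos_pos) (auto intro!: add_pos_nonneg)
  show ?thesis
  proof (rule that[of "n * (- ln c) + 1"])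
    show "n * (- ln c) + 1 > 0" using n0 lc by (meson add_nonneg_pos less_imp_le mult_nonneg_nonneg zero_less_one)
    fix L w A assume L: "separated_by \<delta> L" and w: "cmod w < 1" and A: "A \<subseteq> L" "finite A"
      and far: "\<And>a. a \<in> A \<Longrightarrow> c \<le> pseudo_dist a w"
    have A1: "cmod a < 1" if "a \<in> A" for a using L A that by (auto simp: separated_by_def)
    have "(\<Sum>a\<in>A. - ln (pseudo_dist a w)) \<le> (\<Sum>a\<in>A. (1 + \<epsilon>) * (1 - pseudo_dist a w) + (if pseudo_dist a w < x0 then - ln c else 0))"
    proof (rule sum_mono)
      fix a assume a: "a \<in> A"
      define x where "x = pseudo_dist a w"
      have x: "c \<le> x" "x < 1" using far[OF a] pseudo_dist_less_1[OF A1[OF a] w] by (auto simp: x_def)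
      show "- ln (pseudo_dist a w) \<le> (1 + \<epsilon>) * (1 - pseudo_dist a w) + (if pseudo_dist a w < x0 then - ln c else 0)"
      proof (cases "x < x0")
        case True
        have "ln c \<le> ln x" using x c by (intro ln_mono) auto
        moreover have "0 \<le> (1 + \<epsilon>) * (1 - x)" using x e by simp
        ultimately show ?thesis using True unfolding x_def[symmetric] by simp
      next
        case False
        have "- ln x = ln (1 / x)" using x c by (simp add: ln_div)
        also have "\<dots> \<le> 1 / x - 1" using x c by (intro ln_le_minus_one) auto
        also have "\<dots> = (1 - x) * (1 / x)" using x c by (simp add: field_simps)
        also have "\<dots> \<le> (1 - x) * (1 + \<epsilon>)"
        proof (rule mult_left_mono)
          have "1 / x \<le> 1 / x0" using False x0 x c by (intro divide_left_mono) auto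
          then show "1 / x \<le> 1 + \<epsilon>" by (simp add: x0_def)
        qed (use x in simp)
        finally show ?thesis using False unfolding x_def[symmetric] by (simp add: mult.commute)
      qed
    qed
    also have "\<dots> = (1 + \<epsilon>) * (\<Sum>a\<in>A. 1 - pseudo_dist a w) + real (card {a \<in> A. pseudo_dist a w < x0}) * (- ln c)"
      using A(2) by (simp add: sum.distrib sum_distrib_left sum.If_cases Int_def)
    also have "\<dots> \<le> (1 + \<epsilon>) * (\<Sum>a\<in>A. 1 - pseudo_dist a w) + n * (- ln c)"
    proof (intro add_left_mono mult_right_mono lc)
      have "card {a \<in> A. pseudo_dist a w < x0} \<le> card {a \<in> L. pseudo_dist a w < x0}"
        by (rule card_mono[OF finite_pseudo_ball[OF L w x0(2)]]) (use A in auto)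
      then show "real (card {a \<in> A. pseudo_dist a w < x0}) \<le> n"
        using C0(2)[OF L w, of x0] x0 by (simp add: n_def)
    qed
    finally show "(\<Sum>a\<in>A. - ln (pseudo_dist a w)) \<le> (1 + \<epsilon>) * (\<Sum>a\<in>A. 1 - pseudo_dist a w) + (n * (- ln c) + 1)"
      by simp
  qed
qed

section \<open>Comparison of the densities\<close>

lemma ln_one_div_one_minus: "r < 1 \<Longrightarrow> ln (1 / (1 - r)) = - ln (1 - r)" for r :: real
  by (simp add: ln_div)

lemma sum_pseudo_ball:
  assumes "0 < \<delta>"
  obtains C where "C > 0" "\<And>L w r. separated_by \<delta> L \<Longrightarrow> cmod w < 1 \<Longrightarrow> 0 \<le> r \<Longrightarrow> r < 1 \<Longrightarrow>
      (\<Sum>a\<in>{a \<in> L. pseudo_dist a w < r}. 1 - pseudo_dist a w) \<le> C * (1 - ln (1 - r))"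
proof (rule sum_one_minus_pseudo_dist[OF assms])
  fix C :: real
  assume C: "C > 0" "\<And>L w r. separated_by \<delta> L \<Longrightarrow> cmod w < 1 \<Longrightarrow> 0 \<le> r \<Longrightarrow> r < 1 \<Longrightarrow>
      (\<Sum>a\<in>{a \<in> L. pseudo_dist a w < r}. 1 - pseudo_dist a w) \<le> C * (1 + ln (1 / (1 - r)))"
  show thesis
  proof (rule that[OF C(1)])
    fix L w and r :: real assume H: "separated_by \<delta> L" "cmod w < 1" "0 \<le> r" "r < 1"
    show "(\<Sum>a\<in>{a \<in> L. pseudo_dist a w < r}. 1 - pseudo_dist a w) \<le> C * (1 - ln (1 - r))"
      using C(2)[OF H] H(4) by (simp add: ln_one_div_one_minus)
  qed
qed

lemma log_inv_hm_le_density_quotient: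
  assumes L: "separated_by \<delta> L" and e: "\<epsilon> > 0"
  shows "eventually (\<lambda>r. \<forall>z u. cmod z < 1 \<longrightarrow> circle_solution L z r u \<longrightarrow>
     exp (- (density_quotient L z r + \<epsilon>)) \<le> u z) (at_left 1)"
proof -
  have d: "0 < \<delta>" using L by (simp add: separated_by_def)
  obtain C where C: "C > 0" "\<And>L w r. separated_by \<delta> L \<Longrightarrow> cmod w < 1 \<Longrightarrow> 0 \<le> r \<Longrightarrow> r < 1 \<Longrightarrow>
      (\<Sum>a\<in>{a \<in> L. pseudo_dist a w < r}. 1 - pseudo_dist a w) \<le> C * (1 - ln (1 - r))"
    using sum_pseudo_ball[OF d] by blast
  \<comment> \<open>Since (1 + e1)^2 \<le> 1 + 3 e1 and S / N \<le> 2 C, the first error is at most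
    \<epsilon> / 2; the other half of \<epsilon> is for 2 C1 / N.\<close>
  define e1 where "e1 = min 1 (\<epsilon> / (12 * C))"
  have e1: "0 < e1" "e1 \<le> 1" "e1 * (12 * C) \<le> \<epsilon>"
  proof -
    show "0 < e1" "e1 \<le> 1" using e C by (auto simp: e1_def)
    have "e1 \<le> \<epsilon> / (12 * C)" by (simp add: e1_def)
    then show "e1 * (12 * C) \<le> \<epsilon>" using C(1) by (simp add: pos_le_divide_eq)
  qed
  obtain C1 where C1: "C1 > 0" "\<And>L w A. separated_by \<delta> L \<Longrightarrow> cmod w < 1 \<Longrightarrow> A \<subseteq> L \<Longrightarrow> finite A \<Longrightarrow>
     (\<And>a. a \<in> A \<Longrightarrow> 1/2 \<le> pseudo_dist a w) \<Longrightarrow>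
     (\<Sum>a\<in>A. - ln (pseudo_dist a w)) \<le> (1 + e1) * (\<Sum>a\<in>A. 1 - pseudo_dist a w) + C1"
    using green_sum_le[OF d e1(1), of "1/2"] by auto
  have "eventually (\<lambda>N::real. 1 \<le> N \<and> 4 * C1 / \<epsilon> \<le> N) at_top"
    by (intro eventually_conj eventually_ge_at_top)
  from eventually_minus_ln[OF this] hm_lower_bound_holes[OF L e1(1)] eventually_near_1 show ?thesis
  proof eventually_elim
    case (elim r)
    define N where "N = - ln (1 - r)"
    have N: "1 \<le> N" "4 * C1 / \<epsilon> \<le> N" and r: "1/2 \<le> r" "r < 1" using elim by (auto simp: N_def)
    show ?case
    proof (intro allI impI)
      fix z u assume z: "cmod z < 1" and u: "circle_solution L z r u"
      define S where "S = (\<Sum>a\<in>{a \<in> L. pseudo_dist a z < r}. 1 - pseudo_dist a z)"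
      define H where "H = (\<Sum>a\<in>holes L z r. - ln (pseudo_dist a z))"
      have q: "density_quotient L z r = S / N"
        using r by (simp add: density_quotient_def S_def N_def ln_one_div_one_minus)
      have "H \<le> (1 + e1) * (\<Sum>a\<in>holes L z r. 1 - pseudo_dist a z) + C1"
        unfolding H_def by (rule C1(2)[OF L z _ finite_holes[OF L z r(2)]]) (auto simp: holes_def)
      also have "(\<Sum>a\<in>holes L z r. 1 - pseudo_dist a z) \<le> S"
        unfolding S_def by (rule sum_mono2[OF finite_pseudo_ball[OF L z r(2)]]) (use r in \<open>auto simp: holes_def\<close>)
      finally have H: "H \<le> (1 + e1) * S + C1" using e1 by simp
      have S0: "0 \<le> S" unfolding S_def by (rule sum_nonneg) (use r in auto)
      have "S \<le> C * (1 + N)" unfolding S_def N_def using C(2)[OF L z, of r] r by simp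
      also have "\<dots> \<le> C * (2 * N)" using N C by (intro mult_left_mono) auto
      finally have "S / N \<le> 2 * C" using N by (simp add: pos_divide_le_eq)
      then have "e1 * (S / N) \<le> e1 * (2 * C)" using e1 by (intro mult_left_mono) auto
      then have S1: "6 * (e1 * (S / N)) \<le> \<epsilon>" using e1 by simp
      have C1N: "C1 / N \<le> \<epsilon> / 4"
      proof -
        have "4 * C1 \<le> N * \<epsilon>" using N(2) e by (simp add: pos_divide_le_eq)
        then show ?thesis using N(1) by (simp add: pos_divide_le_eq mult.commute)
      qed
      have "(1 + e1) * (H / N) \<le> (1 + e1) * (((1 + e1) * S + C1) / N)"
        using H N e1 by (intro mult_left_mono divide_right_mono) auto
      also have "\<dots> = S / N + (2 * (e1 * (S / N)) + e1 * (e1 * (S / N))) + (1 + e1) * (C1 / N)"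
        by (simp add: algebra_simps add_divide_distrib)
      also have "\<dots> \<le> S / N + (2 * (e1 * (S / N)) + 1 * (e1 * (S / N))) + 2 * (C1 / N)"
        using e1 S0 N C1 by (intro add_mono mult_right_mono) auto
      also have "\<dots> \<le> S / N + \<epsilon>"
      proof -
        have *: "s + (2 * t + 1 * t) + 2 * c \<le> s + \<epsilon>" if "6 * t \<le> \<epsilon>" "c \<le> \<epsilon> / 4" for s t c :: real
          using that by simp
        show ?thesis by (rule *[OF S1 C1N])
      qed
      finally have "(1 + e1) * (H / N) \<le> S / N + \<epsilon>" .
      then have "exp (- (S / N + \<epsilon>)) \<le> exp (- (1 + e1) * (H / N))"
        by (simp only: exp_le_cancel_iff mult_minus_left neg_le_iff_le)
      also have "\<dots> \<le> u z" using elim(2) z u unfolding H_def N_def by blast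
      finally show "exp (- (density_quotient L z r + \<epsilon>)) \<le> u z" by (simp add: q)
    qed
  qed
qed

lemma log_inv_hm_circle_solution:
  assumes "separated_by \<delta> L" "cmod z < 1" "1/2 \<le> r" "r < 1"
  obtains u where "circle_solution L z r u" "log_inv_hm L z r = ln (1 / u z)"
  using circle_solution_ex[OF assms] unfolding log_inv_hm_def by metis

lemma eventually_log_inv_hm_le:
  assumes L: "separated_by \<delta> L" and e: "\<epsilon> > 0"
  shows "eventually (\<lambda>r. \<forall>z. cmod z < 1 \<longrightarrow> log_inv_hm L z r \<le> density_quotient L z r + \<epsilon>) (at_left 1)"
  using log_inv_hm_le_density_quotient[OF L e] eventually_near_1
proof eventually_elim
  case (elim r)
  show ?case
  proof (intro allI impI)
    fix z assume z: "cmod z < 1"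
    obtain u where u: "circle_solution L z r u" "log_inv_hm L z r = ln (1 / u z)" using log_inv_hm_circle_solution[OF L z] elim by blast
    have le: "exp (- (density_quotient L z r + \<epsilon>)) \<le> u z" using elim z u by blast
    \<comment> \<open>Positivity excludes a division by 0 inside the logarithm.\<close>
    then have "u z > 0" by (rule less_le_trans[OF exp_gt_zero])
    moreover have "- (density_quotient L z r + \<epsilon>) \<le> ln (u z)" using ln_mono[OF le exp_gt_zero] by simp
    ultimately show "log_inv_hm L z r \<le> density_quotient L z r + \<epsilon>" using u(2) by (simp add: ln_div)
  qed
qed

lemma lower_h_density_le:
  assumes L: "separated_by \<delta> L"
  shows "lower_h_density L \<le> lower_density L"
  unfolding lower_density_def le_Liminf_iff
proof (intro allI impI)
  fix y :: ennreal assume "y < lower_h_density L"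
  then obtain y1 where y1: "y < y1" "y1 < lower_h_density L" using dense by blast
  obtain c where c: "c \<ge> 0" "y = ennreal c" using y1(1) by (cases y) auto
  obtain c1 where c1: "c1 \<ge> 0" "y1 = ennreal c1" using y1(2) by (cases y1) auto
  have cc: "c < c1" using y1(1) c c1 by (simp add: ennreal_less_iff)
  define \<epsilon> where "\<epsilon> = (c1 - c) / 2"
  have e: "\<epsilon> > 0" using cc by (simp add: \<epsilon>_def)
  have "eventually (\<lambda>r. y1 < (INF z\<in>unit_disk. ennreal (log_inv_hm L z r))) (at_left 1)"
    using y1(2) unfolding lower_h_density_def by (rule less_LiminfD)
  then show "eventually (\<lambda>r. y < (INF z\<in>unit_disk. ennreal (density_quotient L z r))) (at_left 1)"
    using eventually_log_inv_hm_le[OF L e]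
  proof eventually_elim
    case (elim r)
    have "ennreal (c + \<epsilon>) \<le> (INF z\<in>unit_disk. ennreal (density_quotient L z r))"
    proof (rule INF_greatest)
      fix z :: complex assume z: "z \<in> unit_disk"
      have "ennreal c1 < ennreal (log_inv_hm L z r)"
        using elim(1) INF_lower[OF z, of "\<lambda>z. ennreal (log_inv_hm L z r)"] c1 by order
      then have "c1 < log_inv_hm L z r" using c1 by (simp add: ennreal_less_iff)
      then have "c + \<epsilon> \<le> density_quotient L z r" using elim(2) z by (force simp: \<epsilon>_def field_simps)
      then show "ennreal (c + \<epsilon>) \<le> ennreal (density_quotient L z r)" by (rule ennreal_leI)
    qed
    moreover have "ennreal c < ennreal (c + \<epsilon>)" using c e by (simp add: ennreal_less_iff)
    ultimately show ?case using c by order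
  qed
qed

lemma upper_h_density_le:
  assumes L: "separated_by \<delta> L"
  shows "upper_h_density L \<le> upper_density L"
  unfolding upper_h_density_def Limsup_le_iff
proof (intro allI impI)
  fix y :: ennreal assume "upper_density L < y"
  then obtain y2 where y2: "upper_density L < y2" "y2 < y" using dense by blast
  obtain y1 where y1: "upper_density L < y1" "y1 < y2" using y2 dense by blast
  obtain c where c: "c \<ge> 0" "y2 = ennreal c" using y2(2) by (cases y2) auto
  obtain c1 where c1: "c1 \<ge> 0" "y1 = ennreal c1" using y1(2) by (cases y1) auto
  have cc: "c1 < c" using y1(2) c c1 by (simp add: ennreal_less_iff)
  have e: "c - c1 > 0" using cc by simp
  have "eventually (\<lambda>r. (SUP z\<in>unit_disk. ennreal (density_quotient L z r)) < y1) (at_left 1)"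
    using y1(1) unfolding upper_density_def by (rule Limsup_lessD)
  then show "eventually (\<lambda>r. (SUP a\<in>L. ennreal (log_inv_hm L a r)) < y) (at_left 1)"
    using eventually_log_inv_hm_le[OF L e]
  proof eventually_elim
    case (elim r)
    have "(SUP a\<in>L. ennreal (log_inv_hm L a r)) \<le> ennreal c"
    proof (rule SUP_least)
      fix a assume "a \<in> L"
      then have a: "a \<in> unit_disk" using L by (auto simp: separated_by_def)
      have "ennreal (density_quotient L a r) < ennreal c1"
        using elim(1) SUP_upper[OF a, of "\<lambda>z. ennreal (density_quotient L z r)"] c1 by order
      then have "density_quotient L a r < c1" by (metis c1(1) ennreal_leI linorder_not_less)
      then have "log_inv_hm L a r \<le> c" using elim(2) a by force
      then show "ennreal (log_inv_hm L a r) \<le> ennreal c" by (rule ennreal_leI)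
    qed
    then show ?case using y2 c by order
  qed
qed

text \<open>One radius r1 with density quotient above \<beta>' at every centre is fixed and gives a
  walk with steps of constant length, after which r tends to 1. The losses per step (factor 2 in the
  depth, points that are not holes, a slightly enlarged disc) are constants or a small proportion,
  so a long step brings the rate above \<beta>.\<close>

lemma eventually_log_inv_hm_ge:
  assumes L: "separated_by \<delta> L" and b: "0 < \<beta>" "ennreal \<beta> < lower_density L"
  shows "eventually (\<lambda>r. \<forall>z. cmod z < 1 \<longrightarrow> \<beta> \<le> log_inv_hm L z r) (at_left 1)"
proof -
  have d: "0 < \<delta>" using L by (simp add: separated_by_def)
  obtain y where y: "ennreal \<beta> < y" "y < lower_density L" using b dense by blast
  obtain \<beta>' where \<beta>': "\<beta>' \<ge> 0" "y = ennreal \<beta>'" using y(2) by (cases y) auto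
  have bb: "\<beta> < \<beta>'" using y(1) \<beta>' b by (simp add: ennreal_less_iff)
  obtain C0 where C0: "C0 > 0" "\<And>L w r. separated_by \<delta> L \<Longrightarrow> cmod w < 1 \<Longrightarrow> 0 \<le> r \<Longrightarrow> r < 1 \<Longrightarrow>
      real (card {a \<in> L. pseudo_dist a w < r}) \<le> C0 * (1 + ln (1 / (1 - r))) / (1 - r)"
    using card_pseudo_ball[OF d] by blast
  define n where "n = C0 * (1 + ln (1 / (1 - 3/5))) / (1 - 3/5)"
  \<comment> \<open>\<open>K\<close> governs the enlargement of the step disc to radius 1 - (1 - r1)
    / K, which preserves the proportion 1 - 1 / K of each summand. Its value makes (1 - 1 / K)
    \<beta>' the midpoint of \<beta> and \<beta>'.\<close>
  define K where "K = 2 * \<beta>' / (\<beta>' - \<beta>)"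
  have K1: "K > 1" using bb b by (simp add: K_def field_simps)
  have Kb: "\<beta> < (1 - 1 / K) * \<beta>'"
  proof -
    have "1 / K * \<beta>' = (\<beta>' - \<beta>) / 2" using bb b by (simp add: K_def)
    then have eq: "(1 - 1 / K) * \<beta>' = \<beta>' - (\<beta>' - \<beta>) / 2" by (simp only: left_diff_distrib mult_1)
    show ?thesis unfolding eq using bb by (simp add: field_simps)
  qed
  define k where "k = (1 - 1 / K) * \<beta>'"
  have kp: "k > \<beta>" using Kb by (simp add: k_def)
  have "((\<lambda>N. (k * N - n) / (N + ln (2 * K))) \<longlongrightarrow> k) at_top" by real_asymp
  then have "eventually (\<lambda>N. \<beta> < (k * N - n) / (N + ln (2 * K))) at_top"
    using kp by (rule order_tendstoD(1))
  from eventually_minus_ln[OF this]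
  have "eventually (\<lambda>r. \<beta> < (k * (- ln (1 - r)) - n) / (- ln (1 - r) + ln (2 * K)) \<and> 1/2 \<le> r \<and> r < 1 \<and>
      y < (INF z\<in>unit_disk. ennreal (density_quotient L z r))) (at_left 1)"
    using eventually_near_1 less_LiminfD[OF y(2)[unfolded lower_density_def]] by eventually_elim auto
  then obtain r1 where r1: "\<beta> < (k * (- ln (1 - r1)) - n) / (- ln (1 - r1) + ln (2 * K))" "1/2 \<le> r1" "r1 < 1"
      "y < (INF z\<in>unit_disk. ennreal (density_quotient L z r1))"
    using eventually_happens' trivial_limit_at_left_real by (metis (mono_tags, lifting))
  define N where "N = - ln (1 - r1)"
  have Np: "N > 0" using r1 by (simp add: N_def)
  define \<rho> where "\<rho> = 1 - (1 - r1) / K"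
  have "(1 - r1) / K < 1 - r1" using K1 r1 by (simp add: pos_divide_less_eq)
  moreover have "(1 - r1) / K > 0" using K1 r1 by simp
  ultimately have \<rho>: "r1 < \<rho>" "\<rho> < 1" "0 < \<rho>" using r1 by (auto simp: \<rho>_def)
  have l: "ln (2 / (1 - \<rho>)) = N + ln (2 * K)"
  proof -
    have "2 / (1 - \<rho>) = 2 * K / (1 - r1)" by (simp add: \<rho>_def)
    then show ?thesis using r1 K1 by (simp add: N_def ln_div)
  qed
  have lp: "N + ln (2 * K) > 0" using Np K1 by (intro add_pos_nonneg) auto
  define X where "X = k * N - n"
  have XN: "\<beta> < X / (N + ln (2 * K))" using r1(1) by (simp add: X_def N_def)
  have X0: "0 \<le> X" using XN lp b(1) by (simp add: pos_less_divide_eq) (meson less_imp_le less_trans mult_pos_pos)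
  define e where "e = X / (N + ln (2 * K)) - \<beta>"
  have e: "e > 0" using XN by (simp add: e_def)
  have "eventually (\<lambda>r. \<forall>z u. cmod z < 1 \<longrightarrow> circle_solution L z r u \<longrightarrow> u z \<le> exp (- (X / ln (2 / (1 - \<rho>)) - e))) (at_left 1)"
  proof (rule walk_bound[OF L \<rho>(3,2) e X0])
    fix z w assume z: "cmod z < 1" and w: "cmod w < 1"
      and ne: "\<And>a. a \<in> L \<Longrightarrow> 1/2 < pseudo_dist a z \<Longrightarrow> pseudo_dist a w < \<rho> \<Longrightarrow> a \<noteq> w"
    have L1: "cmod a < 1" if "a \<in> L" for a using L that by (auto simp: separated_by_def)
    define A where "A = {a \<in> L. 1/2 < pseudo_dist a z \<and> pseudo_dist a w < r1}"
    define A' where "A' = {a \<in> L. 1/2 < pseudo_dist a z \<and> pseudo_dist a w < \<rho>}"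
    have fA': "finite A'" by (rule finite_subset[OF _ finite_pseudo_ball[OF L w \<rho>(2)]]) (auto simp: A'_def)
    have AA: "A \<subseteq> A'" using \<rho> by (auto simp: A_def A'_def)
    have pos: "0 < pseudo_dist a w" if "a \<in> A'" for a
      using ne[of a] that pseudo_dist_eq_0_iff[of a w] L1 w pseudo_dist_nonneg[of a w] by (force simp: A'_def)
    have S: "\<beta>' * N \<le> (\<Sum>a\<in>{a \<in> L. pseudo_dist a w < r1}. 1 - pseudo_dist a w)"
    proof -
      have wd: "w \<in> unit_disk" using w by simp
      have "ennreal \<beta>' < ennreal (density_quotient L w r1)"
        using r1(4) INF_lower[OF wd, of "\<lambda>z. ennreal (density_quotient L z r1)"] \<beta>' by order
      then have "\<beta>' < density_quotient L w r1" using \<beta>' by (simp add: ennreal_less_iff)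
      then show ?thesis using Np r1 unfolding density_quotient_def
        by (simp add: ln_one_div_one_minus N_def[symmetric] pos_less_divide_eq)
    qed
    \<comment> \<open>Points within 1/2 of \<open>z\<close> are not holes. The radius 3/5 catches
      all of them with a strict inequality, and the count \<open>n\<close> bounds what is
      lost.\<close>
    define P where "P = {a \<in> L. pseudo_dist a z < 3/5}"
    have fP: "finite P" unfolding P_def by (rule finite_pseudo_ball[OF L z]) simp
    have cP: "real (card P) \<le> n" using C0(2)[OF L z, of "3/5"] by (simp add: P_def n_def)
    have fA: "finite A" using fA' AA finite_subset by blast
    have "(\<Sum>a\<in>{a \<in> L. pseudo_dist a w < r1}. 1 - pseudo_dist a w) \<le> (\<Sum>a\<in>A \<union> P. 1 - pseudo_dist a w)"
      by (rule sum_mono2) (use fA fP L1 w pseudo_dist_less_1 in \<open>auto simp: A_def P_def less_imp_le\<close>)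
    also have "\<dots> \<le> (\<Sum>a\<in>A. 1 - pseudo_dist a w) + (\<Sum>a\<in>P. 1 - pseudo_dist a w)"
    proof -
      have "0 \<le> (\<Sum>a\<in>A \<inter> P. 1 - pseudo_dist a w)"
        by (rule sum_nonneg) (use L1 w pseudo_dist_less_1 in \<open>auto simp: A_def less_imp_le\<close>)
      then show ?thesis using sum.union_inter[OF fA fP, of "\<lambda>a. 1 - pseudo_dist a w"] by linarith
    qed
    also have "(\<Sum>a\<in>P. 1 - pseudo_dist a w) \<le> (\<Sum>a\<in>P. 1)" by (rule sum_mono) (simp add: pseudo_dist_nonneg)
    finally have SA: "\<beta>' * N - n \<le> (\<Sum>a\<in>A. 1 - pseudo_dist a w)" using S cP by simp
    have K01: "0 \<le> 1 - 1 / K" "1 - 1 / K \<le> 1" using K1 by auto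
    have "0 < n" unfolding n_def using C0(1) by (intro divide_pos_pos mult_pos_pos add_pos_nonneg) auto
    then have "(1 - 1 / K) * n \<le> n" using K01 by (simp add: mult_left_le_one_le)
    then have "X \<le> (1 - 1 / K) * (\<beta>' * N - n)" by (simp add: X_def k_def algebra_simps)
    also have "\<dots> \<le> (1 - 1 / K) * (\<Sum>a\<in>A. 1 - pseudo_dist a w)" using SA K01(1) by (rule mult_left_mono)
    also have "\<dots> = (\<Sum>a\<in>A. (1 - 1 / K) * (1 - pseudo_dist a w))" by (rule sum_distrib_left)
    also have "\<dots> \<le> (\<Sum>a\<in>A. ln (\<rho> / pseudo_dist a w))"
    proof (rule sum_mono)
      fix a assume a: "a \<in> A"
      define x where "x = pseudo_dist a w"
      have x: "0 < x" "x < r1" using a pos AA by (auto simp: x_def A_def)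
      have "(1 - r1) / K \<le> (1 - x) / K" using x K1 by (intro divide_right_mono) auto
      then have "(1 - 1 / K) * (1 - x) \<le> \<rho> - x" by (simp add: \<rho>_def left_diff_distrib)
      also have "\<dots> \<le> (\<rho> - x) / \<rho>" using x \<rho> by (simp add: pos_le_divide_eq mult_left_le)
      also have "\<dots> = 1 - x / \<rho>" using \<rho> by (simp add: diff_divide_distrib)
      also have "\<dots> \<le> - ln (x / \<rho>)" using ln_le_minus_one[of "x / \<rho>"] x \<rho> by simp
      also have "\<dots> = ln (\<rho> / x)" using x \<rho> by (simp add: ln_div)
      finally show "(1 - 1 / K) * (1 - pseudo_dist a w) \<le> ln (\<rho> / pseudo_dist a w)" by (simp add: x_def)
    qed
    also have "\<dots> \<le> (\<Sum>a\<in>A'. ln (\<rho> / pseudo_dist a w))"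
    proof (rule sum_mono2[OF fA' AA])
      fix a assume "a \<in> A' - A"
      then show "0 \<le> ln (\<rho> / pseudo_dist a w)" using pos[of a]
        by (intro ln_ge_zero) (auto simp: A'_def pos_le_divide_eq)
    qed
    finally show "X \<le> (\<Sum>a\<in>{a \<in> L. 1/2 < pseudo_dist a z \<and> pseudo_dist a w < \<rho>}. ln (\<rho> / pseudo_dist a w))"
      by (simp add: A'_def)
  qed
  moreover have "X / ln (2 / (1 - \<rho>)) - e = \<beta>" by (simp add: l e_def)
  ultimately have "eventually (\<lambda>r. \<forall>z u. cmod z < 1 \<longrightarrow> circle_solution L z r u \<longrightarrow> u z \<le> exp (- \<beta>)) (at_left 1)" by simp
  \<comment> \<open>The lower bound for \<open>u\<close>, with error 1, is used for the positivity
    of \<open>u z\<close>.\<close>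
  with log_inv_hm_le_density_quotient[OF L zero_less_one] eventually_near_1 show ?thesis
  proof eventually_elim
    case (elim r)
    show ?case
    proof (intro allI impI)
      fix z assume z: "cmod z < 1"
      obtain u where u: "circle_solution L z r u" "log_inv_hm L z r = ln (1 / u z)" using log_inv_hm_circle_solution[OF L z] elim by blast
      have "exp (- (density_quotient L z r + 1)) \<le> u z" using elim z u by blast
      then have up: "u z > 0" by (rule less_le_trans[OF exp_gt_zero])
      have "u z \<le> exp (- \<beta>)" using elim z u by blast
      from ln_mono[OF this up] have "ln (u z) \<le> - \<beta>" by simp
      then show "\<beta> \<le> log_inv_hm L z r" using u(2) up by (simp add: ln_div)
    qed
  qed
qed

lemma lower_density_le:
  assumes L: "separated_by \<delta> L"
  shows "lower_density L \<le> lower_h_density L"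
  unfolding lower_h_density_def le_Liminf_iff
proof (intro allI impI)
  fix y :: ennreal assume "y < lower_density L"
  then obtain y1 where y1: "y < y1" "y1 < lower_density L" using dense by blast
  obtain c1 where c1: "c1 \<ge> 0" "y1 = ennreal c1" using y1(2) by (cases y1) auto
  have "0 < y1" using y1(1) by (rule order_le_less_trans[OF zero_le])
  then have "0 < c1" using c1 by simp
  from eventually_log_inv_hm_ge[OF L this] y1(2) c1
  have "eventually (\<lambda>r. \<forall>z. cmod z < 1 \<longrightarrow> c1 \<le> log_inv_hm L z r) (at_left 1)" by simp
  then show "eventually (\<lambda>r. y < (INF z\<in>unit_disk. ennreal (log_inv_hm L z r))) (at_left 1)"
  proof eventually_elim
    case (elim r)
    have "ennreal c1 \<le> (INF z\<in>unit_disk. ennreal (log_inv_hm L z r))"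
      by (rule INF_greatest) (use elim in \<open>auto intro!: ennreal_leI\<close>)
    then show ?case using y1(1) c1 by order
  qed
qed

section \<open>The upper density\<close>

text \<open>The points \<open>a\<close> of modulus less than \<open>1 - exp (- N)\<close> which are much further from \<open>w\<close> than the
  circle of radius \<open>1 - exp (- N)\<close> are seen from \<open>w\<close> through the point \<open>p\<close> above \<open>w\<close>.\<close>

lemma sum_sideways_centred:
  assumes L: "separated_by \<delta> L" and C: "C > 0" "\<And>L w r. separated_by \<delta> L \<Longrightarrow> cmod w < 1 \<Longrightarrow> 0 \<le> r \<Longrightarrow> r < 1 \<Longrightarrow>
      (\<Sum>a\<in>{a \<in> L. pseudo_dist a w < r}. 1 - pseudo_dist a w) \<le> C * (1 - ln (1 - r))"
    and w: "cmod w < 1" and N: "N > 0" and m: "m \<ge> 4" and x: "exp (- N) / 3 \<le> 1 - cmod w"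
  defines "T \<equiv> {a \<in> L. exp (- N) < 1 - cmod a \<and> 1 - pseudo_dist a w \<le> exp (- N) / (m\<^sup>2 * (1 - cmod w))}"
  shows "(\<Sum>a\<in>T. 1 - pseudo_dist a w) \<le> 64 / m * (C * (3 + 2 * N))"
proof (cases "T = {}")
  case True
  then show ?thesis using C(1) N m by simp
next
  case False
  define t where "t = exp (- N)"
  define x where "x = 1 - cmod w"
  have t: "0 < t" "t < 1" using N by (auto simp: t_def)
  have x: "0 < x" "x \<le> 1" "t / 3 \<le> x" using w x by (auto simp: x_def t_def)
  have T: "cmod a < 1" "a \<in> L" "t < 1 - cmod a" "1 - pseudo_dist a w \<le> t / (m\<^sup>2 * x)" if "a \<in> T" for a
    using that L by (auto simp: T_def t_def x_def separated_by_def)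
  \<comment> \<open>The identity for 1 - \<open>pseudo_dist\<close> squared turns smallness of 1 -
    \<open>pseudo_dist a w\<close> into sideways distance: |1 - cnj w a| is at least m / 2 times the
    height 1 - |w|.\<close>
  have mx: "m * x \<le> 2 * cmod (1 - cnj w * a)" if a: "a \<in> T" for a
  proof -
    note Ta = T[OF a]
    have c: "cmod (1 - cnj w * a) > 0" using one_minus_cnj_mult_neq_0[OF w, of a] Ta by simp
    have p: "pseudo_dist w a = pseudo_dist a w" by (rule pseudo_dist_commute)
    have "1 - (pseudo_dist a w)\<^sup>2 = (1 - pseudo_dist a w) * (1 + pseudo_dist a w)"
      by (simp add: power2_eq_square algebra_simps)
    also have "\<dots> \<le> t / (m\<^sup>2 * x) * 2"
      using Ta pseudo_dist_less_1[OF Ta(1) w] pseudo_dist_nonneg[of a w] by (intro mult_mono) auto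
    finally have 1: "1 - (pseudo_dist a w)\<^sup>2 \<le> 2 * t / (m\<^sup>2 * x)" by (simp add: mult.commute)
    have "t * x \<le> (1 - (cmod a)\<^sup>2) * (1 - (cmod w)\<^sup>2)"
    proof (rule mult_mono)
      have "(cmod a)\<^sup>2 \<le> cmod a" using Ta by (simp add: power2_eq_square mult_left_le)
      then show "t \<le> 1 - (cmod a)\<^sup>2" using Ta by simp
      have "(cmod w)\<^sup>2 \<le> cmod w" using w by (simp add: power2_eq_square mult_left_le)
      then show "x \<le> 1 - (cmod w)\<^sup>2" by (simp add: x_def)
      show "0 \<le> 1 - (cmod a)\<^sup>2" using Ta by (simp add: abs_square_le_1)
    qed (use x in simp)
    also have "\<dots> = (1 - (pseudo_dist a w)\<^sup>2) * (cmod (1 - cnj w * a))\<^sup>2"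
      using one_minus_pseudo_dist_square[OF w, of a] Ta c by (simp add: p mult.commute)
    also have "\<dots> \<le> 2 * t / (m\<^sup>2 * x) * (cmod (1 - cnj w * a))\<^sup>2" using 1 by (intro mult_right_mono) auto
    finally have "t * x * (m\<^sup>2 * x) \<le> 2 * t * (cmod (1 - cnj w * a))\<^sup>2"
      using x m by (simp add: pos_le_divide_eq)
    then have "t * (m * x)\<^sup>2 \<le> t * (2 * (cmod (1 - cnj w * a))\<^sup>2)" by (simp add: power2_eq_square mult_ac)
    then have "(m * x)\<^sup>2 \<le> 2 * (cmod (1 - cnj w * a))\<^sup>2" using t by simp
    also have "\<dots> \<le> (2 * cmod (1 - cnj w * a))\<^sup>2" by (simp add: power_mult_distrib)
    finally show ?thesis by (rule power2_le_imp_le) simp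
  qed
  obtain a0 where a0: "a0 \<in> T" using False by blast
  \<comment> \<open>At height m x / 4 the point \<open>p\<close> is low enough for |1 - cnj p a|
    \<le> 2 |1 - cnj w a|, but m / 4 times as high as \<open>w\<close>; this gain in height produces
    the factor 64 / m.\<close>
  define y where "y = m * x / 4"
  have c2: "cmod (1 - cnj w * a) < 2" if "a \<in> T" for a
  proof -
    have "cmod (1 - cnj w * a) \<le> 1 + cmod w * cmod a"
      using norm_triangle_ineq4[of 1 "cnj w * a"] by (simp add: norm_mult)
    also have "cmod w * cmod a \<le> cmod w" using T(1)[OF that] by (simp add: mult_left_le)
    finally show ?thesis using w by simp
  qed
  have y: "x \<le> y" "y < 1"
    using mx[OF a0] c2[OF a0] m x by (auto simp: y_def)
  have w0: "w \<noteq> 0" using y by (auto simp: x_def)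
  define p where "p = of_real ((1 - y) / cmod w) * w"
  have np: "cmod p = 1 - y" unfolding p_def norm_mult norm_of_real using y w0 by simp
  have p1: "cmod p < 1" using np y x by simp
  have wp: "cmod (w - p) \<le> y"
  proof -
    have "w - p = of_real (1 - (1 - y) / cmod w) * w" by (simp add: p_def algebra_simps)
    then have "cmod (w - p) = \<bar>1 - (1 - y) / cmod w\<bar> * cmod w" by (simp only: norm_mult norm_of_real)
    also have "\<dots> = \<bar>(1 - (1 - y) / cmod w) * cmod w\<bar>" by (simp only: abs_mult abs_norm_cancel)
    also have "\<dots> = \<bar>cmod w - (1 - y)\<bar>"
    proof -
      have "(1 - y) / cmod w * cmod w = 1 - y" using w0 by simp
      then show ?thesis by (simp only: left_diff_distrib mult_1)
    qed
    also have "\<dots> \<le> y" using y w x_def by auto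
    finally show ?thesis .
  qed
  define R where "R = 1 - t\<^sup>2 / 6"
  have "t\<^sup>2 \<le> 1" using t by (simp add: power_le_one)
  then have R: "0 \<le> R" "R < 1" using t by (auto simp: R_def)
  have le: "1 - pseudo_dist a w \<le> 64 / m * (1 - pseudo_dist a p) \<and> pseudo_dist a p < R" if a: "a \<in> T" for a
  proof
    note Ta = T[OF a]
    have c: "cmod (1 - cnj w * a) > 0" using one_minus_cnj_mult_neq_0[OF w, of a] Ta by simp
    have cp: "cmod (1 - cnj p * a) > 0" using one_minus_cnj_mult_neq_0[OF p1, of a] Ta by simp
    have "1 - cnj p * a = (1 - cnj w * a) + cnj (w - p) * a" by (simp add: algebra_simps)
    then have "cmod (1 - cnj p * a) \<le> cmod (1 - cnj w * a) + cmod (cnj (w - p) * a)"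
      by (metis norm_triangle_ineq)
    also have "cmod (cnj (w - p) * a) \<le> y * 1"
      unfolding norm_mult complex_mod_cnj using wp Ta x y by (intro mult_mono) auto
    also have "y * 1 \<le> cmod (1 - cnj w * a)" using mx[OF a] c unfolding y_def by linarith
    finally have "cmod (1 - cnj p * a) \<le> 2 * cmod (1 - cnj w * a)" by simp
    then have P2: "(cmod (1 - cnj p * a))\<^sup>2 \<le> 4 * (cmod (1 - cnj w * a))\<^sup>2"
      using power_mono[of "cmod (1 - cnj p * a)" "2 * cmod (1 - cnj w * a)" 2] by (simp add: power_mult_distrib)
    define A where "A = 1 - (cmod a)\<^sup>2"
    have A: "A > 0" using Ta by (simp add: A_def abs_square_less_1)
    have "y \<le> 1 - (cmod p)\<^sup>2"
    proof -
      have "(cmod p)\<^sup>2 \<le> cmod p" using p1 by (simp add: power2_eq_square mult_left_le)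
      then show ?thesis using np by simp
    qed
    then have "y * A / (4 * (cmod (1 - cnj w * a))\<^sup>2) \<le> (1 - (cmod p)\<^sup>2) * A / (cmod (1 - cnj p * a))\<^sup>2"
      using P2 A y x cp by (intro frac_le mult_right_mono) auto
    also have "\<dots> = 1 - (pseudo_dist a p)\<^sup>2"
      using one_minus_pseudo_dist_square[OF p1, of a] Ta by (simp add: A_def pseudo_dist_commute[of p a])
    also have "\<dots> \<le> 2 * (1 - pseudo_dist a p)"
    proof -
      have "0 \<le> (1 - pseudo_dist a p)\<^sup>2" by simp
      then show ?thesis by (simp add: power2_eq_square algebra_simps)
    qed
    finally have 1: "y * A / (4 * (cmod (1 - cnj w * a))\<^sup>2) \<le> 2 * (1 - pseudo_dist a p)" .
    have pd: "0 \<le> pseudo_dist a w" "pseudo_dist a w < 1" using pseudo_dist_nonneg pseudo_dist_less_1[OF Ta(1) w] by auto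
    have "1 - pseudo_dist a w \<le> 1 - (pseudo_dist a w)\<^sup>2" using pd by (simp add: power2_eq_square mult_left_le)
    also have "\<dots> = (1 - (cmod w)\<^sup>2) * A / (cmod (1 - cnj w * a))\<^sup>2"
      using one_minus_pseudo_dist_square[OF w, of a] Ta by (simp add: A_def pseudo_dist_commute[of w a])
    also have "\<dots> \<le> (2 * x) * A / (cmod (1 - cnj w * a))\<^sup>2"
    proof (intro divide_right_mono mult_right_mono)
      have "0 \<le> (1 - cmod w)\<^sup>2" by simp
      then show "1 - (cmod w)\<^sup>2 \<le> 2 * x" by (simp add: x_def power2_eq_square algebra_simps)
    qed (use A in auto)
    also have "\<dots> = 32 / m * (y * A / (4 * (cmod (1 - cnj w * a))\<^sup>2))" using m by (simp add: y_def)
    also have "\<dots> \<le> 32 / m * (2 * (1 - pseudo_dist a p))" using 1 m by (intro mult_left_mono) auto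
    finally show "1 - pseudo_dist a w \<le> 64 / m * (1 - pseudo_dist a p)" by simp
    have "t\<^sup>2 / 6 = t * (t / 3) / 2" by (simp add: power2_eq_square)
    also have "\<dots> < (1 - cmod a) * (t / 3) / 2" using Ta t by simp
    also have "\<dots> \<le> (1 - cmod a) * (1 - cmod p) / 2"
      using Ta np y x by (intro divide_right_mono mult_left_mono) auto
    also have "\<dots> \<le> 1 - pseudo_dist a p"
      using one_minus_pseudo_dist_ge_half[of a 0 p] Ta p1 by (simp add: pseudo_dist_0_left pseudo_dist_commute[of a 0])
    finally show "pseudo_dist a p < R" by (simp add: R_def)
  qed
  have fin: "finite {a \<in> L. pseudo_dist a p < R}" by (rule finite_pseudo_ball[OF L p1 R(2)])
  have "(\<Sum>a\<in>T. 1 - pseudo_dist a w) \<le> (\<Sum>a\<in>T. 64 / m * (1 - pseudo_dist a p))"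
    using le by (intro sum_mono) blast
  also have "\<dots> = 64 / m * (\<Sum>a\<in>T. 1 - pseudo_dist a p)" by (rule sum_distrib_left[symmetric])
  also have "\<dots> \<le> 64 / m * (C * (3 + 2 * N))"
  proof (rule mult_left_mono)
    have "(\<Sum>a\<in>T. 1 - pseudo_dist a p) \<le> (\<Sum>a\<in>{a \<in> L. pseudo_dist a p < R}. 1 - pseudo_dist a p)"
      by (rule sum_mono2[OF fin]) (use le T R in auto)
    also have "\<dots> \<le> C * (1 - ln (1 - R))" by (rule C(2)[OF L p1 R])
    also have "\<dots> \<le> C * (3 + 2 * N)"
    proof (rule mult_left_mono)
      have "ln (1 - R) = - 2 * N - ln 6" using t by (simp add: R_def ln_div ln_realpow t_def)
      then show "1 - ln (1 - R) \<le> 3 + 2 * N" using ln_6_le_2 by simp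
    qed (use C in simp)
    finally show "(\<Sum>a\<in>T. 1 - pseudo_dist a p) \<le> C * (3 + 2 * N)" .
  qed (use m in simp)
  finally show ?thesis .
qed

lemma sum_sideways:
  assumes L: "separated_by \<delta> L" and C: "C > 0" "\<And>L w r. separated_by \<delta> L \<Longrightarrow> cmod w < 1 \<Longrightarrow> 0 \<le> r \<Longrightarrow> r < 1 \<Longrightarrow>
      (\<Sum>a\<in>{a \<in> L. pseudo_dist a w < r}. 1 - pseudo_dist a w) \<le> C * (1 - ln (1 - r))"
    and w: "cmod w < 1" and z: "cmod z < 1" and N: "N > 0" and m: "m \<ge> 4"
    and x: "exp (- N) / 3 \<le> 1 - pseudo_dist w z"
  shows "(\<Sum>a\<in>{a \<in> L. exp (- N) < 1 - pseudo_dist a z \<and> 1 - pseudo_dist a w \<le> exp (- N) / (m\<^sup>2 * (1 - pseudo_dist w z))}.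
      1 - pseudo_dist a w) \<le> 64 / m * (C * (3 + 2 * N))"
proof -
  have L1: "cmod a < 1" if "a \<in> L" for a using L that by (auto simp: separated_by_def)
  have pm: "cmod (mob z a) = pseudo_dist a z" for a using pseudo_dist_mob pseudo_dist_commute by metis
  have pw: "pseudo_dist (mob z a) (mob z w) = pseudo_dist a w" if "a \<in> L" for a
    by (rule pseudo_dist_mob_mob[OF z L1[OF that] w])
  define T where "T = {a \<in> L. exp (- N) < 1 - pseudo_dist a z \<and> 1 - pseudo_dist a w \<le> exp (- N) / (m\<^sup>2 * (1 - pseudo_dist w z))}"
  have inj: "inj_on (mob z) T" using inj_on_mob[OF z] by (rule inj_on_subset) (use L1 in \<open>auto simp: T_def\<close>)
  have im: "mob z ` T = {a \<in> mob z ` L. exp (- N) < 1 - cmod a \<and>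
      1 - pseudo_dist a (mob z w) \<le> exp (- N) / (m\<^sup>2 * (1 - cmod (mob z w)))}"
    using pw by (auto simp: T_def pm)
  have "(\<Sum>a\<in>T. 1 - pseudo_dist a w) = (\<Sum>a\<in>mob z ` T. 1 - pseudo_dist a (mob z w))"
    by (subst sum.reindex[OF inj]) (rule sum.cong, use pw in \<open>auto simp: T_def\<close>)
  also have "\<dots> \<le> 64 / m * (C * (3 + 2 * N))"
    unfolding im by (rule sum_sideways_centred[OF separated_by_mob[OF L z] C mob_less_1[OF z w] N m]) (use x in \<open>simp_all add: pm\<close>)
  finally show ?thesis by (simp add: T_def)
qed

text \<open>Let \<open>w\<close> have depth \<Lambda> = - ln (1 - \<open>pseudo_dist w z\<close>).
  Apart from sideways points, the points of depth less than N seen from \<open>z\<close> have depth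
  at most about N - \<Lambda> seen from \<open>w\<close>, where the density bound applies. The depth
  allowance e1 N, from m^2 = exp (e1 N), makes the sideways part negligible; the third admits points
  \<open>w\<close> on the edges of holes.\<close>

lemma green_sum_outer:
  assumes L: "separated_by \<delta> L" and b: "b \<ge> 0" "C1 \<ge> 0" "\<And>w s. cmod w < 1 \<Longrightarrow> 0 \<le> s \<Longrightarrow> s < 1 \<Longrightarrow>
      (\<Sum>a\<in>{a \<in> L. pseudo_dist a w < s}. 1 - pseudo_dist a w) \<le> b * (- ln (1 - s)) + C1"
    and e: "\<epsilon> > 0" and c: "0 < c" "c \<le> 1"
  shows "eventually (\<lambda>N. \<forall>z w A. cmod z < 1 \<longrightarrow> cmod w < 1 \<longrightarrow> exp (- N) / 3 \<le> 1 - pseudo_dist w z \<longrightarrow>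
      finite A \<longrightarrow> A \<subseteq> L \<longrightarrow> (\<forall>a\<in>A. exp (- N) < 1 - pseudo_dist a z \<and> c \<le> pseudo_dist a w) \<longrightarrow>
      (\<Sum>a\<in>A. - ln (pseudo_dist a w)) \<le> b * (N + ln (1 - pseudo_dist w z)) + \<epsilon> * N) at_top"
proof -
  have d: "0 < \<delta>" using L by (simp add: separated_by_def)
  obtain C where C: "C > 0" "\<And>L w r. separated_by \<delta> L \<Longrightarrow> cmod w < 1 \<Longrightarrow> 0 \<le> r \<Longrightarrow> r < 1 \<Longrightarrow>
      (\<Sum>a\<in>{a \<in> L. pseudo_dist a w < r}. 1 - pseudo_dist a w) \<le> C * (1 - ln (1 - r))"
    using sum_pseudo_ball[OF d] by blast
  \<comment> \<open>The error terms e1 b N occur with total factor at most 3, so they use at most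
    half of \<epsilon> N.\<close>
  define e1 where "e1 = min 1 (\<epsilon> / (6 * (b + 1)))"
  have e1: "0 < e1" "e1 \<le> 1" "6 * (e1 * b) \<le> \<epsilon>"
  proof -
    show "0 < e1" "e1 \<le> 1" using e b by (auto simp: e1_def)
    have "e1 \<le> \<epsilon> / (6 * (b + 1))" by (simp add: e1_def)
    then have "e1 * (6 * (b + 1)) \<le> \<epsilon>" using b by (simp add: pos_le_divide_eq)
    then show "6 * (e1 * b) \<le> \<epsilon>" using \<open>0 < e1\<close> by (simp add: algebra_simps)
  qed
  obtain C2 where C2: "C2 > 0" "\<And>L w A. separated_by \<delta> L \<Longrightarrow> cmod w < 1 \<Longrightarrow> A \<subseteq> L \<Longrightarrow> finite A \<Longrightarrow>
     (\<And>a. a \<in> A \<Longrightarrow> c \<le> pseudo_dist a w) \<Longrightarrow>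
     (\<Sum>a\<in>A. - ln (pseudo_dist a w)) \<le> (1 + e1) * (\<Sum>a\<in>A. 1 - pseudo_dist a w) + C2"
    using green_sum_le[OF d e1(1) c] by blast
  have l1: "((\<lambda>N. (2 * C1 + C2 + 2 * (64 / exp (e1 / 2 * N) * (C * (3 + 2 * N)))) / N) \<longlongrightarrow> 0) at_top"
    using e1(1) by real_asymp
  have l2: "filterlim (\<lambda>N. exp (e1 / 2 * N)) at_top at_top" using e1(1) by real_asymp
  have "eventually (\<lambda>N. (2 * C1 + C2 + 2 * (64 / exp (e1 / 2 * N) * (C * (3 + 2 * N)))) / N < \<epsilon> / 2) at_top"
    using order_tendstoD(2)[OF l1, of "\<epsilon>/2"] e by simp
  moreover have "eventually (\<lambda>N. 4 \<le> exp (e1 / 2 * N)) at_top" using l2 by (simp add: filterlim_at_top)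
  moreover have "eventually (\<lambda>N::real. 1 \<le> N) at_top" by (rule eventually_ge_at_top)
  ultimately show ?thesis
  proof eventually_elim
    case (elim N)
    define m where "m = exp (e1 / 2 * N)"
    have m: "m \<ge> 4" and N: "N \<ge> 1" using elim by (auto simp: m_def)
    have Np: "N > 0" using N by linarith
    define R where "R = 64 / m * (C * (3 + 2 * N))"
    have R0: "0 \<le> R" using m N C by (simp add: R_def)
    have small: "2 * C1 + C2 + 2 * R \<le> \<epsilon> / 2 * N" using elim(1) N by (simp add: m_def R_def pos_divide_less_eq)
    show ?case
    proof (intro allI impI)
      fix z w A assume z: "cmod z < 1" and w: "cmod w < 1" and x: "exp (- N) / 3 \<le> 1 - pseudo_dist w z"
        and A: "finite A" "A \<subseteq> L" "\<forall>a\<in>A. exp (- N) < 1 - pseudo_dist a z \<and> c \<le> pseudo_dist a w"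
      define X where "X = 1 - pseudo_dist w z"
      define t where "t = exp (- N) / (m\<^sup>2 * X)"
      have X: "0 < X" "X \<le> 1" "exp (- N) / 3 \<le> X"
        using x pseudo_dist_less_1[OF w z] pseudo_dist_nonneg[of w z] by (auto simp: X_def)
      have t: "0 < t" "t \<le> 1"
      proof -
        show "0 < t" using X m by (simp add: t_def)
        have "16 \<le> m\<^sup>2" using power_mono[OF m, of 2] by simp
        then have "3 * X \<le> m\<^sup>2 * X" using X by (intro mult_right_mono) auto
        then have "exp (- N) \<le> m\<^sup>2 * X" using X(3) by linarith
        then show "t \<le> 1" using X m by (simp add: t_def)
      qed
      define A1 where "A1 = {a \<in> A. t < 1 - pseudo_dist a w}"
      have L1: "cmod a < 1" if "a \<in> L" for a using L that by (auto simp: separated_by_def)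
      have lnt: "- ln (1 - (1 - t)) = N + e1 * N + ln X"
        using X m by (simp add: t_def ln_div ln_mult ln_realpow) (simp add: m_def)
      have "(\<Sum>a\<in>A1. 1 - pseudo_dist a w) \<le> (\<Sum>a\<in>{a \<in> L. pseudo_dist a w < 1 - t}. 1 - pseudo_dist a w)"
        by (rule sum_mono2[OF finite_pseudo_ball[OF L w]]) (use t A in \<open>auto simp: A1_def\<close>)
      also have "\<dots> \<le> b * (N + e1 * N + ln X) + C1" using b(3)[OF w, of "1 - t", unfolded lnt] t by simp
      finally have S1: "(\<Sum>a\<in>A1. 1 - pseudo_dist a w) \<le> b * (N + e1 * N + ln X) + C1" .
      define T where "T = {a \<in> L. exp (- N) < 1 - pseudo_dist a z \<and> 1 - pseudo_dist a w \<le> exp (- N) / (m\<^sup>2 * (1 - pseudo_dist w z))}"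
      have fT: "finite T"
        by (rule finite_subset[OF _ finite_pseudo_ball[OF L z, of "1 - exp (- N)"]]) (auto simp: T_def)
      have "(\<Sum>a\<in>A - A1. 1 - pseudo_dist a w) \<le> (\<Sum>a\<in>T. 1 - pseudo_dist a w)"
        by (rule sum_mono2[OF fT])
           (use A L1 w pseudo_dist_less_1 in \<open>auto simp: A1_def T_def t_def X_def not_less less_imp_le\<close>)
      also have "\<dots> \<le> R" unfolding T_def R_def
        by (rule sum_sideways[OF L C(1) _ w z Np m x]) (rule C(2))
      finally have S2: "(\<Sum>a\<in>A - A1. 1 - pseudo_dist a w) \<le> R" .
      define S where "S = (\<Sum>a\<in>A. 1 - pseudo_dist a w)"
      have "S = (\<Sum>a\<in>A - A1. 1 - pseudo_dist a w) + (\<Sum>a\<in>A1. 1 - pseudo_dist a w)"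
        unfolding S_def by (rule sum.subset_diff) (use A in \<open>auto simp: A1_def\<close>)
      then have S: "S \<le> b * (N + e1 * N + ln X) + C1 + R" using S1 S2 by linarith
      have lX: "ln X \<le> 0" using X by simp
      have "(\<Sum>a\<in>A. - ln (pseudo_dist a w)) \<le> (1 + e1) * S + C2"
        unfolding S_def by (rule C2(2)[OF L w A(2,1)]) (use A in auto)
      also have "\<dots> \<le> (1 + e1) * (b * (N + e1 * N + ln X) + C1 + R) + C2"
        using S e1 by (intro add_right_mono mult_left_mono) auto
      also have "\<dots> = b * (N + ln X) + (e1 * b * (N + ln X) + (1 + e1) * (e1 * b * N)) + (1 + e1) * (C1 + R) + C2"
        by (simp add: algebra_simps)
      also have "\<dots> \<le> b * (N + ln X) + (e1 * b * N + 2 * (e1 * b * N)) + 2 * (C1 + R) + C2"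
        using e1 b R0 lX N by (intro add_mono mult_left_mono mult_right_mono order_refl) auto
      also have "\<dots> \<le> b * (N + ln X) + \<epsilon> * N"
      proof -
        have "6 * (e1 * b) * N \<le> \<epsilon> * N" using e1 N by (intro mult_right_mono) auto
        then show ?thesis using small by (simp add: algebra_simps)
      qed
      finally show "(\<Sum>a\<in>A. - ln (pseudo_dist a w)) \<le> b * (N + ln (1 - pseudo_dist w z)) + \<epsilon> * N"
        by (simp add: X_def)
    qed
  qed
qed

text \<open>If \<open>w\<close> is much shallower than the layer, the potential is harmonic on the
  disc of depth l - 1 about \<open>z\<close>, and the maximum principle carries the bound from its
  boundary, where \<Lambda> = l - 1, to \<open>w\<close>. The unit of depth keeps the layer away
  from this disc and costs \<open>b\<close>, which \<epsilon> N / 2 absorbs.\<close>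

lemma green_sum_layer:
  assumes L: "separated_by \<delta> L" and b: "b \<ge> 0" "C1 \<ge> 0" "\<And>w s. cmod w < 1 \<Longrightarrow> 0 \<le> s \<Longrightarrow> s < 1 \<Longrightarrow>
      (\<Sum>a\<in>{a \<in> L. pseudo_dist a w < s}. 1 - pseudo_dist a w) \<le> b * (- ln (1 - s)) + C1"
    and e: "\<epsilon> > 0" and c: "0 < c" "c \<le> 1/4"
  shows "eventually (\<lambda>N. \<forall>z w A l. cmod z < 1 \<longrightarrow> cmod w < 1 \<longrightarrow> exp (- N) / 3 \<le> 1 - pseudo_dist w z \<longrightarrow>
      0 \<le> l \<longrightarrow> l \<le> N \<longrightarrow> finite A \<longrightarrow> A \<subseteq> L \<longrightarrow>
      (\<forall>a\<in>A. exp (- N) < 1 - pseudo_dist a z \<and> 1 - pseudo_dist a z < exp (- l) \<and> c \<le> pseudo_dist a w) \<longrightarrow>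
      (\<Sum>a\<in>A. - ln (pseudo_dist a w)) \<le> b * (N - max l (- ln (1 - pseudo_dist w z))) + \<epsilon> * N) at_top"
proof -
  have "eventually (\<lambda>N. \<forall>z w A. cmod z < 1 \<longrightarrow> cmod w < 1 \<longrightarrow> exp (- N) / 3 \<le> 1 - pseudo_dist w z \<longrightarrow>
      finite A \<longrightarrow> A \<subseteq> L \<longrightarrow> (\<forall>a\<in>A. exp (- N) < 1 - pseudo_dist a z \<and> c \<le> pseudo_dist a w) \<longrightarrow>
      (\<Sum>a\<in>A. - ln (pseudo_dist a w)) \<le> b * (N + ln (1 - pseudo_dist w z)) + (\<epsilon>/2) * N) at_top"
    by (rule green_sum_outer[OF L b]) (use e c in auto)
  moreover have "eventually (\<lambda>N. 2 * b / \<epsilon> \<le> N) at_top" by (rule eventually_ge_at_top)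
  ultimately show ?thesis
  proof eventually_elim
    case (elim N)
    have bN: "b \<le> \<epsilon> / 2 * N" using elim(2) e by (simp add: pos_divide_le_eq mult.commute)
    show ?case
    proof (intro allI impI)
      fix z w A l assume z: "cmod z < 1" and w: "cmod w < 1" and x: "exp (- N) / 3 \<le> 1 - pseudo_dist w z"
        and l: "0 \<le> l" "l \<le> N"
        and A: "finite A" "A \<subseteq> L" "\<forall>a\<in>A. exp (- N) < 1 - pseudo_dist a z \<and> 1 - pseudo_dist a z < exp (- l) \<and> c \<le> pseudo_dist a w"
      have L1: "cmod a < 1" if "a \<in> A" for a using L that A by (auto simp: separated_by_def)
      define \<Lambda> where "\<Lambda> = - ln (1 - pseudo_dist w z)"
      have wz: "0 < 1 - pseudo_dist w z" using pseudo_dist_less_1[OF w z] by simp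
      have ex: "exp (- \<Lambda>) = 1 - pseudo_dist w z" using wz by (simp add: \<Lambda>_def)
      show "(\<Sum>a\<in>A. - ln (pseudo_dist a w)) \<le> b * (N - max l (- ln (1 - pseudo_dist w z))) + \<epsilon> * N"
      proof (cases "l - 1 \<le> \<Lambda>")
        case True
        have "(\<Sum>a\<in>A. - ln (pseudo_dist a w)) \<le> b * (N + ln (1 - pseudo_dist w z)) + (\<epsilon>/2) * N"
          using elim(1) z w x A by blast
        also have "\<dots> \<le> b * ((N - max l \<Lambda>) + 1) + (\<epsilon>/2) * N"
          using True b by (intro add_right_mono mult_left_mono) (auto simp: \<Lambda>_def)
        also have "\<dots> = b * (N - max l \<Lambda>) + (b + (\<epsilon>/2) * N)" by (simp add: algebra_simps)
        also have "\<dots> \<le> b * (N - max l \<Lambda>) + \<epsilon> * N" using bN by simp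
        finally show ?thesis by (simp add: \<Lambda>_def)
      next
        case False
        have \<Lambda>0: "0 \<le> \<Lambda>" using wz pseudo_dist_nonneg[of w z] by (simp add: \<Lambda>_def)
        have l1: "l > 1" using False \<Lambda>0 by simp
        define \<sigma> where "\<sigma> = 1 - exp (- (l - 1))"
        have \<sigma>: "0 < \<sigma>" "\<sigma> < 1" using l1 by (auto simp: \<sigma>_def)
        define B where "B = {x \<in> ball 0 1. pseudo_dist z x < \<sigma>}"
        define G where "G = (\<lambda>x. \<Sum>a\<in>A. - ln (pseudo_dist a x))"
        have czx: "continuous_on (cball 0 1) (pseudo_dist z)" by (rule continuous_on_pseudo_dist[OF z order_refl])
        have oB: "open B"
        proof -
          have "continuous_on (ball 0 1) (pseudo_dist z)" by (rule continuous_on_subset[OF czx]) auto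
          then have "open (pseudo_dist z -` {..<\<sigma>} \<inter> ball 0 1)"
            using continuous_on_open_vimage[of "ball 0 1" "pseudo_dist z"] by simp
          moreover have "pseudo_dist z -` {..<\<sigma>} \<inter> ball 0 1 = B" by (auto simp: B_def)
          ultimately show ?thesis by simp
        qed
        have c0: "closure B \<subseteq> cball 0 1" by (rule closure_minimal) (auto simp: B_def)
        have cB: "pseudo_dist z x \<le> \<sigma> \<and> cmod x < 1" if "x \<in> closure B" for x
        proof -
          have le: "pseudo_dist z x \<le> \<sigma>"
            by (rule continuous_le_on_closure[OF continuous_on_subset[OF czx c0] that]) (auto simp: B_def)
          have "cmod x \<noteq> 1" using pseudo_dist_boundary[OF z, of x] le \<sigma> by auto
          moreover have "cmod x \<le> 1" using c0 that by auto
          ultimately show ?thesis using le by simp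
        qed
        have far: "c \<le> pseudo_dist a x" if "a \<in> A" "cmod x < 1" "pseudo_dist z x \<le> \<sigma>" for a x
        proof (rule ccontr)
          assume "\<not> c \<le> pseudo_dist a x"
          then have ac: "pseudo_dist x a \<le> c" using pseudo_dist_commute[of a x] by simp
          \<comment> \<open>Since 3 e / 5 > 1, a point within c \<le> 1/4 of the disc of depth l - 1
            still has depth less than l, so it is outside the layer.\<close>
          have "exp (- (l - 1)) * (3/5) \<le> (1 - pseudo_dist z x) * ((1 - c) / (1 + c))"
          proof (rule mult_mono)
            show "exp (- (l - 1)) \<le> 1 - pseudo_dist z x" using that(3) by (simp add: \<sigma>_def)
            show "3/5 \<le> (1 - c) / (1 + c)" using c by (simp add: pos_le_divide_eq)
          qed (use that \<sigma> in auto)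
          also have "\<dots> \<le> 1 - pseudo_dist z a"
            by (rule one_minus_pseudo_dist_ge_near[OF z that(2) L1[OF that(1)] ac]) (use c in simp)
          also have "\<dots> < exp (- l)" using A(3) that(1) pseudo_dist_commute[of z a] by auto
          finally have "exp (- l) * (exp 1 * (3/5)) < exp (- l) * 1"
            by (simp add: exp_diff exp_minus field_simps)
          then have "exp 1 * (3/5) < (1::real)" by (subst (asm) mult_less_cancel_left_pos) auto
          then show False using exp_ge_add_one_self[of "1::real"] by simp
        qed
        have "G w \<le> b * (N - (l - 1)) + (\<epsilon>/2) * N"
        proof (rule har_max_principle[of G B])
          have "har (\<lambda>x. - 1 * (\<Sum>a\<in>A. ln (pseudo_dist a x))) B"
          proof (intro har_cmult har_sum oB har_ln_pseudo_dist L1)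
            fix a assume a: "a \<in> A"
            show "a \<notin> B"
            proof
              assume "a \<in> B"
              then have "c \<le> pseudo_dist a a" using far[OF a] by (auto simp: B_def)
              then show False using c by (simp add: pseudo_dist_def)
            qed
          qed (auto simp: B_def)
          then show "har G B" by (rule har_cong) (simp add: G_def sum_negf)
          show "bounded B" by (rule bounded_subset[of "ball 0 1"]) (auto simp: B_def)
          show "continuous_on (closure B) G" unfolding G_def
          proof (intro continuous_intros)
            fix a assume a: "a \<in> A"
            show "continuous_on (closure B) (pseudo_dist a)" by (rule continuous_on_pseudo_dist[OF L1[OF a] c0])
            show "\<forall>x\<in>closure B. pseudo_dist a x \<noteq> 0" using far[OF a] cB c by force
          qed
          have "exp (- (l - 1)) < 1 - pseudo_dist w z" using False unfolding ex[symmetric] by simp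
          then have "pseudo_dist z w < \<sigma>" using pseudo_dist_commute[of z w] by (simp add: \<sigma>_def)
          then show "w \<in> closure B" using w closure_subset[of B] by (auto simp: B_def)
          fix x assume xf: "x \<in> frontier B"
          then have xc: "x \<in> closure B" "x \<notin> B" using oB by (auto simp: frontier_def interior_open)
          note xB = cB[OF xc(1)]
          have e1: "1 - pseudo_dist x z = exp (- (l - 1))"
            using xc(2) xB pseudo_dist_commute[of z x] by (auto simp: B_def \<sigma>_def)
          have e2: "exp (- N) / 3 \<le> 1 - pseudo_dist x z"
          proof -
            have "exp (- N) \<le> exp (- (l - 1))" using l by simp
            moreover have "exp (- N) / 3 \<le> exp (- N)" by simp
            ultimately show ?thesis unfolding e1 by (rule order_trans[rotated])
          qed
          have "\<forall>a\<in>A. exp (- N) < 1 - pseudo_dist a z \<and> c \<le> pseudo_dist a x"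
            using A(3) far xB by blast
          then have "G x \<le> b * (N + ln (1 - pseudo_dist x z)) + (\<epsilon>/2) * N"
            unfolding G_def using elim(1) z xB e2 A(1,2) by blast
          then show "G x \<le> b * (N - (l - 1)) + (\<epsilon>/2) * N" unfolding e1 by (simp add: algebra_simps)
        qed
        also have "\<dots> = b * (N - l) + (b + (\<epsilon>/2) * N)" by (simp add: algebra_simps)
        also have "\<dots> \<le> b * (N - l) + \<epsilon> * N" using bN by simp
        also have "l = max l \<Lambda>" using False by simp
        finally show ?thesis by (simp add: G_def \<Lambda>_def)
      qed
    qed
  qed
qed

section \<open>Discretised exponential weights\<close>

context
  fixes b :: real and m :: nat
  assumes b: "0 \<le> b" and m: "1 \<le> m"
begin

text \<open>Step function approximation with \<open>m\<close> steps of the weight \<open>w(t) = exp (- b (1 - t))\<close>. The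
  function \<open>step_total\<close> is the corresponding discretization of the identity
  \<open>w(p) + b (w(p) (1 - p) + \<integral> (1 - t) dw(t)) = 1\<close>, the integral being over \<open>p < t < 1\<close>.\<close>

definition exp_step :: "nat \<Rightarrow> real" where
  "exp_step i = exp (- b * (1 - real i / real m))"

definition step_total :: "nat \<Rightarrow> real" where
  "step_total p = exp_step p + b * (exp_step p * (1 - real p / real m) +
     (\<Sum>i\<in>{Suc p..<m}. (exp_step i - exp_step (i - 1)) * (1 - real i / real m)))"

lemma exp_step_pos: "exp_step i > 0" by (simp add: exp_step_def)

lemma exp_step_Suc: "exp_step (Suc i) = exp_step i * exp (b / m)"
  by (simp add: exp_step_def algebra_simps add_divide_distrib flip: exp_add)

lemma exp_step_m: "exp_step m = 1" using m by (simp add: exp_step_def)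

lemma exp_step_mono: "i \<le> j \<Longrightarrow> exp_step i \<le> exp_step j"
  unfolding exp_step_def using b m by (auto intro!: mult_left_mono divide_right_mono)

lemma step_total_Suc:
  assumes "Suc p < m"
  shows "step_total (Suc p) - step_total p = exp_step (Suc p) - exp_step p - b / m * exp_step p"
proof -
  define s where "s = (\<Sum>i\<in>{Suc (Suc p)..<m}. (exp_step i - exp_step (i - 1)) * (1 - real i / real m))"
  have "(\<Sum>i\<in>{Suc p..<m}. (exp_step i - exp_step (i - 1)) * (1 - real i / real m)) =
      (exp_step (Suc p) - exp_step p) * (1 - real (Suc p) / real m) + s"
    using assms by (simp add: sum.atLeast_Suc_lessThan s_def)
  note sumeq = this
  define X where "X = 1 - real (Suc p) / real m"
  define Y where "Y = 1 - real p / real m"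
  have A: "step_total p = exp_step p + b * (exp_step p * Y + ((exp_step (Suc p) - exp_step p) * X + s))"
    unfolding step_total_def sumeq X_def Y_def ..
  have B: "step_total (Suc p) = exp_step (Suc p) + b * (exp_step (Suc p) * X + s)"
    unfolding step_total_def s_def X_def ..
  have XY: "X = Y - 1 / m" unfolding X_def Y_def by (simp add: add_divide_distrib)
  have "step_total (Suc p) - step_total p = exp_step (Suc p) - exp_step p + b * (exp_step p * (X - Y))"
    unfolding A B by (simp add: algebra_simps)
  also have "X - Y = - 1 / m" by (simp add: XY)
  finally show ?thesis by simp
qed

lemma step_total_last: "step_total (m - 1) = exp (- (b / m)) * (1 + b / m)"
proof -
  have *: "1 - real (m - 1) / real m = 1 / m" using m by (simp add: field_simps of_nat_diff)
  show ?thesis using m unfolding step_total_def exp_step_def * by (simp add: algebra_simps)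
qed

text \<open>With x = b / m each increment is \<open>exp_step p\<close> times exp x - 1 - x, which is
  nonnegative, so the total increases up to its last value (1 + x) exp (- x) \<le> 1.\<close>

lemma step_total_le:
  assumes "p < m"
  shows "step_total p \<le> 1"
proof -
  have "p \<le> m - 1" using assms by simp
  then show ?thesis
  proof (induction p rule: inc_induct)
    case base
    have "exp (- (b / m)) * (1 + b / m) \<le> exp (- (b / m)) * exp (b / m)"
      by (intro mult_left_mono exp_ge_add_one_self) simp
    also have "\<dots> = 1" by (simp flip: exp_add)
    finally show ?case unfolding step_total_last .
  next
    case (step p)
    have "0 \<le> exp_step p * (exp (b / m) - (1 + b / m))"
      using exp_step_pos[of p] exp_ge_add_one_self[of "b/m"] by (intro mult_nonneg_nonneg) linarith+
    also have "\<dots> = step_total (Suc p) - step_total p"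
      using step(2) by (subst step_total_Suc) (auto simp: exp_step_Suc algebra_simps)
    finally show ?case using step by simp
  qed
qed

text \<open>With x = b / m, each increment and the defect of the last value are at most x^2; m such
  errors add up to b^2 / m.\<close>

lemma step_total_ge:
  assumes bm: "b \<le> m"
  shows "1 - b\<^sup>2 / m \<le> step_total 0"
proof -
  define x where "x = b / m"
  have x: "0 \<le> x" "x \<le> 1" using b m bm by (auto simp: x_def)
  have "1 - x\<^sup>2 * real (m - p) \<le> step_total p" if "p \<le> m - 1" for p
    using that
  proof (induction p rule: inc_induct)
    case base
    have "1 - x\<^sup>2 = (1 - x) * (1 + x)" by (simp add: power2_eq_square algebra_simps)
    also have "\<dots> \<le> exp (- x) * (1 + x)"
      using x exp_ge_add_one_self[of "- x"] by (intro mult_right_mono) auto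
    finally show ?case using m unfolding step_total_last x_def[symmetric] by simp
  next
    case (step p)
    have "exp_step p \<le> 1" using exp_step_mono[of p m] exp_step_m step by simp
    have "exp_step p * (exp x - (1 + x)) \<le> 1 * x\<^sup>2"
      using exp_bound[OF x] exp_step_pos[of p] \<open>exp_step p \<le> 1\<close> exp_ge_add_one_self[of x]
      by (intro mult_mono) linarith+
    moreover have "exp_step p * (exp x - (1 + x)) = step_total (Suc p) - step_total p"
      using step(2) by (subst step_total_Suc) (auto simp: exp_step_Suc algebra_simps x_def)
    moreover have "x\<^sup>2 * real (m - p) = x\<^sup>2 * real (m - Suc p) + x\<^sup>2"
      using step(2) by (simp add: of_nat_diff algebra_simps)
    ultimately show ?case using step(3) by linarith
  qed
  from this[of 0] have "1 - x\<^sup>2 * real (m - 0) \<le> step_total 0" by simp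
  moreover have "x\<^sup>2 * real (m - 0) = b\<^sup>2 / m" using m by (simp add: x_def power2_eq_square)
  ultimately show ?thesis by simp
qed

lemma exp_step_telescope: "exp_step 0 + (\<Sum>i\<in>{1..<Suc p}. exp_step i - exp_step (i - 1)) = exp_step p"
  by (induction p) simp_all

text \<open>Weights increasing with the level of the point; the sum is organised by thresholds so that only
  upper bounds for the outer layers of the sequence are needed.\<close>

definition step_weight :: "(nat \<Rightarrow> 'a \<Rightarrow> bool) \<Rightarrow> 'a \<Rightarrow> real" where
  "step_weight P a = exp_step 0 + (\<Sum>i\<in>{1..<m}. (exp_step i - exp_step (i - 1)) * (if P i a then 1 else 0))"

text \<open>Summation by parts: each increment of the weight is charged to the layer of points
  beyond its threshold.\<close>

lemma sum_step_weight:
  assumes "finite A"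
  shows "(\<Sum>a\<in>A. step_weight P a * g a) =
    exp_step 0 * (\<Sum>a\<in>A. g a) + (\<Sum>i\<in>{1..<m}. (exp_step i - exp_step (i - 1)) * (\<Sum>a\<in>{a\<in>A. P i a}. g a))"
proof -
  have "(\<Sum>a\<in>A. step_weight P a * g a) =
     (\<Sum>a\<in>A. exp_step 0 * g a) + (\<Sum>a\<in>A. \<Sum>i\<in>{1..<m}. (exp_step i - exp_step (i - 1)) * ((if P i a then 1 else 0) * g a))"
    by (simp add: step_weight_def distrib_right sum.distrib sum_distrib_right mult.assoc)
  also have "(\<Sum>a\<in>A. \<Sum>i\<in>{1..<m}. (exp_step i - exp_step (i - 1)) * ((if P i a then 1 else 0) * g a)) =
     (\<Sum>i\<in>{1..<m}. (exp_step i - exp_step (i - 1)) * (\<Sum>a\<in>A. (if P i a then 1 else 0) * g a))"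
    by (subst sum.swap) (simp add: sum_distrib_left)
  finally have 1: "(\<Sum>a\<in>A. step_weight P a * g a) =
     (\<Sum>a\<in>A. exp_step 0 * g a) + (\<Sum>i\<in>{1..<m}. (exp_step i - exp_step (i - 1)) * (\<Sum>a\<in>A. (if P i a then 1 else 0) * g a))" .
  have 2: "(\<Sum>a\<in>A. (if P i a then 1 else 0) * g a) = (\<Sum>a\<in>{a\<in>A. P i a}. g a)" for i
    using assms by (intro sum.mono_neutral_cong_right) auto
  show ?thesis unfolding 1 2 by (simp add: sum_distrib_left)
qed

lemma step_weight_nonneg: "0 \<le> step_weight P a"
  unfolding step_weight_def using exp_step_pos[of 0] exp_step_mono
  by (intro add_nonneg_nonneg sum_nonneg mult_nonneg_nonneg) (auto simp: less_imp_le)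

lemma step_weight_eq:
  assumes p: "p < m" and P: "\<And>i. i \<in> {1..<m} \<Longrightarrow> P i a \<longleftrightarrow> i \<le> p"
  shows "step_weight P a = exp_step p"
proof -
  have "(\<Sum>i\<in>{1..<m}. (exp_step i - exp_step (i - 1)) * (if P i a then 1 else 0)) =
     (\<Sum>i\<in>{1..<Suc p}. exp_step i - exp_step (i - 1))"
    using p P by (intro sum.mono_neutral_cong_right) auto
  then show ?thesis by (simp only: step_weight_def exp_step_telescope)
qed

text \<open>This is the potential at a hole of level \<open>p\<close>: the hole itself gives
  \<open>exp_step p\<close> N, layers with threshold at most \<open>p\<close> are bounded by their
  size beyond \<open>p\<close>, and deeper ones by their full size. The bounds assemble to N
  \<open>step_total p\<close>, and the errors telescope to at most \<open>E\<close>.\<close>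

lemma layer_sum_le:
  assumes p: "p < m" and G0: "G 0 \<le> N * b * (1 - real p / m) + E"
    and G1: "\<And>i. i \<in> {1..<m} \<Longrightarrow> i \<le> p \<Longrightarrow> G i \<le> N * b * (1 - real p / m) + E"
    and G2: "\<And>i. i \<in> {1..<m} \<Longrightarrow> p < i \<Longrightarrow> G i \<le> N * b * (1 - real i / m) + E"
    and E: "0 \<le> E" and N: "0 \<le> N"
  shows "exp_step p * N + (exp_step 0 * G 0 + (\<Sum>i\<in>{1..<m}. (exp_step i - exp_step (i - 1)) * G i)) \<le> N + E"
proof -
  have D: "0 \<le> exp_step i - exp_step (i - 1)" for i using exp_step_mono[of "i - 1" i] by simp
  define q where "q = N * b * (1 - real p / m) + E"
  have split: "{1..<m} = {1..<Suc p} \<union> {Suc p..<m}" using p by auto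
  have dis: "{1..<Suc p} \<inter> {Suc p..<m} = {}" by auto
  have "(\<Sum>i\<in>{1..<m}. (exp_step i - exp_step (i - 1)) * G i) =
     (\<Sum>i\<in>{1..<Suc p}. (exp_step i - exp_step (i - 1)) * G i) + (\<Sum>i\<in>{Suc p..<m}. (exp_step i - exp_step (i - 1)) * G i)"
    unfolding split by (rule sum.union_disjoint) (use dis in auto)
  also have "\<dots> \<le> (\<Sum>i\<in>{1..<Suc p}. (exp_step i - exp_step (i - 1)) * q) +
     (\<Sum>i\<in>{Suc p..<m}. (exp_step i - exp_step (i - 1)) * (N * b * (1 - real i / m) + E))"
    using D G1 G2 p by (intro add_mono sum_mono mult_left_mono) (auto simp: q_def)
  also have "(\<Sum>i\<in>{1..<Suc p}. (exp_step i - exp_step (i - 1)) * q) = (exp_step p - exp_step 0) * q"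
    using exp_step_telescope[of p] by (simp flip: sum_distrib_right)
  also have "(\<Sum>i\<in>{Suc p..<m}. (exp_step i - exp_step (i - 1)) * (N * b * (1 - real i / m) + E)) =
     N * b * (\<Sum>i\<in>{Suc p..<m}. (exp_step i - exp_step (i - 1)) * (1 - real i / m)) +
     (\<Sum>i\<in>{Suc p..<m}. exp_step i - exp_step (i - 1)) * E"
    by (simp add: distrib_left sum.distrib sum_distrib_left sum_distrib_right mult_ac)
  also have "(\<Sum>i\<in>{Suc p..<m}. exp_step i - exp_step (i - 1)) = exp_step (m - 1) - exp_step p"
  proof -
    have "exp_step 0 + (\<Sum>i\<in>{1..<Suc (m - 1)}. exp_step i - exp_step (i - 1)) = exp_step (m - 1)"
      by (rule exp_step_telescope)
    moreover have "(\<Sum>i\<in>{1..<Suc (m - 1)}. exp_step i - exp_step (i - 1)) =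
       (\<Sum>i\<in>{1..<Suc p}. exp_step i - exp_step (i - 1)) + (\<Sum>i\<in>{Suc p..<m}. exp_step i - exp_step (i - 1))"
      using split dis m by (simp add: sum.union_disjoint)
    ultimately show ?thesis using exp_step_telescope[of p] by simp
  qed
  finally have 1: "(\<Sum>i\<in>{1..<m}. (exp_step i - exp_step (i - 1)) * G i) \<le>
     (exp_step p - exp_step 0) * q + (N * b * (\<Sum>i\<in>{Suc p..<m}. (exp_step i - exp_step (i - 1)) * (1 - real i / m)) +
      (exp_step (m - 1) - exp_step p) * E)" .
  have 2: "exp_step 0 * G 0 \<le> exp_step 0 * q"
    using G0 exp_step_pos[of 0] by (intro mult_left_mono) (auto simp: q_def)
  define s where "s = (\<Sum>i\<in>{Suc p..<m}. (exp_step i - exp_step (i - 1)) * (1 - real i / m))"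
  have "exp_step p * N + (exp_step 0 * G 0 + (\<Sum>i\<in>{1..<m}. (exp_step i - exp_step (i - 1)) * G i)) \<le>
     exp_step p * N + (exp_step 0 * q + ((exp_step p - exp_step 0) * q + (N * b * s + (exp_step (m - 1) - exp_step p) * E)))"
    using 1 2 unfolding s_def by simp
  also have "\<dots> = N * step_total p + exp_step (m - 1) * E"
  proof -
    define Y where "Y = 1 - real p / m"
    show ?thesis unfolding q_def step_total_def s_def[symmetric] Y_def[symmetric] by (simp add: algebra_simps)
  qed
  also have "\<dots> \<le> N * 1 + 1 * E"
  proof (intro add_mono mult_left_mono mult_right_mono)
    show "exp_step (m - 1) \<le> 1" using exp_step_mono[of "m - 1" m] exp_step_m by simp
  qed (use step_total_le[OF p] N E in auto)
  finally show ?thesis by simp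
qed

text \<open>The corresponding sum at the centre, of level 0 and without an own term: the lower
  bounds assemble to N (\<open>step_total 0\<close> - \<open>exp_step 0\<close>), and
  \<open>exp_step 0\<close> = exp (- b).\<close>

lemma layer_sum_ge:
  assumes bm: "b \<le> m" and G: "\<And>i. i < m \<Longrightarrow> N * b * (1 - real i / m) - E \<le> G i"
    and E: "0 \<le> E" and N: "0 \<le> N"
  shows "N * (1 - b\<^sup>2 / m - exp (- b)) - E \<le> exp_step 0 * G 0 + (\<Sum>i\<in>{1..<m}. (exp_step i - exp_step (i - 1)) * G i)"
proof -
  have D: "0 \<le> exp_step i - exp_step (i - 1)" for i using exp_step_mono[of "i - 1" i] by simp
  define s where "s = (\<Sum>i\<in>{1..<m}. (exp_step i - exp_step (i - 1)) * (1 - real i / m))"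
  have tel: "(\<Sum>i\<in>{1..<m}. exp_step i - exp_step (i - 1)) = exp_step (m - 1) - exp_step 0"
    using exp_step_telescope[of "m - 1"] m by simp
  have e0: "exp_step 0 = exp (- b)" by (simp add: exp_step_def)
  have "N * (1 - b\<^sup>2 / m - exp (- b)) - E \<le> N * (step_total 0 - exp_step 0) - exp_step (m - 1) * E"
  proof (rule diff_mono)
    have "1 - b\<^sup>2 / m - exp (- b) \<le> step_total 0 - exp_step 0" using step_total_ge[OF bm] e0 by simp
    then show "N * (1 - b\<^sup>2 / m - exp (- b)) \<le> N * (step_total 0 - exp_step 0)" using N by (rule mult_left_mono)
    have "exp_step (m - 1) \<le> 1" using exp_step_mono[of "m - 1" m] exp_step_m by simp
    then show "exp_step (m - 1) * E \<le> E" using E exp_step_pos[of "m - 1"] by (simp add: mult_left_le_one_le)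
  qed
  also have "\<dots> = exp_step 0 * (N * b * (1 - real 0 / m) - E) + (N * b * s - (exp_step (m - 1) - exp_step 0) * E)"
    by (simp add: step_total_def s_def algebra_simps)
  also have "N * b * s - (exp_step (m - 1) - exp_step 0) * E =
      (\<Sum>i\<in>{1..<m}. (exp_step i - exp_step (i - 1)) * (N * b * (1 - real i / m) - E))"
  proof -
    have *: "N * b * (\<Sum>i\<in>I. d i * y i) - (\<Sum>i\<in>I. d i) * E = (\<Sum>i\<in>I. d i * (N * b * y i - E))"
      for d y :: "nat \<Rightarrow> real" and I
      by (simp add: right_diff_distrib sum_subtractf sum_distrib_left sum_distrib_right mult_ac)
    show ?thesis unfolding s_def tel[symmetric] by (rule *)
  qed
  also have "exp_step 0 * (N * b * (1 - real 0 / m) - E) + \<dots> \<le>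
      exp_step 0 * G 0 + (\<Sum>i\<in>{1..<m}. (exp_step i - exp_step (i - 1)) * G i)"
    using D exp_step_pos[of 0] G G[of 0] m by (intro add_mono sum_mono mult_left_mono) auto
  finally show ?thesis .
qed

end

text \<open>Compare \<open>u\<close> with \<open>v\<close> = 1 - (weighted potential) / N. On the
  circle \<open>v\<close> = 1; at the holes \<open>v\<close> \<ge> - \<eta> by the upper bounds for
  the layers seen from a hole; at \<open>z\<close> the lower bounds for the layers push
  \<open>v\<close> down to exp (- b) up to errors. Upper and lower bounds carry the same
  \<open>b\<close>, so the centre has to be nearly extremal.\<close>

lemma potential_upper_bound:
  assumes L: "separated_by \<delta> L" and z: "cmod z < 1" and r: "1/2 \<le> r" "r < 1" and u: "circle_solution L z r u"
    and N: "N = - ln (1 - r)" and small: "1 - r \<le> \<delta> / 4" and b: "0 \<le> b" and m: "1 \<le> m" "b \<le> real m" and e: "0 \<le> e" and E: "0 \<le> E"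
    and layer: "\<And>w A l. cmod w < 1 \<Longrightarrow> exp (- N) / 3 \<le> 1 - pseudo_dist w z \<Longrightarrow>
      0 \<le> l \<Longrightarrow> l \<le> N \<Longrightarrow> finite A \<Longrightarrow> A \<subseteq> L \<Longrightarrow>
      (\<And>a. a \<in> A \<Longrightarrow> exp (- N) < 1 - pseudo_dist a z \<and> 1 - pseudo_dist a z < exp (- l) \<and> \<delta> / 2 \<le> pseudo_dist a w) \<Longrightarrow>
      (\<Sum>a\<in>A. - ln (pseudo_dist a w)) \<le> b * (N - max l (- ln (1 - pseudo_dist w z))) + e * N"
    and T: "\<And>l. 0 \<le> l \<Longrightarrow> l \<le> N \<Longrightarrow>
      b * (N - l) - E \<le> (\<Sum>a\<in>{a \<in> holes L z r. 1 - pseudo_dist a z < exp (- l)}. 1 - pseudo_dist a z)"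
  shows "u z \<le> exp (- b) + b\<^sup>2 / m + E / N + 2 * b / N + e"
proof -
  define J where "J = holes L z r"
  define \<Omega> where "\<Omega> = Omega L z r"
  have d: "0 < \<delta>" "\<delta> \<le> 1/2" using L by (auto simp: separated_by_def)
  have fJ: "finite J" unfolding J_def by (rule finite_holes[OF L z r(2)])
  have J1: "cmod a < 1" "a \<in> L" "1/2 < pseudo_dist a z" "pseudo_dist a z < r" if "a \<in> J" for a
    using holes_less_1[OF L] that by (auto simp: J_def holes_def)
  have Np: "N > 0" using r by (simp add: N)
  have er: "exp (- N) = 1 - r" using r by (simp add: N)
  have oO: "open \<Omega>" using u har_open by (auto simp: circle_solution_def \<Omega>_def)
  define lev where "lev = (\<lambda>i::nat. real i * N / real m)"
  define P where "P = (\<lambda>i a. 1 - pseudo_dist a z < exp (- lev i))"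
  define W where "W = step_weight b m P"
  define v where "v = (\<lambda>w. 1 + - (1 / N) * (\<Sum>a\<in>J. W a * - ln (pseudo_dist a w)))"
  define \<eta> where "\<eta> = 2 * b / N + e"
  have lev: "0 \<le> lev i" "i \<le> m \<Longrightarrow> lev i \<le> N" for i
    using Np m by (auto simp: lev_def pos_divide_le_eq mult_right_mono)
  have levb: "b * (N - lev i) = N * b * (1 - real i / m)" for i
    using m by (simp add: lev_def field_simps)
  have lev0: "lev 0 = 0" by (simp add: lev_def)
  have P0: "P 0 a" if "a \<in> J" for a using J1[OF that] by (simp add: P_def lev0)
  have Pmono: "P i a" if "P j a" "i \<le> j" for i j a
  proof -
    have "lev i \<le> lev j" using that(2) Np m by (simp add: lev_def divide_right_mono mult_right_mono)
    then have "exp (- lev j) \<le> exp (- lev i)" by simp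
    then show ?thesis using that(1) unfolding P_def by linarith
  qed
  have clO: "cmod w \<le> 1 \<and> (\<forall>a\<in>J. 1 - r \<le> pseudo_dist a w)" if "w \<in> closure \<Omega>" for w
    using closure_Omega[OF L, of w z r] that by (auto simp: \<Omega>_def J_def)
  have hole: "- \<eta> \<le> v w" if w: "cmod w < 1" "k \<in> J" "pseudo_dist k w = 1 - r" for w k
  proof -
    note k1 = J1[OF w(2)]
    define A where "A = J - {k}"
    have far: "\<delta> / 2 \<le> pseudo_dist a w" if "a \<in> A" for a
    proof -
      have a: "a \<in> J" "a \<noteq> k" using that by (auto simp: A_def)
      have "\<delta> \<le> pseudo_dist a k" using L J1[OF a(1)] k1 a(2) by (auto simp: separated_by_def)
      also have "\<dots> \<le> pseudo_dist a w + pseudo_dist w k"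
        by (rule pseudo_dist_triangle[OF J1(1)[OF a(1)] w(1) k1(1)])
      finally show ?thesis using w(3) small d pseudo_dist_commute[of w k] by linarith
    qed
    define x where "x = 1 - pseudo_dist w z"
    have q: "1/3 \<le> (1 - (1 - r)) / (1 + (1 - r))" using r by (simp add: pos_le_divide_eq)
    have x1: "(1 - r) / 3 \<le> x"
    proof -
      have "(1 - r) * (1/3) \<le> (1 - pseudo_dist z k) * ((1 - (1 - r)) / (1 + (1 - r)))"
        using k1 r q pseudo_dist_commute[of z k] by (intro mult_mono) auto
      also have "\<dots> \<le> 1 - pseudo_dist z w"
        by (rule one_minus_pseudo_dist_ge_near[OF z k1(1) w(1)]) (use w(3) r in auto)
      finally show ?thesis by (simp add: x_def pseudo_dist_commute[of z w])
    qed
    have x0: "0 < x" using x1 r by simp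
    define kk where "kk = 1 - pseudo_dist k z"
    have kk: "0 < kk" using k1 r by (simp add: kk_def)
    have x2: "x \<le> 3 * kk"
    proof -
      have "x * (1/3) \<le> (1 - pseudo_dist z w) * ((1 - (1 - r)) / (1 + (1 - r)))"
        using q x0 pseudo_dist_commute[of z w] by (intro mult_mono) (auto simp: x_def)
      also have "\<dots> \<le> 1 - pseudo_dist z k"
        by (rule one_minus_pseudo_dist_ge_near[OF z w(1) k1(1)]) (use w(3) r pseudo_dist_commute[of w k] in auto)
      finally show ?thesis by (simp add: kk_def pseudo_dist_commute[of z k])
    qed
    define \<Lambda> where "\<Lambda> = - ln x"
    have ln3: "ln (3::real) \<le> 2"
    proof -
      have "ln (3::real) \<le> ln 6" by (intro ln_mono) auto
      then show ?thesis by (rule order_trans[OF _ ln_6_le_2])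
    qed
    \<comment> \<open>The edge point \<open>w\<close> is shallower than the centre \<open>k\<close>
      of its hole by at most ln 3 \<le> 2, which costs the term 2 b / N.\<close>
    have "ln x \<le> ln (3 * kk)" using x2 x0 by (intro ln_mono) auto
    also have "\<dots> = ln 3 + ln kk" using kk by (simp add: ln_mult)
    finally have \<Lambda>k: "- ln kk - 2 \<le> \<Lambda>" using ln3 by (simp add: \<Lambda>_def)
    define G where "G = (\<lambda>i. \<Sum>a\<in>{a\<in>A. P i a}. - ln (pseudo_dist a w))"
    have G: "G i \<le> b * (N - max (lev i) \<Lambda>) + e * N" if i: "i \<le> m" for i
      unfolding G_def \<Lambda>_def x_def
    proof (rule layer)
      show "exp (- N) / 3 \<le> 1 - pseudo_dist w z" using x1 by (simp add: er x_def)
      show "finite {a \<in> A. P i a}" using fJ by (simp add: A_def)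
      show "{a \<in> A. P i a} \<subseteq> L" using J1 by (auto simp: A_def)
      show "exp (- N) < 1 - pseudo_dist a z \<and> 1 - pseudo_dist a z < exp (- lev i) \<and> \<delta> / 2 \<le> pseudo_dist a w"
        if "a \<in> {a \<in> A. P i a}" for a
        using that far J1[of a] by (auto simp: er P_def A_def)
    qed (use w lev i in auto)
    define S where "S = {i \<in> {..<m}. P i k}"
    have S: "finite S" "0 \<in> S" using P0[OF w(2)] m by (auto simp: S_def)
    \<comment> \<open>The deepest threshold passed by \<open>k\<close>, so that the weight of
      \<open>k\<close> is \<open>exp_step p\<close>; threshold 0 is always passed.\<close>
    define p where "p = Max S"
    have "p \<in> S" unfolding p_def by (rule Max_in) (use S in auto)
    then have p: "p < m" "P p k" by (auto simp: S_def)
    have Pp: "P i k \<longleftrightarrow> i \<le> p" if "i \<in> {1..<m}" for i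
    proof
      assume "P i k"
      then have "i \<in> S" using that by (simp add: S_def)
      then show "i \<le> p" unfolding p_def using S(1) by simp
    qed (use Pmono p in blast)
    have Wk: "W k = exp_step b m p" unfolding W_def by (rule step_weight_eq[OF b m(1) p(1)]) (rule Pp)
    have "kk < exp (- lev p)" using p(2) by (simp add: P_def kk_def)
    then have "ln kk < - lev p" using kk by (metis exp_gt_zero ln_exp ln_less_cancel_iff)
    then have \<Lambda>p: "lev p - 2 \<le> \<Lambda>" using \<Lambda>k by linarith
    define B where "B = 2 * b + e * N"
    have B: "0 \<le> B" using b e Np by (simp add: B_def)
    have Gp: "G i \<le> N * b * (1 - real p / m) + B" if i: "i \<le> m" for i
    proof -
      have "b * (N - max (lev i) \<Lambda>) \<le> b * ((N - lev p) + 2)" using \<Lambda>p b by (intro mult_left_mono) auto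
      also have "\<dots> = N * b * (1 - real p / m) + 2 * b" by (simp add: distrib_left levb)
      finally show ?thesis using G[OF i] by (simp add: B_def)
    qed
    have Gi: "G i \<le> N * b * (1 - real i / m) + B" if i: "i \<le> m" for i
    proof -
      have "b * (N - max (lev i) \<Lambda>) \<le> b * (N - lev i)" using b by (intro mult_left_mono) auto
      then show ?thesis using G[OF i] b unfolding levb B_def by linarith
    qed
    have fA: "finite A" using fJ by (simp add: A_def)
    have G0: "(\<Sum>a\<in>A. - ln (pseudo_dist a w)) = G 0"
      unfolding G_def by (rule sum.cong) (use P0 in \<open>auto simp: A_def\<close>)
    have "(\<Sum>a\<in>J. W a * - ln (pseudo_dist a w)) = W k * - ln (pseudo_dist k w) + (\<Sum>a\<in>A. W a * - ln (pseudo_dist a w))"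
      unfolding A_def by (rule sum.remove[OF fJ w(2)])
    also have "W k * - ln (pseudo_dist k w) = exp_step b m p * N" by (simp add: Wk w(3) N)
    also have "(\<Sum>a\<in>A. W a * - ln (pseudo_dist a w)) =
       exp_step b m 0 * G 0 + (\<Sum>i\<in>{1..<m}. (exp_step b m i - exp_step b m (i - 1)) * G i)"
      unfolding W_def by (subst sum_step_weight[OF b m(1) fA]) (simp only: G0, simp add: G_def)
    also have "exp_step b m p * N + \<dots> \<le> N + B"
      by (rule layer_sum_le[OF b m(1) p(1)]) (use Gp Gi B Np m in auto)
    finally have "(\<Sum>a\<in>J. W a * - ln (pseudo_dist a w)) \<le> N + B" .
    then have "(1 / N) * (\<Sum>a\<in>J. W a * - ln (pseudo_dist a w)) \<le> (1 / N) * (N + B)"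
      using Np by (intro mult_left_mono) auto
    also have "\<dots> = 1 + (2 * b / N + e)" using Np by (simp add: B_def add_divide_distrib)
    finally show ?thesis by (simp add: v_def \<eta>_def)
  qed
  have hv: "har v \<Omega>" unfolding v_def
  proof (intro har_add har_const har_cmult har_sum oO har_minus)
    fix a assume a: "a \<in> J"
    show "har (\<lambda>w. ln (pseudo_dist a w)) \<Omega>"
    proof (intro har_ln_pseudo_dist J1[OF a] oO)
      have "pseudo_dist a a = 0" by (simp add: pseudo_dist_def)
      then have "a \<in> pseudo_cball a (1 - r)" using J1(1)[OF a] r by (simp add: pseudo_cball_def)
      then show "a \<notin> \<Omega>" using a by (auto simp: \<Omega>_def Omega_holes J_def)
    qed (auto simp: \<Omega>_def Omega_holes)
  qed
  have cv: "continuous_on (closure \<Omega>) v"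
    unfolding v_def
  proof (intro continuous_intros)
    fix a assume a: "a \<in> J"
    have "closure \<Omega> \<subseteq> cball 0 1" using clO by auto
    then show "continuous_on (closure \<Omega>) (pseudo_dist a)" by (rule continuous_on_pseudo_dist[OF J1(1)[OF a]])
    show "\<forall>x\<in>closure \<Omega>. pseudo_dist a x \<noteq> 0" using clO a r by force
  qed
  have "u z - v z \<le> \<eta>"
  proof (rule har_max_principle[of "\<lambda>w. u w - v w" \<Omega>])
    show "har (\<lambda>w. u w - v w) \<Omega>" using u hv by (intro har_diff) (auto simp: circle_solution_def \<Omega>_def)
    show "bounded \<Omega>" unfolding \<Omega>_def by (rule bounded_Omega)
    show "continuous_on (closure \<Omega>) (\<lambda>w. u w - v w)" using u cv by (intro continuous_intros) (auto simp: circle_solution_def \<Omega>_def)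
    show "z \<in> closure \<Omega>" using z_in_Omega[OF z r(1)] closure_subset by (auto simp: \<Omega>_def)
    fix w assume w: "w \<in> frontier \<Omega>"
    then have wc: "cmod w \<le> 1" using clO by (simp add: frontier_def)
    have \<eta>0: "0 \<le> \<eta>" using b Np e by (simp add: \<eta>_def)
    show "u w - v w \<le> \<eta>"
    proof (cases "cmod w = 1")
      case True
      then have "v w = 1" using pseudo_dist_boundary[OF J1(1) True] by (simp add: v_def)
      then show ?thesis using u True \<eta>0 by (simp add: circle_solution_def)
    next
      case False
      then have w1: "cmod w < 1" using wc by simp
      obtain a where "a \<in> J" "pseudo_dist a w = 1 - r"
        using frontier_Omega[OF L w[unfolded \<Omega>_def] oO[unfolded \<Omega>_def] w1] by (auto simp: J_def)
      moreover have "u w = 0" using u w w1 by (simp add: circle_solution_def \<Omega>_def)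
      ultimately show ?thesis using hole[OF w1] by force
    qed
  qed
  moreover have "v z \<le> exp (- b) + b\<^sup>2 / m + E / N"
  proof -
    define G where "G = (\<lambda>i. \<Sum>a\<in>{a\<in>J. P i a}. 1 - pseudo_dist a z)"
    have "N * (1 - b\<^sup>2 / m - exp (- b)) - E \<le>
        exp_step b m 0 * G 0 + (\<Sum>i\<in>{1..<m}. (exp_step b m i - exp_step b m (i - 1)) * G i)"
    proof (rule layer_sum_ge[OF b m(1,2)])
      show "N * b * (1 - real i / m) - E \<le> G i" if "i < m" for i
        using T[of "lev i"] lev[of i] that unfolding levb by (simp add: G_def P_def J_def)
    qed (use E Np in auto)
    also have "\<dots> = (\<Sum>a\<in>J. W a * (1 - pseudo_dist a z))"
    proof -
      have "(\<Sum>a\<in>J. 1 - pseudo_dist a z) = G 0" unfolding G_def by (rule sum.cong) (use P0 in auto)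
      then show ?thesis unfolding W_def by (subst sum_step_weight[OF b m(1) fJ]) (simp add: G_def)
    qed
    also have "\<dots> \<le> (\<Sum>a\<in>J. W a * - ln (pseudo_dist a z))"
    proof (rule sum_mono, rule mult_left_mono)
      fix a assume a: "a \<in> J"
      have "ln (pseudo_dist a z) \<le> pseudo_dist a z - 1" using J1[OF a] by (intro ln_le_minus_one) auto
      then show "1 - pseudo_dist a z \<le> - ln (pseudo_dist a z)" by simp
      show "0 \<le> W a" unfolding W_def by (rule step_weight_nonneg[OF b m(1)])
    qed
    finally have "(1 / N) * (N * (1 - b\<^sup>2 / m - exp (- b)) - E) \<le> (1 / N) * (\<Sum>a\<in>J. W a * - ln (pseudo_dist a z))"
      using Np by (intro mult_left_mono) auto
    moreover have "(1 / N) * (N * (1 - b\<^sup>2 / m - exp (- b)) - E) = 1 - b\<^sup>2 / m - exp (- b) - E / N"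
      using Np by (simp add: diff_divide_distrib)
    ultimately show ?thesis unfolding v_def by simp
  qed
  ultimately show ?thesis unfolding \<eta>_def by linarith
qed

section \<open>Nearly extremal discs and the upper density\<close>

lemma frequently_at_left_1:
  assumes "\<And>N0. \<exists>N\<ge>N0. P (1 - exp (- N))"
  shows "frequently P (at_left (1::real))"
  unfolding frequently_def
proof
  assume "eventually (\<lambda>r. \<not> P r) (at_left 1)"
  then obtain c where c: "c < 1" "\<And>r. c < r \<Longrightarrow> r < 1 \<Longrightarrow> \<not> P r"
    unfolding eventually_at_left_field by auto
  obtain N where N: "N \<ge> 1 - ln (1 - c)" "P (1 - exp (- N))" using assms by blast
  have "- N < ln (1 - c)" using N(1) by simp
  then have "exp (- N) < exp (ln (1 - c))" by simp
  then have "exp (- N) < 1 - c" using c(1) by simp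
  then show False using c(2)[of "1 - exp (- N)"] N(2) by simp
qed

lemma eventually_at_left_1_obtain:
  assumes "eventually P (at_left (1::real))"
  obtains N0 where "\<And>N. N \<ge> N0 \<Longrightarrow> P (1 - exp (- N))"
proof -
  obtain c where c: "c < 1" "\<And>r. c < r \<Longrightarrow> r < 1 \<Longrightarrow> P r"
    using assms unfolding eventually_at_left_field by auto
  show ?thesis
  proof (rule that[of "1 - ln (1 - c)"])
    fix N assume "N \<ge> 1 - ln (1 - c)"
    then have "exp (- N) < exp (ln (1 - c))" by simp
    then have "exp (- N) < 1 - c" using c(1) by simp
    then show "P (1 - exp (- N))" using c(2)[of "1 - exp (- N)"] by simp
  qed
qed

lemma density_quotient_eq:
  "r < 1 \<Longrightarrow> density_quotient L z r = (\<Sum>a\<in>{a \<in> L. pseudo_dist a z < r}. 1 - pseudo_dist a z) / (- ln (1 - r))"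
  by (simp add: density_quotient_def ln_one_div_one_minus)

text \<open>A number above the upper density bounds the quotients for all large radii; smaller radii
  are absorbed into \<open>C1\<close>, because the sum is monotone in the radius.\<close>

lemma upper_density_sum_bound:
  assumes L: "separated_by \<delta> L" and b: "b \<ge> 0" "upper_density L < ennreal b"
  obtains C1 where "C1 \<ge> 0" "\<And>w s. cmod w < 1 \<Longrightarrow> 0 \<le> s \<Longrightarrow> s < 1 \<Longrightarrow>
      (\<Sum>a\<in>{a \<in> L. pseudo_dist a w < s}. 1 - pseudo_dist a w) \<le> b * (- ln (1 - s)) + C1"
proof -
  have "eventually (\<lambda>r. (SUP z\<in>unit_disk. ennreal (density_quotient L z r)) < ennreal b) (at_left 1)"
    using b(2) unfolding upper_density_def by (rule Limsup_lessD)
  from eventually_at_left_1_obtain[OF this]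
  obtain N0 where N0: "\<And>N. N \<ge> N0 \<Longrightarrow> (SUP z\<in>unit_disk. ennreal (density_quotient L z (1 - exp (- N)))) < ennreal b"
    by blast
  define N1 where "N1 = max N0 1"
  have L1: "cmod a < 1" if "a \<in> L" for a using L that by (auto simp: separated_by_def)
  have big: "(\<Sum>a\<in>{a \<in> L. pseudo_dist a w < 1 - exp (- N)}. 1 - pseudo_dist a w) \<le> b * N" if w: "cmod w < 1" and N: "N \<ge> N1" for w N
  proof -
    have wd: "w \<in> unit_disk" using w by simp
    have N': "N \<ge> N0" "N \<ge> 1" using N by (auto simp: N1_def)
    have "ennreal (density_quotient L w (1 - exp (- N))) < ennreal b"
      using N0[OF N'(1)] SUP_upper[OF wd, of "\<lambda>z. ennreal (density_quotient L z (1 - exp (- N)))"] by order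
    then have "density_quotient L w (1 - exp (- N)) < b" by (metis b(1) ennreal_leI linorder_not_less)
    then show ?thesis using N'(2) by (simp add: density_quotient_eq pos_divide_less_eq)
  qed
  show ?thesis
  proof (rule that[of "b * N1"])
    show "0 \<le> b * N1" using b by (simp add: N1_def)
    fix w and s :: real assume w: "cmod w < 1" and s: "0 \<le> s" "s < 1"
    define N where "N = max N1 (- ln (1 - s))"
    have "- N \<le> ln (1 - s)" by (simp add: N_def max_def)
    then have "exp (- N) \<le> exp (ln (1 - s))" by simp
    then have sN: "s \<le> 1 - exp (- N)" using s by simp
    have "(\<Sum>a\<in>{a \<in> L. pseudo_dist a w < s}. 1 - pseudo_dist a w) \<le> (\<Sum>a\<in>{a \<in> L. pseudo_dist a w < 1 - exp (- N)}. 1 - pseudo_dist a w)"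
      by (rule sum_mono2[OF finite_pseudo_ball[OF L w]])
         (use sN L1 w pseudo_dist_less_1 in \<open>auto simp: less_imp_le\<close>)
    also have "\<dots> \<le> b * N" by (rule big[OF w]) (simp add: N_def)
    also have "\<dots> \<le> b * (- ln (1 - s) + N1)"
    proof (rule mult_left_mono[OF _ b(1)])
      have "0 \<le> - ln (1 - s)" "0 \<le> N1" using s by (auto simp: N1_def)
      then show "N \<le> - ln (1 - s) + N1" by (simp add: N_def)
    qed
    finally show "(\<Sum>a\<in>{a \<in> L. pseudo_dist a w < s}. 1 - pseudo_dist a w) \<le> b * (- ln (1 - s)) + b * N1"
      by (simp only: distrib_left)
  qed
qed

lemma upper_density_attained:
  assumes L: "separated_by \<delta> L" and d: "d \<ge> 0" "ennreal d < upper_density L"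
  shows "\<exists>N\<ge>N0. \<exists>z. cmod z < 1 \<and> d * N \<le> (\<Sum>a\<in>{a \<in> L. pseudo_dist a z < 1 - exp (- N)}. 1 - pseudo_dist a z)"
proof (rule ccontr)
  assume neg: "\<not> ?thesis"
  define c where "c = 1 - exp (- (max N0 1))"
  have "eventually (\<lambda>r. (SUP z\<in>unit_disk. ennreal (density_quotient L z r)) \<le> ennreal d) (at_left 1)"
    unfolding eventually_at_left_field
  proof (intro exI[of _ c] conjI allI impI)
    show "c < 1" by (simp add: c_def)
    fix r assume r: "c < r" "r < 1"
    define N where "N = - ln (1 - r)"
    have rN: "r = 1 - exp (- N)" using r by (simp add: N_def)
    have "exp (- N) < exp (- (max N0 1))" using r(1) unfolding rN c_def by simp
    then have N: "N0 \<le> N" "0 < N" by auto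
    show "(SUP z\<in>unit_disk. ennreal (density_quotient L z r)) \<le> ennreal d"
    proof (rule SUP_least)
      fix z :: complex assume "z \<in> unit_disk"
      then have "\<not> d * N \<le> (\<Sum>a\<in>{a \<in> L. pseudo_dist a z < 1 - exp (- N)}. 1 - pseudo_dist a z)"
        using neg N(1) by auto
      then have "(\<Sum>a\<in>{a \<in> L. pseudo_dist a z < r}. 1 - pseudo_dist a z) \<le> d * N"
        unfolding rN by linarith
      then have "density_quotient L z r \<le> d"
        unfolding density_quotient_eq[OF r(2)] using N(2) by (simp only: N_def pos_divide_le_eq)
      then show "ennreal (density_quotient L z r) \<le> ennreal d" by (rule ennreal_leI)
    qed
  qed
  then have "upper_density L \<le> ennreal d" unfolding upper_density_def by (rule Limsup_bounded)
  then show False using d(2) by simp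
qed

text \<open>The logarithmic bound for separated sets keeps the quotients below 2 C. Finiteness
  allows real numbers slightly above and below the density to be used together.\<close>

lemma upper_density_finite:
  assumes L: "separated_by \<delta> L"
  shows "upper_density L \<noteq> \<top>"
proof -
  have "0 < \<delta>" using L by (simp add: separated_by_def)
  then obtain C where C: "C > 0" "\<And>L w r. separated_by \<delta> L \<Longrightarrow> cmod w < 1 \<Longrightarrow> 0 \<le> r \<Longrightarrow> r < 1 \<Longrightarrow>
      (\<Sum>a\<in>{a \<in> L. pseudo_dist a w < r}. 1 - pseudo_dist a w) \<le> C * (1 - ln (1 - r))"
    using sum_pseudo_ball by blast
  have "eventually (\<lambda>N::real. 1 \<le> N) at_top" by (rule eventually_ge_at_top)
  from eventually_minus_ln[OF this] eventually_near_1
  have "eventually (\<lambda>r. (SUP z\<in>unit_disk. ennreal (density_quotient L z r)) \<le> ennreal (2 * C)) (at_left 1)"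
  proof eventually_elim
    case (elim r)
    show ?case
    proof (rule SUP_least)
      fix z :: complex assume "z \<in> unit_disk"
      then have "(\<Sum>a\<in>{a \<in> L. pseudo_dist a z < r}. 1 - pseudo_dist a z) \<le> C * (1 - ln (1 - r))"
        using C(2)[OF L, of z r] elim by simp
      also have "\<dots> \<le> C * (2 * - ln (1 - r))" using elim C by (intro mult_left_mono) auto
      finally have "density_quotient L z r \<le> 2 * C"
        unfolding density_quotient_eq[OF conjunct2[OF elim(2)]] using elim(1)
        by (subst pos_divide_le_eq) (auto simp: mult_ac)
      then show "ennreal (density_quotient L z r) \<le> ennreal (2 * C)" by (rule ennreal_leI)
    qed
  qed
  then have "upper_density L \<le> ennreal (2 * C)" unfolding upper_density_def by (rule Limsup_bounded)
  then show ?thesis by (auto simp: top_unique)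
qed

text \<open>The extremal centre can be moved to a point of the sequence: by the maximum principle the Green
  potential of the points of the extremal disc is at least as large near some point of the sequence,
  and the upper bounds for outer layers show that this point is not far from the extremal centre.\<close>

lemma dense_point:
  assumes L: "separated_by \<delta> L" and D: "upper_density L = ennreal D" and d: "0 \<le> d" "d < D"
  shows "\<exists>N\<ge>N0. \<exists>a\<in>L. d * N \<le> (\<Sum>j\<in>{j \<in> L. pseudo_dist j a < 1 - exp (- N)}. 1 - pseudo_dist j a)"
proof -
  have \<delta>: "0 < \<delta>" "\<delta> \<le> 1/2" using L by (auto simp: separated_by_def)
  have L1: "cmod a < 1" if "a \<in> L" for a using L that by (auto simp: separated_by_def)
  have Dp: "D > 0" using d by simp
  \<comment> \<open>\<tau> is the common tolerance: 1 - \<tau> is lost on moving from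
    \<open>w\<close> to a point of the sequence, D - \<tau> is the density attained, 1 + \<tau> is
    lost between potential and sum, and 3 \<tau> / (D + \<tau>) is the relative growth of the depth.
    The inequality says that \<open>d\<close> survives all four.\<close>
  have "((\<lambda>\<tau>. (1 - \<tau>) * (D - \<tau>) / (1 + \<tau>) - d * (1 + 3 * \<tau> / (D + \<tau>))) \<longlongrightarrow>
     (1 - 0) * (D - 0) / (1 + 0) - d * (1 + 3 * 0 / (D + 0))) (at_right 0)"
    using Dp by (intro tendsto_intros) auto
  then have "eventually (\<lambda>\<tau>. 0 < (1 - \<tau>) * (D - \<tau>) / (1 + \<tau>) - d * (1 + 3 * \<tau> / (D + \<tau>))) (at_right 0)"
    using d by (intro order_tendstoD(1)) auto
  moreover have "eventually (\<lambda>\<tau>. 0 < \<tau> \<and> \<tau> < min D (1/4)) (at_right 0)"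
    unfolding eventually_at_right_field using Dp by (intro exI[of _ "min D (1/4)"]) auto
  ultimately have "eventually (\<lambda>\<tau>. 0 < (1 - \<tau>) * (D - \<tau>) / (1 + \<tau>) - d * (1 + 3 * \<tau> / (D + \<tau>)) \<and>
      0 < \<tau> \<and> \<tau> < min D (1/4)) (at_right 0)" by eventually_elim auto
  then obtain \<tau> where \<tau>: "d * (1 + 3 * \<tau> / (D + \<tau>)) < (1 - \<tau>) * (D - \<tau>) / (1 + \<tau>)" "0 < \<tau>" "\<tau> < D" "\<tau> < 1/4"
    using eventually_happens'[OF trivial_limit_at_right_real] by force
  define b where "b = D + \<tau>"
  define d1 where "d1 = D - \<tau>"
  have b: "0 < b" "upper_density L < ennreal b" using \<tau> Dp by (auto simp: b_def D ennreal_less_iff)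
  have d1: "0 < d1" "ennreal d1 < upper_density L" using \<tau> by (auto simp: d1_def D ennreal_less_iff)
  obtain C1 where C1: "C1 \<ge> 0" "\<And>w s. cmod w < 1 \<Longrightarrow> 0 \<le> s \<Longrightarrow> s < 1 \<Longrightarrow>
      (\<Sum>a\<in>{a \<in> L. pseudo_dist a w < s}. 1 - pseudo_dist a w) \<le> b * (- ln (1 - s)) + C1"
    using upper_density_sum_bound[OF L less_imp_le[OF b(1)] b(2)] by blast
  define c where "c = min (\<delta> / 2) (\<tau> / 2)"
  have c: "0 < c" "c \<le> 1/4" "c \<le> \<delta> / 2" "2 * c \<le> \<tau>" using \<delta> \<tau> by (auto simp: c_def)
  have c3: "1 - \<tau> \<le> (1 - c) / (1 + c)" "1/3 \<le> (1 - c) / (1 + c)"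
  proof -
    have "(1 - 2 * c) * (1 + c) \<le> 1 - c" using c by (simp add: algebra_simps)
    then have "1 - 2 * c \<le> (1 - c) / (1 + c)" using c by (simp add: pos_le_divide_eq)
    then show "1 - \<tau> \<le> (1 - c) / (1 + c)" using c by linarith
    show "1/3 \<le> (1 - c) / (1 + c)" using c by (simp add: pos_le_divide_eq)
  qed
  have c1: "c \<le> 1" using c by simp
  obtain C2 where C2: "C2 > 0" "\<And>L w A. separated_by \<delta> L \<Longrightarrow> cmod w < 1 \<Longrightarrow> A \<subseteq> L \<Longrightarrow> finite A \<Longrightarrow>
     (\<And>a. a \<in> A \<Longrightarrow> c \<le> pseudo_dist a w) \<Longrightarrow>
     (\<Sum>a\<in>A. - ln (pseudo_dist a w)) \<le> (1 + \<tau>) * (\<Sum>a\<in>A. 1 - pseudo_dist a w) + C2"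
    using green_sum_le[OF \<delta>(1) \<tau>(2) c(1) c1] by blast
  have "eventually (\<lambda>N. \<forall>z w A. cmod z < 1 \<longrightarrow> cmod w < 1 \<longrightarrow> exp (- N) / 3 \<le> 1 - pseudo_dist w z \<longrightarrow>
      finite A \<longrightarrow> A \<subseteq> L \<longrightarrow> (\<forall>a\<in>A. exp (- N) < 1 - pseudo_dist a z \<and> c \<le> pseudo_dist a w) \<longrightarrow>
      (\<Sum>a\<in>A. - ln (pseudo_dist a w)) \<le> b * (N + ln (1 - pseudo_dist w z)) + \<tau> * N) at_top"
    by (rule green_sum_outer[OF L _ C1 \<tau>(2) c(1)]) (use b c in auto)
  then obtain N1 where N1: "\<And>N z w A. N1 \<le> N \<Longrightarrow> cmod z < 1 \<Longrightarrow> cmod w < 1 \<Longrightarrow> exp (- N) / 3 \<le> 1 - pseudo_dist w z \<Longrightarrow>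
      finite A \<Longrightarrow> A \<subseteq> L \<Longrightarrow> (\<forall>a\<in>A. exp (- N) < 1 - pseudo_dist a z \<and> c \<le> pseudo_dist a w) \<Longrightarrow>
      (\<Sum>a\<in>A. - ln (pseudo_dist a w)) \<le> b * (N + ln (1 - pseudo_dist w z)) + \<tau> * N"
    unfolding eventually_at_top_linorder by blast
  define k where "k = (1 - \<tau>) * d1 / (1 + \<tau>) - d * (1 + 3 * \<tau> / b)"
  have k: "0 < k" using \<tau>(1) by (simp add: k_def d1_def b_def)
  define N2 where "N2 = ((1 - \<tau>) * C2 / (1 + \<tau>) + 2 * d) / k"
  obtain N z where N: "N \<ge> max (max N0 1) (max N1 N2)" and z: "cmod z < 1"
      and Nz: "d1 * N \<le> (\<Sum>a\<in>{a \<in> L. pseudo_dist a z < 1 - exp (- N)}. 1 - pseudo_dist a z)"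
    using upper_density_attained[OF L less_imp_le[OF d1(1)] d1(2)] by blast
  have N': "N \<ge> N0" "N \<ge> 1" "N \<ge> N1" "N \<ge> N2" using N by auto
  define J where "J = {a \<in> L. pseudo_dist a z < 1 - exp (- N)}"
  have fJ: "finite J" unfolding J_def by (rule finite_pseudo_ball[OF L z]) simp
  have JL: "J \<subseteq> L" by (auto simp: J_def)
  have J1: "cmod a < 1" if "a \<in> J" for a using that JL L1 by blast
  have Jz: "exp (- N) < 1 - pseudo_dist a z" if "a \<in> J" for a using that by (simp add: J_def)
  have "\<exists>w a. cmod w < 1 \<and> a \<in> J \<and> pseudo_dist w a \<le> c \<and> b * (- ln (1 - pseudo_dist w z)) \<le> 3 * \<tau> * N \<and>
     (d1 * N - C2) / (1 + \<tau>) \<le> (\<Sum>j\<in>J. 1 - pseudo_dist j w)"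
  proof (cases "\<exists>a\<in>J. pseudo_dist z a \<le> c")
    case True
    then obtain a where a: "a \<in> J" "pseudo_dist z a \<le> c" by blast
    have "(d1 * N - C2) / (1 + \<tau>) \<le> (d1 * N) / (1 + \<tau>)" using C2 \<tau> by (intro divide_right_mono) auto
    also have "\<dots> \<le> d1 * N"
    proof -
      have "0 \<le> d1 * N" using d1 N' by (intro mult_nonneg_nonneg) auto
      then show ?thesis using \<tau> by (simp add: pos_divide_le_eq mult_le_cancel_left1)
    qed
    also have "\<dots> \<le> (\<Sum>j\<in>J. 1 - pseudo_dist j z)" using Nz by (simp add: J_def)
    finally show ?thesis using a z \<tau> N' by (intro exI[of _ z] exI[of _ a]) (auto simp: pseudo_dist_def)
  next
    case False
    define O' where "O' = {x \<in> ball 0 1. \<forall>a\<in>J. c < pseudo_dist a x}"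
    define H where "H = (\<lambda>x. \<Sum>a\<in>J. - ln (pseudo_dist a x))"
    have cpd: "continuous_on (cball 0 1) (pseudo_dist a)" if "a \<in> J" for a
      by (rule continuous_on_pseudo_dist[OF J1[OF that] order_refl])
    have oO: "open O'"
    proof -
      have eq: "O' = ball 0 1 \<inter> (\<Inter>a\<in>J. ball 0 1 \<inter> pseudo_dist a -` {c<..})" by (auto simp: O'_def)
      have op: "open (ball 0 1 \<inter> pseudo_dist a -` {c<..})" if "a \<in> J" for a
      proof -
        have "continuous_on (ball 0 1) (pseudo_dist a)"
          by (rule continuous_on_subset[OF cpd[OF that]]) auto
        then show ?thesis using continuous_on_open_vimage[of "ball 0 1" "pseudo_dist a"] by (simp add: Int_commute)
      qed
      show ?thesis unfolding eq by (intro open_Int open_INT ballI open_ball op fJ)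
    qed
    have clO: "closure O' \<subseteq> cball 0 1" by (rule closure_minimal) (auto simp: O'_def)
    have far: "c \<le> pseudo_dist a x" if "x \<in> closure O'" "a \<in> J" for a x
      by (rule continuous_ge_on_closure[OF continuous_on_subset[OF cpd[OF that(2)] clO] that(1)])
         (use that in \<open>auto simp: O'_def less_imp_le\<close>)
    have zO: "z \<in> O'" using False z pseudo_dist_commute[of z] by (auto simp: O'_def not_le)
    have bO: "bounded O'" by (rule bounded_subset[of "ball 0 1"]) (auto simp: O'_def)
    have hH: "har H O'"
    proof -
      have "har (\<lambda>x. - 1 * (\<Sum>a\<in>J. ln (pseudo_dist a x))) O'"
      proof (intro har_cmult har_sum oO har_ln_pseudo_dist J1)
        fix a assume a: "a \<in> J"
        show "a \<notin> O'"
        proof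
          assume "a \<in> O'"
          then have "c < pseudo_dist a a" using a by (auto simp: O'_def)
          then show False using c by (simp add: pseudo_dist_def)
        qed
      qed (auto simp: O'_def)
      then show ?thesis by (rule har_cong) (simp add: H_def sum_negf)
    qed
    have cH: "continuous_on (closure O') H" unfolding H_def
    proof (intro continuous_intros)
      fix a assume a: "a \<in> J"
      show "continuous_on (closure O') (pseudo_dist a)" by (rule continuous_on_subset[OF cpd[OF a] clO])
      show "\<forall>x\<in>closure O'. pseudo_dist a x \<noteq> 0" using far a c by force
    qed
    have zc: "z \<in> closure O'" using zO closure_subset by blast
    \<comment> \<open>With an empty frontier the maximum principle would bound \<open>H z\<close> by
      every real number.\<close>
    have frne: "frontier O' \<noteq> {}"
    proof
      assume "frontier O' = {}"
      then have "H z \<le> m" for m by (intro har_max_principle[OF hH bO cH _ zc]) auto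
      from this[of "H z - 1"] show False by simp
    qed
    have "compact (frontier O')" using bO by (rule compact_frontier_bounded)
    moreover have "continuous_on (frontier O') H"
      by (rule continuous_on_subset[OF cH]) (auto simp: frontier_def)
    ultimately obtain w where w: "w \<in> frontier O'" "\<And>x. x \<in> frontier O' \<Longrightarrow> H x \<le> H w"
      using continuous_attains_sup[OF _ frne] by blast
    have Hz: "H z \<le> H w" by (rule har_max_principle[OF hH bO cH w(2) zc])
    have "d1 * N \<le> (\<Sum>a\<in>J. 1 - pseudo_dist a z)" using Nz by (simp add: J_def)
    also have "\<dots> \<le> H z" unfolding H_def
    proof (rule sum_mono)
      fix a assume a: "a \<in> J"
      have "0 < pseudo_dist a z" using far[OF zc a] c by simp
      then show "1 - pseudo_dist a z \<le> - ln (pseudo_dist a z)" using ln_le_minus_one[of "pseudo_dist a z"] by simp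
    qed
    finally have Hw: "d1 * N \<le> H w" using Hz by simp
    have wc: "w \<in> closure O'" "w \<notin> O'" using w(1) oO by (auto simp: frontier_def interior_open)
    have w1: "cmod w < 1"
    proof (rule ccontr)
      assume "\<not> cmod w < 1"
      then have "cmod w = 1" using clO wc by force
      then have "H w = 0" using pseudo_dist_boundary[OF J1] by (simp add: H_def)
      moreover have "0 < d1 * N" using d1 N' by (intro mult_pos_pos) auto
      ultimately show False using Hw by simp
    qed
    obtain a where a: "a \<in> J" "pseudo_dist a w \<le> c" using wc(2) w1 by (auto simp: O'_def not_less)
    have wa: "pseudo_dist w a \<le> c" using a(2) pseudo_dist_commute[of w a] by simp
    have "exp (- N) * (1 / 3) \<le> (1 - pseudo_dist z a) * ((1 - c) / (1 + c))"
      using Jz[OF a(1)] less_trans[OF exp_gt_zero Jz[OF a(1)]] c3 c pseudo_dist_commute[of z a]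
      by (intro mult_mono) auto
    also have "\<dots> \<le> 1 - pseudo_dist z w"
      by (rule one_minus_pseudo_dist_ge_near[OF z J1[OF a(1)] w1 a(2)]) (use c in simp)
    finally have "exp (- N) / 3 \<le> 1 - pseudo_dist w z" by (simp add: pseudo_dist_commute[of z w])
    then have "H w \<le> b * (N + ln (1 - pseudo_dist w z)) + \<tau> * N"
      unfolding H_def using Jz far[OF wc(1)] by (intro N1[OF N'(3) z w1 _ fJ JL]) auto
    \<comment> \<open>With \<Lambda> = - ln (1 - \<open>pseudo_dist w z\<close>), (D - \<tau>) N
      \<le> H w \<le> (D + \<tau>) (N - \<Lambda>) + \<tau> N: the depth of \<open>w\<close> seen
      from \<open>z\<close> is small on the scale of N.\<close>
    then have 1: "b * (- ln (1 - pseudo_dist w z)) \<le> 3 * \<tau> * N"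
      using Hw by (simp add: b_def d1_def algebra_simps)
    have "H w \<le> (1 + \<tau>) * (\<Sum>a\<in>J. 1 - pseudo_dist a w) + C2"
      unfolding H_def by (rule C2(2)[OF L w1 JL fJ]) (rule far[OF wc(1)])
    then have "(d1 * N - C2) / (1 + \<tau>) \<le> (\<Sum>j\<in>J. 1 - pseudo_dist j w)"
      using Hw \<tau> by (simp add: pos_divide_le_eq mult.commute)
    then show ?thesis using w1 a(1) wa 1 by blast
  qed
  then obtain w a where w: "cmod w < 1" and a: "a \<in> J" "pseudo_dist w a \<le> c"
    and wz: "b * (- ln (1 - pseudo_dist w z)) \<le> 3 * \<tau> * N"
    and S: "(d1 * N - C2) / (1 + \<tau>) \<le> (\<Sum>j\<in>J. 1 - pseudo_dist j w)" by blast
  define \<Lambda> where "\<Lambda> = - ln (1 - pseudo_dist w z)"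
  have wz1: "0 < 1 - pseudo_dist w z" using pseudo_dist_less_1[OF w z] by simp
  have ex\<Lambda>: "exp (- \<Lambda>) = 1 - pseudo_dist w z" using wz1 by (simp add: \<Lambda>_def)
  have \<Lambda>0: "0 \<le> \<Lambda>" using wz1 pseudo_dist_nonneg[of w z] by (simp add: \<Lambda>_def)
  \<comment> \<open>Depths add on the way from j through z to w up to a factor 2, the passage from
    \<open>w\<close> to \<open>a\<close> costs a factor 3, and 6 \<le> e^2.\<close>
  define M where "M = N + \<Lambda> + 2"
  have near: "(1 - \<tau>) * (1 - pseudo_dist j w) \<le> 1 - pseudo_dist j a \<and> pseudo_dist j a < 1 - exp (- M)" if j: "j \<in> J" for j
  proof
    have jw: "0 < 1 - pseudo_dist j w" using pseudo_dist_less_1[OF J1[OF j] w] by simp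
    have n: "(1 - pseudo_dist j w) * ((1 - c) / (1 + c)) \<le> 1 - pseudo_dist j a"
      by (rule one_minus_pseudo_dist_ge_near[OF J1[OF j] w J1[OF a(1)] a(2)]) (use c in simp)
    have "(1 - \<tau>) * (1 - pseudo_dist j w) \<le> (1 - c) / (1 + c) * (1 - pseudo_dist j w)"
      using c3 jw by (intro mult_right_mono) auto
    then show "(1 - \<tau>) * (1 - pseudo_dist j w) \<le> 1 - pseudo_dist j a" using n by (simp add: mult.commute)
    have "exp (- M) = exp (- N) * exp (- \<Lambda>) * exp (- 2)" by (simp add: M_def flip: exp_add)
    also have "\<dots> \<le> exp (- N) * exp (- \<Lambda>) * (1 / 6)"
    proof (rule mult_left_mono)
      have "(6::real) \<le> exp 2" using ln_6_le_2 by (metis exp_le_cancel_iff exp_ln zero_less_numeral)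
      then show "exp (- 2) \<le> (1 / 6 :: real)" by (simp add: exp_minus field_simps)
    qed simp
    also have "\<dots> < (1 - pseudo_dist j z) * exp (- \<Lambda>) * (1 / 6)" using Jz[OF j] by simp
    also have "\<dots> = (1 - pseudo_dist j z) * (1 - pseudo_dist z w) / 2 * (1 / 3)"
      by (simp add: ex\<Lambda> pseudo_dist_commute[of z w])
    also have "\<dots> \<le> (1 - pseudo_dist j w) * ((1 - c) / (1 + c))"
      using one_minus_pseudo_dist_ge_half[OF J1[OF j] z w] c3 jw by (intro mult_mono) auto
    also have "\<dots> \<le> 1 - pseudo_dist j a" by (rule n)
    finally show "pseudo_dist j a < 1 - exp (- M)" by simp
  qed
  have aL: "a \<in> L" using a(1) JL by blast
  have "\<Lambda> \<le> 3 * \<tau> / b * N" using wz b(1) by (simp add: \<Lambda>_def[symmetric] pos_le_divide_eq mult.commute)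
  then have "d * M \<le> d * (N + 3 * \<tau> / b * N + 2)" using d(1) by (intro mult_left_mono) (auto simp: M_def)
  also have "\<dots> = (1 - \<tau>) * d1 / (1 + \<tau>) * N - k * N + 2 * d"
    by (simp add: k_def algebra_simps)
  also have "\<dots> \<le> (1 - \<tau>) * d1 / (1 + \<tau>) * N - (1 - \<tau>) * C2 / (1 + \<tau>)"
  proof -
    have "N2 * k \<le> N * k" using N'(4) k by (intro mult_right_mono) auto
    then have "(1 - \<tau>) * C2 / (1 + \<tau>) + 2 * d \<le> k * N" using k by (simp add: N2_def mult.commute)
    then show ?thesis by linarith
  qed
  also have "\<dots> = (1 - \<tau>) * ((d1 * N - C2) / (1 + \<tau>))" by (simp add: right_diff_distrib diff_divide_distrib)
  also have "\<dots> \<le> (1 - \<tau>) * (\<Sum>j\<in>J. 1 - pseudo_dist j w)" using S \<tau> by (intro mult_left_mono) auto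
  also have "\<dots> = (\<Sum>j\<in>J. (1 - \<tau>) * (1 - pseudo_dist j w))" by (rule sum_distrib_left)
  also have "\<dots> \<le> (\<Sum>j\<in>J. 1 - pseudo_dist j a)" using near by (intro sum_mono) blast
  also have "\<dots> \<le> (\<Sum>j\<in>{j \<in> L. pseudo_dist j a < 1 - exp (- M)}. 1 - pseudo_dist j a)"
  proof (rule sum_mono2)
    show "finite {j \<in> L. pseudo_dist j a < 1 - exp (- M)}" by (rule finite_pseudo_ball[OF L L1[OF aL]]) simp
    show "J \<subseteq> {j \<in> L. pseudo_dist j a < 1 - exp (- M)}" using near JL by blast
    show "0 \<le> 1 - pseudo_dist j a" if "j \<in> {j \<in> L. pseudo_dist j a < 1 - exp (- M)} - J" for j
      using that pseudo_dist_less_1[OF L1 L1[OF aL], of j] by simp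
  qed
  finally have "d * M \<le> (\<Sum>j\<in>{j \<in> L. pseudo_dist j a < 1 - exp (- M)}. 1 - pseudo_dist j a)" .
  moreover have "M \<ge> N0" using N' \<Lambda>0 by (simp add: M_def)
  ultimately show ?thesis using aL by blast
qed

text \<open>The disc about a dense centre carries at least (D - \<epsilon>) N in total. Subtracting
  the upper bound b (l + 1) + C1 for its part of depth up to l + 1, and the points that are not
  holes, leaves the lower bound for each outer layer that \<open>potential_upper_bound\<close> asks
  for.\<close>

lemma frequently_log_inv_hm_ge:
  assumes L: "separated_by \<delta> L" and D: "upper_density L = ennreal D" and d: "0 \<le> d" "d < D"
  shows "frequently (\<lambda>r. \<exists>a\<in>L. d \<le> log_inv_hm L a r) (at_left 1)"
proof (rule frequently_at_left_1)
  fix N0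
  have \<delta>: "0 < \<delta>" "\<delta> \<le> 1/2" using L by (auto simp: separated_by_def)
  have L1: "cmod a < 1" if "a \<in> L" for a using L that by (auto simp: separated_by_def)
  \<comment> \<open>The margin for all errors: 2 \<epsilon>, b^2 / m and (C3 + 2 b) / N are at most
    g / 8 each, and the layer error is g / 16.\<close>
  define g where "g = exp (- d) - exp (- D)"
  have g: "0 < g" using d by (simp add: g_def)
  define \<epsilon> where "\<epsilon> = min (g / 16) (D / 2)"
  have \<epsilon>: "0 < \<epsilon>" "\<epsilon> \<le> g / 16" "\<epsilon> < D" using g d by (auto simp: \<epsilon>_def)
  define b where "b = D + \<epsilon>"
  have b: "0 < b" "upper_density L < ennreal b" "b - 2 * \<epsilon> = D - \<epsilon>" using \<epsilon> by (auto simp: b_def D ennreal_less_iff)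
  obtain C1 where C1: "C1 \<ge> 0" "\<And>w s. cmod w < 1 \<Longrightarrow> 0 \<le> s \<Longrightarrow> s < 1 \<Longrightarrow>
      (\<Sum>a\<in>{a \<in> L. pseudo_dist a w < s}. 1 - pseudo_dist a w) \<le> b * (- ln (1 - s)) + C1"
    using upper_density_sum_bound[OF L less_imp_le[OF b(1)] b(2)] by blast
  obtain C0 where C0: "C0 > 0" "\<And>L w r. separated_by \<delta> L \<Longrightarrow> cmod w < 1 \<Longrightarrow> 0 \<le> r \<Longrightarrow> r < 1 \<Longrightarrow>
      real (card {a \<in> L. pseudo_dist a w < r}) \<le> C0 * (1 + ln (1 / (1 - r))) / (1 - r)"
    using card_pseudo_ball[OF \<delta>(1)] by blast
  define n where "n = C0 * (1 + ln (1 / (1 - 3/5))) / (1 - 3/5)"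
  have n0: "0 < n" unfolding n_def using C0(1) by (intro divide_pos_pos mult_pos_pos add_pos_nonneg) auto
  obtain m :: nat where m: "max (max 1 b) (8 * b\<^sup>2 / g) \<le> real m" using real_arch_simple by blast
  have m1: "1 \<le> m" "b \<le> m" "b\<^sup>2 / m \<le> g / 8"
  proof -
    show "1 \<le> m" "b \<le> m" using m by auto
    have "8 * b\<^sup>2 \<le> real m * g" using m g by (simp add: pos_divide_le_eq)
    then show "b\<^sup>2 / m \<le> g / 8" using \<open>1 \<le> m\<close> by (simp add: pos_divide_le_eq mult.commute)
  qed
  define C3 where "C3 = n + b + C1"
  have C3: "0 \<le> C3" using n0 b C1 by (simp add: C3_def)
  have "eventually (\<lambda>N. \<forall>z w A l. cmod z < 1 \<longrightarrow> cmod w < 1 \<longrightarrow> exp (- N) / 3 \<le> 1 - pseudo_dist w z \<longrightarrow>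
      0 \<le> l \<longrightarrow> l \<le> N \<longrightarrow> finite A \<longrightarrow> A \<subseteq> L \<longrightarrow>
      (\<forall>a\<in>A. exp (- N) < 1 - pseudo_dist a z \<and> 1 - pseudo_dist a z < exp (- l) \<and> \<delta> / 2 \<le> pseudo_dist a w) \<longrightarrow>
      (\<Sum>a\<in>A. - ln (pseudo_dist a w)) \<le> b * (N - max l (- ln (1 - pseudo_dist w z))) + (g / 16) * N) at_top"
    by (rule green_sum_layer[OF L _ C1]) (use b g \<delta> in auto)
  then obtain N1 where N1: "\<And>N z w A l. N1 \<le> N \<Longrightarrow> cmod z < 1 \<Longrightarrow> cmod w < 1 \<Longrightarrow> exp (- N) / 3 \<le> 1 - pseudo_dist w z \<Longrightarrow>
      0 \<le> l \<Longrightarrow> l \<le> N \<Longrightarrow> finite A \<Longrightarrow> A \<subseteq> L \<Longrightarrow>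
      (\<And>a. a \<in> A \<Longrightarrow> exp (- N) < 1 - pseudo_dist a z \<and> 1 - pseudo_dist a z < exp (- l) \<and> \<delta> / 2 \<le> pseudo_dist a w) \<Longrightarrow>
      (\<Sum>a\<in>A. - ln (pseudo_dist a w)) \<le> b * (N - max l (- ln (1 - pseudo_dist w z))) + (g / 16) * N"
    unfolding eventually_at_top_linorder by meson
  obtain N2 where N2: "\<And>N. N2 \<le> N \<Longrightarrow> \<forall>z u. cmod z < 1 \<longrightarrow> circle_solution L z (1 - exp (- N)) u \<longrightarrow>
     exp (- (density_quotient L z (1 - exp (- N)) + 1)) \<le> u z"
    using eventually_at_left_1_obtain[OF log_inv_hm_le_density_quotient[OF L zero_less_one]] by blast
  define N3 where "N3 = max (max N0 1) (max (max N1 N2) (max (- ln (\<delta> / 4)) (8 * (C3 + 2 * b) / g)))"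
  obtain N a where N: "N \<ge> N3" and aL: "a \<in> L"
    and Na: "(D - \<epsilon>) * N \<le> (\<Sum>j\<in>{j \<in> L. pseudo_dist j a < 1 - exp (- N)}. 1 - pseudo_dist j a)"
    using dense_point[OF L D, of "D - \<epsilon>" N3] \<epsilon> by auto
  have N': "N0 \<le> N" "1 \<le> N" "N1 \<le> N" "N2 \<le> N" "- ln (\<delta> / 4) \<le> N" "8 * (C3 + 2 * b) / g \<le> N"
    using N by (auto simp: N3_def)
  define r where "r = 1 - exp (- N)"
  have Nr: "N = - ln (1 - r)" by (simp add: r_def)
  have r: "1/2 \<le> r" "r < 1"
  proof -
    have "2 \<le> exp N" using exp_ge_add_one_self[of N] N'(2) by linarith
    then have "exp (- N) \<le> 1/2" by (simp add: exp_minus field_simps)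
    then show "1/2 \<le> r" "r < 1" by (auto simp: r_def)
  qed
  have small: "1 - r \<le> \<delta> / 4"
  proof -
    have "exp (- N) \<le> exp (ln (\<delta> / 4))" using N'(5) by (simp only: exp_le_cancel_iff)
    then show ?thesis using \<delta> by (simp add: r_def)
  qed
  note a1 = L1[OF aL]
  obtain u where u: "circle_solution L a r u" "log_inv_hm L a r = ln (1 / u a)" using log_inv_hm_circle_solution[OF L a1 r] by blast
  have up: "0 < u a"
    using N2[OF N'(4)] a1 u(1) unfolding r_def[symmetric] by (meson exp_gt_zero less_le_trans)
  have "u a \<le> exp (- b) + b\<^sup>2 / m + (2 * \<epsilon> * N + C3) / N + 2 * b / N + g / 16"
  proof (rule potential_upper_bound[OF L a1 r u(1) Nr small _ m1(1,2)])
    fix l assume l: "0 \<le> l" "l \<le> N"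
    define T where "T = {j \<in> holes L a r. 1 - pseudo_dist j a < exp (- l)}"
    define P where "P = {j \<in> L. pseudo_dist j a < 3/5}"
    \<comment> \<open>Depth l + 1 in place of l makes the strict inequality include the points of
      depth exactly l; the extra \<open>b\<close> enters \<open>C3\<close>.\<close>
    define Q where "Q = {j \<in> L. pseudo_dist j a < 1 - exp (- (l + 1))}"
    have fT: "finite T" using finite_holes[OF L a1 r(2)] by (simp add: T_def)
    have fP: "finite P" unfolding P_def by (rule finite_pseudo_ball[OF L a1]) simp
    have fQ: "finite Q" unfolding Q_def by (rule finite_pseudo_ball[OF L a1]) simp
    have nn: "0 \<le> 1 - pseudo_dist j a" if "j \<in> L" for j using pseudo_dist_less_1[OF L1[OF that] a1] by simp
    have un: "(\<Sum>j\<in>A \<union> B. 1 - pseudo_dist j a) \<le> (\<Sum>j\<in>A. 1 - pseudo_dist j a) + (\<Sum>j\<in>B. 1 - pseudo_dist j a)"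
      if "finite A" "finite B" "A \<subseteq> L" for A B
    proof -
      have "0 \<le> (\<Sum>j\<in>A \<inter> B. 1 - pseudo_dist j a)" by (rule sum_nonneg) (use nn that in auto)
      then show ?thesis using sum.union_inter[OF that(1,2), of "\<lambda>j. 1 - pseudo_dist j a"] by linarith
    qed
    have TL: "T \<subseteq> L" "P \<subseteq> L" "Q \<subseteq> L" by (auto simp: T_def P_def Q_def holes_def)
    have "exp (- (l + 1)) < exp (- l)" by simp
    have cov: "{j \<in> L. pseudo_dist j a < r} \<subseteq> (T \<union> P) \<union> Q"
    proof
      fix j assume j: "j \<in> {j \<in> L. pseudo_dist j a < r}"
      consider "pseudo_dist j a < 3/5" | "3/5 \<le> pseudo_dist j a" "1 - pseudo_dist j a < exp (- l)"
        | "exp (- l) \<le> 1 - pseudo_dist j a" by linarith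
      then show "j \<in> (T \<union> P) \<union> Q"
      proof cases
        case 1
        then show ?thesis using j by (simp add: P_def)
      next
        case 2
        then have "j \<in> T" using j by (simp add: T_def holes_def)
        then show ?thesis by blast
      next
        case 3
        then have "pseudo_dist j a < 1 - exp (- (l + 1))"
          using \<open>exp (- (l + 1)) < exp (- l)\<close> by linarith
        then show ?thesis using j by (simp add: Q_def)
      qed
    qed
    have "(D - \<epsilon>) * N \<le> (\<Sum>j\<in>{j \<in> L. pseudo_dist j a < r}. 1 - pseudo_dist j a)" using Na by (simp add: r_def)
    also have "\<dots> \<le> (\<Sum>j\<in>(T \<union> P) \<union> Q. 1 - pseudo_dist j a)"
      by (rule sum_mono2[OF _ cov]) (use fT fP fQ TL nn in auto)
    also have "\<dots> \<le> (\<Sum>j\<in>T. 1 - pseudo_dist j a) + (\<Sum>j\<in>P. 1 - pseudo_dist j a) + (\<Sum>j\<in>Q. 1 - pseudo_dist j a)"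
      using un[of "T \<union> P" Q] un[of T P] fT fP fQ TL by auto
    also have "(\<Sum>j\<in>P. 1 - pseudo_dist j a) \<le> n"
    proof -
      have "(\<Sum>j\<in>P. 1 - pseudo_dist j a) \<le> (\<Sum>j\<in>P. 1)" by (rule sum_mono) (simp add: pseudo_dist_nonneg)
      also have "\<dots> = real (card P)" by simp
      also have "\<dots> \<le> n" using C0(2)[OF L a1, of "3/5"] by (simp add: P_def n_def)
      finally show ?thesis .
    qed
    also have "(\<Sum>j\<in>Q. 1 - pseudo_dist j a) \<le> b * (l + 1) + C1"
    proof -
      have "0 \<le> 1 - exp (- (l + 1))" "1 - exp (- (l + 1)) < 1" using l by auto
      note C1(2)[OF a1 this]
      moreover have "- ln (1 - (1 - exp (- (l + 1)))) = l + 1" by simp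
      ultimately show ?thesis unfolding Q_def by (simp only:)
    qed
    finally have "(D - \<epsilon>) * N \<le> (\<Sum>j\<in>T. 1 - pseudo_dist j a) + n + (b * (l + 1) + C1)" by simp
    then show "b * (N - l) - (2 * \<epsilon> * N + C3) \<le> (\<Sum>j\<in>{j \<in> holes L a r. 1 - pseudo_dist j a < exp (- l)}. 1 - pseudo_dist j a)"
      unfolding T_def[symmetric] b(3)[symmetric] C3_def by (simp add: algebra_simps)
  qed (use N1[OF N'(3) a1] b g \<epsilon> C3 N' in auto)
  also have "\<dots> \<le> exp (- d)"
  proof -
    have "exp (- b) \<le> exp (- D)" using \<epsilon> by (simp add: b_def)
    moreover have "(2 * \<epsilon> * N + C3) / N + 2 * b / N = 2 * \<epsilon> + (C3 + 2 * b) / N"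
      using N'(2) by (simp add: add_divide_distrib)
    moreover have "(C3 + 2 * b) / N \<le> g / 8"
    proof -
      have "8 * (C3 + 2 * b) \<le> N * g" using N'(6) g by (simp add: pos_divide_le_eq)
      then show ?thesis using N'(2) by (simp add: pos_divide_le_eq mult.commute)
    qed
    ultimately have "exp (- b) + b\<^sup>2 / m + (2 * \<epsilon> * N + C3) / N + 2 * b / N + g / 16 \<le>
       exp (- D) + g / 8 + (2 * (g / 16) + g / 8) + g / 16"
      using m1(3) \<epsilon>(2) by linarith
    also have "\<dots> \<le> exp (- D) + g" using g by linarith
    also have "\<dots> = exp (- d)" by (simp add: g_def)
    finally show ?thesis .
  qed
  finally have "u a \<le> exp (- d)" .
  from ln_mono[OF this up] have "ln (u a) \<le> - d" by simp
  then have "d \<le> log_inv_hm L a r" using u(2) up by (simp add: ln_div)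
  then show "\<exists>N\<ge>N0. \<exists>a\<in>L. d \<le> log_inv_hm L a (1 - exp (- N))" using N'(1) aL by (auto simp: r_def)
qed

lemma upper_density_le:
  assumes L: "separated_by \<delta> L"
  shows "upper_density L \<le> upper_h_density L"
proof (rule ccontr)
  assume "\<not> ?thesis"
  then obtain y where y: "upper_h_density L < y" "y < upper_density L" using dense by (auto simp: not_le)
  obtain D where D: "D \<ge> 0" "upper_density L = ennreal D" using upper_density_finite[OF L] by (cases "upper_density L") auto
  obtain d where d: "d \<ge> 0" "y = ennreal d" using y(2) by (cases y) auto
  have dD: "d < D" using y(2) d D by (simp add: ennreal_less_iff)
  have "eventually (\<lambda>r. (SUP a\<in>L. ennreal (log_inv_hm L a r)) < y) (at_left 1)"
    using y(1) unfolding upper_h_density_def by (rule Limsup_lessD)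
  from frequently_eventually_frequently[OF frequently_log_inv_hm_ge[OF L D(2) d(1) dD] this]
  obtain r where "\<exists>a\<in>L. d \<le> log_inv_hm L a r" "(SUP a\<in>L. ennreal (log_inv_hm L a r)) < y"
    using frequently_ex by blast
  then obtain a where a: "a \<in> L" "d \<le> log_inv_hm L a r" "(SUP a\<in>L. ennreal (log_inv_hm L a r)) < y" by blast
  have "ennreal d \<le> (SUP a\<in>L. ennreal (log_inv_hm L a r))" using a(1,2) by (intro SUP_upper2 ennreal_leI)
  then show False using a(3) d by simp
qed

theorem theorem2:
  fixes \<Lambda> :: "complex set"
  assumes "separated \<Lambda>"
  shows "lower_density \<Lambda> = lower_h_density \<Lambda> \<and> upper_density \<Lambda> = upper_h_density \<Lambda>"
proof -
  obtain \<delta> where L: "separated_by \<delta> \<Lambda>" using separated_imp_separated_by[OF assms] .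
  show ?thesis
    using lower_density_le[OF L] lower_h_density_le[OF L] upper_density_le[OF L] upper_h_density_le[OF L]
    by (intro conjI antisym)
qed

end
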